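(* Let $T$ be a rosy theory, $A$ a set, $n<\omega$, and let $\{a^i : i<n\}$ be a set of tuples which is thorn-independent over $A$. Then there exist sequences $I^i$, $i<n$, such that for each $i<n$: (i) $I^i$ is a thorn-Morley sequence over $AI^{\ne i}$ based on $A$ (so $I^i$ is $AI^{\neq i}$-indiscernible and $I^i\downarrow^{\mathrm{th}}_A I^{\ne i}$); (ii) $I^i$ starts with $a^i$.
   Context: $T$ is a complete first-order theory with $T=T^{eq}$; everything takes place in a monster model $\mathfrak C$; sets are small subsets of $\mathfrak C$; tuples are finite unless said otherwise. A formula $\varphi(x,b)$ strongly divides over $D$ if $b$ is not algebraic over $D$ and $\{\varphi(x,b') : b'\models \mathrm{tp}(b/D)\}$ is $k$-inconsistent for some $k\in\mathbb N$. It thorn-divides over $C$ if it strongly divides over some $D\supseteq C$. It thorn-forks over $C$ if it implies a finite disjunction of formulas each of which thorn-divides over $C$. A type thorn-forks over $A$ if it contains a formula that does. Write $a\downarrow^{\mathrm{th}}_A B$ if $\mathrm{tp}(a/AB)$ does not thorn-fork over $A$. A family $(a^i)_{i<n}$ is thorn-independent over $A$ if $a^i\downarrow^{\mathrm{th}}_A \{a^j : j\ne i\}$ for all $i$. $T$ is rosy if it admits no infinite thorn-forking chains, in the sense that thorn-independence has local character: for every finite tuple $a$ and set $B$ there is $B_0\subseteq B$ with $|B_0|\le |T|$ and $a\downarrow^{\mathrm{th}}_{B_0}B$. For $A\subseteq B$, a thorn-Morley sequence over $B$ based on $A$ is an infinite $B$-indiscernible sequence $(c_j)_{j<\omega}$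 such that $c_j\downarrow^{\mathrm{th}}_A Bc_{<j}$ for all $j$. $I^{\neq i}=\bigcup_{j\ne i}I^j$. *)

theory Defs
  imports Main
begin

unbundle cardinal_syntax

section \<open>Many-sorted first-order logic\<close>

text \<open>Every element of the type \<open>'s\<close> is a sort.\<close>

record ('s, 'f, 'r) language =
  Funs :: "'f set"
  Rels :: "'r set"
  fun_dom :: "'f \<Rightarrow> 's list"
  fun_cod :: "'f \<Rightarrow> 's"
  rel_dom :: "'r \<Rightarrow> 's list"

text \<open>\<open>Var n s\<close> is the \<open>n\<close>-th variable of sort \<open>s\<close>; variables of different sorts are different
  variables, even if their numbers agree.\<close>

datatype ('s, 'f) tm = Var nat 's | App 'f "('s, 'f) tm list"

datatype ('s, 'f, 'r) fm =
    Equal "('s, 'f) tm" "('s, 'f) tm"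
  | Atom 'r "('s, 'f) tm list"
  | Neg "('s, 'f, 'r) fm"
  | Conj "('s, 'f, 'r) fm" "('s, 'f, 'r) fm"
  | Exi nat 's "('s, 'f, 'r) fm"

primrec tm_sort :: "('s, 'f, 'r) language \<Rightarrow> ('s, 'f) tm \<Rightarrow> 's" where
  "tm_sort L (Var n s) = s"
| "tm_sort L (App f ts) = fun_cod L f"

primrec wf_tm :: "('s, 'f, 'r) language \<Rightarrow> ('s, 'f) tm \<Rightarrow> bool" where
  "wf_tm L (Var n s) = True"
| "wf_tm L (App f ts) =
    (f \<in> Funs L \<and> map (tm_sort L) ts = fun_dom L f \<and> list_all id (map (wf_tm L) ts))"

primrec wf_fm :: "('s, 'f, 'r) language \<Rightarrow> ('s, 'f, 'r) fm \<Rightarrow> bool" where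
  "wf_fm L (Equal t u) = (wf_tm L t \<and> wf_tm L u \<and> tm_sort L t = tm_sort L u)"
| "wf_fm L (Atom r ts) =
    (r \<in> Rels L \<and> map (tm_sort L) ts = rel_dom L r \<and> list_all (wf_tm L) ts)"
| "wf_fm L (Neg \<phi>) = wf_fm L \<phi>"
| "wf_fm L (Conj \<phi> \<psi>) = (wf_fm L \<phi> \<and> wf_fm L \<psi>)"
| "wf_fm L (Exi n s \<phi>) = wf_fm L \<phi>"

primrec tm_vars :: "('s, 'f) tm \<Rightarrow> (nat \<times> 's) set" where
  "tm_vars (Var n s) = {(n, s)}"
| "tm_vars (App f ts) = \<Union> (set (map tm_vars ts))"

primrec free_vars :: "('s, 'f, 'r) fm \<Rightarrow> (nat \<times> 's) set" where
  "free_vars (Equal t u) = tm_vars t \<union> tm_vars u"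
| "free_vars (Atom r ts) = \<Union> (set (map tm_vars ts))"
| "free_vars (Neg \<phi>) = free_vars \<phi>"
| "free_vars (Conj \<phi> \<psi>) = free_vars \<phi> \<union> free_vars \<psi>"
| "free_vars (Exi n s \<phi>) = free_vars \<phi> - {(n, s)}"

text \<open>The \<open>L\<close>-formulas \<open>\<phi>(x\<^sub>0, \<dots>, x\<^sub>m)\<close> in a tuple of variables of the sorts \<open>ss\<close>:
  the \<open>i\<close>-th entry of the tuple is \<open>Var i (ss ! i)\<close>.\<close>

definition formulas :: "('s, 'f, 'r) language \<Rightarrow> 's list \<Rightarrow> ('s, 'f, 'r) fm set" where
  "formulas L ss = {\<phi>. wf_fm L \<phi> \<and> free_vars \<phi> \<subseteq> {(i, ss ! i) | i. i < length ss}}"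

abbreviation sentences :: "('s, 'f, 'r) language \<Rightarrow> ('s, 'f, 'r) fm set" where
  "sentences L \<equiv> formulas L []"

text \<open>The sorts of a structure are disjoint: the carrier of the sort \<open>s\<close> consists of the elements
  \<open>a\<close> of \<open>univ\<close> with \<open>sort_of a = s\<close>.\<close>

record ('s, 'f, 'r, 'a) struct =
  univ :: "'a set"
  sort_of :: "'a \<Rightarrow> 's"
  fun_int :: "'f \<Rightarrow> 'a list \<Rightarrow> 'a"
  rel_int :: "'r \<Rightarrow> 'a list \<Rightarrow> bool"

abbreviation sorts :: "('s, 'f, 'r, 'a) struct \<Rightarrow> 'a list \<Rightarrow> 's list" where
  "sorts M a \<equiv> map (sort_of M) a"

definition tuples :: "('s, 'f, 'r, 'a) struct \<Rightarrow> 's list \<Rightarrow> 'a list set" where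
  "tuples M ss = {a. set a \<subseteq> univ M \<and> sorts M a = ss}"

definition is_struct :: "('s, 'f, 'r) language \<Rightarrow> ('s, 'f, 'r, 'a) struct \<Rightarrow> bool" where
  "is_struct L M \<longleftrightarrow>
     (\<forall>s. \<exists>a\<in>univ M. sort_of M a = s) \<and>
     (\<forall>f\<in>Funs L. \<forall>a\<in>tuples M (fun_dom L f).
        fun_int M f a \<in> univ M \<and> sort_of M (fun_int M f a) = fun_cod L f)"

primrec eval :: "('s, 'f, 'r, 'a) struct \<Rightarrow> (nat \<Rightarrow> 's \<Rightarrow> 'a) \<Rightarrow> ('s, 'f) tm \<Rightarrow> 'a" where
  "eval M e (Var n s) = e n s"
| "eval M e (App f ts) = fun_int M f (map (eval M e) ts)"

primrec sat ::
  "('s, 'f, 'r, 'a) struct \<Rightarrow> (nat \<Rightarrow> 's \<Rightarrow> 'a) \<Rightarrow> ('s, 'f, 'r) fm \<Rightarrow> bool" where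
  "sat M e (Equal t u) = (eval M e t = eval M e u)"
| "sat M e (Atom r ts) = rel_int M r (map (eval M e) ts)"
| "sat M e (Neg \<phi>) = (\<not> sat M e \<phi>)"
| "sat M e (Conj \<phi> \<psi>) = (sat M e \<phi> \<and> sat M e \<psi>)"
| "sat M e (Exi n s \<phi>) =
    (\<exists>a\<in>univ M. sort_of M a = s \<and> sat M (e(n := (e n)(s := a))) \<phi>)"

text \<open>\<open>M \<Turnstile> \<phi>(a)\<close>. Meaningful for \<open>\<phi> \<in> formulas L (sorts M a)\<close>, when the entries of \<open>a\<close> determine
  the values of all free variables of \<open>\<phi>\<close>.\<close>

definition holds :: "('s, 'f, 'r, 'a) struct \<Rightarrow> ('s, 'f, 'r) fm \<Rightarrow> 'a list \<Rightarrow> bool" where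
  "holds M \<phi> a = sat M (\<lambda>n s. a ! n) \<phi>"

definition is_model ::
  "('s, 'f, 'r) language \<Rightarrow> ('s, 'f, 'r, 'a) struct \<Rightarrow> ('s, 'f, 'r) fm set \<Rightarrow> bool" where
  "is_model L M T \<longleftrightarrow> is_struct L M \<and> (\<forall>\<phi>\<in>T. holds M \<phi> [])"

text \<open>Complete theories are taken to be deductively closed. Consistency is not part of this
  definition; it follows from the existence of a model. So, \<open>T\<close> being the set of all sentences
  true in its models, \<open>|T|\<close> is the number of \<open>L\<close>-formulas, as usual.\<close>

definition complete_theory ::
  "('s, 'f, 'r) language \<Rightarrow> ('s, 'f, 'r) fm set \<Rightarrow> bool" where
  "complete_theory L T \<longleftrightarrow> T \<subseteq> sentences L \<and> (\<forall>\<phi>\<in>sentences L. \<phi> \<in> T \<or> Neg \<phi> \<in> T)"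

section \<open>Types\<close>

text \<open>A formula \<open>\<phi>(x, b)\<close> with parameters is the pair \<open>(\<phi>, b)\<close>, where \<open>\<phi>(x, y)\<close> is a formula
  in the tuple of variables \<open>x\<close> followed by a tuple \<open>y\<close> matching \<open>b\<close>. Below, \<open>ss\<close> is the list
  of sorts of \<open>x\<close>.\<close>

definition formulas_over ::
  "('s, 'f, 'r) language \<Rightarrow> ('s, 'f, 'r, 'a) struct \<Rightarrow> 's list \<Rightarrow> 'a set \<Rightarrow>
   (('s, 'f, 'r) fm \<times> 'a list) set" where
  "formulas_over L M ss B = {(\<phi>, b). set b \<subseteq> B \<and> \<phi> \<in> formulas L (ss @ sorts M b)}"

definition tp ::
  "('s, 'f, 'r) language \<Rightarrow> ('s, 'f, 'r, 'a) struct \<Rightarrow> 'a list \<Rightarrow> 'a set \<Rightarrow>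
   (('s, 'f, 'r) fm \<times> 'a list) set" where
  "tp L M a B = {(\<phi>, b) \<in> formulas_over L M (sorts M a) B. holds M \<phi> (a @ b)}"

definition realizations ::
  "('s, 'f, 'r, 'a) struct \<Rightarrow> 's list \<Rightarrow> (('s, 'f, 'r) fm \<times> 'a list) set \<Rightarrow> 'a list set" where
  "realizations M ss p = {a \<in> tuples M ss. \<forall>(\<phi>, b)\<in>p. holds M \<phi> (a @ b)}"

definition algebraic_over ::
  "('s, 'f, 'r) language \<Rightarrow> ('s, 'f, 'r, 'a) struct \<Rightarrow> 'a list \<Rightarrow> 'a set \<Rightarrow> bool" where
  "algebraic_over L M b D \<longleftrightarrow>
     (\<exists>(\<theta>, d)\<in>tp L M b D. finite (realizations M (sorts M b) {(\<theta>, d)}))"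

section \<open>The monster model\<close>

definition small :: "'k rel \<Rightarrow> 'a set \<Rightarrow> bool" where
  "small \<kappa> A \<longleftrightarrow> |A| <o \<kappa>"

definition saturated ::
  "('s, 'f, 'r) language \<Rightarrow> 'k rel \<Rightarrow> ('s, 'f, 'r, 'a) struct \<Rightarrow> bool" where
  "saturated L \<kappa> M \<longleftrightarrow>
     (\<forall>A s p. A \<subseteq> univ M \<and> small \<kappa> A \<and> p \<subseteq> formulas_over L M [s] A \<and>
        (\<forall>q\<subseteq>p. finite q \<longrightarrow> realizations M [s] q \<noteq> {}) \<longrightarrow>
        realizations M [s] p \<noteq> {})"

definition elementary_on ::
  "('s, 'f, 'r) language \<Rightarrow> ('s, 'f, 'r, 'a) struct \<Rightarrow> 'a set \<Rightarrow> ('a \<Rightarrow> 'a) \<Rightarrow> bool" where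
  "elementary_on L M A g \<longleftrightarrow>
     (\<forall>a. set a \<subseteq> A \<longrightarrow>
        map g a \<in> tuples M (sorts M a) \<and>
        (\<forall>\<phi>\<in>formulas L (sorts M a). holds M \<phi> (map g a) \<longleftrightarrow> holds M \<phi> a))"

definition automorphism ::
  "('s, 'f, 'r) language \<Rightarrow> ('s, 'f, 'r, 'a) struct \<Rightarrow> ('a \<Rightarrow> 'a) \<Rightarrow> bool" where
  "automorphism L M \<sigma> \<longleftrightarrow>
     bij_betw \<sigma> (univ M) (univ M) \<and>
     (\<forall>a\<in>univ M. sort_of M (\<sigma> a) = sort_of M a) \<and>
     (\<forall>f\<in>Funs L. \<forall>a\<in>tuples M (fun_dom L f). \<sigma> (fun_int M f a) = fun_int M f (map \<sigma> a)) \<and>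
     (\<forall>r\<in>Rels L. \<forall>a\<in>tuples M (rel_dom L r). rel_int M r (map \<sigma> a) \<longleftrightarrow> rel_int M r a)"

definition strongly_homogeneous ::
  "('s, 'f, 'r) language \<Rightarrow> 'k rel \<Rightarrow> ('s, 'f, 'r, 'a) struct \<Rightarrow> bool" where
  "strongly_homogeneous L \<kappa> M \<longleftrightarrow>
     (\<forall>A g. A \<subseteq> univ M \<and> small \<kappa> A \<and> elementary_on L M A g \<longrightarrow>
        (\<exists>\<sigma>. automorphism L M \<sigma> \<and> (\<forall>a\<in>A. \<sigma> a = g a)))"

text \<open>The cardinal \<open>\<kappa>\<close> bounding the size of small sets is only required to exceed \<open>|T|\<^sup>+\<close>, which
  every usual choice of a sufficiently large \<open>\<kappa>\<close> satisfies. Some such bound is needed for the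
  local character of thorn-independence on small sets to be a condition at all: if no small set
  were larger than \<open>|T|\<close>, one could always take \<open>B\<^sub>0 = B\<close>.\<close>

definition monster_model ::
  "('s, 'f, 'r) language \<Rightarrow> ('s, 'f, 'r) fm set \<Rightarrow> 'k rel \<Rightarrow> ('s, 'f, 'r, 'a) struct \<Rightarrow> bool" where
  "monster_model L T \<kappa> M \<longleftrightarrow>
     Card_order \<kappa> \<and> cardSuc |T| <o \<kappa> \<and>
     is_model L M T \<and> saturated L \<kappa> M \<and> strongly_homogeneous L \<kappa> M"

text \<open>\<open>T = T\<^sup>e\<^sup>q\<close>, up to definitional expansion: for every equivalence relation \<open>E\<close> on a finite product
  of sorts that is definable without parameters, the quotient by \<open>E\<close> is a sort, that is, some sort
  is the image of the product under a function \<open>F\<close> that is definable without parameters and whose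
  fibres are the \<open>E\<close>-classes. This property of the model \<open>M\<close> depends only on its theory.\<close>

definition is_eq ::
  "('s, 'f, 'r) language \<Rightarrow> ('s, 'f, 'r, 'a) struct \<Rightarrow> bool" where
  "is_eq L M \<longleftrightarrow>
     (\<forall>ss. \<forall>E\<in>formulas L (ss @ ss).
        equiv (tuples M ss) {(a, b). a \<in> tuples M ss \<and> b \<in> tuples M ss \<and> holds M E (a @ b)} \<longrightarrow>
        (\<exists>s. \<exists>F\<in>formulas L (ss @ [s]). \<exists>\<pi>.
           (\<lambda>a. [\<pi> a]) ` tuples M ss = tuples M [s] \<and>
           (\<forall>a\<in>tuples M ss. \<forall>c\<in>tuples M [s]. holds M F (a @ c) \<longleftrightarrow> c = [\<pi> a]) \<and>
           (\<forall>a\<in>tuples M ss. \<forall>b\<in>tuples M ss. \<pi> a = \<pi> b \<longleftrightarrow> holds M E (a @ b))))"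

section \<open>Thorn-forking\<close>

definition strongly_divides ::
  "('s, 'f, 'r) language \<Rightarrow> ('s, 'f, 'r, 'a) struct \<Rightarrow> 's list \<Rightarrow> ('s, 'f, 'r) fm \<Rightarrow> 'a list \<Rightarrow>
   'a set \<Rightarrow> bool" where
  "strongly_divides L M ss \<phi> b D \<longleftrightarrow>
     \<not> algebraic_over L M b D \<and>
     (\<exists>k::nat. \<forall>S \<subseteq> realizations M (sorts M b) (tp L M b D). finite S \<and> card S = k \<longrightarrow>
        \<not> (\<exists>a\<in>tuples M ss. \<forall>b'\<in>S. holds M \<phi> (a @ b')))"

definition thorn_divides ::
  "('s, 'f, 'r) language \<Rightarrow> 'k rel \<Rightarrow> ('s, 'f, 'r, 'a) struct \<Rightarrow> 's list \<Rightarrow> ('s, 'f, 'r) fm \<Rightarrow>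
   'a list \<Rightarrow> 'a set \<Rightarrow> bool" where
  "thorn_divides L \<kappa> M ss \<phi> b C \<longleftrightarrow>
     (\<exists>D. C \<subseteq> D \<and> D \<subseteq> univ M \<and> small \<kappa> D \<and> strongly_divides L M ss \<phi> b D)"

definition thorn_forks ::
  "('s, 'f, 'r) language \<Rightarrow> 'k rel \<Rightarrow> ('s, 'f, 'r, 'a) struct \<Rightarrow> 's list \<Rightarrow> ('s, 'f, 'r) fm \<Rightarrow>
   'a list \<Rightarrow> 'a set \<Rightarrow> bool" where
  "thorn_forks L \<kappa> M ss \<phi> b C \<longleftrightarrow>
     (\<exists>\<Psi> \<subseteq> formulas_over L M ss (univ M). finite \<Psi> \<and>
        (\<forall>(\<psi>, d)\<in>\<Psi>. thorn_divides L \<kappa> M ss \<psi> d C) \<and>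
        (\<forall>a\<in>tuples M ss. holds M \<phi> (a @ b) \<longrightarrow> (\<exists>(\<psi>, d)\<in>\<Psi>. holds M \<psi> (a @ d))))"

definition type_thorn_forks ::
  "('s, 'f, 'r) language \<Rightarrow> 'k rel \<Rightarrow> ('s, 'f, 'r, 'a) struct \<Rightarrow> 's list \<Rightarrow>
   (('s, 'f, 'r) fm \<times> 'a list) set \<Rightarrow> 'a set \<Rightarrow> bool" where
  "type_thorn_forks L \<kappa> M ss p A \<longleftrightarrow> (\<exists>(\<phi>, b)\<in>p. thorn_forks L \<kappa> M ss \<phi> b A)"

text \<open>\<open>thorn_indep L \<kappa> M a A B\<close>: the tuple \<open>a\<close> is thorn-independent from \<open>B\<close> over \<open>A\<close>.\<close>

definition thorn_indep ::
  "('s, 'f, 'r) language \<Rightarrow> 'k rel \<Rightarrow> ('s, 'f, 'r, 'a) struct \<Rightarrow> 'a list \<Rightarrow> 'a set \<Rightarrow> 'a set \<Rightarrow>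
   bool" where
  "thorn_indep L \<kappa> M a A B \<longleftrightarrow> \<not> type_thorn_forks L \<kappa> M (sorts M a) (tp L M a (A \<union> B)) A"

text \<open>Independence of an infinite tuple with set of entries \<open>C\<close>: a formula in its type involves only
  a finite subtuple.\<close>

definition thorn_indep_set ::
  "('s, 'f, 'r) language \<Rightarrow> 'k rel \<Rightarrow> ('s, 'f, 'r, 'a) struct \<Rightarrow> 'a set \<Rightarrow> 'a set \<Rightarrow> 'a set \<Rightarrow>
   bool" where
  "thorn_indep_set L \<kappa> M C A B \<longleftrightarrow> (\<forall>c. set c \<subseteq> C \<longrightarrow> thorn_indep L \<kappa> M c A B)"

definition thorn_independent_family ::
  "('s, 'f, 'r) language \<Rightarrow> 'k rel \<Rightarrow> ('s, 'f, 'r, 'a) struct \<Rightarrow> 'a set \<Rightarrow> nat \<Rightarrow>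
   (nat \<Rightarrow> 'a list) \<Rightarrow> bool" where
  "thorn_independent_family L \<kappa> M A n a \<longleftrightarrow>
     (\<forall>i<n. thorn_indep L \<kappa> M (a i) A (\<Union>j\<in>{..<n} - {i}. set (a j)))"

definition rosy ::
  "('s, 'f, 'r) language \<Rightarrow> ('s, 'f, 'r) fm set \<Rightarrow> 'k rel \<Rightarrow> ('s, 'f, 'r, 'a) struct \<Rightarrow> bool" where
  "rosy L T \<kappa> M \<longleftrightarrow>
     (\<forall>a B. set a \<subseteq> univ M \<and> B \<subseteq> univ M \<and> small \<kappa> B \<longrightarrow>
        (\<exists>B\<^sub>0\<subseteq>B. |B\<^sub>0| \<le>o |T| \<and> thorn_indep L \<kappa> M a B\<^sub>0 B))"

section \<open>Thorn-Morley sequences\<close>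

definition indiscernible ::
  "('s, 'f, 'r) language \<Rightarrow> ('s, 'f, 'r, 'a) struct \<Rightarrow> 'a set \<Rightarrow> (nat \<Rightarrow> 'a list) \<Rightarrow> bool" where
  "indiscernible L M B c \<longleftrightarrow>
     (\<forall>j. c j \<in> tuples M (sorts M (c 0))) \<and>
     (\<forall>is js. sorted_wrt (<) is \<and> sorted_wrt (<) js \<and> length is = length js \<longrightarrow>
        tp L M (concat (map c is)) B = tp L M (concat (map c js)) B)"

definition thorn_Morley ::
  "('s, 'f, 'r) language \<Rightarrow> 'k rel \<Rightarrow> ('s, 'f, 'r, 'a) struct \<Rightarrow> 'a set \<Rightarrow> 'a set \<Rightarrow>
   (nat \<Rightarrow> 'a list) \<Rightarrow> bool" where
  "thorn_Morley L \<kappa> M A B c \<longleftrightarrow>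
     A \<subseteq> B \<and> indiscernible L M B c \<and>
     (\<forall>j. thorn_indep L \<kappa> M (c j) A (B \<union> (\<Union>l<j. set (c l))))"

definition entries :: "(nat \<Rightarrow> 'a list) \<Rightarrow> 'a set" where
  "entries c = (\<Union>j. set (c j))"

definition other_entries :: "nat \<Rightarrow> (nat \<Rightarrow> nat \<Rightarrow> 'a list) \<Rightarrow> nat \<Rightarrow> 'a set" where
  "other_entries n I i = (\<Union>j\<in>{..<n} - {i}. entries (I j))"

end

theory Submission imports Defs begin

text \<open>Thorn-independence of a possibly infinite set \<open>C\<close> from \<open>B\<close> over \<open>A\<close>, written \<open>ind C A B\<close>, is handled
  through a characterization by algebraic closure: for every small \<open>B'\<close> containing \<open>A\<close> and \<open>B\<close>, some
  conjugate of \<open>C\<close> over \<open>A \<union> B\<close> makes no element of \<open>B'\<close> algebraic over a set \<open>D\<close> with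
  \<open>A \<subseteq> D \<subseteq> B'\<close> unless it is already algebraic over \<open>D\<close> (\<open>ind_obtain\<close>, \<open>ind_intro\<close>). The reason is
  that a formula strongly divides over \<open>D\<close> exactly when its realizations make a nonalgebraic
  parameter algebraic in a uniform way. Monotonicity, base monotonicity, invariance and left
  transitivity follow from this, and extension is a compactness argument.

  Symmetry needs rosiness. If \<open>X\<close> is independent from \<open>Y\<close> over \<open>A\<close> but not conversely, the
  characterization yields a finite configuration with an algebraic dependence. Finite sequences of
  independent copies of the configuration, built from the last one downwards by extension, give by
  compactness a sequence of length \<open>|T|\<^sup>+\<close> along which the dependence occurs at every stage, against
  local character. No indiscernible sequence is involved in this. With symmetry,
  independence is transitive on the right (\<open>right_transitivity\<close>).

  Morley sequences come from types that are finitely satisfiable in a small model \<open>N\<close>, since these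
  are independent over \<open>N\<close>: iterating the average along an ultrafilter on \<open>N\<close> yields an
  indiscernible sequence of independent realizations (\<open>Morley_sequence_over_model\<close>). If \<open>a\<close> is
  independent from \<open>B\<close> over \<open>A\<close>, then \<open>N\<close> can be chosen to contain \<open>A \<union> B\<close> and to be independent
  from \<open>a\<close> over \<open>A\<close>, and transitivity turns the sequence into one based on \<open>A\<close> (\<open>Morley_sequence\<close>).
  The same iterated averages, now along a nonprincipal ultrafilter on the natural numbers, extract
  an indiscernible sequence from an arbitrary one (\<open>extract_indiscernible\<close>).

  The required sequences are obtained in two passes. First the tuples \<open>a i\<close> are replaced one after
  the other by Morley sequences that are independent from everything else; a sequence is then
  indiscernible over the earlier sequences and the first terms of the later ones. In the second pass
  each sequence is replaced by one extracted from it over all the others. This makes it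
  indiscernible over the others, and destroys nothing, because indiscernibility of the others over it
  and independence from it can be read off its Ehrenfeucht-Mostowski type (\<open>em_indisc\<close>, \<open>em_ind\<close>). The
  first terms of the sequences keep their joint type over \<open>A\<close>, so an automorphism over \<open>A\<close> moves them
  back to the tuples \<open>a i\<close>.\<close>

section \<open>Renaming variables\<close>

primrec rename_tm :: "(nat \<Rightarrow> 's \<Rightarrow> nat) \<Rightarrow> ('s, 'f) tm \<Rightarrow> ('s, 'f) tm" where
  "rename_tm \<rho> (Var n s) = Var (\<rho> n s) s"
| "rename_tm \<rho> (App f ts) = App f (map (rename_tm \<rho>) ts)"

lemma tm_sort_rename_tm [simp]: "tm_sort L (rename_tm \<rho> t) = tm_sort L t"
  by (cases t) auto

lemma wf_tm_rename_tm: "wf_tm L t \<Longrightarrow> wf_tm L (rename_tm \<rho> t)"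
  by (induction t) (auto simp: list_all_iff comp_def)

lemma tm_vars_rename_tm: "tm_vars (rename_tm \<rho> t) = (\<lambda>(n, s). (\<rho> n s, s)) ` tm_vars t"
  by (induction t) auto

lemma eval_rename_tm: "eval M e (rename_tm \<rho> t) = eval M (\<lambda>n s. e (\<rho> n s) s) t"
  by (induction t) (auto simp: comp_def cong: map_cong)

lemma eval_cong: "(\<And>n s. (n, s) \<in> tm_vars t \<Longrightarrow> e n s = e' n s) \<Longrightarrow> eval M e t = eval M e' t"
proof (induction t)
  case (App f ts)
  have "eval M e t = eval M e' t" if "t \<in> set ts" for t
    by (rule App.IH[OF that]) (use App.prems that in auto)
  then have "map (eval M e) ts = map (eval M e') ts" by simp
  then show ?case by (metis eval.simps(2))
qed auto

lemma sat_cong: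
  "(\<And>n s. (n, s) \<in> free_vars \<phi> \<Longrightarrow> e n s = e' n s) \<Longrightarrow> sat M e \<phi> = sat M e' \<phi>"
proof (induction \<phi> arbitrary: e e')
  case (Equal t u)
  then show ?case using eval_cong[of t e e' M] eval_cong[of u e e' M] by auto
next
  case (Atom r ts)
  then have "map (eval M e) ts = map (eval M e') ts"
    by (intro map_cong refl eval_cong) auto
  then show ?case by (metis sat.simps(2))
next
  case (Neg \<phi>)
  then show ?case by (metis free_vars.simps(3) sat.simps(3))
next
  case (Conj \<phi>1 \<phi>2)
  then show ?case by (metis UnCI free_vars.simps(4) sat.simps(4))
next
  case (Exi n s \<phi>)
  have "sat M (e(n := (e n)(s := a))) \<phi> = sat M (e'(n := (e' n)(s := a))) \<phi>" for a
    by (rule Exi.IH) (use Exi.prems in auto)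
  then show ?case by simp
qed

lemma finite_tm_vars: "finite (tm_vars t)"
  by (induction t) auto

lemma finite_free_vars: "finite (free_vars \<phi>)"
  by (induction \<phi>) (auto simp: finite_tm_vars)

text \<open>Bound variables have to be renamed as well, to numbers that avoid capture; so the renamed
  formula is constructed together with its properties.\<close>

lemma rename_fm:
  "\<exists>\<phi>'. (wf_fm L \<phi> \<longrightarrow> wf_fm L \<phi>') \<and> free_vars \<phi>' = (\<lambda>(n, s). (\<rho> n s, s)) ` free_vars \<phi> \<and>
     (\<forall>e. sat M e \<phi>' = sat M (\<lambda>n s. e (\<rho> n s) s) \<phi>)"
proof (induction \<phi> arbitrary: \<rho>)
  case (Equal t u)
  show ?case
    by (rule exI[of _ "Equal (rename_tm \<rho> t) (rename_tm \<rho> u)"])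
      (auto simp: wf_tm_rename_tm tm_vars_rename_tm eval_rename_tm)
next
  case (Atom r ts)
  show ?case
    by (rule exI[of _ "Atom r (map (rename_tm \<rho>) ts)"])
      (auto simp: wf_tm_rename_tm tm_vars_rename_tm eval_rename_tm comp_def list_all_iff)
next
  case (Neg \<phi>)
  from Neg[of \<rho>] obtain \<phi>' where "(wf_fm L \<phi> \<longrightarrow> wf_fm L \<phi>')"
    "free_vars \<phi>' = (\<lambda>(n, s). (\<rho> n s, s)) ` free_vars \<phi>"
    "(\<forall>e. sat M e \<phi>' = sat M (\<lambda>n s. e (\<rho> n s) s) \<phi>)" by blast
  then show ?case by (intro exI[of _ "Neg \<phi>'"]) auto
next
  case (Conj \<phi> \<psi>)
  from Conj(1)[of \<rho>] obtain \<phi>' where 1: "(wf_fm L \<phi> \<longrightarrow> wf_fm L \<phi>')"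
    "free_vars \<phi>' = (\<lambda>(n, s). (\<rho> n s, s)) ` free_vars \<phi>"
    "(\<forall>e. sat M e \<phi>' = sat M (\<lambda>n s. e (\<rho> n s) s) \<phi>)" by blast
  from Conj(2)[of \<rho>] obtain \<psi>' where 2: "(wf_fm L \<psi> \<longrightarrow> wf_fm L \<psi>')"
    "free_vars \<psi>' = (\<lambda>(n, s). (\<rho> n s, s)) ` free_vars \<psi>"
    "(\<forall>e. sat M e \<psi>' = sat M (\<lambda>n s. e (\<rho> n s) s) \<psi>)" by blast
  from 1 2 show ?case by (intro exI[of _ "Conj \<phi>' \<psi>'"]) auto
next
  case (Exi n s \<phi>)
  let ?V = "(\<lambda>(n, s). \<rho> n s) ` free_vars \<phi>"
  obtain m where m: "\<forall>x\<in>?V. x < m"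
    using finite_nat_set_iff_bounded[of ?V] finite_free_vars[of \<phi>] by auto
  let ?\<rho> = "\<rho>(n := (\<rho> n)(s := m))"
  from Exi[of ?\<rho>] obtain \<phi>' where 1: "(wf_fm L \<phi> \<longrightarrow> wf_fm L \<phi>')"
    "free_vars \<phi>' = (\<lambda>(n, s). (?\<rho> n s, s)) ` free_vars \<phi>"
    "\<And>e. sat M e \<phi>' = sat M (\<lambda>n s. e (?\<rho> n s) s) \<phi>" by blast
  have fresh: "\<rho> n' s' \<noteq> m" if "(n', s') \<in> free_vars \<phi>" for n' s'
    using m that by force
  have "free_vars (Exi m s \<phi>') = (\<lambda>(n, s). (\<rho> n s, s)) ` free_vars (Exi n s \<phi>)"
  proof -
    have "(case z of (n', s') \<Rightarrow> (?\<rho> n' s', s')) = (case z of (n', s') \<Rightarrow> (\<rho> n' s', s'))"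
      if "z \<in> free_vars \<phi> - {(n, s)}" for z using that by (cases z) auto
    then have "(\<lambda>(n, s). (\<rho> n s, s)) ` free_vars (Exi n s \<phi>) =
        (\<lambda>(n, s). (?\<rho> n s, s)) ` (free_vars \<phi> - {(n, s)})"
      by (auto intro!: image_cong)
    moreover have "(\<lambda>(n, s). (?\<rho> n s, s)) ` free_vars \<phi> - {(m, s)} =
        (\<lambda>(n, s). (?\<rho> n s, s)) ` (free_vars \<phi> - {(n, s)})"
      by (auto dest: fresh split: if_splits)
    ultimately show ?thesis by (simp add: 1(2))
  qed
  moreover have "sat M e (Exi m s \<phi>') = sat M (\<lambda>n s. e (\<rho> n s) s) (Exi n s \<phi>)" for e
  proof -
    have "sat M (e(m := (e m)(s := a))) \<phi>' =
        sat M ((\<lambda>n s. e (\<rho> n s) s)(n := (\<lambda>s. e (\<rho> n s) s)(s := a))) \<phi>" for a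
      unfolding 1(3) by (rule sat_cong) (auto dest: fresh)
    then show ?thesis by simp
  qed
  ultimately show ?case using 1(1) by (intro exI[of _ "Exi m s \<phi>'"]) auto
qed

lemma rename_formula:
  assumes "\<phi> \<in> formulas L ss" "length idx = length ss"
    "\<And>k. k < length ss \<Longrightarrow> idx ! k < length tt \<and> tt ! (idx ! k) = ss ! k"
  shows "\<exists>\<phi>'\<in>formulas L tt. \<forall>a. holds M \<phi>' a = holds M \<phi> (map ((!) a) idx)"
proof -
  obtain \<phi>' where 1: "wf_fm L \<phi> \<longrightarrow> wf_fm L \<phi>'"
    "free_vars \<phi>' = (\<lambda>(n, s). (idx ! n, s)) ` free_vars \<phi>"
    "\<And>e. sat M e \<phi>' = sat M (\<lambda>n s. e (idx ! n) s) \<phi>"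
    using rename_fm[of L \<phi> "\<lambda>n s. idx ! n" M] by auto
  have fv: "free_vars \<phi> \<subseteq> {(i, ss ! i) |i. i < length ss}" and wf: "wf_fm L \<phi>"
    using assms(1) by (auto simp: formulas_def)
  have "free_vars \<phi>' \<subseteq> {(i, tt ! i) |i. i < length tt}"
    unfolding 1(2)
  proof
    fix z assume "z \<in> (\<lambda>(n, s). (idx ! n, s)) ` free_vars \<phi>"
    then obtain n s where z: "z = (idx ! n, s)" "(n, s) \<in> free_vars \<phi>" by auto
    then have "n < length ss" "s = ss ! n" using fv by auto
    then show "z \<in> {(i, tt ! i) |i. i < length tt}" using assms(3)[of n] z by auto
  qed
  then have "\<phi>' \<in> formulas L tt" using 1(1) wf by (simp add: formulas_def)
  moreover have "holds M \<phi>' a = holds M \<phi> (map ((!) a) idx)" for a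
    unfolding holds_def 1(3) using fv assms(2) by (intro sat_cong) auto
  ultimately show ?thesis by blast
qed

lemma holds_Neg [simp]: "holds M (Neg \<phi>) a \<longleftrightarrow> \<not> holds M \<phi> a"
  and holds_Conj [simp]: "holds M (Conj \<phi> \<psi>) a \<longleftrightarrow> holds M \<phi> a \<and> holds M \<psi> a"
  by (simp_all add: holds_def)

lemma formulas_Neg [simp]: "Neg \<phi> \<in> formulas L ss \<longleftrightarrow> \<phi> \<in> formulas L ss"
  and formulas_Conj [simp]:
    "Conj \<phi> \<psi> \<in> formulas L ss \<longleftrightarrow> \<phi> \<in> formulas L ss \<and> \<psi> \<in> formulas L ss"
  by (auto simp: formulas_def)

lemma formulas_Exi: "\<phi> \<in> formulas L (ss @ [s]) \<Longrightarrow> Exi (length ss) s \<phi> \<in> formulas L ss"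
  unfolding formulas_def by (auto simp: nth_append less_Suc_eq)

lemma holds_Exi:
  assumes "\<phi> \<in> formulas L (ss @ [s])" "length a = length ss"
  shows "holds M (Exi (length ss) s \<phi>) a \<longleftrightarrow>
    (\<exists>x\<in>univ M. sort_of M x = s \<and> holds M \<phi> (a @ [x]))"
proof -
  have "sat M ((\<lambda>n s. a ! n)(length ss := (\<lambda>s. a ! length ss)(s := x))) \<phi> =
      sat M (\<lambda>n s. (a @ [x]) ! n) \<phi>" for x
  proof (rule sat_cong)
    fix n s' assume "(n, s') \<in> free_vars \<phi>"
    then have "n < length ss \<or> n = length ss \<and> s' = s"
      using assms(1) by (auto simp: formulas_def nth_append less_Suc_eq)
    then show "((\<lambda>n s. a ! n)(length ss := (\<lambda>s. a ! length ss)(s := x))) n s' = (a @ [x]) ! n"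
      using assms(2) by (auto simp: nth_append)
  qed
  then show ?thesis by (simp add: holds_def)
qed

text \<open>The substitution of variables in the form in which it is used: the entries of the lists are
  names, \<open>S\<close> gives their sorts and \<open>f\<close> their values.\<close>

lemma rename_names:
  assumes "\<phi> \<in> formulas L (map S ts)" "set ts \<subseteq> set tt"
  shows "\<exists>\<phi>'\<in>formulas L (map S tt). \<forall>f. holds M \<phi>' (map f tt) = holds M \<phi> (map f ts)"
proof -
  define ix where "ix t = (SOME i. i < length tt \<and> tt ! i = t)" for t
  have ix: "ix t < length tt \<and> tt ! ix t = t" if "t \<in> set ts" for t
  proof -
    have "t \<in> set tt" using that assms(2) by blast
    then show ?thesis unfolding ix_def in_set_conv_nth by (rule someI_ex)
  qed
  have "\<exists>\<phi>'\<in>formulas L (map S tt). \<forall>a. holds M \<phi>' a = holds M \<phi> (map ((!) a) (map ix ts))"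
    by (rule rename_formula[OF assms(1)]) (use ix in auto)
  then obtain \<phi>' where \<phi>': "\<phi>' \<in> formulas L (map S tt)"
    "\<And>a. holds M \<phi>' a = holds M \<phi> (map ((!) a) (map ix ts))" by blast
  have "holds M \<phi>' (map f tt) = holds M \<phi> (map f ts)" for f
  proof -
    have "map ((!) (map f tt)) (map ix ts) = map f ts" using ix by auto
    then show ?thesis by (simp only: \<phi>'(2))
  qed
  then show ?thesis using \<phi>'(1) by blast
qed

section \<open>Automorphisms preserve formulas\<close>

lemma eval_in_univ:
  assumes "is_struct L M" "\<And>n s. e n s \<in> univ M \<and> sort_of M (e n s) = s" "wf_tm L t"
  shows "eval M e t \<in> univ M \<and> sort_of M (eval M e t) = tm_sort L t"
  using assms(3)
proof (induction t)
  case (App f ts)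
  then have "map (eval M e) ts \<in> tuples M (fun_dom L f)"
    by (auto simp: tuples_def list_all_iff comp_def cong: map_cong)
  with App.prems show ?case using assms(1) by (auto simp: is_struct_def)
qed (use assms(2) in auto)

lemma map_eval_tuples:
  assumes "is_struct L M" "\<And>n s. e n s \<in> univ M \<and> sort_of M (e n s) = s"
    "\<forall>t\<in>set ts. wf_tm L t" "map (tm_sort L) ts = ss"
  shows "map (eval M e) ts \<in> tuples M ss"
  using eval_in_univ[OF assms(1,2)] assms(3,4) by (auto simp: tuples_def)

lemma eval_automorphism:
  assumes "is_struct L M" "automorphism L M \<sigma>"
    "\<And>n s. e n s \<in> univ M \<and> sort_of M (e n s) = s" "wf_tm L t"
  shows "eval M (\<lambda>n s. \<sigma> (e n s)) t = \<sigma> (eval M e t)"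
  using assms(4)
proof (induction t)
  case (App f ts)
  have 1: "map (eval M (\<lambda>n s. \<sigma> (e n s))) ts = map \<sigma> (map (eval M e) ts)"
    using App by (auto simp: list_all_iff)
  have "map (eval M e) ts \<in> tuples M (fun_dom L f)"
    using App.prems by (intro map_eval_tuples[OF assms(1,3)]) (auto simp: list_all_iff)
  then show ?case using App.prems assms(2) unfolding eval.simps 1
    by (auto simp: automorphism_def)
qed auto

lemma sat_automorphism:
  assumes "is_struct L M" "automorphism L M \<sigma>"
    "\<And>n s. e n s \<in> univ M \<and> sort_of M (e n s) = s" "wf_fm L \<phi>"
  shows "sat M (\<lambda>n s. \<sigma> (e n s)) \<phi> = sat M e \<phi>"
  using assms(3,4)
proof (induction \<phi> arbitrary: e)
  case (Equal t u)
  have "inj_on \<sigma> (univ M)" using assms(2) by (auto simp: automorphism_def bij_betw_def)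
  then show ?case
    using Equal eval_automorphism[OF assms(1,2) Equal(1)] eval_in_univ[OF assms(1) Equal(1)]
    by (auto dest: inj_onD)
next
  case (Atom r ts)
  have 1: "map (eval M (\<lambda>n s. \<sigma> (e n s))) ts = map \<sigma> (map (eval M e) ts)"
    using Atom eval_automorphism[OF assms(1,2) Atom(1)] by (auto simp: list_all_iff)
  have "map (eval M e) ts \<in> tuples M (rel_dom L r)"
    using Atom by (intro map_eval_tuples[OF assms(1)]) (auto simp: list_all_iff)
  then have "rel_int M r (map \<sigma> (map (eval M e) ts)) = rel_int M r (map (eval M e) ts)"
    using Atom.prems assms(2) unfolding automorphism_def wf_fm.simps by blast
  then show ?case unfolding sat.simps 1 .
next
  case (Exi n s \<phi>)
  have bij: "bij_betw \<sigma> (univ M) (univ M)" and so: "\<And>a. a \<in> univ M \<Longrightarrow> sort_of M (\<sigma> a) = sort_of M a"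
    using assms(2) by (auto simp: automorphism_def)
  have upd: "(\<lambda>n' s'. \<sigma> ((e(n := (e n)(s := x))) n' s')) =
      (\<lambda>n s. \<sigma> (e n s))(n := (\<lambda>s. \<sigma> (e n s))(s := \<sigma> x))" for x by (intro ext) auto
  have IH: "sat M ((\<lambda>n s. \<sigma> (e n s))(n := (\<lambda>s. \<sigma> (e n s))(s := \<sigma> x))) \<phi> =
      sat M (e(n := (e n)(s := x))) \<phi>" if "x \<in> univ M" "sort_of M x = s" for x
    unfolding upd[symmetric] by (rule Exi.IH) (use Exi.prems that in auto)
  show ?case
  proof
    assume "sat M (\<lambda>n s. \<sigma> (e n s)) (Exi n s \<phi>)"
    then obtain y where y: "y \<in> univ M" "sort_of M y = s"
      "sat M ((\<lambda>n s. \<sigma> (e n s))(n := (\<lambda>s. \<sigma> (e n s))(s := y))) \<phi>" by auto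
    moreover obtain x where "x \<in> univ M" "y = \<sigma> x" using bij y(1) by (auto simp: bij_betw_def)
    ultimately show "sat M e (Exi n s \<phi>)" using IH[of x] so[of x] by auto
  next
    assume "sat M e (Exi n s \<phi>)"
    then obtain x where x: "x \<in> univ M" "sort_of M x = s" "sat M (e(n := (e n)(s := x))) \<phi>" by auto
    moreover have "\<sigma> x \<in> univ M" using bij x(1) by (auto simp: bij_betw_def)
    ultimately show "sat M (\<lambda>n s. \<sigma> (e n s)) (Exi n s \<phi>)" using IH[of x] so[of x] by auto
  qed
qed auto

lemma holds_automorphism:
  assumes "is_struct L M" "automorphism L M \<sigma>" "set a \<subseteq> univ M" "\<phi> \<in> formulas L (sorts M a)"
  shows "holds M \<phi> (map \<sigma> a) = holds M \<phi> a"
proof -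
  obtain d where d: "\<And>s. d s \<in> univ M \<and> sort_of M (d s) = s"
    using assms(1) unfolding is_struct_def by metis
  define e where "e n s = (if n < length a \<and> sort_of M (a ! n) = s then a ! n else d s)" for n s
  have fv: "free_vars \<phi> \<subseteq> {(i, sorts M a ! i) |i. i < length a}" and wf: "wf_fm L \<phi>"
    using assms(4) by (auto simp: formulas_def)
  have "holds M \<phi> (map \<sigma> a) = sat M (\<lambda>n s. \<sigma> (e n s)) \<phi>"
    unfolding holds_def using fv by (intro sat_cong) (auto simp: e_def)
  also have "\<dots> = sat M e \<phi>"
    using d assms(3) wf by (intro sat_automorphism[OF assms(1,2)]) (auto simp: e_def)
  also have "\<dots> = holds M \<phi> a"
    unfolding holds_def using fv by (intro sat_cong) (auto simp: e_def)
  finally show ?thesis .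
qed

lemma automorphism_fun_int:
    "automorphism L M \<sigma> \<Longrightarrow> f \<in> Funs L \<Longrightarrow> a \<in> tuples M (fun_dom L f) \<Longrightarrow>
      \<sigma> (fun_int M f a) = fun_int M f (map \<sigma> a)"
  and automorphism_rel_int:
    "automorphism L M \<sigma> \<Longrightarrow> r \<in> Rels L \<Longrightarrow> a \<in> tuples M (rel_dom L r) \<Longrightarrow>
      rel_int M r (map \<sigma> a) = rel_int M r a"
  by (simp_all add: automorphism_def)

lemma automorphism_inv:
  assumes "is_struct L M" "automorphism L M \<sigma>"
  shows "automorphism L M (inv_into (univ M) \<sigma>)"
proof -
  let ?\<tau> = "inv_into (univ M) \<sigma>"
  have bij: "bij_betw \<sigma> (univ M) (univ M)"
    and so: "\<And>a. a \<in> univ M \<Longrightarrow> sort_of M (\<sigma> a) = sort_of M a"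
    using assms(2) by (auto simp: automorphism_def)
  have b2: "bij_betw ?\<tau> (univ M) (univ M)" using bij by (rule bij_betw_inv_into)
  have \<tau>1: "\<sigma> (?\<tau> a) = a" if "a \<in> univ M" for a using bij that by (rule bij_betw_inv_into_right)
  have \<tau>2: "?\<tau> (\<sigma> a) = a" if "a \<in> univ M" for a using bij that by (rule bij_betw_inv_into_left)
  have \<tau>u: "?\<tau> a \<in> univ M" if "a \<in> univ M" for a using b2 that by (auto simp: bij_betw_def)
  have \<tau>s: "sort_of M (?\<tau> a) = sort_of M a" if "a \<in> univ M" for a
    using so[OF \<tau>u[OF that]] \<tau>1[OF that] by simp
  have \<tau>t: "map ?\<tau> a \<in> tuples M ss \<and> map \<sigma> (map ?\<tau> a) = a" if "a \<in> tuples M ss" for a ss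
  proof -
    have a: "set a \<subseteq> univ M" "sorts M a = ss" using that by (auto simp: tuples_def)
    have "map \<sigma> (map ?\<tau> a) = a" using a(1) \<tau>1 by (simp add: map_idI subset_iff)
    moreover have "sorts M (map ?\<tau> a) = sorts M a" using a(1) \<tau>s by (simp add: subset_iff)
    ultimately show ?thesis using a \<tau>u unfolding tuples_def by auto
  qed
  show ?thesis unfolding automorphism_def
  proof (intro conjI ballI b2 \<tau>s)
    fix f a assume fa: "f \<in> Funs L" "a \<in> tuples M (fun_dom L f)"
    have "\<sigma> (fun_int M f (map ?\<tau> a)) = fun_int M f a"
      using \<tau>t[OF fa(2)] automorphism_fun_int[OF assms(2) fa(1)] by metis
    moreover have "fun_int M f (map ?\<tau> a) \<in> univ M"
      using \<tau>t[OF fa(2)] assms(1) fa(1) unfolding is_struct_def by blast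
    ultimately show "?\<tau> (fun_int M f a) = fun_int M f (map ?\<tau> a)" using \<tau>2 by metis
  next
    fix r a assume ra: "r \<in> Rels L" "a \<in> tuples M (rel_dom L r)"
    show "rel_int M r (map ?\<tau> a) = rel_int M r a"
      using \<tau>t[OF ra(2)] automorphism_rel_int[OF assms(2) ra(1)] by metis
  qed auto
qed

lemma automorphism_comp:
  assumes "automorphism L M \<sigma>" "automorphism L M \<tau>" "is_struct L M"
  shows "automorphism L M (\<tau> \<circ> \<sigma>)"
proof -
  have bij: "bij_betw \<sigma> (univ M) (univ M)"
    and so: "\<And>a. a \<in> univ M \<Longrightarrow> sort_of M (\<sigma> a) = sort_of M a"
    using assms(1) by (auto simp: automorphism_def)
  have u: "\<sigma> a \<in> univ M" if "a \<in> univ M" for a using bij that by (auto simp: bij_betw_def)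
  have t: "map \<sigma> a \<in> tuples M ss" if "a \<in> tuples M ss" for a ss
    using that u so by (auto simp: tuples_def subset_iff)
  show ?thesis unfolding automorphism_def
  proof (intro conjI ballI)
    show "bij_betw (\<tau> \<circ> \<sigma>) (univ M) (univ M)"
      using assms(1,2) unfolding automorphism_def by (blast intro: bij_betw_trans)
  next
    fix a assume "a \<in> univ M"
    then show "sort_of M ((\<tau> \<circ> \<sigma>) a) = sort_of M a"
      using u so assms(2) by (auto simp: automorphism_def)
  next
    fix f a assume fa: "f \<in> Funs L" "a \<in> tuples M (fun_dom L f)"
    show "(\<tau> \<circ> \<sigma>) (fun_int M f a) = fun_int M f (map (\<tau> \<circ> \<sigma>) a)"
      using automorphism_fun_int[OF assms(1) fa] automorphism_fun_int[OF assms(2) fa(1) t[OF fa(2)]]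
      by simp
  next
    fix r a assume ra: "r \<in> Rels L" "a \<in> tuples M (rel_dom L r)"
    show "rel_int M r (map (\<tau> \<circ> \<sigma>) a) = rel_int M r a"
      using automorphism_rel_int[OF assms(1) ra] automorphism_rel_int[OF assms(2) ra(1) t[OF ra(2)]]
      by simp
  qed
qed

lemma automorphism_id: "automorphism L M id"
  by (auto simp: automorphism_def)

section \<open>Definable conditions on families of elements\<close>

locale monster =
  fixes L :: "('s, 'f, 'r) language"
    and T :: "('s, 'f, 'r) fm set"
    and \<kappa> :: "'k rel"
    and M :: "('s, 'f, 'r, 'a) struct"
  assumes complete: "complete_theory L T"
    and monster: "monster_model L T \<kappa> M"
begin

lemma is_struct: "is_struct L M"
  using monster by (simp add: monster_model_def is_model_def)

lemma Card_order_\<kappa>: "Card_order \<kappa>"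
  using monster by (simp add: monster_model_def)

lemma ex_sort: "\<exists>x\<in>univ M. sort_of M x = s"
  using is_struct by (simp add: is_struct_def)

definition asg :: "'v set \<Rightarrow> ('v \<Rightarrow> 's) \<Rightarrow> ('v \<Rightarrow> 'a) \<Rightarrow> bool" where
  "asg V s g \<longleftrightarrow> (\<forall>v\<in>V. g v \<in> univ M \<and> sort_of M (g v) = s v)"

text \<open>A condition \<open>P\<close> on assignments is definable over \<open>B\<close> if it is given by a formula whose
  variables are named by elements of \<open>V\<close>. Naming the variables by an arbitrary type, rather than by
  positions in a tuple, is what makes the later arguments free of index computations: an element
  of the model can serve as the name of a variable for itself.\<close>

definition definable :: "'a set \<Rightarrow> 'v set \<Rightarrow> ('v \<Rightarrow> 's) \<Rightarrow> (('v \<Rightarrow> 'a) \<Rightarrow> bool) \<Rightarrow> bool" where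
  "definable B V s P \<longleftrightarrow>
     (\<exists>\<phi> ts. set ts \<subseteq> Inl ` V \<union> Inr ` B \<and> \<phi> \<in> formulas L (map (case_sum s (sort_of M)) ts) \<and>
        (\<forall>g. asg V s g \<longrightarrow> P g = holds M \<phi> (map (case_sum g id) ts)))"

lemma definableE:
  assumes "definable B V s P"
  obtains \<phi> ts where "set ts \<subseteq> Inl ` V \<union> Inr ` B"
    "\<phi> \<in> formulas L (map (case_sum s (sort_of M)) ts)"
    "\<And>g. asg V s g \<Longrightarrow> P g = holds M \<phi> (map (case_sum g id) ts)"
  using assms unfolding definable_def by blast

lemma definable_cong:
  "definable B V s P \<Longrightarrow> (\<And>g. asg V s g \<Longrightarrow> P g = Q g) \<Longrightarrow> definable B V s Q"
  unfolding definable_def by (elim exE conjE, intro exI conjI) auto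

lemma asg_mono: "asg W s g \<Longrightarrow> V \<subseteq> W \<Longrightarrow> asg V s g"
  by (auto simp: asg_def)

lemma asg_id: "V \<subseteq> univ M \<Longrightarrow> asg V (sort_of M) id"
  by (auto simp: asg_def)

lemma ex_asg: "\<exists>g. asg V s g"
proof -
  obtain d where "\<forall>s. d s \<in> univ M \<and> sort_of M (d s) = s" using ex_sort by metis
  then show ?thesis unfolding asg_def by (intro exI[of _ "\<lambda>v. d (s v)"]) blast
qed

lemma asg_cong: "\<forall>v\<in>V. g v = g' v \<Longrightarrow> asg V s g = asg V s g'"
  by (auto simp: asg_def)

lemma definable_mono: "definable B V s P \<Longrightarrow> B \<subseteq> B' \<Longrightarrow> V \<subseteq> V' \<Longrightarrow> definable B' V' s P"
  unfolding definable_def by (blast dest: asg_mono)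

lemma definable_agree:
  assumes "definable B V s P" "asg V s g" "\<forall>v\<in>V. g v = g' v"
  shows "P g = P g'"
proof -
  from assms(1) obtain \<phi> ts where *: "set ts \<subseteq> Inl ` V \<union> Inr ` B"
    "\<And>g. asg V s g \<Longrightarrow> P g = holds M \<phi> (map (case_sum g id) ts)" by (rule definableE) blast
  have "map (case_sum g id) ts = map (case_sum g' id) ts" using *(1) assms(3) by auto
  moreover have "asg V s g'" using assms(2) asg_cong[OF assms(3)] by simp
  ultimately show ?thesis using *(2)[OF assms(2)] *(2)[of g'] by (simp only:)
qed

lemma definable_finite_support:
  assumes "definable B V s P"
  shows "\<exists>W P' C. finite W \<and> W \<subseteq> V \<and> finite C \<and> C \<subseteq> B \<and> definable C W s P' \<and> (\<forall>g. asg V s g \<longrightarrow> P g = P' g)"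
proof -
  from assms obtain \<phi> ts where *: "set ts \<subseteq> Inl ` V \<union> Inr ` B"
    "\<phi> \<in> formulas L (map (case_sum s (sort_of M)) ts)"
    "\<And>g. asg V s g \<Longrightarrow> P g = holds M \<phi> (map (case_sum g id) ts)" by (rule definableE) blast
  let ?W = "{v. Inl v \<in> set ts}" and ?C = "{c. Inr c \<in> set ts}"
  have "finite (Inl -` set ts)" "finite (Inr -` set ts)" by (auto intro!: finite_vimageI)
  moreover have "definable ?C ?W s (\<lambda>g. holds M \<phi> (map (case_sum g id) ts))"
  proof -
    have "t \<in> Inl ` ?W \<union> Inr ` ?C" if "t \<in> set ts" for t
      by (cases t) (use that in auto)
    then show ?thesis
      unfolding definable_def using *(2) by (intro exI[of _ \<phi>] exI[of _ ts]) blast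
  qed
  ultimately show ?thesis using * unfolding vimage_def
    by (intro exI[of _ ?W] exI[of _ ?C] exI[of _ "\<lambda>g. holds M \<phi> (map (case_sum g id) ts)"]) auto
qed

lemma definable_Not: "definable B V s P \<Longrightarrow> definable B V s (\<lambda>g. \<not> P g)"
  unfolding definable_def
proof (elim exE conjE)
  fix \<phi> ts
  assume "set ts \<subseteq> Inl ` V \<union> Inr ` B" "\<phi> \<in> formulas L (map (case_sum s (sort_of M)) ts)"
    "\<forall>g. asg V s g \<longrightarrow> P g = holds M \<phi> (map (case_sum g id) ts)"
  then show "\<exists>\<phi> ts. set ts \<subseteq> Inl ` V \<union> Inr ` B \<and> \<phi> \<in> formulas L (map (case_sum s (sort_of M)) ts) \<and>
      (\<forall>g. asg V s g \<longrightarrow> (\<not> P g) = holds M \<phi> (map (case_sum g id) ts))"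
    by (intro exI[of _ "Neg \<phi>"] exI[of _ ts]) auto
qed

lemma definable_And:
  assumes "definable B V s P" "definable B V s Q"
  shows "definable B V s (\<lambda>g. P g \<and> Q g)"
proof -
  let ?S = "case_sum s (sort_of M)"
  from assms(1) obtain \<phi> ts where 1: "set ts \<subseteq> Inl ` V \<union> Inr ` B" "\<phi> \<in> formulas L (map ?S ts)"
    "\<And>g. asg V s g \<Longrightarrow> P g = holds M \<phi> (map (case_sum g id) ts)" by (rule definableE) blast
  from assms(2) obtain \<psi> us where 2: "set us \<subseteq> Inl ` V \<union> Inr ` B" "\<psi> \<in> formulas L (map ?S us)"
    "\<And>g. asg V s g \<Longrightarrow> Q g = holds M \<psi> (map (case_sum g id) us)" by (rule definableE) blast
  obtain \<phi>' where \<phi>': "\<phi>' \<in> formulas L (map ?S (ts @ us))"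
    "\<forall>f. holds M \<phi>' (map f (ts @ us)) = holds M \<phi> (map f ts)"
    using rename_names[OF 1(2), of "ts @ us" M] by (auto simp del: map_append)
  obtain \<psi>' where \<psi>': "\<psi>' \<in> formulas L (map ?S (ts @ us))"
    "\<forall>f. holds M \<psi>' (map f (ts @ us)) = holds M \<psi> (map f us)"
    using rename_names[OF 2(2), of "ts @ us" M] by (auto simp del: map_append)
  show ?thesis unfolding definable_def
    by (intro exI[of _ "Conj \<phi>' \<psi>'"] exI[of _ "ts @ us"])
      (use 1 2 \<phi>' \<psi>' in \<open>auto simp del: map_append\<close>)
qed

lemma definable_Or:
  assumes "definable B V s P" "definable B V s Q"
  shows "definable B V s (\<lambda>g. P g \<or> Q g)"
proof -
  have "definable B V s (\<lambda>g. \<not> (\<not> P g \<and> \<not> Q g))"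
    by (intro definable_Not definable_And assms)
  then show ?thesis by (simp only: de_Morgan_conj not_not)
qed

lemma definable_Imp:
  "definable B V s P \<Longrightarrow> definable B V s Q \<Longrightarrow> definable B V s (\<lambda>g. P g \<longrightarrow> Q g)"
  unfolding imp_conv_disj by (intro definable_Or definable_Not)

lemma definable_Equal:
  assumes "v \<in> V" "w \<in> V" "s v = s w"
  shows "definable B V s (\<lambda>g. g v = g w)"
proof -
  let ?\<phi> = "Equal (Var 0 (s v)) (Var 1 (s v))"
  have "?\<phi> \<in> formulas L (map (case_sum s (sort_of M)) [Inl v, Inl w])"
    using assms(3) by (auto simp: formulas_def less_Suc_eq)
  then show ?thesis unfolding definable_def using assms
    by (intro exI[of _ ?\<phi>] exI[of _ "[Inl v, Inl w]"]) (auto simp: holds_def)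
qed

lemma definable_True: "definable B V s (\<lambda>g. True)"
proof -
  let ?\<phi> = "Exi 0 undefined (Equal (Var 0 undefined) (Var 0 undefined))"
  show ?thesis unfolding definable_def
    by (intro exI[of _ ?\<phi>] exI[of _ "[]"])
      (use ex_sort in \<open>auto simp: formulas_def holds_def\<close>)
qed

lemma definable_const: "definable B V s (\<lambda>g. c)"
  using definable_Not[OF definable_True, of B V s] by (cases c) (simp_all add: definable_True)

lemma definable_Ball:
  "finite F \<Longrightarrow> (\<And>i. i \<in> F \<Longrightarrow> definable B V s (P i)) \<Longrightarrow> definable B V s (\<lambda>g. \<forall>i\<in>F. P i g)"
proof (induction F rule: finite_induct)
  case (insert i F)
  then have "definable B V s (\<lambda>g. P i g \<and> (\<forall>i\<in>F. P i g))" by (intro definable_And) auto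
  then show ?case by (rule definable_cong) auto
qed (simp add: definable_const)

lemma definable_subst:
  fixes h :: "'v \<Rightarrow> 'w + 'a"
  assumes "definable B V s P" "B \<subseteq> B'" "B' \<subseteq> univ M"
    "\<And>v. v \<in> V \<Longrightarrow> h v \<in> Inl ` W \<union> Inr ` B' \<and> case_sum s' (sort_of M) (h v) = s v"
  shows "definable B' W s' (\<lambda>g. P (\<lambda>v. case_sum g id (h v)))"
proof -
  from assms(1) obtain \<phi> ts where 1: "set ts \<subseteq> Inl ` V \<union> Inr ` B"
    "\<phi> \<in> formulas L (map (case_sum s (sort_of M)) ts)"
    "\<And>g. asg V s g \<Longrightarrow> P g = holds M \<phi> (map (case_sum g id) ts)" by (rule definableE) blast
  let ?us = "map (case_sum h Inr) ts"
  have "map (case_sum s' (sort_of M)) ?us = map (case_sum s (sort_of M)) ts"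
    using 1(1) assms(4) by auto
  moreover have "set ?us \<subseteq> Inl ` W \<union> Inr ` B'"
  proof
    fix u assume "u \<in> set ?us"
    then obtain t where t: "t \<in> set ts" "u = case_sum h Inr t" by auto
    show "u \<in> Inl ` W \<union> Inr ` B'"
    proof (cases t)
      case (Inl v)
      then have "v \<in> V" using 1(1) t(1) by auto
      then show ?thesis using assms(4) t(2) Inl by auto
    next
      case (Inr c)
      then have "c \<in> B" using 1(1) t(1) by auto
      then show ?thesis using assms(2) t(2) Inr by auto
    qed
  qed
  moreover have "P (\<lambda>v. case_sum g id (h v)) = holds M \<phi> (map (case_sum g id) ?us)"
    if "asg W s' g" for g
  proof -
    have "asg V s (\<lambda>v. case_sum g id (h v))" unfolding asg_def
    proof
      fix v assume "v \<in> V"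
      from assms(4)[OF this] show "case_sum g id (h v) \<in> univ M \<and>
          sort_of M (case_sum g id (h v)) = s v"
        using that assms(3) by (auto simp: asg_def)
    qed
    moreover have "map (case_sum (\<lambda>v. case_sum g id (h v)) id) ts = map (case_sum g id) ?us"
      using 1(1) by auto
    ultimately show ?thesis using 1(3)[of "\<lambda>v. case_sum g id (h v)"] by (simp only:)
  qed
  ultimately show ?thesis unfolding definable_def using 1(2)
    by (intro exI[of _ \<phi>] exI[of _ ?us]) (simp only: simp_thms, blast)
qed

lemma definable_rename:
  assumes "definable B V s P" "B \<subseteq> univ M" "\<And>v. v \<in> V \<Longrightarrow> h v \<in> W \<and> s' (h v) = s v"
  shows "definable B W s' (\<lambda>g. P (\<lambda>v. g (h v)))"
  using definable_subst[OF assms(1) order_refl assms(2), of "\<lambda>v. Inl (h v)" W s'] assms(3) by auto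

lemma definable_insert_params:
  assumes "definable B V s P" "B \<subseteq> B'" "B' \<subseteq> univ M"
    "\<And>v. v \<in> V \<Longrightarrow> v \<notin> W \<Longrightarrow> k v \<in> B' \<and> sort_of M (k v) = s v"
  shows "definable B' W s (\<lambda>g. P (\<lambda>v. if v \<in> W then g v else k v))"
proof -
  have "definable B' W s (\<lambda>g. P (\<lambda>v. case_sum g id (if v \<in> W then Inl v else Inr (k v))))"
    by (rule definable_subst[OF assms(1-3)]) (use assms(4) in auto)
  moreover have "(\<lambda>v. case_sum g id (if v \<in> W then Inl v else Inr (k v))) =
    (\<lambda>v. if v \<in> W then g v else k v)" for g by auto
  ultimately show ?thesis by (simp only:)
qed

lemma definable_Ex:
  assumes "definable B (insert v V) s P"
  shows "definable B (V - {v}) s (\<lambda>g. \<exists>x\<in>univ M. sort_of M x = s v \<and> P (g(v := x)))"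
proof -
  let ?S = "case_sum s (sort_of M)"
  from assms obtain \<phi> ts where 1: "set ts \<subseteq> Inl ` insert v V \<union> Inr ` B"
    "\<phi> \<in> formulas L (map ?S ts)"
    "\<And>g. asg (insert v V) s g \<Longrightarrow> P g = holds M \<phi> (map (case_sum g id) ts)"
    by (rule definableE) blast
  let ?us = "filter (\<lambda>t. t \<noteq> Inl v) ts"
  have "set ts \<subseteq> set (?us @ [Inl v])" by auto
  from rename_names[OF 1(2) this, of M] obtain \<phi>' where
    \<phi>': "\<phi>' \<in> formulas L (map ?S ?us @ [s v])"
    "\<forall>f. holds M \<phi>' (map f (?us @ [Inl v])) = holds M \<phi> (map f ts)" by auto
  let ?\<psi> = "Exi (length (map ?S ?us)) (s v) \<phi>'"
  have "(\<exists>x\<in>univ M. sort_of M x = s v \<and> P (g(v := x))) = holds M ?\<psi> (map (case_sum g id) ?us)"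
    if g: "asg (V - {v}) s g" for g
  proof -
    have "P (g(v := x)) = holds M \<phi>' (map (case_sum g id) ?us @ [x])"
      if "x \<in> univ M" "sort_of M x = s v" for x
    proof -
      have "asg (insert v V) s (g(v := x))" using g that by (auto simp: asg_def)
      then have "P (g(v := x)) = holds M \<phi>' (map (case_sum (g(v := x)) id) (?us @ [Inl v]))"
        using 1(3) \<phi>'(2) by metis
      moreover have "map (case_sum (g(v := x)) id) (?us @ [Inl v]) = map (case_sum g id) ?us @ [x]"
        by (auto split: sum.splits)
      ultimately show ?thesis by (simp only:)
    qed
    then show ?thesis by (subst holds_Exi[OF \<phi>'(1)]) auto
  qed
  moreover have "?\<psi> \<in> formulas L (map ?S ?us)" by (rule formulas_Exi[OF \<phi>'(1)])
  moreover have "set ?us \<subseteq> Inl ` (V - {v}) \<union> Inr ` B" using 1(1) by auto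
  ultimately show ?thesis unfolding definable_def by blast
qed

lemma definable_Ex_finite:
  assumes "finite W" "definable B (V \<union> W) s P" "V \<inter> W = {}"
  shows "definable B V s (\<lambda>g. \<exists>g'. asg (V \<union> W) s g' \<and> (\<forall>v\<in>V. g' v = g v) \<and> P g')"
  using assms
proof (induction W arbitrary: P rule: finite_induct)
  case empty
  show ?case
  proof (rule definable_cong)
    show "definable B V s P" using empty by simp
    show "P g = (\<exists>g'. asg (V \<union> {}) s g' \<and> (\<forall>v\<in>V. g' v = g v) \<and> P g')" if "asg V s g" for g
    proof
      assume "P g"
      then show "\<exists>g'. asg (V \<union> {}) s g' \<and> (\<forall>v\<in>V. g' v = g v) \<and> P g'"
        using that by (intro exI[of _ g]) simp
    next
      assume "\<exists>g'. asg (V \<union> {}) s g' \<and> (\<forall>v\<in>V. g' v = g v) \<and> P g'"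
      then obtain g' where g': "\<forall>v\<in>V. g' v = g v" "P g'" by blast
      have "definable B V s P" using empty(1) by simp
      from definable_agree[OF this that, of g'] g' show "P g" by simp
    qed
  qed
next
  case (insert w W)
  let ?Q = "\<lambda>g. \<exists>x\<in>univ M. sort_of M x = s w \<and> P (g(w := x))"
  have eq: "V \<union> W - {w} = V \<union> W" using insert.prems(2) insert.hyps by auto
  have d: "definable B (insert w (V \<union> W)) s P" using insert.prems(1) by simp
  have "definable B (V \<union> W) s ?Q" using definable_Ex[OF d] eq by simp
  then have "definable B V s (\<lambda>g. \<exists>g'. asg (V \<union> W) s g' \<and> (\<forall>v\<in>V. g' v = g v) \<and> ?Q g')"
    using insert by auto
  then show ?case
  proof (rule definable_cong)
    fix g
    show "(\<exists>g'. asg (V \<union> W) s g' \<and> (\<forall>v\<in>V. g' v = g v) \<and> ?Q g') =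
        (\<exists>g'. asg (V \<union> insert w W) s g' \<and> (\<forall>v\<in>V. g' v = g v) \<and> P g')" (is "?l = ?r")
    proof
      assume ?l
      then obtain g' x where "asg (V \<union> W) s g'" "\<forall>v\<in>V. g' v = g v" "x \<in> univ M" "sort_of M x = s w"
        "P (g'(w := x))" by blast
      then show ?r using insert.prems(2)
        by (intro exI[of _ "g'(w := x)"]) (auto simp: asg_def)
    next
      assume ?r
      then obtain g' where "asg (V \<union> insert w W) s g'" "\<forall>v\<in>V. g' v = g v" "P g'" by blast
      then show ?l
      proof (intro exI[of _ g'] conjI bexI[of _ "g' w"])
        show "P (g'(w := g' w))" using \<open>P g'\<close> by simp
      qed (use \<open>asg (V \<union> insert w W) s g'\<close> in \<open>auto simp: asg_def\<close>)
    qed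
  qed
qed

text \<open>``At least \<open>n\<close> values of \<open>v\<close> satisfy \<open>P\<close>'' is definable: the existential quantifiers range
  over \<open>n\<close> additional variables.\<close>

lemma definable_at_least:
  fixes s :: "'v \<Rightarrow> 's"
  assumes P: "definable B V s P" and v: "v \<in> V" and B: "B \<subseteq> univ M"
  shows "definable B V s (\<lambda>g. \<exists>Y\<subseteq>{y\<in>univ M. sort_of M y = s v}.
    finite Y \<and> card Y = n \<and> (\<forall>y\<in>Y. P (g(v := y))))"
proof -
  let ?S = "case_sum s (\<lambda>i::nat. s v)"
  let ?W = "Inr ` {..<n} :: ('v + nat) set"
  let ?V = "Inl ` V :: ('v + nat) set"
  let ?P = "\<lambda>i g. P (\<lambda>u. g (if u = v then Inr i else Inl u))"
  let ?Q = "\<lambda>g. (\<forall>i\<in>{..<n}. ?P i g) \<and> (\<forall>p\<in>{p\<in>{..<n} \<times> {..<n}. fst p \<noteq> snd p}. g (Inr (fst p)) \<noteq> g (Inr (snd p)))"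
  have "definable B (?V \<union> ?W) ?S ?Q"
    by (intro definable_And definable_Ball definable_Not definable_Equal definable_rename[OF P B]) (use v in auto)
  then have "definable B ?V ?S (\<lambda>g. \<exists>g'. asg (?V \<union> ?W) ?S g' \<and> (\<forall>v\<in>?V. g' v = g v) \<and> ?Q g')"
    by (rule definable_Ex_finite[rotated]) auto
  then have d: "definable B V s (\<lambda>g. \<exists>g'. asg (?V \<union> ?W) ?S g' \<and>
      (\<forall>u\<in>?V. g' u = g (case_sum id (\<lambda>i. v) u)) \<and> ?Q g')"
    by (rule definable_rename[OF _ B]) auto
  show ?thesis
  proof (rule definable_cong[OF d])
    fix g assume g: "asg V s g"
    show "(\<exists>g'. asg (?V \<union> ?W) ?S g' \<and> (\<forall>u\<in>?V. g' u = g (case_sum id (\<lambda>i. v) u)) \<and> ?Q g') =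
      (\<exists>Y\<subseteq>{y\<in>univ M. sort_of M y = s v}. finite Y \<and> card Y = n \<and> (\<forall>y\<in>Y. P (g(v := y))))" (is "?l = ?r")
    proof
      assume ?l
      then obtain g' where g': "asg (?V \<union> ?W) ?S g'" "\<And>u. u \<in> V \<Longrightarrow> g' (Inl u) = g u"
        "\<And>i. i < n \<Longrightarrow> ?P i g'" "\<And>i j. i < n \<Longrightarrow> j < n \<Longrightarrow> i \<noteq> j \<Longrightarrow> g' (Inr i) \<noteq> g' (Inr j)" by auto
      let ?Y = "(\<lambda>i. g' (Inr i)) ` {..<n}"
      have "P (g(v := g' (Inr i)))" if "i < n" for i
      proof -
        have "asg V s (\<lambda>u. g' (if u = v then Inr i else Inl u))"
          using g'(1) that v by (auto simp: asg_def)
        from definable_agree[OF P this, of "g(v := g' (Inr i))"] g'(2,3) that show ?thesis by auto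
      qed
      moreover have "card ?Y = n"
      proof (subst card_image)
        show "inj_on (\<lambda>i. g' (Inr i)) {..<n}" using g'(4) unfolding inj_on_def by blast
      qed simp
      moreover have "?Y \<subseteq> {y\<in>univ M. sort_of M y = s v}" using g'(1) by (auto simp: asg_def)
      ultimately show ?r by (intro exI[of _ ?Y]) auto
    next
      assume ?r
      then obtain Y where Y: "Y \<subseteq> {y\<in>univ M. sort_of M y = s v}" "finite Y" "card Y = n"
        "\<forall>y\<in>Y. P (g(v := y))" by blast
      obtain e where e: "bij_betw e {..<n} Y" using ex_bij_betw_nat_finite[OF Y(2)] Y(3)
        by (auto simp: atLeast0LessThan)
      let ?g' = "case_sum g e"
      have eY: "e i \<in> Y" if "i < n" for i using e that by (auto simp: bij_betw_def)
      have "e i \<in> univ M \<and> sort_of M (e i) = s v" if "i < n" for i using Y(1) eY[OF that] by blast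
      then have "asg (?V \<union> ?W) ?S ?g'" using g by (auto simp: asg_def)
      moreover have "(\<lambda>u. ?g' (if u = v then Inr i else Inl u)) = g(v := e i)" for i by auto
      moreover have "e i \<noteq> e j" if "i < n" "j < n" "i \<noteq> j" for i j
        using e that by (auto simp: bij_betw_def dest: inj_onD)
      ultimately show ?l using Y(4) eY by (intro exI[of _ ?g']) auto
    qed
  qed
qed

text \<open>Parameters can be turned into variables, each named by itself.\<close>

lemma definable_abstract_params:
  fixes s :: "'v \<Rightarrow> 's"
  assumes "definable (B \<union> C) V s P"
  shows "\<exists>P'. definable B (Inl ` V \<union> Inr ` C) (case_sum s (sort_of M)) P' \<and>
    (\<forall>g. asg V s g \<longrightarrow> P g = P' (case_sum g id))"
proof -
  let ?S = "case_sum s (sort_of M)"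
  from assms(1) obtain \<phi> ts where 1: "set ts \<subseteq> Inl ` V \<union> Inr ` (B \<union> C)"
    "\<phi> \<in> formulas L (map ?S ts)"
    "\<And>g. asg V s g \<Longrightarrow> P g = holds M \<phi> (map (case_sum g id) ts)" by (rule definableE) blast
  let ?k = "case_sum (\<lambda>v. Inl (Inl v)) (\<lambda>c. if c \<in> C then Inl (Inr c) else Inr c)"
  let ?us = "map ?k ts :: (('v + 'a) + 'a) list"
  have eq: "case_sum ?S (sort_of M) (?k t) = ?S t" for t by (auto split: sum.split)
  have m: "map (case_sum ?S (sort_of M)) ?us = map ?S ts" by (simp add: eq comp_def)
  have ss: "set ?us \<subseteq> Inl ` (Inl ` V \<union> Inr ` C) \<union> Inr ` B"
  proof
    fix u assume "u \<in> set ?us"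
    then obtain t where t: "t \<in> set ts" "u = ?k t" by auto
    then show "u \<in> Inl ` (Inl ` V \<union> Inr ` C) \<union> Inr ` B"
      using 1(1) by (cases t rule: sum.exhaust) auto
  qed
  have eq2: "case_sum (case_sum g id) id (?k t) = case_sum g id t" for t and g :: "'v \<Rightarrow> 'a"
    by (auto split: sum.split)
  have h: "holds M \<phi> (map (case_sum (case_sum g id) id) ?us) = holds M \<phi> (map (case_sum g id) ts)"
    for g :: "'v \<Rightarrow> 'a" by (simp only: map_map comp_def eq2)
  have "definable B (Inl ` V \<union> Inr ` C) ?S (\<lambda>g. holds M \<phi> (map (case_sum g id) ?us))"
    unfolding definable_def
    by (intro exI[of _ \<phi>] exI[of _ ?us] conjI ss allI impI refl) (simp only: m 1(2))
  then show ?thesis using 1(3) h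
    by (intro exI[of _ "\<lambda>g. holds M \<phi> (map (case_sum g id) ?us)"]) blast
qed

text \<open>Back to formulas in a tuple of variables.\<close>

lemma definable_formula:
  assumes "definable B (set xs) s P"
  shows "\<exists>\<phi> b. (\<phi>, b) \<in> formulas_over L M (map s xs) B \<and>
    (\<forall>g. asg (set xs) s g \<longrightarrow> P g = holds M \<phi> (map g xs @ b))"
proof -
  let ?S = "case_sum s (sort_of M)"
  from assms obtain \<phi> ts where 1: "set ts \<subseteq> Inl ` set xs \<union> Inr ` B"
    "\<phi> \<in> formulas L (map ?S ts)"
    "\<And>g. asg (set xs) s g \<Longrightarrow> P g = holds M \<phi> (map (case_sum g id) ts)" by (rule definableE) blast
  obtain b where b: "set b = Inr -` set ts"
    using finite_list[OF finite_vimageI[of "set ts" Inr]] by auto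
  then have "set b \<subseteq> B" using 1(1) by auto
  let ?us = "map Inl xs @ map Inr b"
  have "t \<in> set ?us" if "t \<in> set ts" for t
    using 1(1) b that by (cases t rule: sum.exhaust) auto
  then have "set ts \<subseteq> set ?us" by blast
  from rename_names[OF 1(2) this, of M] obtain \<phi>' where \<phi>': "\<phi>' \<in> formulas L (map ?S ?us)"
    "\<forall>f. holds M \<phi>' (map f ?us) = holds M \<phi> (map f ts)" by blast
  have u1: "map ?S ?us = map s xs @ sorts M b" by simp
  have u2: "map (case_sum g id) ?us = map g xs @ b" for g by (simp add: comp_def)
  have "P g = holds M \<phi>' (map g xs @ b)" if "asg (set xs) s g" for g
    unfolding 1(3)[OF that] u2[symmetric] using \<phi>'(2) by (simp only:)
  moreover have "(\<phi>', b) \<in> formulas_over L M (map s xs) B"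
    using \<phi>'(1) \<open>set b \<subseteq> B\<close> unfolding u1 formulas_over_def by simp
  ultimately show ?thesis by blast
qed

lemma formula_definable:
  assumes "(\<phi>, b) \<in> formulas_over L M (map s xs) B"
  shows "definable B (set xs) s (\<lambda>g. holds M \<phi> (map g xs @ b))"
proof -
  let ?ts = "map Inl xs @ map Inr b"
  have "set b \<subseteq> B" "\<phi> \<in> formulas L (map s xs @ sorts M b)" using assms by (auto simp: formulas_over_def)
  then have "set ?ts \<subseteq> Inl ` set xs \<union> Inr ` B" "\<phi> \<in> formulas L (map (case_sum s (sort_of M)) ?ts)"
    by (auto simp: comp_def)
  moreover have "map (case_sum g id) ?ts = map g xs @ b" for g by (simp add: comp_def)
  ultimately show ?thesis unfolding definable_def
    by (intro exI[of _ \<phi>] exI[of _ ?ts]) (simp only: simp_thms)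
qed

end

context monster
begin

section \<open>Small sets\<close>

lemma T_infinite: "infinite T"
proof -
  define e :: "('s, 'f, 'r) fm" where
    "e = Exi 0 undefined (Equal (Var 0 undefined) (Var 0 undefined))"
  have inj: "(Neg ^^ m) e = (Neg ^^ n) e \<Longrightarrow> m = n" for m n
  proof (induction m arbitrary: n)
    case 0
    then show ?case by (cases n) (auto simp: e_def)
  next
    case (Suc m)
    then show ?case by (cases n) (auto simp: e_def)
  qed
  have sent: "(Neg ^^ n) e \<in> sentences L" for n
    by (induction n) (auto simp: formulas_def e_def)
  define k where "k n = (if (Neg ^^ (2 * n)) e \<in> T then 2 * n else Suc (2 * n))" for n
  have "(Neg ^^ k n) e \<in> T" for n
    using complete sent[of "2 * n"] by (auto simp: complete_theory_def k_def)
  moreover have "inj (\<lambda>n. (Neg ^^ k n) e)"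
  proof (rule injI)
    fix m n assume "(Neg ^^ k m) e = (Neg ^^ k n) e"
    then have "k m = k n" by (rule inj)
    then show "m = n" unfolding k_def by (auto split: if_splits)
  qed
  ultimately show ?thesis using infinite_iff_countable_subset[of T] by blast
qed

lemma T_less_\<kappa>: "|T| <o \<kappa>"
proof -
  have "|T| <o cardSuc |T|" by (rule cardSuc_greater) (rule card_of_Card_order)
  moreover have "cardSuc |T| <o \<kappa>" using monster by (simp add: monster_model_def)
  ultimately show ?thesis by (rule ordLess_transitive)
qed

lemma \<kappa>_infinite: "infinite (Field \<kappa>)"
proof
  assume fin: "finite (Field \<kappa>)"
  have "|T| \<le>o |Field \<kappa>|"
    using T_less_\<kappa> card_of_Field_ordIso[OF Card_order_\<kappa>]
    by (meson ordIso_symmetric ordLess_imp_ordLeq ordLeq_ordIso_trans)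
  then show False using fin T_infinite card_of_ordLeq_finite by blast
qed

abbreviation sm :: "'x set \<Rightarrow> bool" where "sm \<equiv> small \<kappa>"

lemma sm_Un [simp]: "sm (A \<union> B) \<longleftrightarrow> sm A \<and> sm B"
proof
  assume "sm (A \<union> B)"
  then show "sm A \<and> sm B" unfolding small_def
    by (meson card_of_mono1 ordLeq_ordLess_trans sup_ge1 sup_ge2)
next
  assume "sm A \<and> sm B"
  then show "sm (A \<union> B)" unfolding small_def
    using card_of_Un_ordLess_infinite_Field[OF \<kappa>_infinite Card_order_\<kappa>] by blast
qed

lemma sm_le_T: "|A| \<le>o |T| \<Longrightarrow> sm A"
  using T_less_\<kappa> unfolding small_def by (rule ordLeq_ordLess_trans[rotated])

lemma sm_ordLeq: "|A| \<le>o |B| \<Longrightarrow> sm B \<Longrightarrow> sm A"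
  unfolding small_def by (rule ordLeq_ordLess_trans)

lemma sm_subset: "A \<subseteq> B \<Longrightarrow> sm B \<Longrightarrow> sm A"
  by (rule sm_ordLeq[OF card_of_mono1])

lemma sm_image: "sm A \<Longrightarrow> sm (f ` A)"
  by (rule sm_ordLeq[OF card_of_image])

lemma sm_countable: "sm (UNIV :: nat set)"
  using T_infinite infinite_iff_card_of_nat sm_le_T by blast

lemma sm_finite [simp]: "finite A \<Longrightarrow> sm A"
proof (rule sm_le_T)
  assume A: "finite A"
  have "\<not> |T| \<le>o |A|" using A T_infinite card_of_ordLeq_finite by blast
  then show "|A| \<le>o |T|" using ordLeq_total[OF card_of_Well_order card_of_Well_order] by blast
qed

lemma sm_entries: "sm (entries c)"
proof -
  have "entries c \<subseteq> range (\<lambda>p. c (fst p) ! snd p)"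
  proof
    fix x assume "x \<in> entries c"
    then obtain j i where "x = c j ! i" by (auto simp: entries_def in_set_conv_nth)
    then have "x = (\<lambda>p. c (fst p) ! snd p) (j, i)" by simp
    then show "x \<in> range (\<lambda>p. c (fst p) ! snd p)" by blast
  qed
  moreover have "sm (UNIV :: (nat \<times> nat) set)"
  proof -
    have "|UNIV :: (nat \<times> nat) set| \<le>o |UNIV :: nat set|"
      using card_of_Times_same_infinite[of "UNIV :: nat set"] ordIso_imp_ordLeq by auto
    then show ?thesis using sm_countable sm_ordLeq by blast
  qed
  ultimately show ?thesis using sm_image sm_subset by blast
qed

section \<open>Automorphisms over a set\<close>

definition Aut :: "'a set \<Rightarrow> ('a \<Rightarrow> 'a) set" where
  "Aut B = {\<sigma>. automorphism L M \<sigma> \<and> (\<forall>b\<in>B. \<sigma> b = b)}"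

lemma Aut_fix: "\<sigma> \<in> Aut B \<Longrightarrow> b \<in> B \<Longrightarrow> \<sigma> b = b"
  by (simp add: Aut_def)

lemma Aut_fix_image: "\<sigma> \<in> Aut B \<Longrightarrow> C \<subseteq> B \<Longrightarrow> \<sigma> ` C = C"
  by (force simp: Aut_def)

lemma Aut_mono: "\<sigma> \<in> Aut B \<Longrightarrow> A \<subseteq> B \<Longrightarrow> \<sigma> \<in> Aut A"
  by (auto simp: Aut_def)

lemma Aut_univ: "\<sigma> \<in> Aut B \<Longrightarrow> x \<in> univ M \<Longrightarrow> \<sigma> x \<in> univ M"
  by (auto simp: Aut_def automorphism_def bij_betw_def)

lemma Aut_univ_image: "\<sigma> \<in> Aut B \<Longrightarrow> C \<subseteq> univ M \<Longrightarrow> \<sigma> ` C \<subseteq> univ M"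
  using Aut_univ by blast

lemma Aut_sort: "\<sigma> \<in> Aut B \<Longrightarrow> x \<in> univ M \<Longrightarrow> sort_of M (\<sigma> x) = sort_of M x"
  by (auto simp: Aut_def automorphism_def)

lemma Aut_id: "id \<in> Aut B"
  by (simp add: Aut_def automorphism_id)

lemma Aut_comp: "\<sigma> \<in> Aut B \<Longrightarrow> \<tau> \<in> Aut B \<Longrightarrow> \<tau> \<circ> \<sigma> \<in> Aut B"
  by (simp add: Aut_def automorphism_comp is_struct)

lemma Aut_sorts: "\<sigma> \<in> Aut B \<Longrightarrow> set a \<subseteq> univ M \<Longrightarrow> sorts M (map \<sigma> a) = sorts M a"
  using Aut_sort by (auto simp: subset_iff)

lemma Aut_tuples: "\<sigma> \<in> Aut B \<Longrightarrow> a \<in> tuples M ss \<Longrightarrow> map \<sigma> a \<in> tuples M ss"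
  using Aut_sorts[of \<sigma> B a] Aut_univ[of \<sigma> B] by (auto simp: tuples_def)

lemma Aut_inv:
  assumes "\<sigma> \<in> Aut B" "B \<subseteq> univ M"
  obtains \<tau> where "\<tau> \<in> Aut B" "\<And>x. x \<in> univ M \<Longrightarrow> \<tau> (\<sigma> x) = x" "\<And>x. x \<in> univ M \<Longrightarrow> \<sigma> (\<tau> x) = x"
proof -
  let ?\<tau> = "inv_into (univ M) \<sigma>"
  have bij: "bij_betw \<sigma> (univ M) (univ M)" using assms(1) by (simp add: Aut_def automorphism_def)
  have 1: "?\<tau> (\<sigma> x) = x" if "x \<in> univ M" for x using bij that by (rule bij_betw_inv_into_left)
  have 2: "\<sigma> (?\<tau> x) = x" if "x \<in> univ M" for x using bij that by (rule bij_betw_inv_into_right)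
  have "?\<tau> b = b" if "b \<in> B" for b using 1[of b] Aut_fix[OF assms(1) that] assms(2) that by auto
  then have "?\<tau> \<in> Aut B"
    using automorphism_inv[OF is_struct] assms(1) by (simp add: Aut_def)
  then show thesis using 1 2 that by blast
qed

lemma Aut_conj:
  assumes "\<sigma> \<in> Aut {}" "\<tau> \<in> Aut B" "B \<subseteq> univ M"
  obtains \<rho> where "\<rho> \<in> Aut (\<sigma> ` B)" "\<And>x. x \<in> univ M \<Longrightarrow> \<rho> (\<sigma> x) = \<sigma> (\<tau> x)"
proof -
  obtain \<sigma>' where \<sigma>': "\<sigma>' \<in> Aut {}" "\<And>x. x \<in> univ M \<Longrightarrow> \<sigma>' (\<sigma> x) = x"
    by (rule Aut_inv[OF assms(1)]) auto
  have "\<sigma> \<circ> (\<tau> \<circ> \<sigma>') \<in> Aut {}"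
    using Aut_comp[OF Aut_comp[OF \<sigma>'(1) Aut_mono[OF assms(2)]] assms(1)] by simp
  then have "\<sigma> \<circ> (\<tau> \<circ> \<sigma>') \<in> Aut (\<sigma> ` B)"
    using \<sigma>'(2) assms(3) Aut_fix[OF assms(2)] by (auto simp: Aut_def subset_iff)
  then show thesis using that[of "\<sigma> \<circ> (\<tau> \<circ> \<sigma>')"] \<sigma>'(2) by auto
qed

lemma asg_Aut: "\<sigma> \<in> Aut B \<Longrightarrow> asg V s g \<Longrightarrow> asg V s (\<lambda>v. \<sigma> (g v))"
  using Aut_univ Aut_sort by (auto simp: asg_def)

lemma holds_Aut:
  "\<sigma> \<in> Aut B \<Longrightarrow> set a \<subseteq> univ M \<Longrightarrow> \<phi> \<in> formulas L (sorts M a) \<Longrightarrow>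
    holds M \<phi> (map \<sigma> a) = holds M \<phi> a"
  using holds_automorphism[OF is_struct] by (auto simp: Aut_def)

lemma definable_Aut:
  assumes "definable B V s P" "\<sigma> \<in> Aut B" "asg V s g" "B \<subseteq> univ M"
  shows "P (\<lambda>v. \<sigma> (g v)) = P g"
proof -
  from assms(1) obtain \<phi> ts where 1: "set ts \<subseteq> Inl ` V \<union> Inr ` B"
    "\<phi> \<in> formulas L (map (case_sum s (sort_of M)) ts)"
    "\<And>g. asg V s g \<Longrightarrow> P g = holds M \<phi> (map (case_sum g id) ts)" by (rule definableE) blast
  have e: "case_sum (\<lambda>v. \<sigma> (g v)) id t = \<sigma> (case_sum g id t) \<and>
      case_sum g id t \<in> univ M \<and> sort_of M (case_sum g id t) = case_sum s (sort_of M) t"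
    if "t \<in> set ts" for t
    using 1(1) that assms(3,4) Aut_fix[OF assms(2)] by (cases t) (auto simp: asg_def)
  have "map (case_sum (\<lambda>v. \<sigma> (g v)) id) ts = map \<sigma> (map (case_sum g id) ts)"
    using e by simp
  moreover have "holds M \<phi> (map \<sigma> (map (case_sum g id) ts)) = holds M \<phi> (map (case_sum g id) ts)"
  proof (rule holds_Aut[OF assms(2)])
    show "set (map (case_sum g id) ts) \<subseteq> univ M" using e by auto
    have "sorts M (map (case_sum g id) ts) = map (case_sum s (sort_of M)) ts" using e by simp
    then show "\<phi> \<in> formulas L (sorts M (map (case_sum g id) ts))" using 1(2) by (simp only:)
  qed
  ultimately show ?thesis using 1(3)[OF assms(3)] 1(3)[OF asg_Aut[OF assms(2,3)]] by (simp only:)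
qed

section \<open>Saturation for small families of variables\<close>

lemma one_variable_saturation:
  fixes \<Pi> :: "((unit \<Rightarrow> 'a) \<Rightarrow> bool) set"
  assumes "B \<subseteq> univ M" "sm B" "\<And>P. P \<in> \<Pi> \<Longrightarrow> definable B {()} (\<lambda>_. s) P"
    "\<And>\<Pi>0. finite \<Pi>0 \<Longrightarrow> \<Pi>0 \<subseteq> \<Pi> \<Longrightarrow> \<exists>x\<in>univ M. sort_of M x = s \<and> (\<forall>P\<in>\<Pi>0. P (\<lambda>_. x))"
  shows "\<exists>x\<in>univ M. sort_of M x = s \<and> (\<forall>P\<in>\<Pi>. P (\<lambda>_. x))"
proof -
  have "\<exists>\<phi> b. (\<phi>, b) \<in> formulas_over L M [s] B \<and>
      (\<forall>g. asg {()} (\<lambda>_. s) g \<longrightarrow> P g = holds M \<phi> (g () # b))" if "P \<in> \<Pi>" for P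
    using definable_formula[of B "[()]" "\<lambda>_. s" P] assms(3)[OF that] by simp
  then have "\<forall>P. \<exists>\<phi>b. P \<in> \<Pi> \<longrightarrow> \<phi>b \<in> formulas_over L M [s] B \<and>
      (\<forall>g. asg {()} (\<lambda>_. s) g \<longrightarrow> P g = holds M (fst \<phi>b) (g () # snd \<phi>b))" by (metis fst_conv snd_conv)
  from choice[OF this] obtain F where F: "\<forall>P. P \<in> \<Pi> \<longrightarrow> F P \<in> formulas_over L M [s] B \<and>
      (\<forall>g. asg {()} (\<lambda>_. s) g \<longrightarrow> P g = holds M (fst (F P)) (g () # snd (F P)))" ..
  define \<phi> b where "\<phi> P = fst (F P)" and "b P = snd (F P)" for P
  have \<phi>: "\<And>P. P \<in> \<Pi> \<Longrightarrow> (\<phi> P, b P) \<in> formulas_over L M [s] B"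
    "\<And>P g. P \<in> \<Pi> \<Longrightarrow> asg {()} (\<lambda>_. s) g \<Longrightarrow> P g = holds M (\<phi> P) (g () # b P)"
    using F by (simp_all add: \<phi>_def b_def)
  have eq: "P (\<lambda>_. x) = holds M (\<phi> P) (x # b P)" if "P \<in> \<Pi>" "x \<in> univ M" "sort_of M x = s" for P x
    using \<phi>(2)[OF that(1), of "\<lambda>_. x"] that by (simp add: asg_def)
  let ?p = "(\<lambda>P. (\<phi> P, b P)) ` \<Pi>"
  have "realizations M [s] q \<noteq> {}" if q: "q \<subseteq> ?p" "finite q" for q
  proof -
    obtain \<Pi>0 where \<Pi>0: "\<Pi>0 \<subseteq> \<Pi>" "finite \<Pi>0" "q = (\<lambda>P. (\<phi> P, b P)) ` \<Pi>0"
      using finite_subset_image[OF q(2,1)] by blast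
    from assms(4)[OF \<Pi>0(2,1)] obtain x where
      x: "x \<in> univ M" "sort_of M x = s" "\<forall>P\<in>\<Pi>0. P (\<lambda>_. x)" by blast
    have "holds M (\<phi> P) (x # b P)" if "P \<in> \<Pi>0" for P
      using eq[of P x] x that \<Pi>0(1) by blast
    then have "[x] \<in> realizations M [s] q" using x(1,2) \<Pi>0(3)
      by (auto simp: realizations_def tuples_def)
    then show ?thesis by blast
  qed
  moreover have "saturated L \<kappa> M" using monster by (simp add: monster_model_def)
  ultimately have "realizations M [s] ?p \<noteq> {}"
  proof -
    have p: "?p \<subseteq> formulas_over L M [s] B" using \<phi>(1) by blast
    assume q: "\<And>q. q \<subseteq> ?p \<Longrightarrow> finite q \<Longrightarrow> realizations M [s] q \<noteq> {}" and sat: "saturated L \<kappa> M"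
    show ?thesis
      by (rule sat[unfolded saturated_def, rule_format, of B]) (use assms(1,2) p q in simp)
  qed
  then obtain a where a: "a \<in> realizations M [s] ?p" by blast
  then obtain x where x: "a = [x]" "x \<in> univ M" "sort_of M x = s"
    by (auto simp: realizations_def tuples_def)
  have "P (\<lambda>_. x)" if "P \<in> \<Pi>" for P
  proof -
    have "holds M (\<phi> P) ([x] @ b P)" using a that unfolding x(1) realizations_def by blast
    then show ?thesis using eq[OF that x(2,3)] by simp
  qed
  then show ?thesis using x by blast
qed

text \<open>A maximal partial assignment that is compatible with all finite parts of \<open>\<Gamma>\<close> is total: the
  conditions that it imposes on a further variable form a type over a small set.\<close>

theorem saturation:
  fixes V :: "'v set"
  assumes B: "B \<subseteq> univ M" "sm B" and V: "sm V"
    and \<Gamma>: "\<And>P. P \<in> \<Gamma> \<Longrightarrow> definable B V s P"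
    and fin: "\<And>\<Gamma>0. finite \<Gamma>0 \<Longrightarrow> \<Gamma>0 \<subseteq> \<Gamma> \<Longrightarrow> \<exists>g. asg V s g \<and> (\<forall>P\<in>\<Gamma>0. P g)"
  shows "\<exists>g. asg V s g \<and> (\<forall>P\<in>\<Gamma>. P g)"
proof -
  define ok where "ok G \<longleftrightarrow> (\<forall>\<Gamma>0\<subseteq>\<Gamma>. finite \<Gamma>0 \<longrightarrow>
    (\<exists>g. asg V s g \<and> (\<forall>(v, c)\<in>G. g v = c) \<and> (\<forall>P\<in>\<Gamma>0. P g)))" for G
  have okD: "\<exists>g. asg V s g \<and> (\<forall>(v, c)\<in>G. g v = c) \<and> (\<forall>P\<in>\<Gamma>0. P g)"
    if "ok G" "finite \<Gamma>0" "\<Gamma>0 \<subseteq> \<Gamma>" for G \<Gamma>0 using that unfolding ok_def by blast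
  have ok_fun: "c = c'" if okG: "ok G" and that: "(v, c) \<in> G" "(v, c') \<in> G" for G v c c'
  proof -
    from okD[OF okG, of "{}"] obtain g where "\<forall>(v, c)\<in>G. g v = c" by auto
    then have "g v = c" "g v = c'" using that by auto
    then show ?thesis by simp
  qed
  have ok_asg: "c \<in> univ M \<and> sort_of M c = s v" if "ok G" "(v, c) \<in> G" "v \<in> V" for G v c
  proof -
    from okD[OF that(1), of "{}"] obtain g where g: "asg V s g" "\<forall>(v, c)\<in>G. g v = c" by auto
    then have "g v = c" using that(2) by auto
    then show ?thesis using g(1) that(3) unfolding asg_def by blast
  qed
  have supp: "\<exists>W. finite W \<and> W \<subseteq> V \<and> (\<forall>P\<in>\<Gamma>0. \<forall>g g'. asg V s g \<longrightarrow> asg V s g' \<longrightarrow>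
      (\<forall>v\<in>W. g v = g' v) \<longrightarrow> P g = P g')" if "finite \<Gamma>0" "\<Gamma>0 \<subseteq> \<Gamma>" for \<Gamma>0
  proof -
    have "definable B V s (\<lambda>g. True)" by (rule definable_True)
    have "\<exists>W. finite W \<and> W \<subseteq> V \<and> (\<forall>g g'. asg V s g \<longrightarrow> asg V s g' \<longrightarrow>
      (\<forall>v\<in>W. g v = g' v) \<longrightarrow> P g = P g')" if "P \<in> \<Gamma>0" for P
    proof -
      have "definable B V s P" using \<Gamma> that \<open>\<Gamma>0 \<subseteq> \<Gamma>\<close> by blast
      from definable_finite_support[OF this] obtain W P' C where W: "finite W" "W \<subseteq> V"
        "definable C W s P'" "\<And>g. asg V s g \<Longrightarrow> P g = P' g" by blast
      have "P g = P g'" if "asg V s g" "asg V s g'" "\<forall>v\<in>W. g v = g' v" for g g'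
        using definable_agree[OF W(3) asg_mono[OF that(1) W(2)] that(3)] W(4) that by simp
      then show ?thesis using W(1,2) by blast
    qed
    then have "\<forall>P\<in>\<Gamma>0. \<exists>W. finite W \<and> W \<subseteq> V \<and> (\<forall>g g'. asg V s g \<longrightarrow> asg V s g' \<longrightarrow>
      (\<forall>v\<in>W. g v = g' v) \<longrightarrow> P g = P g')" by (rule ballI)
    from bchoice[OF this] obtain W where W: "\<forall>P\<in>\<Gamma>0. finite (W P) \<and> W P \<subseteq> V \<and>
      (\<forall>g g'. asg V s g \<longrightarrow> asg V s g' \<longrightarrow> (\<forall>v\<in>W P. g v = g' v) \<longrightarrow> P g = P g')" ..
    show ?thesis
    proof (intro exI[of _ "\<Union>P\<in>\<Gamma>0. W P"] conjI ballI allI impI)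
      show "finite (\<Union>P\<in>\<Gamma>0. W P)" "(\<Union>P\<in>\<Gamma>0. W P) \<subseteq> V" using W \<open>finite \<Gamma>0\<close> by auto
      fix P g g' assume *: "P \<in> \<Gamma>0" "asg V s g" "asg V s g'" "\<forall>v\<in>\<Union>P\<in>\<Gamma>0. W P. g v = g' v"
      then have "\<forall>v\<in>W P. g v = g' v" by blast
      then show "P g = P g'" using W * by blast
    qed
  qed
  let ?A = "{G. G \<subseteq> V \<times> UNIV \<and> ok G}"
  have "\<exists>G\<in>?A. \<forall>X\<in>?A. G \<subseteq> X \<longrightarrow> X = G"
  proof (rule subset_Zorn_nonempty)
    have "ok {}" using fin by (simp add: ok_def)
    then show "?A \<noteq> {}" by blast
  next
    fix C assume C: "C \<noteq> {}" "subset.chain ?A C"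
    let ?U = "\<Union>C"
    have CA: "G \<subseteq> V \<times> UNIV" "ok G" if "G \<in> C" for G
      using C(2) that by (auto simp: subset.chain_def)
    have U_pair: "\<exists>G\<in>C. {p, q} \<subseteq> G" if "p \<in> ?U" "q \<in> ?U" for p q
    proof -
      have "finite {p, q}" "{p, q} \<subseteq> ?U" using that by simp_all
      from finite_subset_Union_chain[OF this C] show ?thesis by blast
    qed
    have U_fun: "c = c'" if "(v, c) \<in> ?U" "(v, c') \<in> ?U" for v c c'
    proof -
      from U_pair[OF that] obtain G where "G \<in> C" "(v, c) \<in> G" "(v, c') \<in> G" by auto
      then show ?thesis using ok_fun[OF CA(2)] by metis
    qed
    have "ok ?U" unfolding ok_def
    proof (intro allI impI)
      fix \<Gamma>0 assume \<Gamma>0: "\<Gamma>0 \<subseteq> \<Gamma>" "finite \<Gamma>0"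
      from supp[OF \<Gamma>0(2,1)] obtain W where W0: "finite W \<and> W \<subseteq> V \<and> (\<forall>P\<in>\<Gamma>0. \<forall>g g'. asg V s g \<longrightarrow>
          asg V s g' \<longrightarrow> (\<forall>v\<in>W. g v = g' v) \<longrightarrow> P g = P g')" ..
      have W: "finite W" "W \<subseteq> V" using W0 by simp_all
      have W3: "P g = P g'" if "P \<in> \<Gamma>0" "asg V s g" "asg V s g'" "\<forall>v\<in>W. g v = g' v" for P g g'
        using W0 that by (simp only: simp_thms)
      let ?U' = "{p\<in>?U. fst p \<in> W}"
      have "inj_on fst ?U'" using U_fun by (auto simp: inj_on_def)
      then have "finite ?U'" by (rule inj_on_finite[OF _ _ W(1)]) auto
      moreover have "?U' \<subseteq> ?U" by blast
      ultimately obtain G where G: "G \<in> C" "?U' \<subseteq> G"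
        using finite_subset_Union_chain[OF _ _ C, of ?U'] by metis
      obtain g where g: "asg V s g" "\<forall>(v, c)\<in>G. g v = c" "\<forall>P\<in>\<Gamma>0. P g"
        using okD[OF CA(2)[OF G(1)] \<Gamma>0(2,1)] by blast
      define g' where "g' v = (if \<exists>c. (v, c) \<in> ?U then THE c. (v, c) \<in> ?U else g v)" for v
      have g'U: "g' v = c" if "(v, c) \<in> ?U" for v c
      proof -
        have "(THE c. (v, c) \<in> ?U) = c" using that U_fun by (intro the_equality) blast+
        then show ?thesis using that unfolding g'_def by auto
      qed
      have "asg V s g'" unfolding asg_def
      proof
        fix v assume v: "v \<in> V"
        show "g' v \<in> univ M \<and> sort_of M (g' v) = s v"
        proof (cases "\<exists>c. (v, c) \<in> ?U")
          case True
          then obtain c G where c: "(v, c) \<in> G" "G \<in> C" by blast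
          then have "g' v = c" using g'U by blast
          then show ?thesis using ok_asg[OF CA(2)[OF c(2)] c(1) v] by (simp only: simp_thms)
        next
          case False
          then show ?thesis using g(1) v by (simp add: g'_def asg_def)
        qed
      qed
      have "g v = g' v" if "v \<in> W" for v
      proof (cases "\<exists>c. (v, c) \<in> ?U")
        case True
        then obtain c where c: "(v, c) \<in> ?U" by blast
        then have "(v, c) \<in> G" using G(2) that by auto
        then show ?thesis using g(2) g'U[OF c] by auto
      qed (simp add: g'_def)
      then have "\<forall>v\<in>W. g v = g' v" ..
      then have "\<forall>P\<in>\<Gamma>0. P g'" using W3[OF _ g(1) \<open>asg V s g'\<close>] g(3) by (metis (full_types))
      then show "\<exists>g. asg V s g \<and> (\<forall>(v, c)\<in>?U. g v = c) \<and> (\<forall>P\<in>\<Gamma>0. P g)"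
        using \<open>asg V s g'\<close> g'U by blast
    qed
    moreover have "?U \<subseteq> V \<times> UNIV" using CA(1) by (intro Union_least)
    ultimately show "?U \<in> ?A" by (simp only: mem_Collect_eq simp_thms)
  qed
  then obtain G where "G \<in> ?A" and m: "\<forall>X\<in>?A. G \<subseteq> X \<longrightarrow> X = G" ..
  then have G: "G \<subseteq> V \<times> UNIV" "ok G" by (simp_all only: mem_Collect_eq)
  have max: "X = G" if "X \<subseteq> V \<times> UNIV" "ok X" "G \<subseteq> X" for X
    by (rule m[rule_format]) (simp_all only: that mem_Collect_eq simp_thms)
  have total: "\<exists>c. (v, c) \<in> G" if v: "v \<in> V" for v
  proof (rule ccontr)
    assume nov: "\<not> ?thesis"
    define D where "D = fst ` G"
    define k where "k u = (THE c. (u, c) \<in> G)" for u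
    have k: "(u, k u) \<in> G" if u: "u \<in> D" for u
    proof -
      obtain c where c: "(u, c) \<in> G" using u D_def by auto
      moreover have "k u = c" unfolding k_def
        by (rule the_equality) (use c ok_fun[OF G(2)] in blast)+
      ultimately show ?thesis by simp
    qed
    have D: "D \<subseteq> V" "v \<notin> D" using G(1) nov by (auto simp: D_def)
    define B' where "B' = B \<union> k ` D"
    have kD: "k u \<in> univ M \<and> sort_of M (k u) = s u" if "u \<in> D" for u
      using ok_asg[OF G(2) k[OF that]] D(1) that by blast
    have B': "B' \<subseteq> univ M" "sm B'" "B \<subseteq> B'"
      using B kD sm_image[OF sm_subset[OF D(1) V]] by (auto simp: B'_def)
    define p where "p \<Gamma>0 = (\<lambda>h :: unit \<Rightarrow> 'a. \<exists>g. asg V s g \<and> (\<forall>(u, c)\<in>G. g u = c) \<and> g v = h () \<and> (\<forall>P\<in>\<Gamma>0. P g))" for \<Gamma>0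
    have "definable B' {()} (\<lambda>_. s v) (p \<Gamma>0)" if \<Gamma>0: "finite \<Gamma>0" "\<Gamma>0 \<subseteq> \<Gamma>" for \<Gamma>0
    proof -
      have "definable B V s (\<lambda>g. \<forall>P\<in>\<Gamma>0. P g)"
        by (rule definable_Ball) (use \<Gamma>0 \<Gamma> in auto)
      from definable_finite_support[OF this] obtain W R C where W: "finite W" "W \<subseteq> V" "C \<subseteq> B"
        "definable C W s R" "\<And>g. asg V s g \<Longrightarrow> (\<forall>P\<in>\<Gamma>0. P g) = R g" by auto
      let ?W = "W - D - {v}"
      let ?R = "\<lambda>g. R (\<lambda>u. if u \<in> {v} \<union> ?W then g u else k u)"
      have "definable B' ({v} \<union> ?W) s ?R"
        by (rule definable_insert_params[OF W(4) _ B'(1)]) (use W(3) B'(3) kD in \<open>auto simp: B'_def\<close>)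
      then have "definable B' {v} s (\<lambda>g. \<exists>g'. asg ({v} \<union> ?W) s g' \<and> (\<forall>v\<in>{v}. g' v = g v) \<and> ?R g')"
        by (rule definable_Ex_finite[rotated]) (use W(1) in auto)
      then have "definable B' {()} (\<lambda>_. s v) (\<lambda>g. \<exists>g'. asg ({v} \<union> ?W) s g' \<and> (\<forall>u\<in>{v}. g' u = g ()) \<and> ?R g')"
        by (rule definable_rename[OF _ B'(1)]) auto
      then show ?thesis
      proof (rule definable_cong)
        fix h :: "unit \<Rightarrow> 'a" assume h: "asg {()} (\<lambda>_. s v) h"
        show "(\<exists>g'. asg ({v} \<union> ?W) s g' \<and> (\<forall>u\<in>{v}. g' u = h ()) \<and> ?R g') = p \<Gamma>0 h" (is "?l = ?r")
        proof
          assume ?r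
          then obtain g where g: "asg V s g" "\<forall>(u, c)\<in>G. g u = c" "g v = h ()" "\<forall>P\<in>\<Gamma>0. P g"
            unfolding p_def by blast
          have "R g" using W(5)[OF g(1)] g(4) by blast
          moreover have "g u = k u" if "u \<in> D" for u using g(2) k[OF that] by auto
          then have "\<forall>u\<in>W. g u = (if u \<in> {v} \<union> ?W then g u else k u)" by simp
          ultimately have "?R g"
            using definable_agree[OF W(4) asg_mono[OF g(1) W(2)],
              of "\<lambda>u. if u \<in> {v} \<union> ?W then g u else k u"] by (simp only: simp_thms)
          moreover have "asg ({v} \<union> ?W) s g" using g(1) v W(2) by (auto simp: asg_def)
          ultimately show ?l using g(3) by blast
        next
          assume ?l
          then obtain g where g: "asg ({v} \<union> ?W) s g" "g v = h ()" "?R g" by blast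
          obtain d where d: "asg V s d" using ex_asg by blast
          let ?g = "\<lambda>u. if u \<in> {v} \<union> ?W then g u else if u \<in> D then k u else d u"
          have "asg V s ?g" using g(1) kD d by (auto simp: asg_def)
          moreover have "R ?g"
          proof (subst definable_agree[OF W(4)])
            show "asg W s ?g" using \<open>asg V s ?g\<close> W(2) by (rule asg_mono)
            show "\<forall>u\<in>W. ?g u = (if u \<in> {v} \<union> ?W then g u else k u)" by auto
          qed (rule g(3))
          moreover have "?g u = c" if "(u, c) \<in> G" for u c
          proof -
            have u: "u \<in> D" using that D_def by force
            then have "k u = c" using ok_fun[OF G(2) k[OF u] that] by simp
            then show ?thesis using u D(2) by auto
          qed
          then have "\<forall>(u, c)\<in>G. ?g u = c" by blast
          moreover have "\<forall>P\<in>\<Gamma>0. P ?g" using W(5)[OF \<open>asg V s ?g\<close>] \<open>R ?g\<close> by blast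
          moreover have "?g v = h ()" using g(2) by simp
          ultimately show ?r using \<open>asg V s ?g\<close> unfolding p_def by blast
        qed
      qed
    qed
    moreover have "\<exists>x\<in>univ M. sort_of M x = s v \<and> (\<forall>P\<in>\<Pi>0. P (\<lambda>_. x))"
      if "finite \<Pi>0" "\<Pi>0 \<subseteq> p ` {\<Gamma>0. finite \<Gamma>0 \<and> \<Gamma>0 \<subseteq> \<Gamma>}" for \<Pi>0
    proof -
      from finite_subset_image[OF that] obtain F where F:
        "F \<subseteq> {\<Gamma>0. finite \<Gamma>0 \<and> \<Gamma>0 \<subseteq> \<Gamma>}" "finite F" "\<Pi>0 = p ` F" by blast
      have "finite (\<Union>F)" "\<Union>F \<subseteq> \<Gamma>" using F(1,2) by auto
      from okD[OF G(2) this] obtain g where g: "asg V s g" "\<forall>(v, c)\<in>G. g v = c" "\<forall>P\<in>\<Union>F. P g" by blast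
      have "p \<Gamma>0 (\<lambda>_. g v)" if "\<Gamma>0 \<in> F" for \<Gamma>0
        unfolding p_def using g that by (intro exI[of _ g]) auto
      then have "\<forall>P\<in>\<Pi>0. P (\<lambda>_. g v)" unfolding F(3) by blast
      moreover have "g v \<in> univ M" "sort_of M (g v) = s v" using g(1) v by (auto simp: asg_def)
      ultimately show ?thesis by blast
    qed
    ultimately have "\<exists>x\<in>univ M. sort_of M x = s v \<and> (\<forall>P\<in>p ` {\<Gamma>0. finite \<Gamma>0 \<and> \<Gamma>0 \<subseteq> \<Gamma>}. P (\<lambda>_. x))"
    proof -
      assume d: "\<And>\<Gamma>0. finite \<Gamma>0 \<Longrightarrow> \<Gamma>0 \<subseteq> \<Gamma> \<Longrightarrow> definable B' {()} (\<lambda>_. s v) (p \<Gamma>0)"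
        and f: "\<And>\<Pi>0. finite \<Pi>0 \<Longrightarrow> \<Pi>0 \<subseteq> p ` {\<Gamma>0. finite \<Gamma>0 \<and> \<Gamma>0 \<subseteq> \<Gamma>} \<Longrightarrow>
          \<exists>x\<in>univ M. sort_of M x = s v \<and> (\<forall>P\<in>\<Pi>0. P (\<lambda>_. x))"
      show ?thesis by (rule one_variable_saturation[OF B'(1,2)]) (use d f in blast)+
    qed
    then obtain x where x0: "\<forall>P\<in>p ` {\<Gamma>0. finite \<Gamma>0 \<and> \<Gamma>0 \<subseteq> \<Gamma>}. P (\<lambda>_. x)" by (elim bexE conjE)
    have x: "p \<Gamma>0 (\<lambda>_. x)" if "finite \<Gamma>0" "\<Gamma>0 \<subseteq> \<Gamma>" for \<Gamma>0
      using x0 that by (simp only: ball_simps mem_Collect_eq simp_thms)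
    have "ok (insert (v, x) G)" unfolding ok_def
    proof (intro allI impI)
      fix \<Gamma>0 assume "\<Gamma>0 \<subseteq> \<Gamma>" "finite \<Gamma>0"
      from x[OF this(2,1)] obtain g where
        "asg V s g" "\<forall>(u, c)\<in>G. g u = c" "g v = x" "\<forall>P\<in>\<Gamma>0. P g" unfolding p_def by blast
      then show "\<exists>g. asg V s g \<and> (\<forall>(u, c)\<in>insert (v, x) G. g u = c) \<and> (\<forall>P\<in>\<Gamma>0. P g)"
        by (intro exI[of _ g]) simp
    qed
    then have "insert (v, x) G = G" using max[of "insert (v, x) G"] G(1) v by blast
    then show False using nov by blast
  qed
  define g where "g v = (THE c. (v, c) \<in> G)" for v
  have g: "(v, g v) \<in> G" if "v \<in> V" for v
  proof -
    obtain c where c: "(v, c) \<in> G" using total \<open>v \<in> V\<close> by blast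
    moreover have "g v = c" unfolding g_def
      by (rule the_equality) (use c ok_fun[OF G(2)] in blast)+
    ultimately show ?thesis by simp
  qed
  have "asg V s g" using ok_asg[OF G(2) g] by (simp add: asg_def)
  moreover have "P g" if P: "P \<in> \<Gamma>" for P
  proof -
    obtain g' where g': "asg V s g'" "\<forall>(v, c)\<in>G. g' v = c" "P g'"
      using okD[OF G(2), of "{P}"] P by auto
    have "g' v = g v" if "v \<in> V" for v using g'(2) g[OF that] by auto
    then have "\<forall>v\<in>V. g' v = g v" ..
    then show ?thesis using definable_agree[OF \<Gamma>[OF P] g'(1), of g] g'(3) by (simp only: simp_thms)
  qed
  ultimately show ?thesis by blast
qed

section \<open>Homogeneity for small families\<close>

lemma definable_eq_param:
  assumes "v \<in> V" "c \<in> B" "B \<subseteq> univ M"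
  shows "definable B V s (\<lambda>g. g v = c)"
proof (cases "sort_of M c = s v")
  case True
  have "definable B (UNIV :: bool set) (\<lambda>_. s v) (\<lambda>g. g True = g False)"
    by (rule definable_Equal) auto
  from definable_subst[OF this order_refl assms(3), of "\<lambda>b. if b then Inl v else Inr c" V s] show ?thesis
    using assms True by simp
next
  case False
  show ?thesis
    by (rule definable_cong[OF definable_const[of B V s False]]) (use False assms(1) in \<open>auto simp: asg_def\<close>)
qed

text \<open>An implication for each \<open>P\<close> is enough, because the negation of a definable condition is
  definable; that \<open>g v \<mapsto> g' v\<close> is well defined is the instance of equalities.\<close>

theorem homogeneity:
  assumes B: "B \<subseteq> univ M" "sm B" and V: "sm V" and g: "asg V s g1" "asg V s g2"
    and P: "\<And>P. definable B V s P \<Longrightarrow> P g1 \<Longrightarrow> P g2"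
  shows "\<exists>\<sigma>\<in>Aut B. \<forall>v\<in>V. \<sigma> (g1 v) = g2 v"
proof -
  define A where "A = B \<union> g1 ` V"
  define nm where "nm x = (if x \<in> B then Inr x else Inl (SOME v. v \<in> V \<and> g1 v = x))" for x
  define h where "h x = case_sum g2 id (nm x)" for x
  have nm: "nm x \<in> Inl ` V \<union> Inr ` B \<and> case_sum g1 id (nm x) = x" if "x \<in> A" for x
  proof (cases "x \<in> B")
    case False
    then have "\<exists>v. v \<in> V \<and> g1 v = x" using that by (auto simp: A_def)
    from someI_ex[OF this] show ?thesis using False by (simp add: nm_def)
  qed (simp add: nm_def)
  have nms: "case_sum s (sort_of M) (nm x) = sort_of M x" if "x \<in> A" for x
    using nm[OF that] g(1) by (auto simp: asg_def)
  have hs: "h x \<in> univ M \<and> sort_of M (h x) = sort_of M x" if "x \<in> A" for x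
    using nm[OF that] g B(1) by (auto simp: asg_def h_def)
  have hv: "h (g1 v) = g2 v" if "v \<in> V" for v
  proof (cases "g1 v \<in> B")
    case True
    have "g2 v = g1 v" by (rule P[OF definable_eq_param[OF that True B(1)]]) simp
    then show ?thesis using True by (simp add: h_def nm_def)
  next
    case False
    have "g1 v \<in> A" using that by (simp add: A_def)
    from nm[OF this] obtain w where w: "nm (g1 v) = Inl w" "w \<in> V" "g1 w = g1 v"
      using False by (auto simp: nm_def)
    have "s w = s v" using g(1) w that by (metis asg_def)
    have "g2 w = g2 v" by (rule P[OF definable_Equal[OF w(2) that \<open>s w = s v\<close>]]) (rule w(3))
    then show ?thesis by (simp add: h_def w(1))
  qed
  have "elementary_on L M A h" unfolding elementary_on_def
  proof (intro allI impI conjI ballI)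
    fix a assume a: "set a \<subseteq> A"
    then show "map h a \<in> tuples M (sorts M a)" using hs by (auto simp: tuples_def subset_iff)
    fix \<phi> assume \<phi>: "\<phi> \<in> formulas L (sorts M a)"
    let ?P = "\<lambda>g. holds M \<phi> (map (case_sum g id) (map nm a))"
    have "map (case_sum s (sort_of M)) (map nm a) = sorts M a" using nms a by (auto simp: subset_iff)
    moreover have "set (map nm a) \<subseteq> Inl ` V \<union> Inr ` B" using nm a by auto
    ultimately have d: "definable B V s ?P"
      unfolding definable_def using \<phi> by (intro exI[of _ \<phi>] exI[of _ "map nm a"]) (simp only: simp_thms)
    have e1: "map (case_sum g1 id) (map nm a) = a" using nm a by (auto intro!: map_idI simp: subset_iff)
    have e2: "map (case_sum g2 id) (map nm a) = map h a" by (simp add: h_def)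
    show "holds M \<phi> (map h a) = holds M \<phi> a"
      using P[OF d] P[OF definable_Not[OF d]] unfolding e1 e2 by blast
  qed
  moreover have "A \<subseteq> univ M" using B(1) g(1) by (auto simp: A_def asg_def)
  moreover have "sm A" using B(2) sm_image[OF V] by (simp add: A_def)
  moreover have "strongly_homogeneous L \<kappa> M" using monster by (simp add: monster_model_def)
  ultimately obtain \<sigma> where \<sigma>: "automorphism L M \<sigma>" "\<forall>a\<in>A. \<sigma> a = h a"
    unfolding strongly_homogeneous_def by blast
  have "\<sigma> \<in> Aut B" using \<sigma> by (auto simp: Aut_def A_def h_def nm_def)
  moreover have "\<forall>v\<in>V. \<sigma> (g1 v) = g2 v" using \<sigma>(2) hv by (simp add: A_def)
  ultimately show ?thesis by blast
qed

text \<open>Saturation and homogeneity combined: conditions on a small set \<open>C\<close> that are finitely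
  consistent with the type of \<open>C\<close> over \<open>B\<close> can be satisfied by moving \<open>C\<close> over \<open>B\<close>.\<close>

theorem realize_by_automorphism:
  assumes B: "B \<subseteq> B'" "B' \<subseteq> univ M" "sm B'" and C: "C \<subseteq> univ M" "sm C"
    and \<Gamma>: "\<And>P. P \<in> \<Gamma> \<Longrightarrow> definable B' C (sort_of M) P"
    and fin: "\<And>\<Gamma>0 Q. finite \<Gamma>0 \<Longrightarrow> \<Gamma>0 \<subseteq> \<Gamma> \<Longrightarrow> definable B C (sort_of M) Q \<Longrightarrow> Q id \<Longrightarrow>
      \<exists>g. asg C (sort_of M) g \<and> Q g \<and> (\<forall>P\<in>\<Gamma>0. P g)"
  shows "\<exists>\<sigma>\<in>Aut B. \<forall>P\<in>\<Gamma>. P \<sigma>"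
proof -
  let ?\<Gamma> = "\<Gamma> \<union> {Q. definable B C (sort_of M) Q \<and> Q id}"
  have "\<exists>g. asg C (sort_of M) g \<and> (\<forall>P\<in>?\<Gamma>. P g)"
  proof (rule saturation[OF B(2,3) C(2)])
    show "definable B' C (sort_of M) P" if "P \<in> ?\<Gamma>" for P
      using that \<Gamma> definable_mono[OF _ B(1) order_refl] by blast
  next
    fix \<Gamma>0 assume \<Gamma>0: "finite \<Gamma>0" "\<Gamma>0 \<subseteq> ?\<Gamma>"
    let ?Q = "\<lambda>g. \<forall>P\<in>\<Gamma>0 - \<Gamma>. P g"
    have "definable B C (sort_of M) ?Q" by (rule definable_Ball) (use \<Gamma>0 in auto)
    moreover have "?Q id" using \<Gamma>0 by auto
    ultimately have "\<exists>g. asg C (sort_of M) g \<and> ?Q g \<and> (\<forall>P\<in>\<Gamma>0 \<inter> \<Gamma>. P g)"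
      using \<Gamma>0(1) by (intro fin) auto
    then show "\<exists>g. asg C (sort_of M) g \<and> (\<forall>P\<in>\<Gamma>0. P g)" by blast
  qed
  then obtain g where g: "asg C (sort_of M) g" "\<And>P. P \<in> ?\<Gamma> \<Longrightarrow> P g" by blast
  have "\<exists>\<sigma>\<in>Aut B. \<forall>v\<in>C. \<sigma> (id v) = g v"
  proof (rule homogeneity[OF _ _ C(2) asg_id[OF C(1)] g(1)])
    show "B \<subseteq> univ M" "sm B" using B sm_subset by blast+
    show "P g" if "definable B C (sort_of M) P" "P id" for P using that g(2) by blast
  qed
  then obtain \<sigma> where \<sigma>: "\<sigma> \<in> Aut B" "\<forall>v\<in>C. g v = \<sigma> v" by auto
  have "P \<sigma>" if "P \<in> \<Gamma>" for P
    using definable_agree[OF \<Gamma>[OF that] g(1) \<sigma>(2)] g(2) that by auto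
  then show ?thesis using \<sigma>(1) by blast
qed

section \<open>Algebraic closure\<close>

text \<open>Defined by orbits, the algebraic closure is visibly invariant under automorphisms; the formulas
  with finitely many solutions are recovered by saturation and homogeneity.\<close>

definition acl :: "'a set \<Rightarrow> 'a set" where
  "acl D = {x\<in>univ M. finite {\<sigma> x |\<sigma>. \<sigma> \<in> Aut D}}"

lemma acl_univ: "acl D \<subseteq> univ M"
  by (auto simp: acl_def)

lemma acl_mono: "D \<subseteq> D' \<Longrightarrow> acl D \<subseteq> acl D'"
proof
  fix x assume D: "D \<subseteq> D'" "x \<in> acl D"
  have "{\<sigma> x |\<sigma>. \<sigma> \<in> Aut D'} \<subseteq> {\<sigma> x |\<sigma>. \<sigma> \<in> Aut D}" using Aut_mono[OF _ D(1)] by blast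
  then show "x \<in> acl D'" using D(2) unfolding acl_def by (auto intro: finite_subset)
qed

lemma acl_Aut:
  assumes "\<sigma> \<in> Aut {}" "x \<in> acl D" "D \<subseteq> univ M"
  shows "\<sigma> x \<in> acl (\<sigma> ` D)"
proof -
  obtain \<sigma>' where \<sigma>': "\<sigma>' \<in> Aut {}" "\<And>x. x \<in> univ M \<Longrightarrow> \<sigma>' (\<sigma> x) = x" "\<And>x. x \<in> univ M \<Longrightarrow> \<sigma> (\<sigma>' x) = x"
    by (rule Aut_inv[OF assms(1)]) auto
  have x: "x \<in> univ M" using assms(2) acl_univ by blast
  have "{\<tau> (\<sigma> x) |\<tau>. \<tau> \<in> Aut (\<sigma> ` D)} \<subseteq> \<sigma> ` {\<tau> x |\<tau>. \<tau> \<in> Aut D}"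
  proof
    fix y assume "y \<in> {\<tau> (\<sigma> x) |\<tau>. \<tau> \<in> Aut (\<sigma> ` D)}"
    then obtain \<tau> where \<tau>: "\<tau> \<in> Aut (\<sigma> ` D)" "y = \<tau> (\<sigma> x)" by blast
    obtain \<rho> where \<rho>: "\<rho> \<in> Aut (\<sigma>' ` (\<sigma> ` D))" "\<And>x. x \<in> univ M \<Longrightarrow> \<rho> (\<sigma>' x) = \<sigma>' (\<tau> x)"
      using Aut_conj[OF \<sigma>'(1) \<tau>(1) Aut_univ_image[OF assms(1,3)]] by blast
    have "\<sigma>' ` (\<sigma> ` D) = D" using \<sigma>'(2) assms(3) by (force simp: image_image)
    moreover have "\<sigma> x \<in> univ M" "\<tau> (\<sigma> x) \<in> univ M" using Aut_univ assms(1) \<tau>(1) x by auto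
    then have "\<rho> x = \<sigma>' y" "y = \<sigma> (\<sigma>' y)" using \<rho>(2)[of "\<sigma> x"] \<sigma>'(2,3) x \<tau>(2) by auto
    ultimately show "y \<in> \<sigma> ` {\<tau> x |\<tau>. \<tau> \<in> Aut D}" using \<rho>(1) by (auto simp: image_iff)
  qed
  moreover have "finite (\<sigma> ` {\<tau> x |\<tau>. \<tau> \<in> Aut D})" using assms(2) by (simp add: acl_def)
  ultimately have "finite {\<tau> (\<sigma> x) |\<tau>. \<tau> \<in> Aut (\<sigma> ` D)}" by (rule finite_subset)
  then show ?thesis using Aut_univ[OF assms(1) x] unfolding acl_def by blast
qed

lemma acl_intro:
  assumes "definable D {()} (\<lambda>_. sort_of M x) P" "P (\<lambda>_. x)" "x \<in> univ M" "D \<subseteq> univ M"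
    "finite {y\<in>univ M. sort_of M y = sort_of M x \<and> P (\<lambda>_. y)}"
  shows "x \<in> acl D"
proof -
  have "{\<sigma> x |\<sigma>. \<sigma> \<in> Aut D} \<subseteq> {y\<in>univ M. sort_of M y = sort_of M x \<and> P (\<lambda>_. y)}"
    using definable_Aut[OF assms(1) _ _ assms(4), of _ "\<lambda>_. x"] assms(2,3) Aut_univ Aut_sort
    by (auto simp: asg_def)
  then show ?thesis using assms(3,5) unfolding acl_def by (auto intro: finite_subset)
qed

lemma acl_definable:
  assumes "x \<in> acl D" "D \<subseteq> univ M" "sm D"
  shows "\<exists>P. definable D {()} (\<lambda>_. sort_of M x) P \<and> P (\<lambda>_. x) \<and>
    finite {y\<in>univ M. sort_of M y = sort_of M x \<and> P (\<lambda>_. y)}"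
proof (rule ccontr)
  assume no: "\<not> ?thesis"
  let ?O = "{\<sigma> x |\<sigma>. \<sigma> \<in> Aut D}"
  have x: "x \<in> univ M" and O: "finite ?O" using assms(1) by (auto simp: acl_def)
  have Ou: "?O \<subseteq> univ M" using Aut_univ x by blast
  have "\<exists>\<sigma>\<in>Aut D. \<forall>P\<in>(\<lambda>c g. g x \<noteq> c) ` ?O. P \<sigma>"
  proof (rule realize_by_automorphism[where B' = "D \<union> ?O" and C = "{x}"])
    show "D \<union> ?O \<subseteq> univ M" "sm (D \<union> ?O)" using assms(2,3) Ou O by auto
    then show "definable (D \<union> ?O) {x} (sort_of M) P" if "P \<in> (\<lambda>c g. g x \<noteq> c) ` ?O" for P
      using that by (auto intro!: definable_Not definable_eq_param)
  next
    fix \<Gamma>0 Q assume \<Gamma>0: "finite \<Gamma>0" "\<Gamma>0 \<subseteq> (\<lambda>c g. g x \<noteq> c) ` ?O"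
      and Q: "definable D {x} (sort_of M) Q" "Q id"
    let ?Q = "\<lambda>g :: unit \<Rightarrow> 'a. Q (\<lambda>_. g ())"
    have "definable D {()} (\<lambda>_. sort_of M x) ?Q" by (rule definable_rename[OF Q(1) assms(2)]) auto
    moreover have "?Q (\<lambda>_. x)" using definable_agree[OF Q(1), of id "\<lambda>_. x"] Q(2) x by (simp add: asg_def)
    ultimately have "infinite {y\<in>univ M. sort_of M y = sort_of M x \<and> ?Q (\<lambda>_. y)}" using no by blast
    then have "\<not> {y\<in>univ M. sort_of M y = sort_of M x \<and> ?Q (\<lambda>_. y)} \<subseteq> ?O"
      using O finite_subset by blast
    then obtain y where y: "y \<in> univ M" "sort_of M y = sort_of M x" "Q (\<lambda>_. y)" "y \<notin> ?O"
      by blast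
    then show "\<exists>g. asg {x} (sort_of M) g \<and> Q g \<and> (\<forall>P\<in>\<Gamma>0. P g)"
      using \<Gamma>0(2) by (intro exI[of _ "\<lambda>_. y"]) (auto simp: asg_def)
  qed (use x in auto)
  then show False by auto
qed

lemma acl_finite_support:
  assumes "x \<in> acl D" "D \<subseteq> univ M" "sm D"
  shows "\<exists>D0\<subseteq>D. finite D0 \<and> x \<in> acl D0"
proof -
  obtain P where P: "definable D {()} (\<lambda>_. sort_of M x) P" "P (\<lambda>_. x)"
    "finite {y\<in>univ M. sort_of M y = sort_of M x \<and> P (\<lambda>_. y)}" using acl_definable[OF assms] by blast
  have x: "x \<in> univ M" using assms(1) acl_univ by blast
  obtain W P' C where W: "W \<subseteq> {()}" "finite C" "C \<subseteq> D" "definable C W (\<lambda>_. sort_of M x) P'"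
    "\<And>g. asg {()} (\<lambda>_. sort_of M x) g \<Longrightarrow> P g = P' g"
    using definable_finite_support[OF P(1)] by blast
  have eq: "P (\<lambda>_. y) = P' (\<lambda>_. y)" if "y \<in> univ M" "sort_of M y = sort_of M x" for y
    using W(5) that by (simp add: asg_def)
  have "x \<in> acl C"
  proof (rule acl_intro[OF definable_mono[OF W(4) order_refl W(1)] _ x])
    show "P' (\<lambda>_. x)" using eq[OF x] P(2) by simp
    show "C \<subseteq> univ M" using W(3) assms(2) by blast
    have "{y\<in>univ M. sort_of M y = sort_of M x \<and> P' (\<lambda>_. y)} =
        {y\<in>univ M. sort_of M y = sort_of M x \<and> P (\<lambda>_. y)}" using eq by auto
    then show "finite {y\<in>univ M. sort_of M y = sort_of M x \<and> P' (\<lambda>_. y)}" using P(3) by simp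
  qed
  then show ?thesis using W(2,3) by blast
qed

end

context monster
begin

section \<open>Types and orbits\<close>

lemma sm_UN_finite: "finite I \<Longrightarrow> (\<And>i. i \<in> I \<Longrightarrow> sm (F i)) \<Longrightarrow> sm (\<Union>i\<in>I. F i)"
  by (induction I rule: finite_induct) auto

lemma map_Aut_fix: "\<sigma> \<in> Aut B \<Longrightarrow> set b \<subseteq> B \<Longrightarrow> map \<sigma> b = b"
  using Aut_fix by (auto intro!: map_idI)

lemma tp_map_Aut:
  assumes "\<sigma> \<in> Aut B" "set a \<subseteq> univ M" "B \<subseteq> univ M"
  shows "tp L M (map \<sigma> a) B = tp L M a B"
proof -
  have "holds M \<phi> (map \<sigma> a @ b) = holds M \<phi> (a @ b)" if "(\<phi>, b) \<in> formulas_over L M (sorts M a) B" for \<phi> b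
  proof -
    have b: "set b \<subseteq> B" "\<phi> \<in> formulas L (sorts M (a @ b))" using that by (auto simp: formulas_over_def)
    have "map \<sigma> a @ b = map \<sigma> (a @ b)" using map_Aut_fix[OF assms(1) b(1)] by simp
    then show ?thesis using holds_Aut[OF assms(1) _ b(2)] b(1) assms(2,3) by auto
  qed
  then show ?thesis unfolding tp_def Aut_sorts[OF assms(1,2)] by blast
qed

lemma realizations_tp:
  assumes b: "set b \<subseteq> univ M" and D: "D \<subseteq> univ M" "sm D"
  shows "realizations M (sorts M b) (tp L M b D) = {map \<sigma> b |\<sigma>. \<sigma> \<in> Aut D}"
proof (intro equalityI subsetI)
  fix a assume "a \<in> {map \<sigma> b |\<sigma>. \<sigma> \<in> Aut D}"
  then obtain \<sigma> where \<sigma>: "\<sigma> \<in> Aut D" "a = map \<sigma> b" by blast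
  have "a \<in> tuples M (sorts M b)" using Aut_tuples[OF \<sigma>(1), of b] b \<sigma>(2) by (simp add: tuples_def)
  moreover have "holds M \<phi> (a @ d)" if "(\<phi>, d) \<in> tp L M b D" for \<phi> d
    using that tp_map_Aut[OF \<sigma>(1) b D(1)] unfolding \<sigma>(2) tp_def by blast
  ultimately show "a \<in> realizations M (sorts M b) (tp L M b D)" by (auto simp: realizations_def)
next
  fix a assume "a \<in> realizations M (sorts M b) (tp L M b D)"
  then have a: "a \<in> tuples M (sorts M b)" "\<And>\<phi> d. (\<phi>, d) \<in> tp L M b D \<Longrightarrow> holds M \<phi> (a @ d)"
    by (auto simp: realizations_def)
  have len: "length a = length b" using a(1) by (auto simp: tuples_def dest: map_eq_imp_length_eq)
  let ?s = "\<lambda>i. sort_of M (b ! i)"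
  have au: "a ! i \<in> univ M \<and> sort_of M (a ! i) = sort_of M (b ! i)" if i: "i < length b" for i
  proof -
    have "a ! i \<in> set a" using i len by simp
    moreover have "sorts M a ! i = sorts M b ! i" using a(1) by (simp add: tuples_def)
    ultimately show ?thesis using a(1) i len by (auto simp: tuples_def)
  qed
  have "\<exists>\<sigma>\<in>Aut D. \<forall>i\<in>{..<length b}. \<sigma> (b ! i) = a ! i"
  proof (rule homogeneity[OF D])
    show "asg {..<length b} ?s ((!) b)" using b by (auto simp: asg_def)
    show "asg {..<length b} ?s ((!) a)" using au by (simp add: asg_def)
    fix P assume P: "definable D {..<length b} ?s P" "P ((!) b)"
    have "definable D (set [0..<length b]) ?s P" using P(1) by (simp add: atLeast_upt lessThan_atLeast0)
    from definable_formula[OF this] obtain \<phi> d where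
      \<phi>: "(\<phi>, d) \<in> formulas_over L M (map ?s [0..<length b]) D"
      "\<And>g. asg (set [0..<length b]) ?s g \<Longrightarrow> P g = holds M \<phi> (map g [0..<length b] @ d)" by blast
    have e: "map ?s [0..<length b] = sorts M b" by (rule nth_equalityI) auto
    have eb: "map ((!) b) [0..<length b] = b" by (rule map_nth)
    have ea: "map ((!) a) [0..<length b] = a" using map_nth[of a] len by simp
    have "asg (set [0..<length b]) ?s ((!) b)" using b by (auto simp: asg_def)
    from \<phi>(2)[OF this] have "holds M \<phi> (b @ d)" using P(2) eb by simp
    then have "holds M \<phi> (a @ d)" using \<phi>(1) a(2) unfolding tp_def e by blast
    moreover have "asg (set [0..<length b]) ?s ((!) a)" using au by (simp add: asg_def)
    ultimately show "P ((!) a)" using \<phi>(2)[of "(!) a"] ea by simp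
  qed simp
  then obtain \<sigma> where \<sigma>: "\<sigma> \<in> Aut D" "\<forall>i\<in>{..<length b}. \<sigma> (b ! i) = a ! i" ..
  then have "a = map \<sigma> b" using len by (intro nth_equalityI) auto
  then show "a \<in> {map \<sigma> b |\<sigma>. \<sigma> \<in> Aut D}" using \<sigma>(1) by blast
qed

lemma algebraic_over_subset_acl:
  assumes "algebraic_over L M b D" "set b \<subseteq> univ M" "D \<subseteq> univ M" "sm D"
  shows "set b \<subseteq> acl D"
proof
  fix x assume "x \<in> set b"
  then obtain i where i: "i < length b" "x = b ! i" by (auto simp: in_set_conv_nth)
  obtain \<theta> d where \<theta>: "(\<theta>, d) \<in> tp L M b D" "finite (realizations M (sorts M b) {(\<theta>, d)})"
    using assms(1) unfolding algebraic_over_def by blast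
  have "{\<sigma> x |\<sigma>. \<sigma> \<in> Aut D} \<subseteq> (\<lambda>a. a ! i) ` realizations M (sorts M b) {(\<theta>, d)}"
  proof
    fix y assume "y \<in> {\<sigma> x |\<sigma>. \<sigma> \<in> Aut D}"
    then obtain \<sigma> where \<sigma>: "\<sigma> \<in> Aut D" "y = \<sigma> x" by blast
    have "map \<sigma> b \<in> realizations M (sorts M b) (tp L M b D)"
      unfolding realizations_tp[OF assms(2-4)] using \<sigma>(1) by blast
    then have "map \<sigma> b \<in> realizations M (sorts M b) {(\<theta>, d)}"
      using \<theta>(1) by (auto simp: realizations_def)
    moreover have "y = map \<sigma> b ! i" using i \<sigma>(2) by simp
    ultimately show "y \<in> (\<lambda>a. a ! i) ` realizations M (sorts M b) {(\<theta>, d)}" by blast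
  qed
  then have "finite {\<sigma> x |\<sigma>. \<sigma> \<in> Aut D}" using \<theta>(2) finite_subset by blast
  then show "x \<in> acl D" using assms(2) i by (auto simp: acl_def)
qed

lemma subset_acl_algebraic_over:
  assumes b: "set b \<subseteq> acl D" and D: "D \<subseteq> univ M" "sm D"
  shows "algebraic_over L M b D"
proof -
  let ?s = "\<lambda>i. sort_of M (b ! i)"
  let ?F = "\<lambda>P i. {y\<in>univ M. sort_of M y = ?s i \<and> P (\<lambda>_. y)}"
  have bu: "set b \<subseteq> univ M" using b acl_univ by blast
  have "\<forall>i\<in>{..<length b}. \<exists>P. definable D {()} (\<lambda>_. ?s i) P \<and> P (\<lambda>_. b ! i) \<and> finite (?F P i)"
  proof
    fix i assume "i \<in> {..<length b}"
    then have "b ! i \<in> acl D" using b by auto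
    from acl_definable[OF this D]
    show "\<exists>P. definable D {()} (\<lambda>_. ?s i) P \<and> P (\<lambda>_. b ! i) \<and> finite (?F P i)" .
  qed
  from bchoice[OF this] obtain P where P: "\<And>i. i < length b \<Longrightarrow> definable D {()} (\<lambda>_. ?s i) (P i)"
    "\<And>i. i < length b \<Longrightarrow> P i (\<lambda>_. b ! i)" "\<And>i. i < length b \<Longrightarrow> finite (?F (P i) i)" by auto
  let ?R = "\<lambda>g. \<forall>i\<in>{..<length b}. P i (\<lambda>_. g i)"
  have "definable D (set [0..<length b]) ?s ?R"
    by (intro definable_Ball definable_rename[OF P(1) D(1)]) auto
  from definable_formula[OF this] obtain \<phi> d where
    \<phi>: "(\<phi>, d) \<in> formulas_over L M (map ?s [0..<length b]) D"
    "\<And>g. asg (set [0..<length b]) ?s g \<Longrightarrow> ?R g = holds M \<phi> (map g [0..<length b] @ d)" by blast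
  have e: "map ?s [0..<length b] = sorts M b" by (rule nth_equalityI) auto
  have "asg (set [0..<length b]) ?s ((!) b)" using bu by (auto simp: asg_def)
  from \<phi>(2)[OF this] have "holds M \<phi> (b @ d)" using P(2) by (simp add: map_nth)
  then have "(\<phi>, d) \<in> tp L M b D" using \<phi>(1) unfolding tp_def e by blast
  moreover have "finite (realizations M (sorts M b) {(\<phi>, d)})"
  proof (rule finite_subset)
    let ?U = "\<Union>i\<in>{..<length b}. ?F (P i) i"
    show "finite {a. set a \<subseteq> ?U \<and> length a = length b}"
      using P(3) by (intro finite_lists_length_eq finite_UN_I) auto
    show "realizations M (sorts M b) {(\<phi>, d)} \<subseteq> {a. set a \<subseteq> ?U \<and> length a = length b}"
    proof
      fix a assume a: "a \<in> realizations M (sorts M b) {(\<phi>, d)}"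
      then have at: "set a \<subseteq> univ M" "sorts M a = sorts M b" "holds M \<phi> (a @ d)"
        by (auto simp: realizations_def tuples_def)
      have len: "length a = length b" using at(2) by (rule map_eq_imp_length_eq)
      have ai: "a ! i \<in> univ M \<and> sort_of M (a ! i) = ?s i" if "i < length b" for i
      proof -
        have "sorts M a ! i = sorts M b ! i" using at(2) by simp
        then show ?thesis using that len at(1) by auto
      qed
      have "asg (set [0..<length b]) ?s ((!) a)" using ai by (simp add: asg_def)
      moreover have "map ((!) a) [0..<length b] = a" using map_nth[of a] len by simp
      ultimately have R: "?R ((!) a)" using \<phi>(2)[of "(!) a"] at(3) by simp
      have "a ! i \<in> ?F (P i) i" if "i < length b" for i using ai[OF that] R that by simp
      then have "set a \<subseteq> ?U" using len by (auto simp: in_set_conv_nth) blast+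
      then show "a \<in> {a. set a \<subseteq> ?U \<and> length a = length b}" using len by simp
    qed
  qed
  ultimately show ?thesis unfolding algebraic_over_def by blast
qed

section \<open>Thorn-forking and algebraic closure\<close>

abbreviation ind :: "'a set \<Rightarrow> 'a set \<Rightarrow> 'a set \<Rightarrow> bool" where
  "ind \<equiv> thorn_indep_set L \<kappa> M"

text \<open>Only the parameter of a strongly dividing formula that is not algebraic matters: a tuple
  satisfying the formula makes it algebraic, as the formula holds of boundedly many conjugates.\<close>

lemma strongly_divides_acl:
  assumes "strongly_divides L M ss \<psi> d D" "(\<psi>, d) \<in> formulas_over L M ss (univ M)"
    "c \<in> tuples M ss" "holds M \<psi> (c @ d)" "D \<subseteq> univ M" "sm D"
  shows "\<exists>x\<in>set d. x \<notin> acl D \<and> x \<in> acl (D \<union> set c)"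
proof -
  have d: "set d \<subseteq> univ M" "\<psi> \<in> formulas L (ss @ sorts M d)"
    using assms(2) by (auto simp: formulas_over_def)
  have c: "set c \<subseteq> univ M" "sorts M c = ss" using assms(3) by (auto simp: tuples_def)
  have "\<exists>k::nat. \<forall>S \<subseteq> realizations M (sorts M d) (tp L M d D). finite S \<and> card S = k \<longrightarrow>
      \<not> (\<exists>a\<in>tuples M ss. \<forall>b'\<in>S. holds M \<psi> (a @ b'))"
    using assms(1) unfolding strongly_divides_def by (rule conjunct2)
  then obtain k where k0: "\<forall>S \<subseteq> realizations M (sorts M d) (tp L M d D). finite S \<and> card S = k \<longrightarrow>
      \<not> (\<exists>a\<in>tuples M ss. \<forall>b'\<in>S. holds M \<psi> (a @ b'))" ..
  have k: "\<not> (\<exists>a\<in>tuples M ss. \<forall>b'\<in>S. holds M \<psi> (a @ b'))"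
    if "S \<subseteq> realizations M (sorts M d) (tp L M d D)" "finite S" "card S = k" for S
    using k0 that by (simp only: simp_thms)
  obtain x where x: "x \<in> set d" "x \<notin> acl D"
  proof -
    have "\<not> algebraic_over L M d D" using assms(1) by (simp add: strongly_divides_def)
    then show thesis using subset_acl_algebraic_over[OF _ assms(5,6)] that by blast
  qed
  let ?O = "{map \<sigma> d |\<sigma>. \<sigma> \<in> Aut (D \<union> set c)}"
  have "?O \<subseteq> realizations M (sorts M d) (tp L M d D)"
    unfolding realizations_tp[OF d(1) assms(5,6)] using Aut_mono[of _ "D \<union> set c" D] by blast
  moreover have h: "holds M \<psi> (c @ b')" if "b' \<in> ?O" for b'
  proof -
    obtain \<sigma> where \<sigma>: "\<sigma> \<in> Aut (D \<union> set c)" "b' = map \<sigma> d" using \<open>b' \<in> ?O\<close> by blast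
    have "c @ b' = map \<sigma> (c @ d)" using map_Aut_fix[OF \<sigma>(1), of c] \<sigma>(2) by simp
    then show ?thesis using holds_Aut[OF \<sigma>(1), of "c @ d" \<psi>] assms(4) c d by simp
  qed
  ultimately have "finite ?O"
  proof -
    assume O: "?O \<subseteq> realizations M (sorts M d) (tp L M d D)"
    show ?thesis
    proof (rule ccontr)
      assume "infinite ?O"
      then obtain S where "finite S" "card S = k" "S \<subseteq> ?O" using infinite_arbitrarily_large by blast
      then show False using k[of S] O h assms(3) by blast
    qed
  qed
  obtain i where i: "i < length d" "x = d ! i" using x(1) by (auto simp: in_set_conv_nth)
  have "{\<sigma> x |\<sigma>. \<sigma> \<in> Aut (D \<union> set c)} \<subseteq> (\<lambda>a. a ! i) ` ?O"
  proof
    fix y assume "y \<in> {\<sigma> x |\<sigma>. \<sigma> \<in> Aut (D \<union> set c)}"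
    then obtain \<sigma> where \<sigma>: "\<sigma> \<in> Aut (D \<union> set c)" "y = \<sigma> x" by blast
    have "y = map \<sigma> d ! i" using i \<sigma>(2) by simp
    then show "y \<in> (\<lambda>a. a ! i) ` ?O" using \<sigma>(1) by blast
  qed
  then have "finite {\<sigma> x |\<sigma>. \<sigma> \<in> Aut (D \<union> set c)}" using \<open>finite ?O\<close> finite_subset by blast
  then have "x \<in> acl (D \<union> set c)" using x(1) d(1) by (auto simp: acl_def)
  then show ?thesis using x by blast
qed

lemma thorn_divides_forks:
  assumes "thorn_divides L \<kappa> M ss \<phi> b A" "(\<phi>, b) \<in> formulas_over L M ss (univ M)"
  shows "thorn_forks L \<kappa> M ss \<phi> b A"
  unfolding thorn_forks_def using assms by (intro exI[of _ "{(\<phi>, b)}"]) auto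

lemma reindex_append:
  assumes "length idx = length ss" "\<And>k. k < length ss \<Longrightarrow> idx ! k < length tt \<and> tt ! (idx ! k) = ss ! k"
    and k: "k < length (ss @ rr)" and n: "n = length rr"
  shows "(idx @ [length tt..<length tt + n]) ! k < length (tt @ rr) \<and>
    (tt @ rr) ! ((idx @ [length tt..<length tt + n]) ! k) = (ss @ rr) ! k"
proof (cases "k < length ss")
  case True
  then show ?thesis using assms(1) assms(2)[OF True] by (simp add: nth_append)
next
  case False
  then obtain i where i: "k = length ss + i" "i < length rr" using k
    by (metis add_diff_inverse_nat length_append nat_add_left_cancel_less)
  have "(idx @ [length tt..<length tt + n]) ! k = length tt + i"
    using i n assms(1) by (simp add: nth_append)
  then show ?thesis using i by (simp add: nth_append)
qed

text \<open>The order and repetitions of the entries of a tuple do not matter for thorn-dividing, so that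
  independence of a tuple can be read as independence of its set of entries.\<close>

lemma thorn_divides_reindex:
  assumes "(\<psi>, d) \<in> formulas_over L M ss (univ M)" "thorn_divides L \<kappa> M ss \<psi> d A"
    "length idx = length ss" "\<And>k. k < length ss \<Longrightarrow> idx ! k < length tt \<and> tt ! (idx ! k) = ss ! k"
  shows "\<exists>\<psi>'. (\<psi>', d) \<in> formulas_over L M tt (univ M) \<and> thorn_divides L \<kappa> M tt \<psi>' d A \<and>
    (\<forall>y d'. length y = length tt \<longrightarrow> length d' = length d \<longrightarrow>
      holds M \<psi>' (y @ d') = holds M \<psi> (map ((!) y) idx @ d'))"
proof -
  let ?idx = "idx @ [length tt..<length tt + length d]"
  have d: "set d \<subseteq> univ M" "\<psi> \<in> formulas L (ss @ sorts M d)"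
    using assms(1) by (auto simp: formulas_over_def)
  have "\<exists>\<psi>'\<in>formulas L (tt @ sorts M d). \<forall>a. holds M \<psi>' a = holds M \<psi> (map ((!) a) ?idx)"
  proof (rule rename_formula[OF d(2)])
    fix k assume "k < length (ss @ sorts M d)"
    then show "?idx ! k < length (tt @ sorts M d) \<and> (tt @ sorts M d) ! (?idx ! k) = (ss @ sorts M d) ! k"
      by (intro reindex_append[OF assms(3,4)]) simp_all
  qed (simp add: assms(3))
  then obtain \<psi>' where \<psi>': "\<psi>' \<in> formulas L (tt @ sorts M d)"
    "\<And>a. holds M \<psi>' a = holds M \<psi> (map ((!) a) ?idx)" by blast
  have idx: "k < length tt" if k: "k \<in> set idx" for k
  proof -
    obtain i where "i < length idx" "k = idx ! i" using k by (auto simp: in_set_conv_nth)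
    then show ?thesis using assms(3,4) by simp
  qed
  have h: "holds M \<psi>' (y @ d') = holds M \<psi> (map ((!) y) idx @ d')"
    if "length y = length tt" "length d' = length d" for y d'
  proof -
    have 1: "map ((!) (y @ d')) idx = map ((!) y) idx"
      using idx that by (simp add: nth_append)
    have 2: "map ((!) (y @ d')) [length tt..<length tt + length d] = d'"
      using that by (intro nth_equalityI) (auto simp: nth_append)
    show ?thesis unfolding \<psi>'(2) map_append 1 2 ..
  qed
  obtain D where D: "A \<subseteq> D" "D \<subseteq> univ M" "sm D" "strongly_divides L M ss \<psi> d D"
    using assms(2) unfolding thorn_divides_def by blast
  have "\<exists>k::nat. \<forall>S \<subseteq> realizations M (sorts M d) (tp L M d D). finite S \<and> card S = k \<longrightarrow>
      \<not> (\<exists>a\<in>tuples M ss. \<forall>b'\<in>S. holds M \<psi> (a @ b'))"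
    using D(4) unfolding strongly_divides_def by (rule conjunct2)
  then obtain k where k0: "\<forall>S \<subseteq> realizations M (sorts M d) (tp L M d D). finite S \<and> card S = k \<longrightarrow>
      \<not> (\<exists>a\<in>tuples M ss. \<forall>b'\<in>S. holds M \<psi> (a @ b'))" ..
  have k: "\<not> (\<exists>a\<in>tuples M ss. \<forall>b'\<in>S. holds M \<psi> (a @ b'))"
    if "S \<subseteq> realizations M (sorts M d) (tp L M d D)" "finite S" "card S = k" for S
    using k0 that by (simp only: simp_thms)
  have "\<not> (\<exists>a\<in>tuples M tt. \<forall>b'\<in>S. holds M \<psi>' (a @ b'))"
    if S: "S \<subseteq> realizations M (sorts M d) (tp L M d D)" "finite S" "card S = k" for S
  proof
    assume "\<exists>a\<in>tuples M tt. \<forall>b'\<in>S. holds M \<psi>' (a @ b')"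
    then obtain a where a: "a \<in> tuples M tt" "\<And>b'. b' \<in> S \<Longrightarrow> holds M \<psi>' (a @ b')" by blast
    have al: "set a \<subseteq> univ M" "sorts M a = tt" using a(1) by (auto simp: tuples_def)
    have len: "length a = length tt" using al(2) by auto
    have sa: "sort_of M (a ! i) = tt ! i" if "i < length tt" for i
      using al(2) len that by (metis nth_map)
    have "map ((!) a) idx \<in> tuples M ss" unfolding tuples_def
    proof (intro CollectI conjI)
      show "set (map ((!) a) idx) \<subseteq> univ M" using idx len al(1) by auto
      show "sorts M (map ((!) a) idx) = ss"
        using assms(3,4) sa by (intro nth_equalityI) auto
    qed
    moreover have "holds M \<psi> (map ((!) a) idx @ b')" if "b' \<in> S" for b'
    proof -
      have "b' \<in> tuples M (sorts M d)" using S(1) that by (auto simp: realizations_def)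
      then have "length b' = length d" by (auto simp: tuples_def dest: map_eq_imp_length_eq)
      then show ?thesis using a(2)[OF that] h len by simp
    qed
    ultimately show False using k[OF S] by blast
  qed
  note ik = this
  have "strongly_divides L M tt \<psi>' d D" unfolding strongly_divides_def
  proof (intro conjI exI[of _ k] allI impI)
    show "\<not> algebraic_over L M d D" using D(4) by (simp add: strongly_divides_def)
  qed (use ik in simp)
  then have "thorn_divides L \<kappa> M tt \<psi>' d A" using D(1-3) unfolding thorn_divides_def
    by (intro exI[of _ D]) simp
  moreover have "(\<psi>', d) \<in> formulas_over L M tt (univ M)" using \<psi>'(1) d(1) by (simp add: formulas_over_def)
  ultimately show ?thesis using h by (intro exI[of _ \<psi>']) simp
qed

lemma thorn_forks_reindex:
  assumes "finite I"
    and forks: "\<And>i. i \<in> I \<Longrightarrow> thorn_forks L \<kappa> M (ss i) (\<phi> i) (b i) A"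
    and idx: "\<And>i. i \<in> I \<Longrightarrow> length (idx i) = length (ss i)"
      "\<And>i k. i \<in> I \<Longrightarrow> k < length (ss i) \<Longrightarrow> idx i ! k < length tt \<and> tt ! (idx i ! k) = ss i ! k"
    and cover: "\<And>y. y \<in> tuples M tt \<Longrightarrow> holds M \<chi> (y @ e) \<Longrightarrow>
      \<exists>i\<in>I. map ((!) y) (idx i) \<in> tuples M (ss i) \<and> holds M (\<phi> i) (map ((!) y) (idx i) @ b i)"
  shows "thorn_forks L \<kappa> M tt \<chi> e A"
proof -
  have "\<forall>i\<in>I. \<exists>\<Psi>\<subseteq>formulas_over L M (ss i) (univ M). finite \<Psi> \<and>
        (\<forall>(\<psi>, d)\<in>\<Psi>. thorn_divides L \<kappa> M (ss i) \<psi> d A) \<and>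
        (\<forall>a\<in>tuples M (ss i). holds M (\<phi> i) (a @ b i) \<longrightarrow> (\<exists>(\<psi>, d)\<in>\<Psi>. holds M \<psi> (a @ d)))"
    using forks unfolding thorn_forks_def by blast
  from bchoice[OF this] obtain \<Psi> where \<Psi>: "\<forall>i\<in>I. \<Psi> i \<subseteq> formulas_over L M (ss i) (univ M) \<and> finite (\<Psi> i) \<and>
        (\<forall>(\<psi>, d)\<in>\<Psi> i. thorn_divides L \<kappa> M (ss i) \<psi> d A) \<and>
        (\<forall>a\<in>tuples M (ss i). holds M (\<phi> i) (a @ b i) \<longrightarrow> (\<exists>(\<psi>, d)\<in>\<Psi> i. holds M \<psi> (a @ d)))" ..
  let ?J = "SIGMA i:I. \<Psi> i"
  have "\<forall>j\<in>?J. \<exists>\<psi>'. (\<psi>', snd (snd j)) \<in> formulas_over L M tt (univ M) \<and>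
    thorn_divides L \<kappa> M tt \<psi>' (snd (snd j)) A \<and>
    (\<forall>y d'. length y = length tt \<longrightarrow> length d' = length (snd (snd j)) \<longrightarrow>
      holds M \<psi>' (y @ d') = holds M (fst (snd j)) (map ((!) y) (idx (fst j)) @ d'))"
  proof
    fix j assume j: "j \<in> ?J"
    obtain i \<psi> d where ij: "j = (i, \<psi>, d)" using prod_cases3 by blast
    have i: "i \<in> I" "(\<psi>, d) \<in> \<Psi> i" using j ij by auto
    then have "(\<psi>, d) \<in> formulas_over L M (ss i) (univ M)" "thorn_divides L \<kappa> M (ss i) \<psi> d A"
      using \<Psi> by blast+
    from thorn_divides_reindex[OF this idx(1)[OF i(1)] idx(2)[OF i(1)]]
    show "\<exists>\<psi>'. (\<psi>', snd (snd j)) \<in> formulas_over L M tt (univ M) \<and>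
      thorn_divides L \<kappa> M tt \<psi>' (snd (snd j)) A \<and>
      (\<forall>y d'. length y = length tt \<longrightarrow> length d' = length (snd (snd j)) \<longrightarrow>
        holds M \<psi>' (y @ d') = holds M (fst (snd j)) (map ((!) y) (idx (fst j)) @ d'))"
      unfolding ij fst_conv snd_conv by blast
  qed
  from bchoice[OF this] obtain F where F: "\<forall>j\<in>?J. (F j, snd (snd j)) \<in> formulas_over L M tt (univ M) \<and>
    thorn_divides L \<kappa> M tt (F j) (snd (snd j)) A \<and>
    (\<forall>y d'. length y = length tt \<longrightarrow> length d' = length (snd (snd j)) \<longrightarrow>
      holds M (F j) (y @ d') = holds M (fst (snd j)) (map ((!) y) (idx (fst j)) @ d'))" ..
  let ?\<Psi> = "(\<lambda>j. (F j, snd (snd j))) ` ?J"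
  have "finite ?J" using assms(1) \<Psi> by (intro finite_SigmaI) auto
  then have "finite ?\<Psi>" by (rule finite_imageI)
  moreover have "?\<Psi> \<subseteq> formulas_over L M tt (univ M)" using F by blast
  moreover have "\<forall>(\<psi>, d)\<in>?\<Psi>. thorn_divides L \<kappa> M tt \<psi> d A" using F by fast
  moreover have "\<exists>(\<psi>, d)\<in>?\<Psi>. holds M \<psi> (y @ d)" if y: "y \<in> tuples M tt" "holds M \<chi> (y @ e)" for y
  proof -
    from cover[OF y] obtain i where i: "i \<in> I" "map ((!) y) (idx i) \<in> tuples M (ss i)"
      "holds M (\<phi> i) (map ((!) y) (idx i) @ b i)" by blast
    then obtain \<psi> d where \<psi>: "(\<psi>, d) \<in> \<Psi> i" "holds M \<psi> (map ((!) y) (idx i) @ d)" using \<Psi> by blast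
    have j: "(i, \<psi>, d) \<in> ?J" using i(1) \<psi>(1) by blast
    have "length y = length tt" using y(1) by (auto simp: tuples_def)
    then have "holds M (F (i, \<psi>, d)) (y @ d)" using bspec[OF F j] \<psi>(2) by simp
    then have "case (F (i, \<psi>, d), d) of (\<psi>, d) \<Rightarrow> holds M \<psi> (y @ d)" by simp
    moreover have "(F (i, \<psi>, d), d) \<in> ?\<Psi>" using j by force
    ultimately show ?thesis by (rule bexI)
  qed
  ultimately show ?thesis unfolding thorn_forks_def by (intro exI[of _ ?\<Psi>]) simp
qed

lemma thorn_indepD:
  "thorn_indep L \<kappa> M c A B \<Longrightarrow> (\<phi>, b) \<in> formulas_over L M (sorts M c) (A \<union> B) \<Longrightarrow>
    thorn_forks L \<kappa> M (sorts M c) \<phi> b A \<Longrightarrow> \<not> holds M \<phi> (c @ b)"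
  unfolding thorn_indep_def type_thorn_forks_def tp_def by blast

lemma thorn_indepI:
  "(\<And>\<phi> b. (\<phi>, b) \<in> formulas_over L M (sorts M c) (A \<union> B) \<Longrightarrow>
    thorn_forks L \<kappa> M (sorts M c) \<phi> b A \<Longrightarrow> holds M \<phi> (c @ b) \<Longrightarrow> False) \<Longrightarrow> thorn_indep L \<kappa> M c A B"
  unfolding thorn_indep_def type_thorn_forks_def tp_def by blast

lemma ex_index:
  assumes "set c \<subseteq> set cc"
  shows "\<exists>idx. length idx = length c \<and> (\<forall>k<length c. idx ! k < length cc \<and> cc ! (idx ! k) = c ! k)"
proof -
  have "\<forall>k\<in>{..<length c}. \<exists>i. i < length cc \<and> cc ! i = c ! k"
    using assms nth_mem by (fastforce simp: in_set_conv_nth subset_iff)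
  from bchoice[OF this] obtain f where "\<forall>k\<in>{..<length c}. f k < length cc \<and> cc ! f k = c ! k" ..
  then show ?thesis by (intro exI[of _ "map f [0..<length c]"]) simp
qed

lemma tuples_reindex:
  assumes "y \<in> tuples M tt" "length idx = length ss" "\<And>k. k < length ss \<Longrightarrow> idx ! k < length tt \<and> tt ! (idx ! k) = ss ! k"
  shows "map ((!) y) idx \<in> tuples M ss"
proof -
  have y: "set y \<subseteq> univ M" "sorts M y = tt" using assms(1) by (auto simp: tuples_def)
  have len: "length y = length tt" using y(2) by auto
  have "sort_of M (y ! i) = tt ! i \<and> y ! i \<in> univ M" if "i < length tt" for i
    using y len that by (metis nth_map nth_mem subsetD)
  then have *: "y ! (idx ! k) \<in> univ M \<and> sort_of M (y ! (idx ! k)) = ss ! k" if "k < length ss" for k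
    using assms(3)[OF that] by simp
  have "sorts M (map ((!) y) idx) = ss" using * assms(2) by (intro nth_equalityI) auto
  moreover have "set (map ((!) y) idx) \<subseteq> univ M" using * assms(2) by (auto simp: in_set_conv_nth)
  ultimately show ?thesis by (simp add: tuples_def)
qed

lemma thorn_indep_imp_ind:
  assumes a: "thorn_indep L \<kappa> M a A B"
  shows "ind (set a) A B"
  unfolding thorn_indep_set_def
proof (intro allI impI)
  fix c assume c: "set c \<subseteq> set a"
  obtain idx where idx: "length idx = length c" "\<And>k. k < length c \<Longrightarrow> idx ! k < length a \<and> a ! (idx ! k) = c ! k"
    using ex_index[OF c] by blast
  have ic: "map ((!) a) idx = c" using idx by (intro nth_equalityI) auto
  have ids: "idx ! k < length (sorts M a) \<and> sorts M a ! (idx ! k) = sorts M c ! k"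
    if "k < length (sorts M c)" for k using idx(2)[of k] that by simp
  show "thorn_indep L \<kappa> M c A B"
  proof (rule thorn_indepI)
    fix \<phi> b
    assume \<phi>: "(\<phi>, b) \<in> formulas_over L M (sorts M c) (A \<union> B)"
      and f: "thorn_forks L \<kappa> M (sorts M c) \<phi> b A" and h: "holds M \<phi> (c @ b)"
    have b: "set b \<subseteq> A \<union> B" "\<phi> \<in> formulas L (sorts M c @ sorts M b)" using \<phi> by (auto simp: formulas_over_def)
    let ?idx = "idx @ [length a..<length a + length b]"
    have "\<exists>\<phi>'\<in>formulas L (sorts M a @ sorts M b). \<forall>y. holds M \<phi>' y = holds M \<phi> (map ((!) y) ?idx)"
    proof (rule rename_formula[OF b(2)])
      fix k assume k: "k < length (sorts M c @ sorts M b)"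
      have "length idx = length (sorts M c)" "length b = length (sorts M b)" using idx(1) by simp_all
      from reindex_append[OF this(1) ids k this(2)]
      show "?idx ! k < length (sorts M a @ sorts M b) \<and>
          (sorts M a @ sorts M b) ! (?idx ! k) = (sorts M c @ sorts M b) ! k"
        by (simp only: length_map)
    qed (simp add: idx(1))
    then obtain \<phi>' where \<phi>': "\<phi>' \<in> formulas L (sorts M a @ sorts M b)"
      "\<And>y. holds M \<phi>' y = holds M \<phi> (map ((!) y) ?idx)" by blast
    have il: "i < length a" if "i \<in> set idx" for i
    proof -
      obtain k where "k < length idx" "i = idx ! k" using \<open>i \<in> set idx\<close> by (auto simp: in_set_conv_nth)
      then show ?thesis using idx by simp
    qed
    have e: "holds M \<phi>' (y @ b) = holds M \<phi> (map ((!) y) idx @ b)" if len: "length y = length a" for y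
    proof -
      have 1: "map ((!) (y @ b)) idx = map ((!) y) idx" using il len by (simp add: nth_append)
      have 2: "map ((!) (y @ b)) [length a..<length a + length b] = b"
        using len by (intro nth_equalityI) (auto simp: nth_append)
      show ?thesis unfolding \<phi>'(2) map_append 1 2 ..
    qed
    have ls: "length y = length a" if "y \<in> tuples M (sorts M a)" for y
      using that by (auto simp: tuples_def dest: map_eq_imp_length_eq)
    have "thorn_forks L \<kappa> M (sorts M a) \<phi>' b A"
    proof (rule thorn_forks_reindex[of "{()}" "\<lambda>_. sorts M c" "\<lambda>_. \<phi>" "\<lambda>_. b" A "\<lambda>_. idx"])
      fix y assume y: "y \<in> tuples M (sorts M a)" "holds M \<phi>' (y @ b)"
      have "map ((!) y) idx \<in> tuples M (sorts M c)"
        by (rule tuples_reindex[OF y(1) _ ids]) (simp_all add: idx(1))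
      then show "\<exists>i\<in>{()}. map ((!) y) idx \<in> tuples M (sorts M c) \<and> holds M \<phi> (map ((!) y) idx @ b)"
        using e[OF ls[OF y(1)]] y(2) by simp
    next
      fix k assume "k < length (sorts M c)"
      from ids[OF this] show "idx ! k < length (sorts M a) \<and> sorts M a ! (idx ! k) = sorts M c ! k" .
    qed (use f idx(1) in simp_all)
    moreover have "(\<phi>', b) \<in> formulas_over L M (sorts M a) (A \<union> B)" using \<phi>'(1) b(1) by (simp add: formulas_over_def)
    moreover have "holds M \<phi>' (a @ b)" using e[of a] ic h by simp
    ultimately show False using thorn_indepD[OF a] by blast
  qed
qed

text \<open>Independent extensions exist by compactness: if finitely many thorn-forking formulas covered
  a formula of the type of \<open>C\<close>, then that formula would thorn-fork itself.\<close>

theorem extension: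
  assumes CAB: "ind C A B" and B': "B \<subseteq> B'" and sub: "A \<subseteq> univ M" "B' \<subseteq> univ M" "C \<subseteq> univ M"
    and sml: "sm A" "sm B'" "sm C"
  shows "\<exists>\<sigma>\<in>Aut (A \<union> B). ind (\<sigma> ` C) A B'"
proof -
  let ?J = "{(c, \<phi>, b). set c \<subseteq> C \<and> (\<phi>, b) \<in> formulas_over L M (sorts M c) (A \<union> B') \<and>
    thorn_forks L \<kappa> M (sorts M c) \<phi> b A}"
  let ?f = "\<lambda>(c, \<phi>, b) g. \<not> holds M \<phi> (map g c @ b)"
  have "\<exists>\<sigma>\<in>Aut (A \<union> B). \<forall>P\<in>?f ` ?J. P \<sigma>"
  proof (rule realize_by_automorphism[where B' = "A \<union> B'" and C = C])
    show "A \<union> B \<subseteq> A \<union> B'" "A \<union> B' \<subseteq> univ M" "sm (A \<union> B')" "C \<subseteq> univ M" "sm C"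
      using B' sub sml by auto
    show "definable (A \<union> B') C (sort_of M) P" if P: "P \<in> ?f ` ?J" for P
    proof -
      obtain c \<phi> b where j: "set c \<subseteq> C" "(\<phi>, b) \<in> formulas_over L M (sorts M c) (A \<union> B')"
        "P = (\<lambda>g. \<not> holds M \<phi> (map g c @ b))" using P by auto
      show ?thesis unfolding j(3)
        by (intro definable_Not definable_mono[OF formula_definable[OF j(2)] order_refl j(1)])
    qed
  next
    fix \<Gamma>0 Q
    assume \<Gamma>0: "finite \<Gamma>0" "\<Gamma>0 \<subseteq> ?f ` ?J" and Q: "definable (A \<union> B) C (sort_of M) Q" "Q id"
    show "\<exists>g. asg C (sort_of M) g \<and> Q g \<and> (\<forall>P\<in>\<Gamma>0. P g)"
    proof (rule ccontr)
      assume no: "\<not> ?thesis"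
      from finite_subset_image[OF \<Gamma>0] obtain J where J: "J \<subseteq> ?J" "finite J" "\<Gamma>0 = ?f ` J" by blast
      have Jc: "set (fst j) \<subseteq> C \<and> (fst (snd j), snd (snd j)) \<in> formulas_over L M (sorts M (fst j)) (A \<union> B') \<and>
          thorn_forks L \<kappa> M (sorts M (fst j)) (fst (snd j)) (snd (snd j)) A" if "j \<in> J" for j
        using J(1) that by (cases j) auto
      from definable_finite_support[OF Q(1)] obtain W Q' E where W: "finite W" "W \<subseteq> C" "E \<subseteq> A \<union> B"
        "definable E W (sort_of M) Q'" "\<And>g. asg C (sort_of M) g \<Longrightarrow> Q g = Q' g" by blast
      have "finite (W \<union> (\<Union>j\<in>J. set (fst j)))" using W(1) J(2) by simp
      from finite_distinct_list[OF this] obtain cc where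
        cc: "set cc = W \<union> (\<Union>j\<in>J. set (fst j))" "distinct cc" by blast
      have "set (fst j) \<subseteq> C" if "j \<in> J" for j using Jc[OF that] by (simp only: simp_thms)
      then have ccC: "set cc \<subseteq> C" using cc(1) W(2) by blast
      have "definable (A \<union> B) (set cc) (sort_of M) Q'"
        by (rule definable_mono[OF W(4,3)]) (simp add: cc(1))
      from definable_formula[OF this] obtain \<chi> e where
        \<chi>: "(\<chi>, e) \<in> formulas_over L M (sorts M cc) (A \<union> B)"
        "\<And>g. asg (set cc) (sort_of M) g \<Longrightarrow> Q' g = holds M \<chi> (map g cc @ e)" by blast
      have "\<forall>j\<in>J. \<exists>idx. length idx = length (fst j) \<and> (\<forall>k<length (fst j). idx ! k < length cc \<and> cc ! (idx ! k) = fst j ! k)"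
        by (intro ballI ex_index) (auto simp: cc(1))
      from bchoice[OF this] obtain idx where idx: "\<And>j. j \<in> J \<Longrightarrow> length (idx j) = length (fst j)"
        "\<And>j k. j \<in> J \<Longrightarrow> k < length (fst j) \<Longrightarrow> idx j ! k < length cc \<and> cc ! (idx j ! k) = fst j ! k" by blast
      have "thorn_forks L \<kappa> M (sorts M cc) \<chi> e A"
      proof (rule thorn_forks_reindex[OF J(2), of "\<lambda>j. sorts M (fst j)" "\<lambda>j. fst (snd j)" "\<lambda>j. snd (snd j)" A idx])
        fix j k assume "j \<in> J" "k < length (sorts M (fst j))"
        then show "idx j ! k < length (sorts M cc) \<and> sorts M cc ! (idx j ! k) = sorts M (fst j) ! k"
          using idx(2)[of j k] by simp
      next
        fix y assume y: "y \<in> tuples M (sorts M cc)" "holds M \<chi> (y @ e)"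
        have yl: "length y = length cc" using y(1) by (auto simp: tuples_def dest: map_eq_imp_length_eq)
        define ix where "ix u = (THE i. i < length cc \<and> cc ! i = u)" for u
        have ix: "ix (cc ! i) = i" if i: "i < length cc" for i
          unfolding ix_def by (rule the_equality) (use i cc(2) in \<open>auto simp: nth_eq_iff_index_eq\<close>)
        define g where "g u = (if u \<in> set cc then y ! ix u else u)" for u
        have gc: "g (cc ! i) = y ! i" if "i < length cc" for i
          using that ix[OF that] by (simp add: g_def)
        have gy: "map g cc = y" using gc yl by (intro nth_equalityI) auto
        have yi: "y ! i \<in> univ M \<and> sort_of M (y ! i) = sort_of M (cc ! i)" if "i < length cc" for i
        proof -
          have "sorts M y ! i = sorts M cc ! i" using y(1) by (simp add: tuples_def)
          then show ?thesis using y(1) that yl by (auto simp: tuples_def)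
        qed
        have g: "asg C (sort_of M) g" unfolding asg_def
        proof
          fix u assume u: "u \<in> C"
          show "g u \<in> univ M \<and> sort_of M (g u) = sort_of M u"
          proof (cases "u \<in> set cc")
            case True
            then obtain i where "i < length cc" "u = cc ! i" by (auto simp: in_set_conv_nth)
            then show ?thesis using gc yi by simp
          qed (use u sub(3) in \<open>auto simp: g_def\<close>)
        qed
        have "Q g" using W(5)[OF g] \<chi>(2)[OF asg_mono[OF g ccC]] gy y(2) by simp
        then obtain P where P: "P \<in> \<Gamma>0" "\<not> P g" using no g by blast
        then obtain j where j: "j \<in> J" "P = ?f j" using J(3) by blast
        have "holds M (fst (snd j)) (map g (fst j) @ snd (snd j))"
          using P(2) j(2) by (simp add: case_prod_beta)
        moreover have "map g (fst j) = map ((!) y) (idx j)"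
        proof (rule nth_equalityI)
          show "length (map g (fst j)) = length (map ((!) y) (idx j))" using idx(1)[OF j(1)] by simp
          fix k assume "k < length (map g (fst j))"
          then have k: "k < length (fst j)" by simp
          have "g (cc ! (idx j ! k)) = y ! (idx j ! k)" using idx(2)[OF j(1) k] gc by blast
          then show "map g (fst j) ! k = map ((!) y) (idx j) ! k"
            using idx(2)[OF j(1) k] idx(1)[OF j(1)] k by simp
        qed
        moreover have "map ((!) y) (idx j) \<in> tuples M (sorts M (fst j))"
          by (rule tuples_reindex[OF y(1)]) (use idx j(1) in simp_all)
        ultimately show "\<exists>j\<in>J. map ((!) y) (idx j) \<in> tuples M (sorts M (fst j)) \<and>
            holds M (fst (snd j)) (map ((!) y) (idx j) @ snd (snd j))" using j(1) by auto
      qed (use Jc idx(1) in simp_all)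
      moreover have "holds M \<chi> (cc @ e)"
        using W(5)[OF asg_id[OF sub(3)]] \<chi>(2)[OF asg_id] ccC sub(3) Q(2) by simp
      moreover have "thorn_indep L \<kappa> M cc A B" using CAB ccC by (simp add: thorn_indep_set_def)
      ultimately show False using thorn_indepD \<chi>(1) by blast
    qed
  qed
  then obtain \<sigma> where \<sigma>: "\<sigma> \<in> Aut (A \<union> B)" "\<forall>P\<in>?f ` ?J. P \<sigma>" ..
  have "ind (\<sigma> ` C) A B'" unfolding thorn_indep_set_def
  proof (intro allI impI)
    fix c' assume "set c' \<subseteq> \<sigma> ` C"
    then have "c' \<in> lists (\<sigma> ` C)" by (simp add: in_lists_conv_set subset_iff)
    then have "c' \<in> map \<sigma> ` lists C" by (simp add: lists_image)
    then obtain c where c: "set c \<subseteq> C" "c' = map \<sigma> c" by auto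
    have s: "sorts M c' = sorts M c" using Aut_sorts[OF \<sigma>(1), of c] c sub(3) by simp
    show "thorn_indep L \<kappa> M c' A B'"
    proof (rule thorn_indepI)
      fix \<phi> b assume *: "(\<phi>, b) \<in> formulas_over L M (sorts M c') (A \<union> B')"
        "thorn_forks L \<kappa> M (sorts M c') \<phi> b A" "holds M \<phi> (c' @ b)"
      then have "(c, \<phi>, b) \<in> ?J" using c(1) s by simp
      from bspec[OF \<sigma>(2) imageI[OF this]] show False using *(3) c(2) by simp
    qed
  qed
  then show ?thesis using \<sigma>(1) by blast
qed

end

context monster
begin

definition smallset :: "'a set \<Rightarrow> bool" where
  "smallset X \<longleftrightarrow> X \<subseteq> univ M \<and> sm X"

lemma smallset_Un [simp]: "smallset (X \<union> Y) \<longleftrightarrow> smallset X \<and> smallset Y"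
  by (auto simp: smallset_def)

lemma smallset_subset: "smallset Y \<Longrightarrow> X \<subseteq> Y \<Longrightarrow> smallset X"
  using sm_subset by (auto simp: smallset_def)

lemma smallset_Aut: "smallset X \<Longrightarrow> \<sigma> \<in> Aut B \<Longrightarrow> smallset (\<sigma> ` X)"
  unfolding smallset_def using Aut_univ_image[of \<sigma> B X] sm_image[of X \<sigma>] by blast

lemma smallset_finite: "finite X \<Longrightarrow> X \<subseteq> univ M \<Longrightarrow> smallset X"
  by (simp add: smallset_def)

lemma smallset_UN_finite: "finite I \<Longrightarrow> (\<And>i. i \<in> I \<Longrightarrow> smallset (F i)) \<Longrightarrow> smallset (\<Union>i\<in>I. F i)"
  using sm_UN_finite[of I F] by (auto simp: smallset_def)

lemma subset_acl: "D \<subseteq> univ M \<Longrightarrow> D \<subseteq> acl D"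
proof
  fix x assume "D \<subseteq> univ M" "x \<in> D"
  moreover have "{\<sigma> x |\<sigma>. \<sigma> \<in> Aut D} \<subseteq> {x}" using Aut_fix \<open>x \<in> D\<close> by auto
  ultimately show "x \<in> acl D" unfolding acl_def using finite_subset by blast
qed

text \<open>If \<open>x\<close> is algebraic over \<open>D \<union> C\<close>, say one of \<open>N\<close> solutions of \<open>P'(x, c)\<close>, then ``\<open>P'(x, z)\<close> has
  at most \<open>N\<close> solutions'', read as a formula in \<open>z\<close>, strongly divides over \<open>D\<close> unless \<open>x\<close> is
  algebraic over \<open>D\<close>.\<close>

theorem ind_acl:
  assumes CAB: "ind C A B" and D: "A \<subseteq> D" "D \<subseteq> A \<union> B" and AB: "smallset (A \<union> B)" and C: "smallset C"
    and x: "x \<in> A \<union> B" "x \<in> acl (D \<union> C)"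
  shows "x \<in> acl D"
proof (rule ccontr)
  assume xD: "x \<notin> acl D"
  have Ds: "D \<subseteq> univ M" "sm D" using D(2) AB sm_subset unfolding smallset_def by blast+
  have xu: "x \<in> univ M" using x(2) acl_univ by blast
  obtain D0 where D0: "D0 \<subseteq> D \<union> C" "finite D0" "x \<in> acl D0"
    using acl_finite_support[OF x(2)] Ds C by (auto simp: smallset_def)
  let ?C = "D0 \<inter> C"
  have Cu: "?C \<subseteq> univ M" "finite ?C" using C D0(2) by (auto simp: smallset_def)
  have "x \<in> acl (D \<union> ?C)" using D0(1,3) acl_mono[of D0 "D \<union> ?C"] by blast
  from acl_definable[OF this] obtain P where
    P: "definable (D \<union> ?C) {()} (\<lambda>_. sort_of M x) P" "P (\<lambda>_. x)"
      "finite {y\<in>univ M. sort_of M y = sort_of M x \<and> P (\<lambda>_. y)}"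
    using Ds Cu by auto
  let ?F = "{y\<in>univ M. sort_of M y = sort_of M x \<and> P (\<lambda>_. y)}"
  let ?N = "Suc (card ?F)"
  let ?V = "Inl ` {()} \<union> Inr ` ?C :: (unit + 'a) set"
  let ?S = "case_sum (\<lambda>_. sort_of M x) (sort_of M)"
  from definable_abstract_params[OF P(1)] obtain P' where P': "definable D ?V ?S P'"
    "\<And>g. asg {()} (\<lambda>_. sort_of M x) g \<Longrightarrow> P g = P' (case_sum g id)" by blast
  have P'y: "P' (case_sum (\<lambda>_. y) id) = P (\<lambda>_. y)" if "y \<in> univ M" "sort_of M y = sort_of M x" for y
    using P'(2)[of "\<lambda>_. y"] that by (simp add: asg_def)
  let ?many = "\<lambda>g. \<exists>Y\<subseteq>{y\<in>univ M. sort_of M y = ?S (Inl ())}. finite Y \<and> card Y = ?N \<and> (\<forall>y\<in>Y. P' (g(Inl () := y)))"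
  let ?R = "\<lambda>g. P' g \<and> \<not> ?many g"
  have R: "definable D ?V ?S ?R"
    by (intro definable_And definable_Not definable_at_least P'(1) Ds(1)) simp
  obtain c where c: "set c = ?C" "distinct c" using finite_distinct_list[OF Cu(2)] by blast
  let ?xs = "map Inr c @ [Inl ()]"
  have "set ?xs = ?V" using c(1) by auto
  then have "definable D (set ?xs) ?S ?R" using R by (simp only:)
  from definable_formula[OF this] obtain \<psi> e where
    \<psi>: "(\<psi>, e) \<in> formulas_over L M (map ?S ?xs) D"
    "\<And>g. asg (set ?xs) ?S g \<Longrightarrow> ?R g = holds M \<psi> (map g ?xs @ e)" by blast
  have sxs: "map ?S ?xs = sorts M c @ [sort_of M x]" by simp
  have e: "set e \<subseteq> D" "\<psi> \<in> formulas L (sorts M c @ sorts M (x # e))"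
    using \<psi>(1) unfolding sxs by (auto simp: formulas_over_def)
  have Rg: "?R (case_sum (\<lambda>_. y) f) = holds M \<psi> (map f c @ (y # e))"
    if "y \<in> univ M" "sort_of M y = sort_of M x" "asg ?C (sort_of M) f" for y f
  proof -
    have "asg (set ?xs) ?S (case_sum (\<lambda>_. y) f)" using that c(1) by (auto simp: asg_def)
    from \<psi>(2)[OF this] show ?thesis by (simp add: comp_def)
  qed
  have upd: "(case_sum (\<lambda>_. y) f)(Inl () := y') = case_sum (\<lambda>_. y') f" for y y' and f :: "'a \<Rightarrow> 'a"
    by (rule ext) (simp split: sum.split)
  have Rx: "?R (case_sum (\<lambda>_. x) id)"
  proof
    show "P' (case_sum (\<lambda>_. x) id)" using P'y[OF xu refl] P(2) by simp
    show "\<not> ?many (case_sum (\<lambda>_. x) id)"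
    proof
      assume "?many (case_sum (\<lambda>_. x) id)"
      then obtain Y where Y: "Y \<subseteq> {y\<in>univ M. sort_of M y = ?S (Inl ())}" "card Y = ?N"
        "\<forall>y\<in>Y. P' ((case_sum (\<lambda>_. x) id)(Inl () := y))" by (elim exE conjE)
      have "Y \<subseteq> ?F"
      proof
        fix y assume y: "y \<in> Y"
        then have "y \<in> univ M" "sort_of M y = sort_of M x" using Y(1) by auto
        moreover have "P' (case_sum (\<lambda>_. y) id)" using bspec[OF Y(3) y] unfolding upd .
        ultimately show "y \<in> ?F" using P'y by simp
      qed
      then have "card Y \<le> card ?F" using P(3) by (rule card_mono[rotated])
      then show False using Y(2) by simp
    qed
  qed
  have h: "holds M \<psi> (c @ (x # e))"
    using Rg[OF xu refl asg_id[OF Cu(1)]] Rx by (simp only: map_idI id_apply simp_thms list.map_id)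
  have eu: "set (x # e) \<subseteq> univ M" using e(1) Ds(1) xu by auto
  have "strongly_divides L M (sorts M c) \<psi> (x # e) D" unfolding strongly_divides_def
  proof (intro conjI exI[of _ ?N] allI impI)
    show "\<not> algebraic_over L M (x # e) D"
      using algebraic_over_subset_acl[OF _ eu Ds] xD by auto
  next
    fix S assume "S \<subseteq> realizations M (sorts M (x # e)) (tp L M (x # e) D)"
      and cS: "finite S \<and> card S = ?N"
    then have S: "S \<subseteq> {map \<sigma> (x # e) |\<sigma>. \<sigma> \<in> Aut D}" using realizations_tp[OF eu Ds] by simp
    have Sy: "\<exists>y. b' = y # e \<and> y \<in> univ M \<and> sort_of M y = sort_of M x" if b': "b' \<in> S" for b'
    proof -
      obtain \<sigma> where \<sigma>: "\<sigma> \<in> Aut D" "b' = map \<sigma> (x # e)" using S b' by blast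
      then have "b' = \<sigma> x # e" using map_Aut_fix[OF \<sigma>(1) e(1)] by simp
      then show ?thesis using Aut_univ[OF \<sigma>(1) xu] Aut_sort[OF \<sigma>(1) xu] by blast
    qed
    show "\<not> (\<exists>a\<in>tuples M (sorts M c). \<forall>b'\<in>S. holds M \<psi> (a @ b'))"
    proof
      assume "\<exists>a\<in>tuples M (sorts M c). \<forall>b'\<in>S. holds M \<psi> (a @ b')"
      then obtain a where a: "a \<in> tuples M (sorts M c)" "\<forall>b'\<in>S. holds M \<psi> (a @ b')" ..
      have al: "length a = length c" using a(1) by (auto simp: tuples_def dest: map_eq_imp_length_eq)
      define f where "f u = a ! (THE i. i < length c \<and> c ! i = u)" for u
      have fc: "f (c ! i) = a ! i" if i: "i < length c" for i
      proof -
        have "(THE i'. i' < length c \<and> c ! i' = c ! i) = i"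
          by (rule the_equality) (use i c(2) in \<open>auto simp: nth_eq_iff_index_eq\<close>)
        then show ?thesis by (simp add: f_def)
      qed
      have fa: "map f c = a" using fc al by (intro nth_equalityI) auto
      have f: "asg ?C (sort_of M) f" unfolding asg_def
      proof
        fix u assume "u \<in> ?C"
        then have "u \<in> set c" using c(1) by simp
        then obtain i where i: "i < length c" "u = c ! i" by (auto simp: in_set_conv_nth)
        have "sorts M a ! i = sorts M c ! i" using a(1) by (simp add: tuples_def)
        then show "f u \<in> univ M \<and> sort_of M (f u) = sort_of M u"
          using i fc[OF i(1)] al a(1) by (auto simp: tuples_def)
      qed
      let ?Y = "hd ` S"
      have YS: "y \<in> univ M \<and> sort_of M y = sort_of M x \<and> y # e \<in> S" if y: "y \<in> ?Y" for y
      proof -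
        obtain b' where b': "b' \<in> S" "y = hd b'" using y by blast
        then show ?thesis using Sy[OF b'(1)] by auto
      qed
      have PY: "?R (case_sum (\<lambda>_. y) f)" if y: "y \<in> ?Y" for y
        using YS[OF y] Rg[of y f] f fa a(2) by (simp only: simp_thms)
      have hd: "b' = hd b' # e" if "b' \<in> S" for b' using Sy[OF that] by auto
      have "inj_on hd S"
      proof (rule inj_onI)
        fix b1 b2 assume "b1 \<in> S" "b2 \<in> S" "hd b1 = hd b2"
        then show "b1 = b2" using hd[of b1] hd[of b2] by simp
      qed
      then have cY: "card ?Y = ?N" using cS by (simp add: card_image)
      then obtain y0 where y0: "y0 \<in> ?Y" by (metis card.empty equals0I nat.distinct(1))
      have "?many (case_sum (\<lambda>_. y0) f)"
      proof (intro exI[of _ ?Y] conjI ballI)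
        show "?Y \<subseteq> {y\<in>univ M. sort_of M y = ?S (Inl ())}" using YS by auto
        show "finite ?Y" using cS by simp
        show "P' ((case_sum (\<lambda>_. y0) f)(Inl () := y))" if "y \<in> ?Y" for y
          unfolding upd using PY[OF that] by (rule conjunct1)
      qed (rule cY)
      then show False using PY[OF y0] by (simp only: simp_thms)
    qed
  qed
  then have "thorn_divides L \<kappa> M (sorts M c) \<psi> (x # e) A"
    using D(1) Ds unfolding thorn_divides_def by (intro exI[of _ D]) simp
  moreover have "(\<psi>, x # e) \<in> formulas_over L M (sorts M c) (univ M)"
    using e(2) eu by (simp add: formulas_over_def)
  ultimately have "thorn_forks L \<kappa> M (sorts M c) \<psi> (x # e) A" by (rule thorn_divides_forks)
  moreover have "(\<psi>, x # e) \<in> formulas_over L M (sorts M c) (A \<union> B)"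
    using e x(1) D(2) by (auto simp: formulas_over_def)
  moreover have "thorn_indep L \<kappa> M c A B" using CAB c(1) by (simp add: thorn_indep_set_def)
  ultimately show False using thorn_indepD h by blast
qed

text \<open>The following two facts characterize thorn-independence in terms of algebraic closure and
  automorphisms alone; the calculus of independence is derived from them.\<close>

theorem ind_obtain:
  assumes "ind C A B" "A \<union> B \<subseteq> B'" "smallset B'" "smallset C"
  shows "\<exists>\<sigma>\<in>Aut (A \<union> B). \<forall>D x. A \<subseteq> D \<longrightarrow> D \<subseteq> B' \<longrightarrow> x \<in> B' \<longrightarrow> x \<in> acl (D \<union> \<sigma> ` C) \<longrightarrow> x \<in> acl D"
proof -
  have s: "smallset A" using assms(2,3) smallset_subset by blast
  obtain \<sigma> where \<sigma>: "\<sigma> \<in> Aut (A \<union> B)" "ind (\<sigma> ` C) A B'"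
    using extension[OF assms(1), of B'] assms(2-4) s by (auto simp: smallset_def)
  have "x \<in> acl D" if "A \<subseteq> D" "D \<subseteq> B'" "x \<in> B'" "x \<in> acl (D \<union> \<sigma> ` C)" for D x
    using ind_acl[OF \<sigma>(2) that(1) _ _ smallset_Aut[OF assms(4) \<sigma>(1)] _ that(4)] that s assms(3) by auto
  then show ?thesis using \<sigma>(1) by blast
qed

theorem ind_intro:
  assumes C: "C \<subseteq> univ M" and AB: "smallset (A \<union> B)"
    and ex: "\<And>B'. A \<union> B \<subseteq> B' \<Longrightarrow> smallset B' \<Longrightarrow> \<exists>\<sigma>\<in>Aut (A \<union> B).
      \<forall>D x. A \<subseteq> D \<longrightarrow> D \<subseteq> B' \<longrightarrow> x \<in> B' \<longrightarrow> x \<in> acl (D \<union> \<sigma> ` C) \<longrightarrow> x \<in> acl D"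
  shows "ind C A B"
  unfolding thorn_indep_set_def
proof (intro allI impI thorn_indepI)
  fix c \<phi> b
  assume c: "set c \<subseteq> C" and \<phi>: "(\<phi>, b) \<in> formulas_over L M (sorts M c) (A \<union> B)"
    and f: "thorn_forks L \<kappa> M (sorts M c) \<phi> b A" and h: "holds M \<phi> (c @ b)"
  obtain \<Psi> where \<Psi>: "\<Psi> \<subseteq> formulas_over L M (sorts M c) (univ M)" "finite \<Psi>"
    "\<forall>(\<psi>, d)\<in>\<Psi>. thorn_divides L \<kappa> M (sorts M c) \<psi> d A"
    "\<forall>a\<in>tuples M (sorts M c). holds M \<phi> (a @ b) \<longrightarrow> (\<exists>(\<psi>, d)\<in>\<Psi>. holds M \<psi> (a @ d))"
    using f unfolding thorn_forks_def by (elim exE conjE)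
  have "\<forall>p\<in>\<Psi>. \<exists>D. A \<subseteq> D \<and> D \<subseteq> univ M \<and> small \<kappa> D \<and> strongly_divides L M (sorts M c) (fst p) (snd p) D"
    using \<Psi>(3) unfolding thorn_divides_def by (auto simp: case_prod_beta)
  from bchoice[OF this] obtain D where D: "\<forall>p\<in>\<Psi>. A \<subseteq> D p \<and> D p \<subseteq> univ M \<and> small \<kappa> (D p) \<and>
    strongly_divides L M (sorts M c) (fst p) (snd p) (D p)" ..
  let ?B' = "A \<union> B \<union> (\<Union>p\<in>\<Psi>. D p \<union> set (snd p))"
  have "smallset (\<Union>p\<in>\<Psi>. D p \<union> set (snd p))"
  proof (rule smallset_UN_finite[OF \<Psi>(2)])
    fix p assume p: "p \<in> \<Psi>"
    then have "p \<in> formulas_over L M (sorts M c) (univ M)" using \<Psi>(1) by blast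
    then have "set (snd p) \<subseteq> univ M" by (auto simp: formulas_over_def)
    then show "smallset (D p \<union> set (snd p))" using D p by (simp add: smallset_def)
  qed
  then have "smallset ?B'" using AB by simp
  from ex[OF _ this] obtain \<sigma> where \<sigma>: "\<sigma> \<in> Aut (A \<union> B)" and
    acl: "\<And>D x. A \<subseteq> D \<Longrightarrow> D \<subseteq> ?B' \<Longrightarrow> x \<in> ?B' \<Longrightarrow> x \<in> acl (D \<union> \<sigma> ` C) \<Longrightarrow> x \<in> acl D" by blast
  have cu: "set c \<subseteq> univ M" using c C by blast
  have b: "set b \<subseteq> A \<union> B" "\<phi> \<in> formulas L (sorts M (c @ b))" using \<phi> by (auto simp: formulas_over_def)
  have "holds M \<phi> (map \<sigma> (c @ b))"
    using holds_Aut[OF \<sigma> _ b(2)] h cu b(1) AB by (auto simp: smallset_def)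
  then have "holds M \<phi> (map \<sigma> c @ b)" using map_Aut_fix[OF \<sigma> b(1)] by simp
  moreover have ct: "map \<sigma> c \<in> tuples M (sorts M c)"
    by (rule Aut_tuples[OF \<sigma>]) (simp add: tuples_def cu)
  ultimately obtain \<psi> d where p: "(\<psi>, d) \<in> \<Psi>" "holds M \<psi> (map \<sigma> c @ d)" using \<Psi>(4) by blast
  have Dp: "A \<subseteq> D (\<psi>, d)" "D (\<psi>, d) \<subseteq> univ M" "sm (D (\<psi>, d))"
    "strongly_divides L M (sorts M c) \<psi> d (D (\<psi>, d))" using D p(1) by auto
  have "(\<psi>, d) \<in> formulas_over L M (sorts M c) (univ M)" using \<Psi>(1) p(1) by blast
  from strongly_divides_acl[OF Dp(4) this ct p(2) Dp(2,3)]
  obtain x where x: "x \<in> set d" "x \<notin> acl (D (\<psi>, d))" "x \<in> acl (D (\<psi>, d) \<union> set (map \<sigma> c))" by blast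
  have "set (map \<sigma> c) \<subseteq> \<sigma> ` C" using c by auto
  then have "x \<in> acl (D (\<psi>, d) \<union> \<sigma> ` C)"
    using x(3) acl_mono[of "D (\<psi>, d) \<union> set (map \<sigma> c)" "D (\<psi>, d) \<union> \<sigma> ` C"] by blast
  moreover have "D (\<psi>, d) \<subseteq> ?B'" using p(1) by blast
  moreover have "x \<in> ?B'" using p(1) x(1) by force
  ultimately show False using acl Dp(1) x(2) by blast
qed

section \<open>The calculus of independence\<close>

lemma ind_mono:
  assumes "ind C A B" "C' \<subseteq> C" "B' \<subseteq> A \<union> B"
  shows "ind C' A B'"
proof -
  have "formulas_over L M ss (A \<union> B') \<subseteq> formulas_over L M ss (A \<union> B)" for ss
    using assms(3) by (auto simp: formulas_over_def)
  then have "thorn_indep L \<kappa> M c A B \<Longrightarrow> thorn_indep L \<kappa> M c A B'" for c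
    by (intro thorn_indepI) (use thorn_indepD in blast)
  then show ?thesis using assms(1,2) by (auto simp: thorn_indep_set_def)
qed

lemma thorn_forks_base:
  assumes "thorn_forks L \<kappa> M ss \<phi> b A'" "A \<subseteq> A'"
  shows "thorn_forks L \<kappa> M ss \<phi> b A"
proof -
  have "thorn_divides L \<kappa> M ss \<psi> d A' \<Longrightarrow> thorn_divides L \<kappa> M ss \<psi> d A" for \<psi> d
    using assms(2) unfolding thorn_divides_def by blast
  note td = this
  from assms(1) obtain \<Psi> where \<Psi>: "\<Psi> \<subseteq> formulas_over L M ss (univ M)" "finite \<Psi>"
    "\<forall>(\<psi>, d)\<in>\<Psi>. thorn_divides L \<kappa> M ss \<psi> d A'"
    "\<forall>a\<in>tuples M ss. holds M \<phi> (a @ b) \<longrightarrow> (\<exists>(\<psi>, d)\<in>\<Psi>. holds M \<psi> (a @ d))"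
    unfolding thorn_forks_def by (elim exE conjE)
  moreover have "\<forall>(\<psi>, d)\<in>\<Psi>. thorn_divides L \<kappa> M ss \<psi> d A" using \<Psi>(3) td by auto
  ultimately show ?thesis unfolding thorn_forks_def by (intro exI[of _ \<Psi>]) simp
qed

lemma thorn_indep_base:
  assumes "thorn_indep L \<kappa> M c A B" "A \<subseteq> A'" "A' \<subseteq> A \<union> B"
  shows "thorn_indep L \<kappa> M c A' B"
proof (rule thorn_indepI)
  fix \<phi> b assume *: "(\<phi>, b) \<in> formulas_over L M (sorts M c) (A' \<union> B)"
    "thorn_forks L \<kappa> M (sorts M c) \<phi> b A'" "holds M \<phi> (c @ b)"
  have "(\<phi>, b) \<in> formulas_over L M (sorts M c) (A \<union> B)"
    using *(1) assms(3) by (auto simp: formulas_over_def)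
  then show False using thorn_indepD[OF assms(1) _ thorn_forks_base[OF *(2) assms(2)]] *(3) by blast
qed

lemma ind_base: "ind C A B \<Longrightarrow> A \<subseteq> A' \<Longrightarrow> A' \<subseteq> A \<union> B \<Longrightarrow> ind C A' B"
  using thorn_indep_base by (auto simp: thorn_indep_set_def)

lemma ind_finite_character:
  assumes "\<And>C0 B0. finite C0 \<Longrightarrow> C0 \<subseteq> C \<Longrightarrow> finite B0 \<Longrightarrow> B0 \<subseteq> B \<Longrightarrow> ind C0 A B0"
  shows "ind C A B"
  unfolding thorn_indep_set_def
proof (intro allI impI thorn_indepI)
  fix c \<phi> b
  assume c: "set c \<subseteq> C" and \<phi>: "(\<phi>, b) \<in> formulas_over L M (sorts M c) (A \<union> B)"
    and f: "thorn_forks L \<kappa> M (sorts M c) \<phi> b A" and h: "holds M \<phi> (c @ b)"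
  have "ind (set c) A (set b \<inter> B)" by (rule assms) (use c in auto)
  then have "thorn_indep L \<kappa> M c A (set b \<inter> B)" by (simp add: thorn_indep_set_def)
  moreover have "(\<phi>, b) \<in> formulas_over L M (sorts M c) (A \<union> (set b \<inter> B))"
    using \<phi> by (auto simp: formulas_over_def)
  ultimately show False using thorn_indepD f h by blast
qed

lemma ind_Aut:
  assumes "ind C A B" "\<sigma> \<in> Aut {}" "smallset C" "smallset A" "smallset B"
  shows "ind (\<sigma> ` C) (\<sigma> ` A) (\<sigma> ` B)"
proof (rule ind_intro)
  show "\<sigma> ` C \<subseteq> univ M" "smallset (\<sigma> ` A \<union> \<sigma> ` B)"
    using smallset_Aut[OF _ assms(2)] assms(3-5) by (auto simp: smallset_def)
  obtain \<sigma>' where \<sigma>': "\<sigma>' \<in> Aut {}" "\<And>x. x \<in> univ M \<Longrightarrow> \<sigma>' (\<sigma> x) = x" "\<And>x. x \<in> univ M \<Longrightarrow> \<sigma> (\<sigma>' x) = x"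
    by (rule Aut_inv[OF assms(2)]) auto
  have ii: "\<sigma>' ` \<sigma> ` X = X" "\<sigma> ` \<sigma>' ` X = X" if "X \<subseteq> univ M" for X
    using \<sigma>'(2,3) that by (force simp: image_image subset_iff)+
  fix B' assume B': "\<sigma> ` A \<union> \<sigma> ` B \<subseteq> B'" "smallset B'"
  have B'u: "B' \<subseteq> univ M" using B'(2) by (simp add: smallset_def)
  have "\<sigma>' ` (\<sigma> ` A \<union> \<sigma> ` B) \<subseteq> \<sigma>' ` B'" using B'(1) by (rule image_mono)
  then have sub: "A \<union> B \<subseteq> \<sigma>' ` B'"
    using ii(1) assms(4,5) by (simp add: image_Un smallset_def)
  from ind_obtain[OF assms(1) sub smallset_Aut[OF B'(2) \<sigma>'(1)] assms(3)]
  obtain \<tau> where \<tau>: "\<tau> \<in> Aut (A \<union> B)" "\<And>D x. A \<subseteq> D \<Longrightarrow> D \<subseteq> \<sigma>' ` B' \<Longrightarrow> x \<in> \<sigma>' ` B' \<Longrightarrow>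
      x \<in> acl (D \<union> \<tau> ` C) \<Longrightarrow> x \<in> acl D" by blast
  have ABu: "A \<union> B \<subseteq> univ M" using assms(4,5) by (auto simp: smallset_def)
  obtain \<rho> where \<rho>: "\<rho> \<in> Aut (\<sigma> ` (A \<union> B))" "\<And>x. x \<in> univ M \<Longrightarrow> \<rho> (\<sigma> x) = \<sigma> (\<tau> x)"
    using Aut_conj[OF assms(2) \<tau>(1) ABu] by blast
  have \<rho>C: "\<rho> ` \<sigma> ` C = \<sigma> ` \<tau> ` C"
    using \<rho>(2) assms(3) unfolding image_image by (intro image_cong) (auto simp: smallset_def)
  show "\<exists>\<rho>\<in>Aut (\<sigma> ` A \<union> \<sigma> ` B). \<forall>D x. \<sigma> ` A \<subseteq> D \<longrightarrow> D \<subseteq> B' \<longrightarrow> x \<in> B' \<longrightarrow>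
      x \<in> acl (D \<union> \<rho> ` \<sigma> ` C) \<longrightarrow> x \<in> acl D"
  proof (intro bexI[of _ \<rho>] allI impI)
    show "\<rho> \<in> Aut (\<sigma> ` A \<union> \<sigma> ` B)" using \<rho>(1) by (simp add: image_Un)
    fix D x assume D: "\<sigma> ` A \<subseteq> D" "D \<subseteq> B'" "x \<in> B'" "x \<in> acl (D \<union> \<rho> ` \<sigma> ` C)"
    have \<tau>Cu: "\<tau> ` C \<subseteq> univ M" using Aut_univ_image[OF \<tau>(1)] assms(3) by (simp add: smallset_def)
    have Du: "D \<subseteq> univ M" using D(2) B'u by blast
    have "D \<union> \<sigma> ` \<tau> ` C \<subseteq> univ M" using Aut_univ_image[OF assms(2) \<tau>Cu] Du by simp
    from acl_Aut[OF \<sigma>'(1) D(4)[unfolded \<rho>C] this]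
    have "\<sigma>' x \<in> acl (\<sigma>' ` D \<union> \<tau> ` C)" using ii(1)[OF \<tau>Cu] by (simp add: image_Un)
    moreover have "A \<subseteq> \<sigma>' ` D"
      using image_mono[OF D(1), of \<sigma>'] ii(1)[of A] assms(4) by (simp add: smallset_def)
    ultimately have "\<sigma>' x \<in> acl (\<sigma>' ` D)" using \<tau>(2)[of "\<sigma>' ` D" "\<sigma>' x"] D(2,3) by blast
    from acl_Aut[OF assms(2) this Aut_univ_image[OF \<sigma>'(1) Du]]
    show "x \<in> acl D" using ii(2)[OF Du] \<sigma>'(3)[of x] D(3) B'u by auto
  qed
qed

text \<open>Two applications of the characterization: first \<open>Y\<close>, then \<open>X\<close> over \<open>Y\<close> is moved to a position
  in which it adds nothing to the algebraic closures of subsets of \<open>B'\<close>.\<close>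

theorem left_transitivity:
  assumes X: "ind X (A \<union> Y) B" and Y: "ind Y A B"
    and s: "smallset X" "smallset Y" "smallset A" "smallset B"
  shows "ind (X \<union> Y) A B"
proof (rule ind_intro)
  show "X \<union> Y \<subseteq> univ M" "smallset (A \<union> B)" using s by (auto simp: smallset_def)
  fix B' assume B': "A \<union> B \<subseteq> B'" "smallset B'"
  from ind_obtain[OF Y B' s(2)] obtain \<sigma> where \<sigma>: "\<sigma> \<in> Aut (A \<union> B)"
    "\<And>D x. A \<subseteq> D \<Longrightarrow> D \<subseteq> B' \<Longrightarrow> x \<in> B' \<Longrightarrow> x \<in> acl (D \<union> \<sigma> ` Y) \<Longrightarrow> x \<in> acl D" by blast
  have "ind (\<sigma> ` X) (\<sigma> ` (A \<union> Y)) (\<sigma> ` B)"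
    by (rule ind_Aut[OF X Aut_mono[OF \<sigma>(1)]]) (use s in auto)
  then have "ind (\<sigma> ` X) (A \<union> \<sigma> ` Y) B"
    using Aut_fix_image[OF \<sigma>(1), of A] Aut_fix_image[OF \<sigma>(1), of B] by (simp add: image_Un)
  moreover have "A \<union> \<sigma> ` Y \<union> B \<subseteq> B' \<union> \<sigma> ` Y" "smallset (B' \<union> \<sigma> ` Y)" "smallset (\<sigma> ` X)"
    using B' smallset_Aut[OF _ \<sigma>(1)] s by auto
  ultimately obtain \<tau> where \<tau>: "\<tau> \<in> Aut (A \<union> \<sigma> ` Y \<union> B)"
    "\<And>D x. A \<union> \<sigma> ` Y \<subseteq> D \<Longrightarrow> D \<subseteq> B' \<union> \<sigma> ` Y \<Longrightarrow> x \<in> B' \<union> \<sigma> ` Y \<Longrightarrow>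
      x \<in> acl (D \<union> \<tau> ` \<sigma> ` X) \<Longrightarrow> x \<in> acl D"
    using ind_obtain[of "\<sigma> ` X" "A \<union> \<sigma> ` Y" B "B' \<union> \<sigma> ` Y"] by metis
  have eq: "(\<tau> \<circ> \<sigma>) ` (X \<union> Y) = \<sigma> ` Y \<union> \<tau> ` \<sigma> ` X"
    using Aut_fix_image[OF \<tau>(1), of "\<sigma> ` Y"] by (auto simp: image_Un image_comp[symmetric])
  show "\<exists>\<rho>\<in>Aut (A \<union> B). \<forall>D x. A \<subseteq> D \<longrightarrow> D \<subseteq> B' \<longrightarrow> x \<in> B' \<longrightarrow> x \<in> acl (D \<union> \<rho> ` (X \<union> Y)) \<longrightarrow> x \<in> acl D"
  proof (intro bexI[of _ "\<tau> \<circ> \<sigma>"] allI impI)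
    show "\<tau> \<circ> \<sigma> \<in> Aut (A \<union> B)" by (rule Aut_comp[OF \<sigma>(1) Aut_mono[OF \<tau>(1)]]) blast
    fix D x assume D: "A \<subseteq> D" "D \<subseteq> B'" "x \<in> B'" "x \<in> acl (D \<union> (\<tau> \<circ> \<sigma>) ` (X \<union> Y))"
    then have "x \<in> acl ((D \<union> \<sigma> ` Y) \<union> \<tau> ` \<sigma> ` X)" unfolding eq by (simp add: Un_assoc)
    have "x \<in> acl (D \<union> \<sigma> ` Y)"
      by (rule \<tau>(2)[OF _ _ _ \<open>x \<in> acl ((D \<union> \<sigma> ` Y) \<union> \<tau> ` \<sigma> ` X)\<close>]) (use D in auto)
    then show "x \<in> acl D" using D \<sigma>(2) by blast
  qed
qed

end

section \<open>Existence and symmetry in rosy theories\<close>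

locale rosy_monster = monster L T \<kappa> M
  for L :: "('s, 'f, 'r) language"
    and T :: "('s, 'f, 'r) fm set"
    and \<kappa> :: "'k rel"
    and M :: "('s, 'f, 'r, 'a) struct" +
  assumes rosy: "rosy L T \<kappa> M"
begin

lemma local_character:
  assumes "set a \<subseteq> univ M" "smallset B"
  shows "\<exists>B0\<subseteq>B. |B0| \<le>o |T| \<and> thorn_indep L \<kappa> M a B0 B"
  using rosy assms unfolding rosy_def smallset_def by blast

lemma ind_self:
  assumes "C \<subseteq> univ M" "smallset A"
  shows "ind C A A"
  unfolding thorn_indep_set_def
proof (intro allI impI)
  fix c assume "set c \<subseteq> C"
  then have "set c \<subseteq> univ M" using assms(1) by blast
  from local_character[OF this assms(2)] obtain B0 where "B0 \<subseteq> A" "thorn_indep L \<kappa> M c B0 A" by blast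
  then show "thorn_indep L \<kappa> M c A A" by (intro thorn_indep_base[of c B0 A A]) auto
qed

lemma ext:
  assumes "ind C A B" "B \<subseteq> B'" "smallset C" "smallset A" "smallset B'"
  shows "\<exists>\<sigma>\<in>Aut (A \<union> B). ind (\<sigma> ` C) A B'"
  using extension[OF assms(1,2)] assms(3-5) by (simp add: smallset_def)

lemma existence:
  assumes "smallset C" "smallset A" "smallset B"
  shows "\<exists>\<sigma>\<in>Aut A. ind (\<sigma> ` C) A B"
proof -
  have "ind C A A" using ind_self assms by (simp add: smallset_def)
  from ext[OF this, of "A \<union> B"] assms obtain \<sigma> where "\<sigma> \<in> Aut A" "ind (\<sigma> ` C) A (A \<union> B)" by auto
  then show ?thesis using ind_mono[of _ A "A \<union> B" _ B] by blast
qed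

lemma ind_empty: "smallset A \<Longrightarrow> smallset B \<Longrightarrow> ind {} A B"
  using existence[of "{}" A B] smallset_finite[of "{}"] by auto

text \<open>Copies of \<open>F\<close> over \<open>A \<union> B\<close> indexed by a finite well-ordered set, each of which is independent
  from \<open>B\<close> and the later ones. They are chosen from the last one downwards, which is why only finite
  index sets are possible here.\<close>

lemma finite_descending_sequence:
  assumes F: "ind F A B" "smallset F" "smallset A" "smallset B"
    and r: "wf r" "trans r"
  shows "finite I \<Longrightarrow> \<exists>\<sigma>. \<forall>i\<in>I. \<sigma> i \<in> Aut (A \<union> B) \<and>
    ind (\<Union>j\<in>{j\<in>I. (j, i) \<in> r}. \<sigma> j ` F) A (\<sigma> i ` F)"
proof (induction I rule: finite_psubset_induct)
  case (psubset I)
  show ?case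
  proof (cases "I = {}")
    case False
    then obtain m where m: "m \<in> I" "\<And>y. (y, m) \<in> r \<Longrightarrow> y \<notin> I"
      using wfE_min[OF r(1), of _ I] by blast
    have "I - {m} \<subset> I" using m(1) by blast
    from psubset.IH[OF this] obtain \<sigma> where \<sigma>: "\<And>i. i \<in> I - {m} \<Longrightarrow> \<sigma> i \<in> Aut (A \<union> B) \<and>
      ind (\<Union>j\<in>{j\<in>I - {m}. (j, i) \<in> r}. \<sigma> j ` F) A (\<sigma> i ` F)" by blast
    let ?U = "\<Union>i\<in>I - {m}. \<sigma> i ` F"
    have \<sigma>F: "smallset (\<sigma> i ` F)" if "i \<in> I - {m}" for i
      using smallset_Aut[OF F(2)] \<sigma>[OF that] by blast
    have U: "smallset ?U" using \<sigma>F psubset.hyps by (intro smallset_UN_finite) auto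
    from ext[OF F(1), of "B \<union> ?U"] obtain \<tau> where \<tau>: "\<tau> \<in> Aut (A \<union> B)" "ind (\<tau> ` F) A (B \<union> ?U)"
      using F(2-4) U by auto
    have \<tau>F: "smallset (\<tau> ` F)" by (rule smallset_Aut[OF F(2) \<tau>(1)])
    let ?\<sigma> = "\<sigma>(m := \<tau>)"
    have "?\<sigma> i \<in> Aut (A \<union> B) \<and> ind (\<Union>j\<in>{j\<in>I. (j, i) \<in> r}. ?\<sigma> j ` F) A (?\<sigma> i ` F)" if i: "i \<in> I" for i
    proof (cases "i = m")
      case True
      then have e: "{j\<in>I. (j, i) \<in> r} = {}" using m(2) by blast
      show ?thesis unfolding e using True \<tau>(1) ind_empty[OF F(3) \<tau>F] by simp
    next
      case False
      then have im: "i \<in> I - {m}" using i by blast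
      let ?Y = "\<Union>j\<in>{j\<in>I - {m}. (j, i) \<in> r}. \<sigma> j ` F"
      have Y: "?Y \<subseteq> ?U" by blast
      then have Ys: "smallset ?Y" using U smallset_subset by blast
      have "ind (\<tau> ` F) (A \<union> ?Y) (B \<union> ?U)" by (rule ind_base[OF \<tau>(2)]) (use Y in auto)
      then have "ind (\<tau> ` F) (A \<union> ?Y) (\<sigma> i ` F)" by (rule ind_mono) (use im in auto)
      from left_transitivity[OF this conjunct2[OF \<sigma>[OF im]] \<tau>F Ys F(3) \<sigma>F[OF im]]
      have "ind (\<tau> ` F \<union> ?Y) A (\<sigma> i ` F)" .
      moreover have "(\<Union>j\<in>{j\<in>I. (j, i) \<in> r}. ?\<sigma> j ` F) \<subseteq> \<tau> ` F \<union> ?Y"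
      proof (rule UN_least)
        fix j assume "j \<in> {j\<in>I. (j, i) \<in> r}"
        then show "?\<sigma> j ` F \<subseteq> \<tau> ` F \<union> ?Y" by (cases "j = m") (simp, force)
      qed
      ultimately show ?thesis using ind_mono[of _ A "\<sigma> i ` F"] \<sigma>[OF im] False by auto
    qed
    then show ?thesis by blast
  qed simp
qed

text \<open>By compactness there are such sequences indexed by \<open>|T|\<^sup>+\<close>, at the cost of keeping from
  independence only the type-definable condition that the copy of \<open>x\<close> is not algebraic over the copy
  of \<open>E\<close> and the earlier copies.\<close>

lemma long_sequence:
  fixes \<Lambda> :: "'i set"
  assumes F: "ind (insert x E) A B" "finite E" "insert x E \<subseteq> univ M" "smallset A" "smallset B"
    and x: "x \<notin> acl (A \<union> E)"
    and r: "wf r" "trans r" and \<Lambda>: "sm \<Lambda>"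
  shows "\<exists>\<sigma>. \<forall>i\<in>\<Lambda>. \<sigma> i \<in> Aut (A \<union> B) \<and>
    \<sigma> i x \<notin> acl (A \<union> \<sigma> i ` E \<union> (\<Union>j\<in>{j\<in>\<Lambda>. (j, i) \<in> r}. \<sigma> j ` insert x E))"
proof -
  let ?F = "insert x E"
  let ?s = "\<lambda>(i :: 'i, u). sort_of M u"
  define V' where "V' i = {i} \<times> E \<union> {j\<in>\<Lambda>. (j, i) \<in> r} \<times> ?F" for i :: 'i
  have AB: "A \<union> B \<subseteq> univ M" "sm (A \<union> B)" "A \<subseteq> univ M" "sm A" using F(4,5) by (auto simp: smallset_def)
  have Fs: "smallset ?F" using F(2,3) by (intro smallset_finite) auto
  have xE: "x \<notin> E" using x subset_acl[of "A \<union> E"] AB(3) F(3) by auto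
  have xV: "(i, x) \<notin> V' i" for i using xE r(1) by (auto simp: V'_def)
  let ?many = "\<lambda>n R i g. \<exists>Y\<subseteq>{y\<in>univ M. sort_of M y = ?s (i, x)}. finite Y \<and> card Y = n \<and>
    (\<forall>y\<in>Y. R (g((i, x) := y)))"
  let ?\<Gamma>1 = "{\<lambda>g. P (\<lambda>u. g (i, u)) |i P. i \<in> \<Lambda> \<and> definable (A \<union> B) ?F (sort_of M) P \<and> P id}"
  let ?\<Gamma>2 = "{\<lambda>g. R g \<longrightarrow> ?many n R i g |i n W R. i \<in> \<Lambda> \<and> finite W \<and> W \<subseteq> V' i \<and>
    definable A (insert (i, x) W) ?s R}"
  define good where "good I g \<longleftrightarrow> (\<forall>i\<in>I. (\<exists>\<sigma>\<in>Aut (A \<union> B). \<forall>u\<in>?F. g (i, u) = \<sigma> u) \<and>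
    g (i, x) \<notin> acl (A \<union> g ` (V' i \<inter> I \<times> UNIV)))" for I and g :: "'i \<times> 'a \<Rightarrow> 'a"
  have good_asg: "asg (I \<times> ?F) ?s g" if g: "good I g" for I g
    unfolding asg_def
  proof
    fix v assume "v \<in> I \<times> ?F"
    then obtain i u where v: "v = (i, u)" "i \<in> I" "u \<in> ?F" by blast
    then obtain \<sigma> where "\<sigma> \<in> Aut (A \<union> B)" "g v = \<sigma> u" using g unfolding good_def by blast
    then show "g v \<in> univ M \<and> sort_of M (g v) = ?s v"
      using v F(3) Aut_univ Aut_sort by (metis case_prod_conv subsetD)
  qed
  have part: "\<exists>I\<subseteq>\<Lambda>. finite I \<and> (\<forall>J g. I \<subseteq> J \<longrightarrow> J \<subseteq> \<Lambda> \<longrightarrow> good J g \<longrightarrow> P g)" if P: "P \<in> ?\<Gamma>1 \<union> ?\<Gamma>2" for P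
  proof (cases "P \<in> ?\<Gamma>1")
    case True
    then obtain i Q where Q: "i \<in> \<Lambda>" "definable (A \<union> B) ?F (sort_of M) Q" "Q id"
      "P = (\<lambda>g. Q (\<lambda>u. g (i, u)))" by blast
    have "P g" if g: "i \<in> J" "good J g" for J g
    proof -
      obtain \<sigma> where \<sigma>: "\<sigma> \<in> Aut (A \<union> B)" "\<forall>u\<in>?F. g (i, u) = \<sigma> u" using g unfolding good_def by blast
      have "Q (\<lambda>u. \<sigma> (id u))" using definable_Aut[OF Q(2) \<sigma>(1) asg_id[OF F(3)] AB(1)] Q(3) by (simp only: simp_thms)
      moreover have "Q (\<lambda>u. \<sigma> (id u)) = Q (\<lambda>u. g (i, u))"
        by (rule definable_agree[OF Q(2) asg_Aut[OF \<sigma>(1) asg_id[OF F(3)]]]) (use \<sigma>(2) in simp)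
      ultimately show "P g" unfolding Q(4) by (simp only:)
    qed
    then show ?thesis using Q(1) by (intro exI[of _ "{i}"]) auto
  next
    case False
    then obtain i n W R where R: "i \<in> \<Lambda>" "finite W" "W \<subseteq> V' i" "definable A (insert (i, x) W) ?s R"
      "P = (\<lambda>g. R g \<longrightarrow> ?many n R i g)" using P by blast
    let ?I = "insert i (fst ` W)"
    have IL: "?I \<subseteq> \<Lambda>" using R(1,3) by (auto simp: V'_def)
    have "R g \<longrightarrow> ?many n R i g" if g: "?I \<subseteq> J" "J \<subseteq> \<Lambda>" "good J g" for J g
    proof
      assume Rg: "R g"
      have iJ: "i \<in> J" using g(1) by blast
      have "W \<subseteq> V' i \<inter> J \<times> UNIV" using R(3) g(1) by force
      have Ws: "insert (i, x) W \<subseteq> J \<times> ?F" using \<open>W \<subseteq> V' i \<inter> J \<times> UNIV\<close> iJ by (auto simp: V'_def)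
      have ag: "asg (insert (i, x) W) ?s g" by (rule asg_mono[OF good_asg[OF g(3)] Ws])
      let ?D = "A \<union> g ` W"
      have Du: "?D \<subseteq> univ M" using AB(3) ag by (auto simp: asg_def)
      have gx: "g (i, x) \<in> univ M" "sort_of M (g (i, x)) = sort_of M x" using ag by (auto simp: asg_def)
      have nacl: "g (i, x) \<notin> acl ?D"
      proof
        assume "g (i, x) \<in> acl ?D"
        moreover have "?D \<subseteq> A \<union> g ` (V' i \<inter> J \<times> UNIV)" using \<open>W \<subseteq> V' i \<inter> J \<times> UNIV\<close> by blast
        ultimately show False using acl_mono g(3) iJ unfolding good_def by blast
      qed
      let ?h = "\<lambda>v. if v = (i, x) then Inl () else Inr (g v)"
      let ?Q = "\<lambda>f. R (\<lambda>v. case_sum f id (?h v))"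
      have Q: "definable ?D {()} (\<lambda>_. sort_of M (g (i, x))) ?Q"
        by (rule definable_subst[OF R(4) _ Du]) (use ag gx in \<open>auto simp: asg_def\<close>)
      have upd: "(\<lambda>v. case_sum (\<lambda>_. y) id (?h v)) = g((i, x) := y)" for y by auto
      have "?Q (\<lambda>_. g (i, x))" unfolding upd using Rg by simp
      then have "infinite {y\<in>univ M. sort_of M y = sort_of M (g (i, x)) \<and> ?Q (\<lambda>_. y)}"
        using acl_intro[OF Q _ gx(1) Du] nacl by blast
      then obtain Y where Y: "finite Y" "card Y = n" "Y \<subseteq> {y\<in>univ M. sort_of M y = sort_of M (g (i, x)) \<and> ?Q (\<lambda>_. y)}"
        using infinite_arbitrarily_large by blast
      show "?many n R i g"
      proof (intro exI[of _ Y] conjI ballI Y(1,2))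
        show "Y \<subseteq> {y\<in>univ M. sort_of M y = ?s (i, x)}" using Y(3) gx(2) by auto
        show "R (g((i, x) := y))" if "y \<in> Y" for y
          using subsetD[OF Y(3) that] unfolding upd by simp
      qed
    qed
    then show ?thesis unfolding R(5) using IL R(2) by (intro exI[of _ ?I]) simp
  qed
  have "\<exists>g. asg (\<Lambda> \<times> ?F) ?s g \<and> (\<forall>P\<in>?\<Gamma>1 \<union> ?\<Gamma>2. P g)"
  proof (rule saturation[OF AB(1,2)])
    have "\<Lambda> \<times> ?F = (\<Union>u\<in>?F. (\<lambda>i. (i, u)) ` \<Lambda>)" by auto
    then show "sm (\<Lambda> \<times> ?F)" using F(2) sm_image[OF \<Lambda>] by (simp only:) (intro sm_UN_finite, auto)
  next
    fix P assume P: "P \<in> ?\<Gamma>1 \<union> ?\<Gamma>2"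
    show "definable (A \<union> B) (\<Lambda> \<times> ?F) ?s P"
    proof (cases "P \<in> ?\<Gamma>1")
      case True
      then obtain i Q where Q: "i \<in> \<Lambda>" "definable (A \<union> B) ?F (sort_of M) Q"
        "P = (\<lambda>g. Q (\<lambda>u. g (i, u)))" by blast
      show ?thesis unfolding Q(3) by (rule definable_rename[OF Q(2) AB(1)]) (use Q(1) in auto)
    next
      case False
      then obtain i n W R where R: "i \<in> \<Lambda>" "W \<subseteq> V' i" "definable A (insert (i, x) W) ?s R"
        "P = (\<lambda>g. R g \<longrightarrow> ?many n R i g)" using P by blast
      have "insert (i, x) W \<subseteq> \<Lambda> \<times> ?F" using R(1,2) by (auto simp: V'_def)
      then have "definable (A \<union> B) (\<Lambda> \<times> ?F) ?s R" by (intro definable_mono[OF R(3)]) auto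
      then show ?thesis unfolding R(4)
        using R(1) by (intro definable_Imp definable_at_least AB(1)) auto
    qed
  next
    fix \<Gamma>0 assume \<Gamma>0: "finite \<Gamma>0" "\<Gamma>0 \<subseteq> ?\<Gamma>1 \<union> ?\<Gamma>2"
    have "\<forall>P\<in>\<Gamma>0. \<exists>I\<subseteq>\<Lambda>. finite I \<and> (\<forall>J g. I \<subseteq> J \<longrightarrow> J \<subseteq> \<Lambda> \<longrightarrow> good J g \<longrightarrow> P g)"
      using part \<Gamma>0(2) by (intro ballI) (simp only: subsetD)
    from bchoice[OF this] obtain I where I: "\<forall>P\<in>\<Gamma>0. I P \<subseteq> \<Lambda> \<and> finite (I P) \<and>
      (\<forall>J g. I P \<subseteq> J \<longrightarrow> J \<subseteq> \<Lambda> \<longrightarrow> good J g \<longrightarrow> P g)" ..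
    define J where "J = (\<Union>P\<in>\<Gamma>0. I P)"
    have J: "finite J" "J \<subseteq> \<Lambda>" using I \<Gamma>0(1) by (auto simp: J_def)
    from finite_descending_sequence[OF F(1) Fs F(4,5) r J(1)] obtain \<sigma> where
      \<sigma>: "\<And>i. i \<in> J \<Longrightarrow> \<sigma> i \<in> Aut (A \<union> B)"
        "\<And>i. i \<in> J \<Longrightarrow> ind (\<Union>j\<in>{j\<in>J. (j, i) \<in> r}. \<sigma> j ` ?F) A (\<sigma> i ` ?F)" by blast
    let ?g = "\<lambda>(i, u). if i \<in> J then \<sigma> i u else u"
    have "good J ?g" unfolding good_def
    proof (intro ballI conjI)
      fix i assume i: "i \<in> J"
      show "\<exists>\<sigma>\<in>Aut (A \<union> B). \<forall>u\<in>?F. ?g (i, u) = \<sigma> u"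
        using \<sigma>(1)[OF i] i by (intro bexI[of _ "\<sigma> i"]) simp_all
      show "?g (i, x) \<notin> acl (A \<union> ?g ` (V' i \<inter> J \<times> UNIV))"
      proof
        let ?Y = "\<Union>j\<in>{j\<in>J. (j, i) \<in> r}. \<sigma> j ` ?F"
        assume ac: "?g (i, x) \<in> acl (A \<union> ?g ` (V' i \<inter> J \<times> UNIV))"
        have "?g v \<in> \<sigma> i ` E \<union> ?Y" if v: "v \<in> V' i \<inter> J \<times> UNIV" for v
        proof -
          obtain j u where ju: "v = (j, u)" "j \<in> J" using v by blast
          then have gv: "?g v = \<sigma> j u" by (simp only: prod.case if_True)
          have "j = i \<and> u \<in> E \<or> (j, i) \<in> r \<and> u \<in> ?F" using v ju(1) by (auto simp: V'_def)
          then show ?thesis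
          proof
            assume "(j, i) \<in> r \<and> u \<in> ?F"
            then have "j \<in> {j\<in>J. (j, i) \<in> r}" "\<sigma> j u \<in> \<sigma> j ` ?F" using ju(2) by blast+
            then have "\<sigma> j u \<in> ?Y" by (rule UN_I)
            then show ?thesis unfolding gv by (rule UnI2)
          next
            assume "j = i \<and> u \<in> E"
            then have "\<sigma> j u \<in> \<sigma> i ` E" by blast
            then show ?thesis unfolding gv by (rule UnI1)
          qed
        qed
        then have "?g ` (V' i \<inter> J \<times> UNIV) \<subseteq> \<sigma> i ` E \<union> ?Y" by (rule image_subsetI)
        then have "A \<union> ?g ` (V' i \<inter> J \<times> UNIV) \<subseteq> A \<union> (\<sigma> i ` E \<union> ?Y)" by (rule Un_mono[OF order_refl])
        from subsetD[OF acl_mono[OF this] ac]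
        have "?g (i, x) \<in> acl ((A \<union> \<sigma> i ` E) \<union> ?Y)" unfolding Un_assoc .
        moreover have "?g (i, x) = \<sigma> i x" using i by (simp only: prod.case if_True)
        ultimately have "\<sigma> i x \<in> acl ((A \<union> \<sigma> i ` E) \<union> ?Y)" by (simp only:)
        note ac2 = this
        have Ys: "smallset ?Y"
          by (rule smallset_UN_finite) (use J(1) smallset_Aut[OF Fs] \<sigma>(1) in auto)
        have AF: "smallset (A \<union> \<sigma> i ` ?F)"
          unfolding smallset_Un using F(4) smallset_Aut[OF Fs \<sigma>(1)[OF i]] by (rule conjI)
        have "\<sigma> i x \<in> acl (A \<union> \<sigma> i ` E)"
          by (rule ind_acl[OF \<sigma>(2)[OF i] _ _ AF Ys _ ac2]) blast+
        moreover obtain \<tau> where \<tau>: "\<tau> \<in> Aut (A \<union> B)" "\<And>y. y \<in> univ M \<Longrightarrow> \<tau> (\<sigma> i y) = y"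
          using Aut_inv[OF \<sigma>(1)[OF i] AB(1)] by blast
        ultimately have "\<tau> (\<sigma> i x) \<in> acl (\<tau> ` (A \<union> \<sigma> i ` E))"
          using AB(3) Aut_univ[OF \<sigma>(1)[OF i]] F(3) by (intro acl_Aut[OF Aut_mono[OF \<tau>(1)]]) auto
        moreover have "\<tau> ` (A \<union> \<sigma> i ` E) = A \<union> E"
        proof -
          have "\<tau> ` \<sigma> i ` E = (\<lambda>e. e) ` E"
            unfolding image_image by (intro image_cong refl \<tau>(2)) (use F(3) in blast)
          then have "\<tau> ` \<sigma> i ` E = E" by simp
          then show ?thesis using Aut_fix_image[OF \<tau>(1), of A] by (simp add: image_Un)
        qed
        ultimately show False using x \<tau>(2) F(3) by simp
      qed
    qed
    define g where "g v = (if v \<in> J \<times> ?F then ?g v else (SOME y. y \<in> univ M \<and> sort_of M y = ?s v))" for v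
    have gs: "(SOME y. y \<in> univ M \<and> sort_of M y = ?s v) \<in> univ M \<and>
      sort_of M (SOME y. y \<in> univ M \<and> sort_of M y = ?s v) = ?s v" for v
      by (rule someI_ex) (use ex_sort in blast)
    have eq: "?g v = g v" if "v \<in> J \<times> ?F" for v using that by (simp add: g_def)
    have im: "g ` (V' i \<inter> J \<times> UNIV) = ?g ` (V' i \<inter> J \<times> UNIV)" for i
    proof (rule image_cong[OF refl])
      fix v assume "v \<in> V' i \<inter> J \<times> UNIV"
      then have v: "v \<in> J \<times> ?F" by (auto simp: V'_def)
      show "g v = ?g v" by (rule eq[OF v, symmetric])
    qed
    have "good J g" unfolding good_def im
    proof (intro ballI conjI)
      fix i assume i: "i \<in> J"
      have e: "g (i, u) = ?g (i, u)" if "u \<in> ?F" for u using eq[of "(i, u)"] i that by simp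
      show "\<exists>\<sigma>\<in>Aut (A \<union> B). \<forall>u\<in>?F. g (i, u) = \<sigma> u"
        using \<sigma>(1)[OF i] i e by (intro bexI[of _ "\<sigma> i"]) auto
      show "g (i, x) \<notin> acl (A \<union> ?g ` (V' i \<inter> J \<times> UNIV))"
      proof -
        have "?g (i, x) \<notin> acl (A \<union> ?g ` (V' i \<inter> J \<times> UNIV))"
          using \<open>good J ?g\<close> i unfolding good_def by blast
        moreover have "g (i, x) = ?g (i, x)" by (rule e) simp
        ultimately show ?thesis by (simp only: not_False_eq_True simp_thms)
      qed
    qed
    moreover have "asg (\<Lambda> \<times> ?F) ?s g"
    proof -
      have "g v \<in> univ M \<and> sort_of M (g v) = ?s v" for v
      proof (cases "v \<in> J \<times> ?F")
        case True
        then show ?thesis by (rule bspec[OF good_asg[OF \<open>good J g\<close>, unfolded asg_def]])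
      qed (use gs[of v] in \<open>simp add: g_def\<close>)
      then show ?thesis by (simp add: asg_def)
    qed
    moreover have "P g" if "P \<in> \<Gamma>0" for P
    proof -
      have "I P \<subseteq> J" using that by (auto simp: J_def)
      then show ?thesis using bspec[OF I that] J(2) \<open>good J g\<close> by (simp only: simp_thms)
    qed
    ultimately show "\<exists>g. asg (\<Lambda> \<times> ?F) ?s g \<and> (\<forall>P\<in>\<Gamma>0. P g)" by (intro exI[of _ g] conjI ballI)
  qed
  then obtain g where g: "asg (\<Lambda> \<times> ?F) ?s g" and \<Gamma>: "\<forall>P\<in>?\<Gamma>1 \<union> ?\<Gamma>2. P g" by (elim exE conjE)
  have \<Gamma>1: "P (\<lambda>u. g (i, u))" if "i \<in> \<Lambda>" "definable (A \<union> B) ?F (sort_of M) P" "P id" for i P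
  proof -
    have "(\<lambda>g. P (\<lambda>u. g (i, u))) \<in> ?\<Gamma>1 \<union> ?\<Gamma>2" using that by (intro UnI1 CollectI exI conjI) (rule refl)
    from bspec[OF \<Gamma> this] show ?thesis .
  qed
  have \<Gamma>2: "?many n R i g" if "i \<in> \<Lambda>" "finite W" "W \<subseteq> V' i" "definable A (insert (i, x) W) ?s R" "R g" for i n W R
  proof -
    have "(\<lambda>g. R g \<longrightarrow> ?many n R i g) \<in> ?\<Gamma>1 \<union> ?\<Gamma>2" using that by (intro UnI2 CollectI exI conjI) (rule refl)
    from bspec[OF \<Gamma> this] that(5) show ?thesis by (rule mp)
  qed
  have "\<exists>\<sigma>\<in>Aut (A \<union> B). \<forall>u\<in>?F. \<sigma> (id u) = g (i, u)" if i: "i \<in> \<Lambda>" for i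
  proof (rule homogeneity[OF AB(1,2) _ asg_id[OF F(3)]])
    show "sm ?F" using F(2) by simp
    show "asg ?F (sort_of M) (\<lambda>u. g (i, u))" using g i by (auto simp: asg_def)
    show "P (\<lambda>u. g (i, u))" if "definable (A \<union> B) ?F (sort_of M) P" "P id" for P using \<Gamma>1[OF i that] .
  qed
  then have "\<forall>i\<in>\<Lambda>. \<exists>\<sigma>. \<sigma> \<in> Aut (A \<union> B) \<and> (\<forall>u\<in>?F. \<sigma> u = g (i, u))" by auto
  from bchoice[OF this] obtain \<sigma> where \<sigma>: "\<And>i. i \<in> \<Lambda> \<Longrightarrow> \<sigma> i \<in> Aut (A \<union> B)"
    "\<And>i u. i \<in> \<Lambda> \<Longrightarrow> u \<in> ?F \<Longrightarrow> \<sigma> i u = g (i, u)" by blast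
  have "\<sigma> i x \<notin> acl (A \<union> \<sigma> i ` E \<union> (\<Union>j\<in>{j\<in>\<Lambda>. (j, i) \<in> r}. \<sigma> j ` ?F))" if i: "i \<in> \<Lambda>" for i
  proof
    assume ac: "\<sigma> i x \<in> acl (A \<union> \<sigma> i ` E \<union> (\<Union>j\<in>{j\<in>\<Lambda>. (j, i) \<in> r}. \<sigma> j ` ?F))"
    have "\<sigma> i ` E \<subseteq> g ` V' i" using \<sigma>(2)[OF i] by (force simp: V'_def)
    moreover have "(\<Union>j\<in>{j\<in>\<Lambda>. (j, i) \<in> r}. \<sigma> j ` ?F) \<subseteq> g ` V' i"
      using \<sigma>(2) by (force simp: V'_def)
    ultimately have "\<sigma> i x \<in> acl (A \<union> g ` V' i)"
      using ac acl_mono[of "A \<union> \<sigma> i ` E \<union> (\<Union>j\<in>{j\<in>\<Lambda>. (j, i) \<in> r}. \<sigma> j ` ?F)" "A \<union> g ` V' i"] by blast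
    then have gac: "g (i, x) \<in> acl (A \<union> g ` V' i)" using \<sigma>(2)[OF i] by simp
    have V'F: "V' i \<subseteq> \<Lambda> \<times> ?F" using i by (auto simp: V'_def)
    have gV: "g ` V' i \<subseteq> univ M" using g V'F by (auto simp: asg_def)
    obtain D0 where D0: "D0 \<subseteq> A \<union> g ` V' i" "finite D0" "g (i, x) \<in> acl D0"
    proof -
      have "sm (\<Lambda> \<times> ?F)"
      proof -
        have "\<Lambda> \<times> ?F = (\<Union>u\<in>?F. (\<lambda>i. (i, u)) ` \<Lambda>)" by auto
        then show ?thesis using F(2) sm_image[OF \<Lambda>] by (simp only:) (intro sm_UN_finite, auto)
      qed
      then have "sm (A \<union> g ` V' i)" using AB(4) sm_image[OF sm_subset[OF V'F]] by simp
      then show thesis using acl_finite_support[OF gac] AB(3) gV that by blast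
    qed
    let ?C = "D0 \<inter> g ` V' i"
    have "g (i, x) \<in> acl (A \<union> ?C)" using D0(1,3) acl_mono[of D0 "A \<union> ?C"] by blast
    from acl_definable[OF this] obtain P where
      P: "definable (A \<union> ?C) {()} (\<lambda>_. sort_of M (g (i, x))) P" "P (\<lambda>_. g (i, x))"
        "finite {y\<in>univ M. sort_of M y = sort_of M (g (i, x)) \<and> P (\<lambda>_. y)}"
      using AB(3,4) gV D0(2) by auto
    let ?S = "case_sum (\<lambda>_. sort_of M (g (i, x))) (sort_of M)"
    from definable_abstract_params[OF P(1)] obtain P' where P': "definable A (Inl ` {()} \<union> Inr ` ?C) ?S P'"
      "\<And>f. asg {()} (\<lambda>_. sort_of M (g (i, x))) f \<Longrightarrow> P f = P' (case_sum f id)" by blast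
    have gx: "g (i, x) \<in> univ M" "sort_of M (g (i, x)) = sort_of M x" using g i by (auto simp: asg_def)
    have P'y: "P' (case_sum (\<lambda>_. y) id) = P (\<lambda>_. y)" if "y \<in> univ M" "sort_of M y = sort_of M x" for y
      using P'(2)[of "\<lambda>_. y"] that gx(2) by (simp add: asg_def)
    have "\<forall>c\<in>?C. \<exists>v. v \<in> V' i \<and> g v = c" by blast
    from bchoice[OF this] obtain nm where nm: "\<And>c. c \<in> ?C \<Longrightarrow> nm c \<in> V' i \<and> g (nm c) = c" by blast
    let ?W = "nm ` ?C"
    let ?h = "case_sum (\<lambda>_. (i, x)) nm"
    let ?R = "\<lambda>f. P' (\<lambda>t. f (?h t))"
    have sv: "sort_of M (g v) = ?s v" if "v \<in> V' i" for v using g V'F that by (auto simp: asg_def)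
    have R: "definable A (insert (i, x) ?W) ?s ?R"
    proof (rule definable_rename[OF P'(1) AB(3)])
      fix t assume t: "t \<in> Inl ` {()} \<union> Inr ` ?C"
      show "?h t \<in> insert (i, x) ?W \<and> ?s (?h t) = ?S t"
      proof (cases t)
        case (Inr c)
        then have c: "c \<in> ?C" using t by auto
        then have "?s (nm c) = sort_of M c" using nm[OF c] sv[of "nm c"] by simp
        then show ?thesis using Inr c by simp
      qed (use gx in simp)
    qed
    have ev: "?R (g((i, x) := y)) = P (\<lambda>_. y)" if y: "y \<in> univ M" "sort_of M y = sort_of M x" for y
    proof -
      have "asg (Inl ` {()} \<union> Inr ` ?C) ?S (case_sum (\<lambda>_. y) id)"
        using y gx gV by (auto simp: asg_def)
      moreover have "\<forall>t\<in>Inl ` {()} \<union> Inr ` ?C. case_sum (\<lambda>_. y) id t = (g((i, x) := y)) (?h t)"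
      proof
        fix t assume t: "t \<in> Inl ` {()} \<union> Inr ` ?C"
        show "case_sum (\<lambda>_. y) id t = (g((i, x) := y)) (?h t)"
        proof (cases t)
          case (Inr c)
          then have c: "c \<in> ?C" using t by auto
          then have "nm c \<noteq> (i, x)" using nm[OF c] xV by metis
          then show ?thesis using Inr nm[OF c] by simp
        qed simp
      qed
      ultimately have "P' (case_sum (\<lambda>_. y) id) = ?R (g((i, x) := y))" by (rule definable_agree[OF P'(1)])
      then show ?thesis using P'y[OF y] by simp
    qed
    have "?R g" using ev[OF gx] P(2) by (simp only: fun_upd_triv simp_thms)
    let ?Z = "{y\<in>univ M. sort_of M y = sort_of M (g (i, x)) \<and> P (\<lambda>_. y)}"
    have "finite ?W" using D0(2) by simp
    moreover have "?W \<subseteq> V' i" using nm by blast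
    ultimately have "?many (Suc (card ?Z)) ?R i g" using \<Gamma>2[OF i _ _ R \<open>?R g\<close>] by (simp only:)
    then obtain Y where Y: "Y \<subseteq> {y\<in>univ M. sort_of M y = ?s (i, x)}" "card Y = Suc (card ?Z)"
      "\<forall>y\<in>Y. ?R (g((i, x) := y))" by (elim exE conjE)
    have "Y \<subseteq> ?Z"
    proof
      fix y assume y: "y \<in> Y"
      then have yu: "y \<in> univ M" "sort_of M y = sort_of M x" using Y(1) by auto
      have "P (\<lambda>_. y)" using bspec[OF Y(3) y] unfolding ev[OF yu] .
      then show "y \<in> ?Z" using yu gx(2) by simp
    qed
    then have "card Y \<le> card ?Z" by (rule card_mono[OF P(3)])
    then show False using Y(2) by simp
  qed
  then show ?thesis using \<sigma>(1) by blast
qed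

end

context rosy_monster
begin

text \<open>Along a sequence as in the previous lemma of length \<open>|T|\<^sup>+\<close>, local character of \<open>B\<close> gives an
  initial segment over which \<open>B\<close> is independent from the rest; this makes the next copy of \<open>x\<close>
  non-algebraic over too much.\<close>

lemma acl_symmetry:
  assumes F: "ind (insert x E) A B" "finite E" "insert x E \<subseteq> univ M" "smallset A"
    and B: "finite B" "B \<subseteq> univ M"
    and x: "x \<in> acl (A \<union> E \<union> B)"
  shows "x \<in> acl (A \<union> E)"
proof (rule ccontr)
  assume nx: "x \<notin> acl (A \<union> E)"
  let ?F = "insert x E"
  let ?r = "cardSuc |T|"
  let ?\<Lambda> = "Field ?r"
  have T: "Card_order |T|" "infinite (Field |T| )"
    by (rule card_of_Card_order) (use T_infinite in \<open>simp add: Field_card_of\<close>)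
  have \<Lambda>inf: "infinite ?\<Lambda>" using T(2) cardSuc_finite[OF T(1)] by blast
  have Co: "Card_order ?r" by (rule cardSuc_Card_order[OF T(1)])
  have wo: "Well_order ?r" by (rule card_order_on_well_order_on[OF Co])
  have tr: "trans ?r" and an: "antisym ?r" and wf: "wf (?r - Id)"
    using wo by (auto simp: well_order_on_def linear_order_on_def partial_order_on_def preorder_on_def)
  have tr': "trans (?r - Id)" by (rule trans_diff_Id[OF tr an])
  have Bs: "smallset B" using B by (rule smallset_finite)
  have "|?\<Lambda>| =o ?r" by (rule card_of_Field_ordIso[OF Co])
  moreover have "?r <o \<kappa>" using monster by (simp add: monster_model_def)
  ultimately have "|?\<Lambda>| <o \<kappa>" by (rule ordIso_ordLess_trans)
  then have \<Lambda>: "sm ?\<Lambda>" by (simp add: small_def)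
  from long_sequence[OF F Bs nx wf tr' \<Lambda>] obtain \<sigma> where
    \<sigma>: "\<And>i. i \<in> ?\<Lambda> \<Longrightarrow> \<sigma> i \<in> Aut (A \<union> B)"
      "\<And>i. i \<in> ?\<Lambda> \<Longrightarrow> \<sigma> i x \<notin> acl (A \<union> \<sigma> i ` E \<union> (\<Union>j\<in>{j\<in>?\<Lambda>. (j, i) \<in> ?r - Id}. \<sigma> j ` ?F))" by blast
  have \<sigma>F: "\<sigma> i ` ?F \<subseteq> univ M" if "i \<in> ?\<Lambda>" for i
    by (rule Aut_univ_image[OF \<sigma>(1)[OF that] F(3)])
  let ?C = "A \<union> (\<Union>i\<in>?\<Lambda>. \<sigma> i ` ?F)"
  have "(\<Union>i\<in>?\<Lambda>. \<sigma> i ` ?F) = (\<Union>u\<in>?F. (\<lambda>i. \<sigma> i u) ` ?\<Lambda>)" by auto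
  moreover have "sm (\<Union>u\<in>?F. (\<lambda>i. \<sigma> i u) ` ?\<Lambda>)" by (rule sm_UN_finite) (use F(2) sm_image[OF \<Lambda>] in auto)
  ultimately have C: "smallset ?C" using F(4) \<sigma>F by (auto simp: smallset_def)
  obtain b where b: "set b = B" using finite_list[OF B(1)] by blast
  from local_character[of b ?C] obtain B0 where B0: "B0 \<subseteq> ?C" "|B0| \<le>o |T|" "thorn_indep L \<kappa> M b B0 ?C"
    using b B(2) C by blast
  let ?As = "\<lambda>i. A \<union> (\<Union>j\<in>{j. (j, i) \<in> ?r}. \<sigma> j ` ?F)"
  have "\<exists>i\<in>?\<Lambda>. B0 \<subseteq> ?As i"
  proof (rule cardSuc_UNION[OF T _ _ B0(2)])
    show "relChain ?r ?As" unfolding relChain_def using tr by (auto dest: transD)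
    show "B0 \<subseteq> (\<Union>i\<in>?\<Lambda>. ?As i)"
    proof
      fix y assume "y \<in> B0"
      then have y: "y \<in> ?C" using B0(1) by blast
      obtain i0 where i0: "i0 \<in> ?\<Lambda>"
        using \<Lambda>inf infinite_imp_nonempty by blast
      have refl: "(i, i) \<in> ?r" if "i \<in> ?\<Lambda>" for i
        using wo that by (auto simp: well_order_on_def linear_order_on_def partial_order_on_def
            preorder_on_def refl_on_def)
      show "y \<in> (\<Union>i\<in>?\<Lambda>. ?As i)"
      proof (cases "y \<in> A")
        case True
        then show ?thesis using i0 by blast
      next
        case False
        then obtain i where "i \<in> ?\<Lambda>" "y \<in> \<sigma> i ` ?F" using y by blast
        then show ?thesis using refl by blast
      qed
    qed
  qed
  then obtain i where i: "i \<in> ?\<Lambda>" "B0 \<subseteq> ?As i" ..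
  obtain k where k: "k \<in> ?\<Lambda>" "i \<noteq> k" "(i, k) \<in> ?r"
    using infinite_Card_order_limit[OF Co \<Lambda>inf i(1)] by blast
  let ?D = "A \<union> \<sigma> k ` E \<union> (\<Union>j\<in>{j\<in>?\<Lambda>. (j, k) \<in> ?r - Id}. \<sigma> j ` ?F)"
  have "?As i \<subseteq> ?D"
  proof -
    have "j \<in> {j\<in>?\<Lambda>. (j, k) \<in> ?r - Id}" if j: "(j, i) \<in> ?r" for j
    proof -
      have "(j, k) \<in> ?r" using tr j k(3) by (rule transD)
      moreover have "j \<noteq> k" using j k(2,3) an by (auto dest: antisymD)
      moreover have "j \<in> ?\<Lambda>" using j by (auto simp: Field_def)
      ultimately show ?thesis by simp
    qed
    then show ?thesis by (intro Un_least UN_least) blast+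
  qed
  then have BD: "B0 \<subseteq> ?D" by (rule subset_trans[OF i(2)])
  have DC: "?D \<subseteq> ?C" using k(1) by (intro Un_least UN_least) blast+
  have "ind B B0 ?C" using thorn_indep_imp_ind[OF B0(3)] b by simp
  then have BDC: "ind B ?D ?C" by (rule ind_base[OF _ BD]) (rule le_supI2[OF DC])
  have "A \<union> E \<union> B \<subseteq> univ M" using F(3,4) B(2) by (auto simp: smallset_def)
  from acl_Aut[OF Aut_mono[OF \<sigma>(1)[OF k(1)]] x this]
  have "\<sigma> k x \<in> acl (\<sigma> k ` (A \<union> E \<union> B))" by simp
  moreover have "\<sigma> k ` (A \<union> E \<union> B) \<subseteq> ?D \<union> B"
    using Aut_fix_image[OF \<sigma>(1)[OF k(1)], of A] Aut_fix_image[OF \<sigma>(1)[OF k(1)], of B]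
    by (simp only: image_Un) (intro Un_least; blast)
  ultimately have xD: "\<sigma> k x \<in> acl (?D \<union> B)" by (rule subsetD[OF acl_mono, rotated])
  have "\<sigma> k x \<in> \<sigma> k ` ?F" by simp
  then have "\<sigma> k x \<in> ?C" using k(1) by (intro UnI2 UN_I)
  then have xC: "\<sigma> k x \<in> ?D \<union> ?C" by (rule UnI2)
  have DCs: "smallset (?D \<union> ?C)" unfolding smallset_Un[of ?D] using smallset_subset[OF C DC] C by (rule conjI)
  have "\<sigma> k x \<in> acl ?D"
    by (rule ind_acl[OF BDC order_refl Un_upper1 DCs Bs xC xD])
  with \<sigma>(2)[OF k(1)] show False by (rule notE)
qed

theorem symmetry:
  assumes XY: "ind X A Y" and s: "smallset X" "smallset A" "smallset Y"
  shows "ind Y A X"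
proof (rule ind_finite_character)
  fix b X0 assume b: "finite b" "b \<subseteq> Y" and X0: "finite X0" "X0 \<subseteq> X"
  have bu: "b \<subseteq> univ M" and X0u: "X0 \<subseteq> univ M" using b(2) X0(2) s by (auto simp: smallset_def)
  have bs: "smallset b" and X0s: "smallset X0" using b(1) X0(1) bu X0u by (simp_all add: smallset_finite)
  have Xb: "ind X0 A b" by (rule ind_mono[OF XY X0(2)]) (use b in blast)
  show "ind b A X0"
  proof (rule ind_intro[OF bu])
    show "smallset (A \<union> X0)" using X0s s by simp
    fix B' assume B': "A \<union> X0 \<subseteq> B'" "smallset B'"
    from existence[OF B'(2), of "A \<union> X0" b] X0s s bs
    obtain \<sigma> where \<sigma>: "\<sigma> \<in> Aut (A \<union> X0)" "ind (\<sigma> ` B') (A \<union> X0) b" by auto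
    have AX: "A \<union> X0 \<subseteq> univ M" using X0s s by (simp add: smallset_def)
    obtain \<tau> where \<tau>: "\<tau> \<in> Aut (A \<union> X0)" "\<And>y. y \<in> univ M \<Longrightarrow> \<tau> (\<sigma> y) = y"
      using Aut_inv[OF \<sigma>(1) AX] by blast
    have \<tau>e: "\<tau> \<in> Aut {}" using Aut_mono[OF \<tau>(1)] by simp
    have \<tau>B': "\<tau> ` \<sigma> ` B' = B'" using \<tau>(2) B'(2) by (force simp: image_image smallset_def subset_iff)
    have \<tau>X: "\<tau> ` X0 = X0" "\<tau> ` A = A" "\<tau> ` (A \<union> X0) = A \<union> X0"
      using Aut_fix_image[OF \<tau>(1)] by blast+
    let ?b = "\<tau> ` b"
    have b's: "smallset ?b" by (rule smallset_Aut[OF bs \<tau>e])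
    have "ind (\<tau> ` \<sigma> ` B') (\<tau> ` (A \<union> X0)) ?b"
      by (rule ind_Aut[OF \<sigma>(2) \<tau>e smallset_Aut[OF B'(2) \<sigma>(1)]]) (use X0s s bs in simp_all)
    then have 1: "ind B' (A \<union> X0) ?b" unfolding \<tau>B' \<tau>X(3) .
    have "ind (\<tau> ` X0) (\<tau> ` A) ?b" by (rule ind_Aut[OF Xb \<tau>e X0s s(2) bs])
    then have 2: "ind X0 A ?b" unfolding \<tau>X .
    have 3: "ind (B' \<union> X0) A ?b" by (rule left_transitivity[OF 1 2 B'(2) X0s s(2) b's])
    show "\<exists>\<tau>\<in>Aut (A \<union> X0). \<forall>D x. A \<subseteq> D \<longrightarrow> D \<subseteq> B' \<longrightarrow> x \<in> B' \<longrightarrow> x \<in> acl (D \<union> \<tau> ` b) \<longrightarrow> x \<in> acl D"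
    proof (intro bexI[OF _ \<tau>(1)] allI impI)
      fix D x assume D: "A \<subseteq> D" "D \<subseteq> B'" "x \<in> B'" "x \<in> acl (D \<union> ?b)"
      have Ds: "smallset D" by (rule smallset_subset[OF B'(2) D(2)])
      then obtain D0 where D0: "D0 \<subseteq> D \<union> ?b" "finite D0" "x \<in> acl D0"
        using acl_finite_support[OF D(4)] b's by (auto simp: smallset_def)
      let ?E = "D0 \<inter> D"
      have EB: "insert x ?E \<subseteq> B'" using D(2,3) by blast
      then have Eu: "insert x ?E \<subseteq> univ M" using B'(2) by (auto simp: smallset_def)
      have "D0 \<subseteq> A \<union> ?E \<union> ?b" using D0(1) by blast
      then have "x \<in> acl (A \<union> ?E \<union> ?b)" using D0(3) acl_mono by blast
      moreover have "ind (insert x ?E) A ?b" by (rule ind_mono[OF 3]) (use EB in auto)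
      ultimately have "x \<in> acl (A \<union> ?E)"
        using D0(2) Eu s(2) b(1) b's by (intro acl_symmetry[of x ?E A ?b]) (auto simp: smallset_def)
      moreover have "A \<union> ?E \<subseteq> D" using D(1) by blast
      ultimately show "x \<in> acl D" using acl_mono by blast
    qed
  qed
qed

lemma right_transitivity:
  assumes 1: "ind C A N" and 2: "ind C (A \<union> N) B"
    and s: "smallset C" "smallset A" "smallset N" "smallset B"
  shows "ind C A (N \<union> B)"
proof -
  have "ind B (A \<union> N) C" using symmetry[OF 2] s by simp
  from left_transitivity[OF this symmetry[OF 1 s(1-3)]] have "ind (B \<union> N) A C" using s by simp
  from symmetry[OF this] show ?thesis using s by (simp add: Un_commute)
qed

end

section \<open>Small elementary submodels\<close>

context monster
begin

lemma card_T_sentences: "|sentences L| \<le>o |T|"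
proof -
  let ?f = "\<lambda>\<psi>. if \<psi> \<in> T then Inl \<psi> else Inr (Neg \<psi>)"
  have "inj_on ?f (sentences L)" by (auto simp: inj_on_def)
  moreover have "?f ` sentences L \<subseteq> T <+> T" using complete by (auto simp: complete_theory_def)
  ultimately have "|sentences L| \<le>o |T <+> T|"
    unfolding card_of_ordLeq[symmetric] by (intro exI[of _ ?f] conjI)
  also have "|T <+> T| =o |T|"
    by (rule card_of_Plus_infinite1[OF T_infinite card_of_mono1[OF subset_refl]])
  finally show ?thesis .
qed

lemma card_T_formulas: "|formulas L ss| \<le>o |T|"
proof -
  have "\<exists>f. inj_on f (formulas L ss) \<and> f ` formulas L ss \<subseteq> sentences L"
  proof (induction ss rule: rev_induct)
    case Nil
    show ?case by (rule exI[of _ id]) simp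
  next
    case (snoc s ss)
    then obtain f where f: "inj_on f (formulas L ss)" "f ` formulas L ss \<subseteq> sentences L" by blast
    let ?e = "Exi (length ss) s"
    have e: "?e ` formulas L (ss @ [s]) \<subseteq> formulas L ss" by (rule image_subsetI) (rule formulas_Exi)
    have "inj_on (f \<circ> ?e) (formulas L (ss @ [s]))"
    proof (rule comp_inj_on)
      show "inj_on ?e (formulas L (ss @ [s]))" by (simp add: inj_on_def)
      show "inj_on f (?e ` formulas L (ss @ [s]))" using f(1) e by (rule inj_on_subset)
    qed
    moreover have "(f \<circ> ?e) ` formulas L (ss @ [s]) \<subseteq> sentences L"
      using e f(2) by (auto simp: image_subset_iff)
    ultimately show ?case by blast
  qed
  then obtain f where f: "inj_on f (formulas L ss)" "f ` formulas L ss \<subseteq> sentences L" by (elim exE conjE)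
  then have "|formulas L ss| \<le>o |sentences L|" unfolding card_of_ordLeq[symmetric] by (intro exI[of _ f] conjI)
  then show ?thesis using card_T_sentences by (rule ordLeq_transitive)
qed

lemma card_T_sorts: "|UNIV :: 's set| \<le>o |T|"
proof -
  let ?f = "\<lambda>s. Exi 0 s (Equal (Var 0 s) (Var 0 s)) :: ('s, 'f, 'r) fm"
  have "inj_on ?f UNIV" by (simp add: inj_on_def)
  moreover have "?f ` UNIV \<subseteq> sentences L" by (auto simp: formulas_def)
  ultimately have "|UNIV :: 's set| \<le>o |sentences L|" unfolding card_of_ordLeq[symmetric] by blast
  then show ?thesis using card_T_sentences by (rule ordLeq_transitive)
qed

lemma card_lists_le:
  assumes K: "infinite K" and X: "|X| \<le>o |K|"
  shows "|lists X| \<le>o |K|"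
proof -
  have l: "|{xs \<in> lists X. length xs = n}| \<le>o |K|" for n
  proof (induction n)
    case 0
    have "{xs \<in> lists X. length xs = 0} = {[]}" by auto
    moreover have "|{[]}| \<le>o |K|" using K by (intro ordLess_imp_ordLeq finite_ordLess_infinite)
      (auto simp: Field_card_of card_of_well_order_on)
    ultimately show ?case by (simp only:)
  next
    case (Suc n)
    have "|\<Union>x\<in>X. \<Union>xs\<in>{xs \<in> lists X. length xs = n}. {x # xs}| \<le>o |K|"
    proof (rule card_of_UNION_ordLeq_infinite[OF K X], rule ballI, rule card_of_UNION_ordLeq_infinite[OF K Suc.IH], rule ballI)
      fix x :: 'x and xs
      show "|{x # xs}| \<le>o |K|" using K by (intro ordLess_imp_ordLeq finite_ordLess_infinite)
        (auto simp: Field_card_of card_of_well_order_on)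
    qed
    moreover have "{xs \<in> lists X. length xs = Suc n} \<subseteq> (\<Union>x\<in>X. \<Union>xs\<in>{xs \<in> lists X. length xs = n}. {x # xs})"
      by (auto simp: length_Suc_conv)
    ultimately show ?case using card_of_mono1 ordLeq_transitive by blast
  qed
  have "|UNIV :: nat set| \<le>o |K|" using K infinite_iff_card_of_nat by blast
  then have "|\<Union>n. {xs \<in> lists X. length xs = n}| \<le>o |K|"
    using l by (intro card_of_UNION_ordLeq_infinite[OF K]) blast+
  moreover have "lists X = (\<Union>n. {xs \<in> lists X. length xs = n})" by blast
  ultimately show ?thesis by (simp only:)
qed

lemma card_Un_le:
  assumes K: "infinite K" and "|X| \<le>o |K|" "|Y| \<le>o |K|"
  shows "|X \<union> Y| \<le>o |K|"
proof -
  have "|X \<union> Y| \<le>o |X <+> Y|" by (rule card_of_Un_Plus_ordLeq)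
  also have "|X <+> Y| \<le>o |K <+> K|" using assms(2,3) by (rule card_of_Plus_mono)
  also have "|K <+> K| =o |K|" by (rule card_of_Plus_infinite1[OF K card_of_mono1[OF subset_refl]])
  finally show ?thesis .
qed

text \<open>This is the criterion of Tarski and Vaught for \<open>N\<close> to be an elementary submodel.\<close>

definition model :: "'a set \<Rightarrow> bool" where
  "model N \<longleftrightarrow> N \<subseteq> univ M \<and> (\<forall>s P. definable N {()} (\<lambda>_. s) P \<longrightarrow>
    (\<exists>y\<in>univ M. sort_of M y = s \<and> P (\<lambda>_. y)) \<longrightarrow> (\<exists>y\<in>N. sort_of M y = s \<and> P (\<lambda>_. y)))"

text \<open>Closing \<open>B\<close> under a choice of witnesses for all formulas adds at most \<open>|T|\<close> elements for each
  finite tuple, and \<open>|T|\<close> is small.\<close>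

theorem Loewenheim_Skolem:
  assumes B: "smallset B"
  shows "\<exists>N. model N \<and> B \<subseteq> N \<and> smallset N"
proof -
  define w where "w \<phi> s b = (SOME y. y \<in> univ M \<and> sort_of M y = s \<and>
    ((\<exists>y\<in>univ M. sort_of M y = s \<and> holds M \<phi> (y # b)) \<longrightarrow> holds M \<phi> (y # b)))" for \<phi> s b
  have w: "w \<phi> s b \<in> univ M \<and> sort_of M (w \<phi> s b) = s \<and>
    ((\<exists>y\<in>univ M. sort_of M y = s \<and> holds M \<phi> (y # b)) \<longrightarrow> holds M \<phi> (w \<phi> s b # b))" for \<phi> s b
    unfolding w_def by (rule someI_ex) (use ex_sort[of s] in blast)
  define \<Phi> where "\<Phi> = (\<Union>ss\<in>lists UNIV. formulas L ss)"
  define step where "step X = X \<union> (\<Union>\<phi>\<in>\<Phi>. \<Union>s\<in>UNIV. \<Union>b\<in>lists X. {w \<phi> s b})" for X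
  define X where "X n = (step ^^ n) B" for n
  have Xs: "X (Suc n) = step (X n)" for n by (simp add: X_def)
  let ?K = "T <+> B"
  have K: "infinite ?K" using T_infinite by (simp add: finite_Plus_iff)
  have TK: "|T| \<le>o |?K|" by (rule card_of_Plus1)
  have lT: "|lists (UNIV :: 's set)| \<le>o |T|" by (rule card_lists_le[OF T_infinite card_T_sorts])
  have \<Phi>K: "|\<Phi>| \<le>o |?K|" unfolding \<Phi>_def
    by (rule ordLeq_transitive[OF card_of_UNION_ordLeq_infinite[OF T_infinite lT] TK]) (simp add: card_T_formulas)
  have sK: "|UNIV :: 's set| \<le>o |?K|" by (rule ordLeq_transitive[OF card_T_sorts TK])
  have one: "|{y}| \<le>o |?K|" for y :: 'a
    using K by (intro ordLess_imp_ordLeq finite_ordLess_infinite) (auto simp: Field_card_of card_of_well_order_on)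
  have XK: "|X n| \<le>o |?K|" for n
  proof (induction n)
    case 0
    then show ?case using card_of_Plus2 by (simp add: X_def)
  next
    case (Suc n)
    have "|\<Union>\<phi>\<in>\<Phi>. \<Union>s\<in>UNIV. \<Union>b\<in>lists (X n). {w \<phi> s b}| \<le>o |?K|"
      by (intro card_of_UNION_ordLeq_infinite[OF K] \<Phi>K sK card_lists_le[OF K Suc.IH] ballI one)
    then show ?case unfolding Xs step_def
      by (rule card_Un_le[OF K Suc.IH])
  qed
  define N where "N = (\<Union>n. X n)"
  have natK: "|UNIV :: nat set| \<le>o |?K|" using K infinite_iff_card_of_nat by blast
  have NK: "|N| \<le>o |?K|" unfolding N_def
    by (rule card_of_UNION_ordLeq_infinite[OF K natK]) (simp add: XK)
  have "|B| <o \<kappa>" using B by (simp add: smallset_def small_def)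
  then have "|?K| <o \<kappa>"
    by (rule card_of_Plus_ordLess_infinite_Field[OF \<kappa>_infinite Card_order_\<kappa> T_less_\<kappa>])
  then have "sm N" unfolding small_def using NK by (rule ordLeq_ordLess_trans[rotated])
  have Xu: "X n \<subseteq> univ M" for n
  proof (induction n)
    case 0
    then show ?case using B by (simp add: X_def smallset_def)
  next
    case (Suc n)
    then show ?case unfolding Xs step_def using w by auto
  qed
  then have Nu: "N \<subseteq> univ M" unfolding N_def by blast
  have Xmono: "X n \<subseteq> X m" if "n \<le> m" for n m
    using that by (rule lift_Suc_mono_le[rotated]) (simp add: Xs step_def)
  have fin: "\<exists>n. F \<subseteq> X n" if "finite F" "F \<subseteq> N" for F
    using that
  proof (induction F rule: finite_induct)
    case (insert y F)
    then obtain n m where "F \<subseteq> X n" "y \<in> X m" by (auto simp: N_def)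
    then have "insert y F \<subseteq> X (max n m)" using Xmono[of n "max n m"] Xmono[of m "max n m"] by auto
    then show ?case by blast
  qed simp
  have "model N" unfolding model_def
  proof (intro conjI allI impI Nu)
    fix s and P :: "(unit \<Rightarrow> 'a) \<Rightarrow> bool"
    assume P: "definable N {()} (\<lambda>_. s) P" and ex: "\<exists>y\<in>univ M. sort_of M y = s \<and> P (\<lambda>_. y)"
    have "definable N (set [()]) (\<lambda>_. s) P" using P by simp
    from definable_formula[OF this] obtain \<phi> b where \<phi>: "(\<phi>, b) \<in> formulas_over L M (map (\<lambda>_. s) [()]) N"
      "\<And>g. asg (set [()]) (\<lambda>_. s) g \<Longrightarrow> P g = holds M \<phi> (map g [()] @ b)" by blast
    have Py: "P (\<lambda>_. y) = holds M \<phi> (y # b)" if "y \<in> univ M" "sort_of M y = s" for y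
      using \<phi>(2)[of "\<lambda>_. y"] that by (simp add: asg_def)
    have b: "set b \<subseteq> N" "\<phi> \<in> formulas L (s # sorts M b)" using \<phi>(1) by (auto simp: formulas_over_def)
    obtain n where n: "set b \<subseteq> X n" using fin[of "set b"] b(1) by auto
    have "\<phi> \<in> \<Phi>" unfolding \<Phi>_def using b(2) by (auto simp: in_lists_conv_set)
    moreover have "b \<in> lists (X n)" using n by auto
    ultimately have "w \<phi> s b \<in> X (Suc n)" unfolding Xs step_def by blast
    then have "w \<phi> s b \<in> N" unfolding N_def by blast
    moreover have "\<exists>y\<in>univ M. sort_of M y = s \<and> holds M \<phi> (y # b)" using ex Py by auto
    then have "holds M \<phi> (w \<phi> s b # b)" using w by blast
    then have "P (\<lambda>_. w \<phi> s b)" using Py w by blast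
    ultimately show "\<exists>y\<in>N. sort_of M y = s \<and> P (\<lambda>_. y)" using w by blast
  qed
  moreover have "B \<subseteq> N" unfolding N_def using UN_upper[of 0 UNIV X] by (simp add: X_def)
  ultimately show ?thesis using Nu \<open>sm N\<close> unfolding smallset_def by blast
qed

lemma modelD:
  "model N \<Longrightarrow> definable N {()} (\<lambda>_. s) P \<Longrightarrow> \<exists>y\<in>univ M. sort_of M y = s \<and> P (\<lambda>_. y) \<Longrightarrow>
    \<exists>y\<in>N. sort_of M y = s \<and> P (\<lambda>_. y)"
  unfolding model_def by (elim conjE allE) (erule (1) impE, erule (1) mp)

lemma model_witness:
  assumes N: "model N" and W: "finite W"
  shows "definable N W s P \<Longrightarrow> asg W s g \<Longrightarrow> P g \<Longrightarrow> \<exists>g'. asg W s g' \<and> g' ` W \<subseteq> N \<and> P g'"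
  using W
proof (induction W arbitrary: P g rule: finite_induct)
  case empty
  then show ?case by (intro exI[of _ g]) simp
next
  case (insert w W)
  have Nu: "N \<subseteq> univ M" using N by (simp add: model_def)
  let ?Q = "\<lambda>y g'. asg ({w} \<union> W) s g' \<and> (\<forall>v\<in>{w}. g' v = y) \<and> P g'"
  have "definable N ({w} \<union> W) s P" using insert.prems(1) by simp
  then have "definable N {w} s (\<lambda>g. \<exists>g'. asg ({w} \<union> W) s g' \<and> (\<forall>v\<in>{w}. g' v = g v) \<and> P g')"
    by (rule definable_Ex_finite[OF insert.hyps(1)]) (use insert.hyps(2) in simp)
  then have d: "definable N {()} (\<lambda>_. s w) (\<lambda>h. \<exists>g'. asg ({w} \<union> W) s g' \<and> (\<forall>v\<in>{w}. g' v = h ()) \<and> P g')"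
    by (rule definable_rename[OF _ Nu]) simp
  have "\<exists>y\<in>univ M. sort_of M y = s w \<and> (\<exists>g'. ?Q y g')"
    using insert.prems(2,3) by (intro bexI[of _ "g w"] conjI exI[of _ g]) (simp_all add: asg_def)
  from modelD[OF N d this] obtain y where y: "y \<in> N" "sort_of M y = s w" "\<exists>g'. ?Q y g'"
    by (elim bexE conjE)
  then obtain g1 where g1: "asg (insert w W) s g1" "g1 w = y" "P g1" by auto
  let ?R = "\<lambda>g. P (\<lambda>v. if v \<in> W then g v else y)"
  have "definable N W s ?R"
    by (rule definable_insert_params[OF insert.prems(1) order_refl Nu]) (use y in auto)
  moreover have "asg W s g1" using g1(1) by (rule asg_mono) blast
  moreover have "?R g1"
    using definable_agree[OF insert.prems(1) g1(1), of "\<lambda>v. if v \<in> W then g1 v else y"] g1(2,3) by simp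
  ultimately obtain g2 where g2: "asg W s g2" "g2 ` W \<subseteq> N" "?R g2" using insert.IH by blast
  let ?g = "\<lambda>v. if v \<in> W then g2 v else y"
  have "asg (insert w W) s ?g" using g2(1) y(1,2) Nu by (auto simp: asg_def)
  moreover have "?g ` insert w W \<subseteq> N" using g2(2) y(1) by auto
  ultimately show ?case using g2(3) by (intro exI[of _ ?g]) simp
qed

text \<open>A type that is finitely satisfiable in \<open>N\<close> is independent over \<open>N\<close>: if \<open>x\<close> were algebraic over
  \<open>D \<union> C\<close>, it would be algebraic over \<open>D\<close> and a tuple from \<open>N \<subseteq> D\<close> satisfying the relevant formula.\<close>

theorem finitely_satisfiable_ind:
  assumes s: "smallset C" "smallset N" "smallset B"
    and fs: "\<And>P. definable (N \<union> B) C (sort_of M) P \<Longrightarrow> P id \<Longrightarrow>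
      \<exists>g. asg C (sort_of M) g \<and> g ` C \<subseteq> N \<and> P g"
  shows "ind C N B"
proof (rule ind_intro)
  show Cu: "C \<subseteq> univ M" and "smallset (N \<union> B)" using s by (simp_all add: smallset_def)
  fix B' assume B': "N \<union> B \<subseteq> B'" "smallset B'"
  have B'u: "B' \<subseteq> univ M" "sm B'" using B'(2) by (simp_all add: smallset_def)
  let ?\<Gamma> = "{P. definable B' C (sort_of M) P \<and> (\<forall>g. asg C (sort_of M) g \<longrightarrow> g ` C \<subseteq> N \<longrightarrow> P g)}"
  have "\<exists>\<sigma>\<in>Aut (N \<union> B). \<forall>P\<in>?\<Gamma>. P \<sigma>"
  proof (rule realize_by_automorphism[OF B'(1) B'u Cu])
    show "sm C" using s by (simp add: smallset_def)
    fix \<Gamma>0 Q assume "finite \<Gamma>0" "\<Gamma>0 \<subseteq> ?\<Gamma>" "definable (N \<union> B) C (sort_of M) Q" "Q id"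
    moreover from fs[OF this(3,4)] obtain g where "asg C (sort_of M) g" "g ` C \<subseteq> N" "Q g" by (elim exE conjE)
    ultimately show "\<exists>g. asg C (sort_of M) g \<and> Q g \<and> (\<forall>P\<in>\<Gamma>0. P g)" by (intro exI[of _ g]) blast
  qed simp
  then obtain \<sigma> where \<sigma>: "\<sigma> \<in> Aut (N \<union> B)" and \<Gamma>: "\<forall>P\<in>?\<Gamma>. P \<sigma>" ..
  have \<sigma>fs: "\<exists>g. asg C (sort_of M) g \<and> g ` C \<subseteq> N \<and> P g" if P: "definable B' C (sort_of M) P" "P \<sigma>" for P
  proof (rule ccontr)
    assume no: "\<not> ?thesis"
    have "(\<lambda>g. \<not> P g) \<in> ?\<Gamma>" using definable_Not[OF P(1)] no by blast
    from bspec[OF \<Gamma> this] P(2) show False by simp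
  qed
  have \<sigma>C: "asg C (sort_of M) \<sigma>" using asg_Aut[OF \<sigma> asg_id[OF Cu]] by simp
  show "\<exists>\<sigma>\<in>Aut (N \<union> B). \<forall>D x. N \<subseteq> D \<longrightarrow> D \<subseteq> B' \<longrightarrow> x \<in> B' \<longrightarrow> x \<in> acl (D \<union> \<sigma> ` C) \<longrightarrow> x \<in> acl D"
  proof (intro bexI[OF _ \<sigma>] allI impI)
    fix D x assume D: "N \<subseteq> D" "D \<subseteq> B'" "x \<in> B'" "x \<in> acl (D \<union> \<sigma> ` C)"
    have Ds: "D \<subseteq> univ M" "sm D" using smallset_subset[OF B'(2) D(2)] by (simp_all add: smallset_def)
    have \<sigma>Cs: "\<sigma> ` C \<subseteq> univ M" "sm (\<sigma> ` C)" using smallset_Aut[OF s(1) \<sigma>] by (simp_all add: smallset_def)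
    have xu: "x \<in> univ M" using D(3) B'u by blast
    have "D \<union> \<sigma> ` C \<subseteq> univ M" "sm (D \<union> \<sigma> ` C)" using Ds \<sigma>Cs by simp_all
    from acl_definable[OF D(4) this] obtain P where P: "definable (D \<union> \<sigma> ` C) {()} (\<lambda>_. sort_of M x) P"
      "P (\<lambda>_. x)" "finite {y\<in>univ M. sort_of M y = sort_of M x \<and> P (\<lambda>_. y)}" by (elim exE conjE)
    let ?F = "{y\<in>univ M. sort_of M y = sort_of M x \<and> P (\<lambda>_. y)}"
    let ?N = "Suc (card ?F)"
    let ?V = "Inl ` {()} \<union> Inr ` \<sigma> ` C :: (unit + 'a) set"
    let ?S = "case_sum (\<lambda>_. sort_of M x) (sort_of M)"
    from definable_abstract_params[OF P(1)] obtain P' where P': "definable D ?V ?S P'"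
      "\<forall>g. asg {()} (\<lambda>_. sort_of M x) g \<longrightarrow> P g = P' (case_sum g id)" by (elim exE conjE)
    have P'y: "P' (case_sum (\<lambda>_. y) id) = P (\<lambda>_. y)" if "y \<in> univ M" "sort_of M y = sort_of M x" for y
      using P'(2) that by (simp add: asg_def)
    let ?many = "\<lambda>g. \<exists>Y\<subseteq>{y\<in>univ M. sort_of M y = ?S (Inl ())}. finite Y \<and> card Y = ?N \<and> (\<forall>y\<in>Y. P' (g(Inl () := y)))"
    let ?R = "\<lambda>g. P' g \<and> \<not> ?many g"
    have R: "definable D ?V ?S ?R"
      by (intro definable_And definable_Not definable_at_least P'(1) Ds(1)) simp
    have upd: "(case_sum (\<lambda>_. y) f)(Inl () := y') = case_sum (\<lambda>_. y') f" for y y' and f :: "'a \<Rightarrow> 'a"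
      by (rule ext) (simp split: sum.split)
    have nmany: "\<not> ?many (case_sum (\<lambda>_. x) id)"
    proof
      assume "?many (case_sum (\<lambda>_. x) id)"
      then obtain Y where Y: "Y \<subseteq> {y\<in>univ M. sort_of M y = ?S (Inl ())}" "card Y = ?N"
        "\<forall>y\<in>Y. P' ((case_sum (\<lambda>_. x) id)(Inl () := y))" by (elim exE conjE)
      have "Y \<subseteq> ?F"
      proof
        fix y assume y: "y \<in> Y"
        then have "y \<in> univ M" "sort_of M y = sort_of M x" using Y(1) by auto
        moreover have "P' (case_sum (\<lambda>_. y) id)" using bspec[OF Y(3) y] unfolding upd .
        ultimately show "y \<in> ?F" using P'y by simp
      qed
      then have "card Y \<le> card ?F" using P(3) by (rule card_mono[rotated])
      then show False using Y(2) by simp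
    qed
    have Rx: "?R (case_sum (\<lambda>_. x) id)"
      using P'y[OF xu refl] P(2) nmany by (simp only: simp_thms)
    define pick where "pick c = (SOME u. u \<in> C \<and> \<sigma> u = c)" for c
    have pick: "pick c \<in> C \<and> \<sigma> (pick c) = c" if "c \<in> \<sigma> ` C" for c
      unfolding pick_def by (rule someI_ex) (use that in blast)
    have psort: "sort_of M (pick c) = sort_of M c" if "c \<in> \<sigma> ` C" for c
    proof -
      have "pick c \<in> univ M" using pick[OF that] Cu by blast
      from Aut_sort[OF \<sigma> this] show ?thesis using pick[OF that] by simp
    qed
    let ?h = "case_sum (\<lambda>_. Inr x) (\<lambda>c. Inl (pick c)) :: unit + 'a \<Rightarrow> 'a + 'a"
    have "definable B' C (sort_of M) (\<lambda>g. ?R (\<lambda>t. case_sum g id (?h t)))"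
    proof (rule definable_subst[OF R D(2) B'u(1)])
      fix t assume "t \<in> ?V"
      then show "?h t \<in> Inl ` C \<union> Inr ` B' \<and> case_sum (sort_of M) (sort_of M) (?h t) = ?S t"
        using D(3) pick psort by (auto simp del: image_iff)
    qed
    moreover have Reh: "(\<lambda>t. case_sum g id (?h t)) = case_sum (\<lambda>_. x) (\<lambda>c. g (pick c))" for g
      by (rule ext) (simp split: sum.split)
    ultimately have dR: "definable B' C (sort_of M) (\<lambda>g. ?R (case_sum (\<lambda>_. x) (\<lambda>c. g (pick c))))"
      by (simp only:)
    have asgx: "asg ?V ?S (case_sum (\<lambda>_. x) id)" using xu \<sigma>Cs(1) by (auto simp: asg_def)
    have "?R (case_sum (\<lambda>_. x) id) = ?R (case_sum (\<lambda>_. x) (\<lambda>c. \<sigma> (pick c)))"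
      by (rule definable_agree[OF R asgx]) (use pick in auto)
    then have "?R (case_sum (\<lambda>_. x) (\<lambda>c. \<sigma> (pick c)))" using Rx by (rule iffD1)
    from \<sigma>fs[OF dR this] obtain g where g0: "asg C (sort_of M) g \<and> g ` C \<subseteq> N \<and>
      ?R (case_sum (\<lambda>_. x) (\<lambda>c. g (pick c)))" by (elim exE)
    note g = conjunct1[OF g0] conjunct1[OF conjunct2[OF g0]] conjunct2[OF conjunct2[OF g0]]
    let ?k = "case_sum (\<lambda>u. Inl u) (\<lambda>c. Inr (g (pick c))) :: unit + 'a \<Rightarrow> unit + 'a"
    let ?P = "\<lambda>f. P' (\<lambda>t. case_sum f id (?k t))"
    have "definable D {()} (\<lambda>_. sort_of M x) ?P"
    proof (rule definable_subst[OF P'(1) order_refl Ds(1)])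
      fix t assume t: "t \<in> ?V"
      show "?k t \<in> Inl ` {()} \<union> Inr ` D \<and> case_sum (\<lambda>_. sort_of M x) (sort_of M) (?k t) = ?S t"
      proof (cases t)
        case (Inr c)
        then have c: "c \<in> \<sigma> ` C" using t by blast
        have "g (pick c) \<in> D" using g(2) pick[OF c] D(1) by blast
        moreover have "sort_of M (g (pick c)) = sort_of M c"
          using g(1) pick[OF c] psort[OF c] by (simp add: asg_def)
        ultimately show ?thesis using Inr by simp
      qed simp
    qed
    moreover have keq: "(\<lambda>t. case_sum f id (?k t)) = case_sum f (\<lambda>c. g (pick c))" for f
      by (rule ext) (simp split: sum.split)
    moreover have "P' (case_sum (\<lambda>_. x) (\<lambda>c. g (pick c)))" using g(3) by (rule conjunct1)
    moreover have "finite {y\<in>univ M. sort_of M y = sort_of M x \<and> P' (case_sum (\<lambda>_. y) (\<lambda>c. g (pick c)))}" (is "finite ?G")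
    proof (rule ccontr)
      assume "infinite ?G"
      then obtain Y where Y: "finite Y" "card Y = ?N" "Y \<subseteq> ?G" using infinite_arbitrarily_large by blast
      have "?many (case_sum (\<lambda>_. x) (\<lambda>c. g (pick c)))"
      proof (intro exI[of _ Y] conjI ballI Y(1,2))
        show "Y \<subseteq> {y\<in>univ M. sort_of M y = ?S (Inl ())}" using Y(3) by auto
        show "P' ((case_sum (\<lambda>_. x) (\<lambda>c. g (pick c)))(Inl () := y))" if "y \<in> Y" for y
          unfolding upd using subsetD[OF Y(3) that] by (elim CollectE conjE)
      qed
      then show False using conjunct2[OF g(3)] by (rule notE[rotated])
    qed
    ultimately show "x \<in> acl D" using xu Ds(1) by (intro acl_intro[of D x ?P]) (simp_all only:)
  qed
qed

end

section \<open>Ultrafilters and iterated averages\<close>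

definition ultra :: "(('j \<Rightarrow> bool) \<Rightarrow> bool) \<Rightarrow> bool" where
  "ultra U \<longleftrightarrow> (\<forall>P. U (\<lambda>j. \<not> P j) \<longleftrightarrow> \<not> U P) \<and> (\<forall>P Q. U (\<lambda>j. P j \<and> Q j) \<longleftrightarrow> U P \<and> U Q)"

lemma ultra_Not: "ultra U \<Longrightarrow> U (\<lambda>j. \<not> P j) \<longleftrightarrow> \<not> U P"
  and ultra_And: "ultra U \<Longrightarrow> U (\<lambda>j. P j \<and> Q j) \<longleftrightarrow> U P \<and> U Q"
  by (simp_all add: ultra_def)

lemma ultra_const: "ultra U \<Longrightarrow> U (\<lambda>j. c) = c"
  using ultra_Not[of U "\<lambda>j. True"] ultra_And[of U "\<lambda>j. True" "\<lambda>j. False"] by (cases c) auto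

lemma ultra_mono:
  assumes "ultra U" "U P" "\<And>j. P j \<Longrightarrow> Q j"
  shows "U Q"
proof -
  have "(\<lambda>j. P j \<and> Q j) = P" using assms(3) by auto
  then show ?thesis using ultra_And[OF assms(1), of P Q] assms(2) by simp
qed

lemma ultra_ex: "ultra U \<Longrightarrow> U P \<Longrightarrow> \<exists>j. P j"
  using ultra_const[of U False] ultra_mono[of U P "\<lambda>_. False"] by auto

lemma ex_ultra:
  fixes F :: "'j set set"
  assumes "\<And>F0. finite F0 \<Longrightarrow> F0 \<subseteq> F \<Longrightarrow> \<Inter>F0 \<noteq> {}"
  shows "\<exists>U. ultra U \<and> (\<forall>X\<in>F. U (\<lambda>j. j \<in> X))"
proof -
  define fip where "fip G \<longleftrightarrow> (\<forall>F0\<subseteq>G. finite F0 \<longrightarrow> \<Inter>F0 \<noteq> {})" for G :: "'j set set"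
  let ?A = "{G. F \<subseteq> G \<and> fip G}"
  have "\<exists>G\<in>?A. \<forall>X\<in>?A. G \<subseteq> X \<longrightarrow> X = G"
  proof (rule subset_Zorn_nonempty)
    have "fip F" using assms by (simp add: fip_def)
    then show "?A \<noteq> {}" by blast
  next
    fix C assume C: "C \<noteq> {}" "subset.chain ?A C"
    have CA: "F \<subseteq> G" "fip G" if "G \<in> C" for G using C(2) that by (auto simp: subset.chain_def)
    have "fip (\<Union>C)" unfolding fip_def
    proof (intro allI impI)
      fix F0 assume F0: "F0 \<subseteq> \<Union>C" "finite F0"
      obtain G where "G \<in> C" "F0 \<subseteq> G" by (rule finite_subset_Union_chain[OF F0(2,1) C])
      then show "\<Inter>F0 \<noteq> {}" using CA(2)[of G] F0(2) unfolding fip_def by simp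
    qed
    moreover have "F \<subseteq> \<Union>C" using C(1) CA(1) by (metis Union_upper all_not_in_conv subset_trans)
    ultimately show "\<Union>C \<in> ?A" by simp
  qed
  then obtain G where "G \<in> ?A" and max: "\<forall>X\<in>?A. G \<subseteq> X \<longrightarrow> X = G" by (elim bexE)
  then have G: "F \<subseteq> G" "fip G" by simp_all
  have out: "\<exists>F0\<subseteq>G. finite F0 \<and> \<Inter>F0 \<inter> A = {}" if A: "A \<notin> G" for A
  proof -
    have "\<not> fip (insert A G)"
    proof
      assume "fip (insert A G)"
      then have "insert A G \<in> ?A" using G(1) by blast
      then have "insert A G = G" using max by (simp add: subset_insertI)
      then show False using A by blast
    qed
    then obtain F1 where F1: "F1 \<subseteq> insert A G" "finite F1" "\<Inter>F1 = {}" unfolding fip_def by blast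
    have "\<Inter>(F1 - {A}) \<inter> A = {}" using F1(3) by blast
    then show ?thesis using F1(1,2) by (intro exI[of _ "F1 - {A}"]) blast
  qed
  have inter: "\<Inter>F0 \<noteq> {}" if "F0 \<subseteq> G" "finite F0" for F0 using G(2) that unfolding fip_def by simp
  have up: "B \<in> G" if AB: "A \<in> G" "A \<subseteq> B" for A B
  proof (rule ccontr)
    assume "B \<notin> G"
    from out[OF this] obtain F0 where F0: "F0 \<subseteq> G" "finite F0" "\<Inter>F0 \<inter> B = {}" by (elim exE conjE)
    have "\<Inter>(insert A F0) = {}" using F0(3) AB(2) by auto
    then show False using inter[of "insert A F0"] AB(1) F0(1,2) by simp
  qed
  have int: "A \<inter> B \<in> G" if AB: "A \<in> G" "B \<in> G" for A B
  proof (rule ccontr)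
    assume "A \<inter> B \<notin> G"
    from out[OF this] obtain F0 where F0: "F0 \<subseteq> G" "finite F0" "\<Inter>F0 \<inter> (A \<inter> B) = {}" by (elim exE conjE)
    have "\<Inter>(insert A (insert B F0)) = {}" using F0(3) by auto
    then show False using inter[of "insert A (insert B F0)"] AB F0(1,2) by simp
  qed
  have compl: "- A \<in> G \<longleftrightarrow> A \<notin> G" for A
  proof
    assume *: "- A \<in> G"
    show "A \<notin> G" using inter[of "{A, - A}"] * by auto
  next
    assume "A \<notin> G"
    from out[OF this] obtain F0 where F0: "F0 \<subseteq> G" "finite F0" "\<Inter>F0 \<inter> A = {}" by (elim exE conjE)
    show "- A \<in> G"
    proof (rule ccontr)
      assume "- A \<notin> G"
      from out[OF this] obtain F1 where F1: "F1 \<subseteq> G" "finite F1" "\<Inter>F1 \<inter> - A = {}" by (elim exE conjE)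
      have "\<Inter>(F0 \<union> F1) = {}" using F0(3) F1(3) by auto
      then show False using inter[of "F0 \<union> F1"] F0(1,2) F1(1,2) by simp
    qed
  qed
  let ?U = "\<lambda>P. Collect P \<in> G"
  have "ultra ?U" unfolding ultra_def
  proof (intro conjI allI)
    fix P :: "'j \<Rightarrow> bool"
    show "{j. \<not> P j} \<in> G \<longleftrightarrow> \<not> Collect P \<in> G" using compl[of "Collect P"] by (simp add: Collect_neg_eq)
  next
    fix P Q :: "'j \<Rightarrow> bool"
    show "{j. P j \<and> Q j} \<in> G \<longleftrightarrow> Collect P \<in> G \<and> Collect Q \<in> G"
    proof
      assume "{j. P j \<and> Q j} \<in> G"
      then show "Collect P \<in> G \<and> Collect Q \<in> G" using up by blast
    next
      assume "Collect P \<in> G \<and> Collect Q \<in> G"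
      then show "{j. P j \<and> Q j} \<in> G" using int[of "Collect P" "Collect Q"] by (simp add: Collect_conj_eq)
    qed
  qed
  moreover have "\<forall>X\<in>F. ?U (\<lambda>j. j \<in> X)" using G(1) by auto
  ultimately show ?thesis by blast
qed

text \<open>The iterated quantifier \<open>U j\<^sub>n\<^sub>-\<^sub>1. \<dots> U j\<^sub>0. R (j\<^sub>0, \<dots>, j\<^sub>n\<^sub>-\<^sub>1)\<close>.\<close>

primrec UU :: "(('j \<Rightarrow> bool) \<Rightarrow> bool) \<Rightarrow> nat \<Rightarrow> ((nat \<Rightarrow> 'j) \<Rightarrow> bool) \<Rightarrow> bool" where
  "UU U 0 R = R (\<lambda>_. undefined)"
| "UU U (Suc n) R = U (\<lambda>j. UU U n (\<lambda>f. R (f(n := j))))"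

definition dep :: "nat \<Rightarrow> ((nat \<Rightarrow> 'j) \<Rightarrow> bool) \<Rightarrow> bool" where
  "dep n R \<longleftrightarrow> (\<forall>f g. (\<forall>k<n. f k = g k) \<longrightarrow> R f = R g)"

lemma depD: "dep n R \<Longrightarrow> (\<And>k. k < n \<Longrightarrow> f k = g k) \<Longrightarrow> R f = R g"
  by (simp add: dep_def)

lemma UU_Not: "ultra U \<Longrightarrow> UU U n (\<lambda>f. \<not> R f) \<longleftrightarrow> \<not> UU U n R"
proof (induction n arbitrary: R)
  case (Suc n)
  show ?case unfolding UU.simps(2) Suc.IH[OF Suc.prems] by (rule ultra_Not[OF Suc.prems])
qed simp

lemma UU_And: "ultra U \<Longrightarrow> UU U n (\<lambda>f. R f \<and> S f) \<longleftrightarrow> UU U n R \<and> UU U n S"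
proof (induction n arbitrary: R S)
  case (Suc n)
  show ?case unfolding UU.simps(2) Suc.IH[OF Suc.prems] by (rule ultra_And[OF Suc.prems])
qed simp

lemma UU_const: "ultra U \<Longrightarrow> UU U n (\<lambda>f. c) = c"
  by (induction n) (simp_all add: ultra_const)

lemma UU_ex: "ultra U \<Longrightarrow> UU U n R \<Longrightarrow> \<exists>f. R f"
proof (induction n arbitrary: R)
  case (Suc n)
  from ultra_ex[OF Suc.prems(1)] Suc.prems(2) obtain j where "UU U n (\<lambda>f. R (f(n := j)))" by auto
  from Suc.IH[OF Suc.prems(1) this] show ?case by blast
qed auto

lemma UU_Suc_dep:
  assumes "ultra U" "dep n R"
  shows "UU U (Suc n) R = UU U n R"
proof -
  have "(\<lambda>f. R (f(n := j))) = R" for j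
  proof
    fix f
    have "\<forall>k<n. (f(n := j)) k = f k" by simp
    then show "R (f(n := j)) = R f" using assms(2) unfolding dep_def by blast
  qed
  then show ?thesis using ultra_const[OF assms(1)] by simp
qed

lemma dep_mono: "dep n R \<Longrightarrow> n \<le> m \<Longrightarrow> dep m R"
  unfolding dep_def by (meson less_le_trans)

lemma UU_dep_mono:
  assumes "ultra U" "dep n R"
  shows "n \<le> m \<Longrightarrow> UU U m R = UU U n R"
proof (induction m rule: dec_induct)
  case (step m)
  then show ?case using UU_Suc_dep[OF assms(1) dep_mono[OF assms(2) step.hyps(1)]] by (simp del: UU.simps)
qed simp

lemma UU_subsequence:
  assumes U: "ultra U"
  shows "dep n R \<Longrightarrow> (\<And>i j. i < j \<Longrightarrow> j < n \<Longrightarrow> h i < h j) \<Longrightarrow> (\<And>i. i < n \<Longrightarrow> h i < m) \<Longrightarrow>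
    UU U m (\<lambda>f. R (\<lambda>k. f (h k))) = UU U n R"
proof (induction m arbitrary: n R)
  case 0
  then have "n = 0" using not_less0 by blast
  then show ?case using 0(1) unfolding dep_def by simp
next
  case (Suc m)
  show ?case
  proof (cases n)
    case 0
    have "R f = R (\<lambda>_. undefined)" for f by (rule depD[OF Suc.prems(1)]) (simp add: 0)
    then have "(\<lambda>f. R (\<lambda>k. f (h k))) = (\<lambda>_. R (\<lambda>_. undefined))" by (intro ext)
    then show ?thesis using UU_const[OF U, of "Suc m" "R (\<lambda>_. undefined)"] by (simp only: 0 UU.simps(1))
  next
    case n: (Suc n')
    show ?thesis
    proof (cases "h n' = m")
      case True
      have hm: "h k \<noteq> m" "h k < m" if "k < n'" for k
        using Suc.prems(2)[of k n'] that n True by auto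
      have eq: "(\<lambda>f. R (\<lambda>k. (f(m := j)) (h k))) = (\<lambda>f. R ((\<lambda>k. f (h k))(n' := j)))" for j
      proof
        fix f :: "nat \<Rightarrow> 'a"
        show "R (\<lambda>k. (f(m := j)) (h k)) = R ((\<lambda>k. f (h k))(n' := j))"
          by (rule depD[OF Suc.prems(1)]) (use hm True n in \<open>auto simp: less_Suc_eq\<close>)
      qed
      have "UU U m (\<lambda>f. R ((\<lambda>k. f (h k))(n' := j))) = UU U n' (\<lambda>f. R (f(n' := j)))" for j
      proof (rule Suc.IH)
        show "dep n' (\<lambda>f. R (f(n' := j)))" unfolding dep_def
        proof (intro allI impI)
          fix f g :: "nat \<Rightarrow> 'a" assume "\<forall>k<n'. f k = g k"
          then show "R (f(n' := j)) = R (g(n' := j))"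
            by (intro depD[OF Suc.prems(1)]) (use n in \<open>auto simp: less_Suc_eq\<close>)
        qed
      qed (use Suc.prems(2) n hm in auto)
      then show ?thesis unfolding n UU.simps(2) eq by simp
    next
      case False
      have hm: "h i < m" if i: "i < n" for i
      proof -
        have "h n' < m" using Suc.prems(3)[of n'] n False by simp
        then show ?thesis using Suc.prems(2)[of i n'] i n by (cases "i = n'") auto
      qed
      have "dep m (\<lambda>f. R (\<lambda>k. f (h k)))" unfolding dep_def
      proof (intro allI impI)
        fix f g :: "nat \<Rightarrow> 'a" assume "\<forall>k<m. f k = g k"
        then show "R (\<lambda>k. f (h k)) = R (\<lambda>k. g (h k))"
          by (intro depD[OF Suc.prems(1)]) (use hm in blast)
      qed
      from UU_Suc_dep[OF U this] show ?thesis
        using Suc.IH[OF Suc.prems(1,2) hm] by (simp del: UU.simps)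
    qed
  qed
qed

lemma UU_decreasing:
  assumes U: "ultra U" and tails: "\<And>l. U (\<lambda>j. l < j)"
  shows "(\<And>f. (\<And>i j. i < j \<Longrightarrow> j < n \<Longrightarrow> f j < f i) \<Longrightarrow> (\<And>k. k < n \<Longrightarrow> l < f k) \<Longrightarrow> R f) \<Longrightarrow>
    UU U n (R :: (nat \<Rightarrow> nat) \<Rightarrow> bool)"
proof (induction n arbitrary: R l)
  case (Suc n)
  have "UU U n (\<lambda>f. R (f(n := j)))" if j: "l < j" for j
  proof (rule Suc.IH[of j])
    fix f assume f: "\<And>i j. i < j \<Longrightarrow> j < n \<Longrightarrow> f j < f i" "\<And>k. k < n \<Longrightarrow> j < f k"
    show "R (f(n := j))"
    proof (rule Suc.prems)
      show "(f(n := j)) i' < (f(n := j)) i" if "i < i'" "i' < Suc n" for i i'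
        using f that by (cases "i' = n") auto
      show "l < (f(n := j)) k" if "k < Suc n" for k
        using f(2)[of k] that j by (cases "k = n") auto
    qed
  qed
  then show ?case unfolding UU.simps(2) by (rule ultra_mono[OF U tails[of l]])
qed simp

lemma UU_Ball:
  assumes "ultra U"
  shows "finite F \<Longrightarrow> (\<And>i. i \<in> F \<Longrightarrow> UU U n (R i)) \<Longrightarrow> UU U n (\<lambda>f. \<forall>i\<in>F. R i f)"
proof (induction F rule: finite_induct)
  case empty
  show ?case using UU_const[OF assms, of n True] by simp
next
  case (insert i F)
  have "UU U n (R i)" "UU U n (\<lambda>f. \<forall>i\<in>F. R i f)" using insert.IH insert.prems by simp_all
  then have "UU U n (\<lambda>f. R i f \<and> (\<forall>i\<in>F. R i f))" unfolding UU_And[OF assms] by (rule conjI)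
  then show ?case by (simp only: ball_simps)
qed

context monster
begin

abbreviation (input) seq :: "(nat \<Rightarrow> 'p \<Rightarrow> 'a) \<Rightarrow> nat \<times> 'p \<Rightarrow> 'a" where
  "seq d \<equiv> (\<lambda>v. d (fst v) (snd v))"

lemma definable_dep:
  fixes m :: "'j \<Rightarrow> 'p \<Rightarrow> 'a"
  assumes P: "definable B ({..<n} \<times> Z) (\<lambda>v. s (snd v)) P" and m: "\<And>j. asg Z s (m j)"
  shows "dep n (\<lambda>f. P (seq (\<lambda>k. m (f k))))"
  unfolding dep_def
proof (intro allI impI)
  fix f g :: "nat \<Rightarrow> 'j" assume fg: "\<forall>k<n. f k = g k"
  show "P (seq (\<lambda>k. m (f k))) = P (seq (\<lambda>k. m (g k)))"
    by (rule definable_agree[OF P]) (use m fg in \<open>auto simp: asg_def\<close>)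
qed

text \<open>The iterated averages of the family \<open>m\<close> along an ultrafilter describe a complete type of a
  sequence, which is finitely satisfied by members of the family and hence realized.\<close>

theorem average_sequence:
  fixes m :: "'j \<Rightarrow> 'p \<Rightarrow> 'a"
  assumes U: "ultra U" and Z: "finite Z" and B: "smallset B" and m: "\<And>j. asg Z s (m j)"
  shows "\<exists>d. (\<forall>k. asg Z s (d k)) \<and> (\<forall>n P. definable B ({..<n} \<times> Z) (\<lambda>v. s (snd v)) P \<longrightarrow>
    (P (seq d) \<longleftrightarrow> UU U n (\<lambda>f. P (seq (\<lambda>k. m (f k))))))"
proof -
  let ?s = "\<lambda>v :: nat \<times> 'p. s (snd v)"
  let ?\<Gamma> = "{P. \<exists>n. definable B ({..<n} \<times> Z) ?s P \<and> UU U n (\<lambda>f. P (seq (\<lambda>k. m (f k))))}"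
  have "\<exists>g. asg (UNIV \<times> Z) ?s g \<and> (\<forall>P\<in>?\<Gamma>. P g)"
  proof (rule saturation)
    show "B \<subseteq> univ M" "sm B" using B by (simp_all add: smallset_def)
    have "(UNIV :: nat set) \<times> Z = (\<Union>p\<in>Z. (\<lambda>k. (k, p)) ` UNIV)" by auto
    moreover have "sm (\<Union>p\<in>Z. (\<lambda>k. (k, p)) ` (UNIV :: nat set))"
      by (rule sm_UN_finite[OF Z]) (rule sm_image[OF sm_countable])
    ultimately show "sm ((UNIV :: nat set) \<times> Z)" by (simp only:)
  next
    fix P assume "P \<in> ?\<Gamma>"
    then obtain n where "definable B ({..<n} \<times> Z) ?s P" by (elim CollectE exE conjE)
    then show "definable B (UNIV \<times> Z) ?s P" by (rule definable_mono) auto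
  next
    fix \<Gamma>0 assume \<Gamma>0: "finite \<Gamma>0" "\<Gamma>0 \<subseteq> ?\<Gamma>"
    have "\<forall>P\<in>\<Gamma>0. \<exists>n. definable B ({..<n} \<times> Z) ?s P \<and> UU U n (\<lambda>f. P (seq (\<lambda>k. m (f k))))"
    proof
      fix P assume "P \<in> \<Gamma>0"
      then have "P \<in> ?\<Gamma>" using \<Gamma>0(2) by (rule subsetD[rotated])
      then show "\<exists>n. definable B ({..<n} \<times> Z) ?s P \<and> UU U n (\<lambda>f. P (seq (\<lambda>k. m (f k))))" by (rule CollectD)
    qed
    from bchoice[OF this] obtain n where n: "\<forall>P\<in>\<Gamma>0. definable B ({..<n P} \<times> Z) ?s P \<and>
      UU U (n P) (\<lambda>f. P (seq (\<lambda>k. m (f k))))" ..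
    let ?n = "\<Sum>P\<in>\<Gamma>0. n P"
    have "UU U ?n (\<lambda>f. \<forall>P\<in>\<Gamma>0. P (seq (\<lambda>k. m (f k))))"
    proof (rule UU_Ball[OF U \<Gamma>0(1)])
      fix P assume P: "P \<in> \<Gamma>0"
      have le: "n P \<le> ?n" by (rule member_le_sum[OF P _ \<Gamma>0(1)]) simp
      have Pn: "definable B ({..<n P} \<times> Z) ?s P" "UU U (n P) (\<lambda>f. P (seq (\<lambda>k. m (f k))))" using bspec[OF n P] by simp_all
      show "UU U ?n (\<lambda>f. P (seq (\<lambda>k. m (f k))))"
        by (rule iffD2[OF UU_dep_mono[OF U definable_dep[OF Pn(1) m] le] Pn(2)])
    qed
    from UU_ex[OF U this] obtain f where f: "\<forall>P\<in>\<Gamma>0. P (seq (\<lambda>k. m (f k)))" by (elim exE)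
    have "asg (UNIV \<times> Z) ?s (seq (\<lambda>k. m (f k)))" using m by (auto simp: asg_def)
    then show "\<exists>g. asg (UNIV \<times> Z) ?s g \<and> (\<forall>P\<in>\<Gamma>0. P g)" using f by (intro exI conjI)
  qed
  then obtain g where g: "asg (UNIV \<times> Z) ?s g" "\<forall>P\<in>?\<Gamma>. P g" by (elim exE conjE)
  let ?d = "\<lambda>k p. g (k, p)"
  have sd: "seq ?d = g" by simp
  have iff: "P g \<longleftrightarrow> UU U n (\<lambda>f. P (seq (\<lambda>k. m (f k))))" if P: "definable B ({..<n} \<times> Z) ?s P" for n P
  proof
    assume Pg: "P g"
    show "UU U n (\<lambda>f. P (seq (\<lambda>k. m (f k))))"
    proof (rule ccontr)
      assume "\<not> UU U n (\<lambda>f. P (seq (\<lambda>k. m (f k))))"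
      then have "UU U n (\<lambda>f. \<not> P (seq (\<lambda>k. m (f k))))" unfolding UU_Not[OF U] .
      then have "(\<lambda>g. \<not> P g) \<in> ?\<Gamma>" using definable_Not[OF P] by (intro CollectI exI conjI)
      from bspec[OF g(2) this] Pg show False by simp
    qed
  next
    assume "UU U n (\<lambda>f. P (seq (\<lambda>k. m (f k))))"
    then have "P \<in> ?\<Gamma>" using P by (intro CollectI exI conjI)
    from bspec[OF g(2) this] show "P g" .
  qed
  show ?thesis
  proof (intro exI[of _ ?d] conjI allI impI)
    show "asg Z s (?d k)" for k unfolding asg_def
    proof
      fix p assume "p \<in> Z"
      then have "(k, p) \<in> UNIV \<times> Z" by simp
      from bspec[OF g(1)[unfolded asg_def] this] show "g (k, p) \<in> univ M \<and> sort_of M (g (k, p)) = s p" by simp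
    qed
    show "P (seq ?d) \<longleftrightarrow> UU U n (\<lambda>f. P (seq (\<lambda>k. m (f k))))"
      if "definable B ({..<n} \<times> Z) ?s P" for n P unfolding sd by (rule iff[OF that])
  qed
qed

lemma average_indiscernible:
  fixes m :: "'j \<Rightarrow> 'p \<Rightarrow> 'a"
  assumes U: "ultra U" and Z: "finite Z" and B: "smallset B" and m: "\<And>j. asg Z s (m j)"
    and d: "\<And>k. asg Z s (d k)" "\<And>n P. definable B ({..<n} \<times> Z) (\<lambda>v. s (snd v)) P \<Longrightarrow>
      P (seq d) \<longleftrightarrow> UU U n (\<lambda>f. P (seq (\<lambda>k. m (f k))))"
    and h: "\<And>i j. i < j \<Longrightarrow> j < n \<Longrightarrow> h i < h j"
  shows "\<exists>\<sigma>\<in>Aut B. \<forall>k<n. \<forall>p\<in>Z. \<sigma> (d k p) = d (h k) p"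
proof -
  let ?s = "\<lambda>v :: nat \<times> 'p. s (snd v)"
  have Bu: "B \<subseteq> univ M" "sm B" using B by (simp_all add: smallset_def)
  define l where "l = Suc (\<Sum>k<n. h k)"
  have hl: "h k < l" if "k < n" for k
    unfolding l_def using member_le_sum[of k "{..<n}" h] that by (simp add: less_Suc_eq_le)
  have "\<exists>\<sigma>\<in>Aut B. \<forall>v\<in>{..<n} \<times> Z. \<sigma> (seq d v) = seq (\<lambda>k. d (h k)) v"
  proof (rule homogeneity[OF Bu])
    show "sm ({..<n} \<times> Z)" using Z by simp
    show "asg ({..<n} \<times> Z) ?s (seq d)" "asg ({..<n} \<times> Z) ?s (seq (\<lambda>k. d (h k)))"
      using d(1) by (auto simp: asg_def)
    fix P assume P: "definable B ({..<n} \<times> Z) ?s P" "P (seq d)"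
    have "definable B ({..<l} \<times> Z) ?s (\<lambda>g. P (\<lambda>v. g (h (fst v), snd v)))"
      by (rule definable_rename[OF P(1) Bu(1)]) (use hl in auto)
    from d(2)[OF this] have "P (seq (\<lambda>k. d (h k))) = UU U l (\<lambda>f. P (seq (\<lambda>k. m (f (h k)))))"
      by (simp only: fst_conv snd_conv)
    also have "\<dots> = UU U n (\<lambda>f. P (seq (\<lambda>k. m (f k))))"
      using UU_subsequence[OF U definable_dep[OF P(1) m] h hl] by simp
    also have "\<dots>" using d(2)[OF P(1)] P(2) by simp
    finally show "P (seq (\<lambda>k. d (h k)))" by simp
  qed
  then show ?thesis by auto
qed

lemma average_finitely_satisfiable:
  fixes m :: "'j \<Rightarrow> 'p \<Rightarrow> 'a"
  assumes U: "ultra U" and Z: "finite Z" and B: "smallset B" and m: "\<And>j. asg Z s (m j)" "\<And>j. m j ` Z \<subseteq> B"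
    and d: "\<And>k. asg Z s (d k)" "\<And>n P. definable B ({..<n} \<times> Z) (\<lambda>v. s (snd v)) P \<Longrightarrow>
      P (seq d) \<longleftrightarrow> UU U n (\<lambda>f. P (seq (\<lambda>k. m (f k))))"
    and P: "definable (B \<union> (\<Union>l<k. d l ` Z)) Z s P" "P (d k)"
  shows "\<exists>j. P (m j)"
proof -
  let ?s = "\<lambda>v :: nat \<times> 'p. s (snd v)"
  let ?E = "\<Union>l<k. d l ` Z"
  have Bu: "B \<subseteq> univ M" using B by (simp add: smallset_def)
  have Eu: "?E \<subseteq> univ M" using d(1) by (auto simp: asg_def)
  from definable_abstract_params[OF P(1)] obtain P' where
    P': "definable B (Inl ` Z \<union> Inr ` ?E) (case_sum s (sort_of M)) P'"
      "\<forall>g. asg Z s g \<longrightarrow> P g = P' (case_sum g id)" by (elim exE conjE)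
  have "\<forall>u\<in>?E. \<exists>v. v \<in> {..<k} \<times> Z \<and> seq d v = u" by force
  from bchoice[OF this] obtain nm where nm: "\<forall>u\<in>?E. nm u \<in> {..<k} \<times> Z \<and> seq d (nm u) = u" ..
  let ?h = "case_sum (\<lambda>p. (k, p)) nm"
  let ?Q = "\<lambda>g. P' (\<lambda>t. g (?h t))"
  have Q: "definable B ({..<Suc k} \<times> Z) ?s ?Q"
  proof (rule definable_rename[OF P'(1) Bu])
    fix t assume t: "t \<in> Inl ` Z \<union> Inr ` ?E"
    show "?h t \<in> {..<Suc k} \<times> Z \<and> ?s (?h t) = case_sum s (sort_of M) t"
    proof (cases t)
      case (Inl p)
      then show ?thesis using t by auto
    next
      case (Inr u)
      then have "u \<in> ?E" using t by blast
      from bspec[OF nm this] have u: "fst (nm u) < k" "snd (nm u) \<in> Z" "seq d (nm u) = u" by auto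
      have "sort_of M (seq d (nm u)) = s (snd (nm u))" using d(1) u(2) by (simp add: asg_def)
      then show ?thesis using u Inr by (simp add: mem_Times_iff)
    qed
  qed
  have Qe: "P' (case_sum g id) = ?Q (\<lambda>v. if fst v < k then seq d v else g (snd v))" if g: "asg Z s g" for g
  proof (rule definable_agree[OF P'(1)])
    show "asg (Inl ` Z \<union> Inr ` ?E) (case_sum s (sort_of M)) (case_sum g id)"
      unfolding asg_def
    proof
      fix t assume t: "t \<in> Inl ` Z \<union> Inr ` ?E"
      show "case_sum g id t \<in> univ M \<and> sort_of M (case_sum g id t) = case_sum s (sort_of M) t"
      proof (cases t)
        case (Inl p)
        then show ?thesis using t g by (auto simp: asg_def)
      next
        case (Inr u)
        then have "u \<in> ?E" using t by blast
        from subsetD[OF Eu this] show ?thesis using Inr by simp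
      qed
    qed
    show "\<forall>t\<in>Inl ` Z \<union> Inr ` ?E. case_sum g id t =
        (if fst (?h t) < k then seq d (?h t) else g (snd (?h t)))"
    proof
      fix t assume t: "t \<in> Inl ` Z \<union> Inr ` ?E"
      show "case_sum g id t = (if fst (?h t) < k then seq d (?h t) else g (snd (?h t)))"
      proof (cases t)
        case (Inr u)
        then have "u \<in> ?E" using t by blast
        from bspec[OF nm this] Inr show ?thesis by auto
      qed simp
    qed
  qed
  have ag: "?Q (\<lambda>v. if fst v < k then g1 v else g2 (snd v)) = ?Q (seq d')"
    if "\<forall>v\<in>{..<k} \<times> Z. g1 v = seq d' v" "\<forall>p\<in>Z. g2 p = d' k p" "asg ({..<Suc k} \<times> Z) ?s (seq d')" for g1 g2 d'
    by (rule definable_agree[OF Q, symmetric]) (use that in \<open>auto simp: less_Suc_eq\<close>)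
  have "P' (case_sum (d k) id)" using P'(2) d(1) P(2) by blast
  then have "?Q (\<lambda>v. if fst v < k then seq d v else d k (snd v))" unfolding Qe[OF d(1)] .
  moreover have "asg ({..<Suc k} \<times> Z) ?s (seq d)" using d(1) by (auto simp: asg_def)
  ultimately have "?Q (seq d)" using ag[of "seq d" d "d k"] by simp
  then have UQ: "UU U (Suc k) (\<lambda>f. ?Q (seq (\<lambda>l. m (f l))))" by (rule iffD1[OF d(2)[OF Q]])
  define K where "K j = UU U k (\<lambda>f. ?Q (seq (\<lambda>l. m ((f(k := j)) l))))" for j
  have "U K" using UQ unfolding UU.simps(2) K_def .
  from ultra_ex[OF U this] obtain j where "K j" by (elim exE)
  then have j: "UU U k (\<lambda>f. ?Q (seq (\<lambda>l. m ((f(k := j)) l))))" unfolding K_def .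
  let ?R = "\<lambda>g. ?Q (\<lambda>v. if v \<in> {..<k} \<times> Z then g v else m j (snd v))"
  have R: "definable B ({..<k} \<times> Z) ?s ?R"
  proof (rule definable_insert_params[OF Q order_refl Bu])
    fix v assume "v \<in> {..<Suc k} \<times> Z" "v \<notin> {..<k} \<times> Z"
    then have "snd v \<in> Z" by auto
    then show "m j (snd v) \<in> B \<and> sort_of M (m j (snd v)) = s (snd v)"
      using m(1)[of j, unfolded asg_def] m(2)[of j] by blast
  qed
  have Rm: "?Q (seq (\<lambda>l. m ((f(k := j)) l))) = ?R (seq (\<lambda>l. m (f l)))" for f
  proof -
    let ?g = "seq (\<lambda>l. m ((f(k := j)) l))"
    let ?g' = "\<lambda>v. if v \<in> {..<k} \<times> Z then m (f (fst v)) (snd v) else m j (snd v)"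
    have "asg ({..<Suc k} \<times> Z) ?s ?g" using m(1) by (auto simp: asg_def)
    moreover have "\<forall>v\<in>{..<Suc k} \<times> Z. ?g v = ?g' v" by auto
    ultimately show ?thesis by (rule definable_agree[OF Q, of ?g ?g'])
  qed
  have "?R (seq d)" by (rule iffD2[OF d(2)[OF R]]) (use j in \<open>simp only: Rm\<close>)
  moreover have "?R (seq d) = ?Q (\<lambda>v. if fst v < k then seq d v else m j (snd v))"
  proof (rule definable_agree[OF Q, of "\<lambda>v. if v \<in> {..<k} \<times> Z then seq d v else m j (snd v)"
        "\<lambda>v. if fst v < k then seq d v else m j (snd v)"])
    show "asg ({..<Suc k} \<times> Z) ?s (\<lambda>v. if v \<in> {..<k} \<times> Z then seq d v else m j (snd v))"
      using d(1) m(1) by (auto simp: asg_def)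
  qed auto
  ultimately have "P' (case_sum (m j) id)" using Qe[OF m(1)] by simp
  then show ?thesis using P'(2) m(1) by blast
qed

end

section \<open>Indiscernible sequences\<close>

context monster
begin

text \<open>Indiscernibility is used in the form of conjugacy. It is enough to compare every increasing tuple
  with the initial segment of the same length.\<close>

definition indisc :: "'a set \<Rightarrow> (nat \<Rightarrow> 'a list) \<Rightarrow> bool" where
  "indisc B c \<longleftrightarrow> (\<forall>j. set (c j) \<subseteq> univ M) \<and>
    (\<forall>n h. (\<forall>i j. i < j \<longrightarrow> j < n \<longrightarrow> h i < h j) \<longrightarrow> (\<exists>\<sigma>\<in>Aut B. \<forall>k<n. map \<sigma> (c k) = c (h k)))"

lemma indiscD:
  "indisc B c \<Longrightarrow> (\<And>i j. i < j \<Longrightarrow> j < n \<Longrightarrow> h i < h j) \<Longrightarrow> \<exists>\<sigma>\<in>Aut B. \<forall>k<n. map \<sigma> (c k) = c (h k)"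
  unfolding indisc_def by simp

lemma indisc_univ: "indisc B c \<Longrightarrow> set (c j) \<subseteq> univ M"
  unfolding indisc_def by simp

lemma indisc_mono:
  assumes c: "indisc B c" and A: "A \<subseteq> B"
  shows "indisc A c"
  unfolding indisc_def
proof (intro conjI allI impI)
  show "set (c j) \<subseteq> univ M" for j by (rule indisc_univ[OF c])
  fix n :: nat and h :: "nat \<Rightarrow> nat"
  assume h: "\<forall>i j. i < j \<longrightarrow> j < n \<longrightarrow> h i < h j"
  obtain \<sigma> where \<sigma>: "\<sigma> \<in> Aut B" "\<forall>k<n. map \<sigma> (c k) = c (h k)"
    using indiscD[OF c, of n h] h by blast
  show "\<exists>\<sigma>\<in>Aut A. \<forall>k<n. map \<sigma> (c k) = c (h k)"
    by (intro bexI[of _ \<sigma>] \<sigma>(2) Aut_mono[OF \<sigma>(1) A])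
qed

lemma indisc_Aut:
  assumes "indisc B c" "\<sigma> \<in> Aut {}" "B \<subseteq> univ M"
  shows "indisc (\<sigma> ` B) (\<lambda>j. map \<sigma> (c j))"
  unfolding indisc_def
proof (intro conjI allI impI)
  show "set (map \<sigma> (c j)) \<subseteq> univ M" for j
    using indisc_univ[OF assms(1)] Aut_univ_image[OF assms(2)] by simp
  fix n :: nat and h :: "nat \<Rightarrow> nat" assume h: "\<forall>i j. i < j \<longrightarrow> j < n \<longrightarrow> h i < h j"
  obtain \<tau> where \<tau>: "\<tau> \<in> Aut B" "\<forall>k<n. map \<tau> (c k) = c (h k)"
    using indiscD[OF assms(1), of n h] h by blast
  obtain \<rho> where \<rho>: "\<rho> \<in> Aut (\<sigma> ` B)" "\<And>x. x \<in> univ M \<Longrightarrow> \<rho> (\<sigma> x) = \<sigma> (\<tau> x)"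
    using Aut_conj[OF assms(2) \<tau>(1) assms(3)] by blast
  have "map \<rho> (map \<sigma> (c k)) = map \<sigma> (c (h k))" if "k < n" for k
  proof -
    have "map \<rho> (map \<sigma> (c k)) = map \<sigma> (map \<tau> (c k))"
      using \<rho>(2) indisc_univ[OF assms(1), of k] by auto
    then show ?thesis using \<tau>(2) that by simp
  qed
  then show "\<exists>\<sigma>'\<in>Aut (\<sigma> ` B). \<forall>k<n. map \<sigma>' (map \<sigma> (c k)) = map \<sigma> (c (h k))"
    by (intro bexI[OF _ \<rho>(1)]) blast
qed

text \<open>The type of \<open>a\<close> over \<open>N\<close> is finitely satisfiable in \<open>N\<close>, so it is the average along some
  ultrafilter of assignments with values in \<open>N\<close>. In the sequence of iterated averages the type of
  each term over \<open>N\<close> and the earlier terms is again finitely satisfiable in \<open>N\<close>; this gives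
  independence.\<close>

theorem Morley_sequence_over_model:
  assumes a: "set a \<subseteq> univ M" and N: "model N" "smallset N"
  shows "\<exists>c. c 0 = a \<and> (\<forall>j. \<exists>\<sigma>\<in>Aut N. c j = map \<sigma> a) \<and> indisc N c \<and>
    (\<forall>j. ind (set (c j)) N (\<Union>l<j. set (c l)))"
proof -
  let ?Z = "set a"
  have Nu: "N \<subseteq> univ M" "sm N" using N(2) by (simp_all add: smallset_def)
  define valid where "valid g \<longleftrightarrow> asg ?Z (sort_of M) g \<and> g ` ?Z \<subseteq> N" for g
  have wit: "\<exists>g. valid g \<and> P g" if "definable N ?Z (sort_of M) P" "P id" for P
    using model_witness[OF N(1) finite_set that(1) asg_id[OF a] that(2)] unfolding valid_def by blast
  obtain g0 where g0: "valid g0" using wit[OF definable_True] by blast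
  define m where "m g = (if valid g then g else g0)" for g
  have mv: "valid (m g)" for g using g0 by (simp add: m_def)
  let ?F = "(\<lambda>P. {g. P (m g)}) ` {P. definable N ?Z (sort_of M) P \<and> P id}"
  have fip: "\<Inter>F0 \<noteq> {}" if F0: "finite F0" "F0 \<subseteq> ?F" for F0
  proof -
    from finite_subset_image[OF F0] obtain \<Pi> where \<Pi>: "\<Pi> \<subseteq> {P. definable N ?Z (sort_of M) P \<and> P id}"
      "finite \<Pi>" "F0 = (\<lambda>P. {g. P (m g)}) ` \<Pi>" by (elim exE conjE)
    have "definable N ?Z (sort_of M) (\<lambda>g. \<forall>P\<in>\<Pi>. P g)"
      by (rule definable_Ball[OF \<Pi>(2)]) (use \<Pi>(1) in blast)
    moreover have "\<forall>P\<in>\<Pi>. P id" using \<Pi>(1) by blast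
    ultimately have "\<exists>g. valid g \<and> (\<forall>P\<in>\<Pi>. P g)" by (rule wit)
    then obtain g where g: "valid g" "\<forall>P\<in>\<Pi>. P g" by (elim exE conjE)
    have "m g = g" using g(1) by (simp add: m_def)
    then have "g \<in> \<Inter>F0" unfolding \<Pi>(3) using g(2) by simp
    then show ?thesis by blast
  qed
  have "\<exists>U. ultra U \<and> (\<forall>X\<in>?F. U (\<lambda>g. g \<in> X))" by (rule ex_ultra) (rule fip)
  then obtain U where U: "ultra U" and UF: "\<forall>X\<in>?F. U (\<lambda>g. g \<in> X)" by (elim exE conjE)
  have UP: "U (\<lambda>g. P (m g))" if "definable N ?Z (sort_of M) P" "P id" for P
  proof -
    have "{g. P (m g)} \<in> ?F" using that by (intro imageI CollectI conjI)
    from bspec[OF UF this] show ?thesis by simp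
  qed
  have ma: "asg ?Z (sort_of M) (m g)" "m g ` ?Z \<subseteq> N" for g using mv unfolding valid_def by simp_all
  from average_sequence[where m = m, OF U finite_set N(2) ma(1)] obtain d where
    d0: "(\<forall>k. asg ?Z (sort_of M) (d k)) \<and> (\<forall>n P. definable N ({..<n} \<times> ?Z) (\<lambda>v. sort_of M (snd v)) P \<longrightarrow>
      (P (seq d) \<longleftrightarrow> UU U n (\<lambda>f. P (seq (\<lambda>k. m (f k))))))" by (elim exE)
  have da: "asg ?Z (sort_of M) (d k)" for k using d0 by simp
  have dU: "P (seq d) \<longleftrightarrow> UU U n (\<lambda>f. P (seq (\<lambda>k. m (f k))))"
    if "definable N ({..<n} \<times> ?Z) (\<lambda>v. sort_of M (snd v)) P" for n P
    using conjunct2[OF d0] that by blast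
  have "\<exists>\<sigma>\<in>Aut N. \<forall>u\<in>?Z. \<sigma> (id u) = d 0 u"
  proof (rule homogeneity[OF Nu _ asg_id[OF a] da])
    show "sm ?Z" by simp
    fix P assume P: "definable N ?Z (sort_of M) P" "P id"
    have "definable N ({..<Suc 0} \<times> ?Z) (\<lambda>v. sort_of M (snd v)) (\<lambda>g. P (\<lambda>p. g (0, p)))"
      by (rule definable_rename[OF P(1) Nu(1)]) simp
    from dU[OF this] have "P (d 0) = U (\<lambda>j. P (m j))" by simp
    then show "P (d 0)" using UP[OF P] by simp
  qed
  then obtain \<sigma>0 where \<sigma>0: "\<sigma>0 \<in> Aut N" "\<forall>u\<in>?Z. \<sigma>0 u = d 0 u" by auto
  obtain \<tau> where \<tau>: "\<tau> \<in> Aut N" "\<And>x. x \<in> univ M \<Longrightarrow> \<tau> (\<sigma>0 x) = x"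
    using Aut_inv[OF \<sigma>0(1) Nu(1)] by blast
  have \<tau>e: "\<tau> \<in> Aut {}" using Aut_mono[OF \<tau>(1)] by simp
  have \<tau>N: "\<tau> ` N = N" using Aut_fix_image[OF \<tau>(1)] by blast
  define c where "c j = map (\<lambda>u. \<tau> (d j u)) a" for j
  have c0: "c 0 = a"
  proof -
    have "\<tau> (d 0 u) = u" if "u \<in> ?Z" for u
    proof -
      have "u \<in> univ M" using a that by blast
      from \<tau>(2)[OF this] show ?thesis using \<sigma>0(2) that by simp
    qed
    then show ?thesis unfolding c_def by (simp add: map_idI)
  qed
  have du: "d j u \<in> univ M" if "u \<in> ?Z" for j u using da that by (simp add: asg_def)
  have cset: "set (c j) = \<tau> ` d j ` ?Z" for j by (auto simp: c_def)
  have ind_c: "indisc N c" unfolding indisc_def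
  proof (intro conjI allI impI)
    show "set (c j) \<subseteq> univ M" for j unfolding cset using du Aut_univ[OF \<tau>(1)] by blast
    fix n :: nat and h :: "nat \<Rightarrow> nat" assume h: "\<forall>i j. i < j \<longrightarrow> j < n \<longrightarrow> h i < (h j :: nat)"
    have "\<exists>\<sigma>\<in>Aut N. \<forall>k<n. \<forall>p\<in>?Z. \<sigma> (d k p) = d (h k) p"
      by (rule average_indiscernible[OF U finite_set N(2) ma(1) da dU]) (use h in blast)+
    then obtain \<sigma> where \<sigma>: "\<sigma> \<in> Aut N" "\<forall>k<n. \<forall>p\<in>?Z. \<sigma> (d k p) = d (h k) p" by (elim bexE)
    obtain \<rho> where \<rho>: "\<rho> \<in> Aut (\<tau> ` N)" "\<And>x. x \<in> univ M \<Longrightarrow> \<rho> (\<tau> x) = \<tau> (\<sigma> x)"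
      using Aut_conj[OF \<tau>e \<sigma>(1) Nu(1)] by blast
    have "map \<rho> (c k) = c (h k)" if "k < n" for k
      unfolding c_def using \<rho>(2)[OF du] \<sigma>(2) that by simp
    then show "\<exists>\<sigma>\<in>Aut N. \<forall>k<n. map \<sigma> (c k) = c (h k)"
      using \<rho>(1) unfolding \<tau>N by (intro bexI[of _ \<rho>]) simp_all
  qed
  have conj: "\<exists>\<sigma>\<in>Aut N. c j = map \<sigma> a" for j
  proof -
    from indiscD[OF ind_c, of 1 "\<lambda>_. j"] obtain \<sigma> where "\<sigma> \<in> Aut N" "map \<sigma> (c 0) = c j" by auto
    then show ?thesis unfolding c0 by (intro bexI[of _ \<sigma>]) simp_all
  qed
  have "ind (set (c k)) N (\<Union>l<k. set (c l))" for k
  proof -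
    let ?C = "d k ` ?Z" and ?E = "\<Union>l<k. d l ` ?Z"
    have dZ: "smallset (d l ` ?Z)" for l using du by (intro smallset_finite) auto
    have E: "smallset ?E" by (rule smallset_UN_finite) (use dZ in auto)
    have "ind ?C N ?E"
    proof (rule finitely_satisfiable_ind[OF dZ N(2) E])
      fix P assume P: "definable (N \<union> ?E) ?C (sort_of M) P" "P id"
      define pick where "pick u = (SOME p. p \<in> ?Z \<and> d k p = u)" for u
      have pick: "pick u \<in> ?Z \<and> d k (pick u) = u" if "u \<in> ?C" for u
        unfolding pick_def by (rule someI_ex) (use that in blast)
      have ps: "sort_of M (pick u) = sort_of M u" if "u \<in> ?C" for u
      proof -
        have "sort_of M (d k (pick u)) = sort_of M (pick u)" using da[of k] conjunct1[OF pick[OF that]] unfolding asg_def by blast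
        then show ?thesis using pick[OF that] by simp
      qed
      have NE: "N \<union> ?E \<subseteq> univ M" using Nu(1) E by (simp add: smallset_def)
      have "definable (N \<union> ?E) ?Z (sort_of M) (\<lambda>g. P (\<lambda>u. g (pick u)))"
        by (rule definable_rename[OF P(1) NE]) (use pick ps in blast)
      moreover have "P (\<lambda>u. d k (pick u))"
      proof -
        have "?C \<subseteq> univ M" using dZ[of k] by (simp add: smallset_def)
        from definable_agree[OF P(1) asg_id[OF this], of "\<lambda>u. d k (pick u)"] show ?thesis
          using pick P(2) by simp
      qed
      ultimately have "\<exists>j. P (\<lambda>u. m j (pick u))"
        using average_finitely_satisfiable[where P = "\<lambda>g. P (\<lambda>u. g (pick u))" and d = d,
          OF U finite_set N(2) ma da dU] by blast
      then obtain j where j: "P (\<lambda>u. m j (pick u))" ..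
      show "\<exists>g. asg ?C (sort_of M) g \<and> g ` ?C \<subseteq> N \<and> P g"
      proof (intro exI[of _ "\<lambda>u. m j (pick u)"] conjI j)
        show "asg ?C (sort_of M) (\<lambda>u. m j (pick u))" unfolding asg_def
        proof
          fix u assume u: "u \<in> ?C"
          show "m j (pick u) \<in> univ M \<and> sort_of M (m j (pick u)) = sort_of M u"
            using ma(1)[of j] pick[OF u] ps[OF u] by (simp add: asg_def)
        qed
        show "(\<lambda>u. m j (pick u)) ` ?C \<subseteq> N"
        proof (rule image_subsetI)
          fix u assume u: "u \<in> ?C"
          show "m j (pick u) \<in> N" using ma(2)[of j] pick[OF u] by blast
        qed
      qed
    qed
    from ind_Aut[OF this \<tau>e dZ N(2) E] show ?thesis unfolding \<tau>N cset image_UN .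
  qed
  then show ?thesis using c0 conj ind_c by (intro exI[of _ c]) simp
qed

section \<open>Extracting an indiscernible sequence\<close>

text \<open>The sequence of iterated averages of \<open>c\<close> along a nonprincipal ultrafilter on the indices. The
  order is reversed: later terms belong to outer quantifiers, which are instantiated first, and each
  inner index may be taken above those already chosen.\<close>

lemma extract_reversed:
  fixes c :: "nat \<Rightarrow> 'a list"
  assumes c: "\<And>j. c j \<in> tuples M ss" and B: "smallset B"
  shows "\<exists>d. (\<forall>j. d j \<in> tuples M ss) \<and> indisc B d \<and>
    (\<forall>n P. definable B ({..<n} \<times> {..<length ss}) (\<lambda>v. ss ! snd v) P \<longrightarrow>
      (\<forall>f. (\<forall>i j. i < j \<longrightarrow> j < n \<longrightarrow> f j < f i) \<longrightarrow> P (seq (\<lambda>k. (!) (c (f k))))) \<longrightarrow>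
      P (seq (\<lambda>k. (!) (d k))))"
proof -
  let ?Z = "{..<length ss}"
  let ?s = "\<lambda>p. ss ! p"
  have fip: "\<Inter>F0 \<noteq> {}" if F0: "finite F0" "F0 \<subseteq> range (\<lambda>l::nat. {j. l < j})" for F0
  proof -
    from finite_subset_image[OF F0] obtain I where I: "finite I" "F0 = (\<lambda>l. {j. l < j}) ` I" by blast
    have "Suc (\<Sum>I) \<in> \<Inter>F0" unfolding I(2)
      using member_le_sum[of _ I "\<lambda>x. x"] I(1) by (auto simp: less_Suc_eq_le)
    then show ?thesis by blast
  qed
  have "\<exists>U. ultra U \<and> (\<forall>X\<in>range (\<lambda>l::nat. {j. l < j}). U (\<lambda>j. j \<in> X))"
    by (rule ex_ultra) (rule fip)
  then obtain U :: "(nat \<Rightarrow> bool) \<Rightarrow> bool" where U: "ultra U"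
    and t0: "\<forall>X\<in>range (\<lambda>l::nat. {j. l < j}). U (\<lambda>j. j \<in> X)" by (elim exE conjE)
  have tails: "U (\<lambda>j. l < j)" for l using t0 by simp
  have m: "asg ?Z ?s ((!) (c j))" for j unfolding asg_def
  proof
    fix p assume "p \<in> ?Z"
    moreover have "sorts M (c j) = ss" "set (c j) \<subseteq> univ M" using c[of j] by (simp_all add: tuples_def)
    ultimately show "c j ! p \<in> univ M \<and> sort_of M (c j ! p) = ss ! p" by auto
  qed
  from average_sequence[where m = "\<lambda>j. (!) (c j)", OF U finite_lessThan B m] obtain d where
    d0: "(\<forall>k. asg ?Z ?s (d k)) \<and> (\<forall>n P. definable B ({..<n} \<times> ?Z) (\<lambda>v. ?s (snd v)) P \<longrightarrow>
      (P (seq d) \<longleftrightarrow> UU U n (\<lambda>f. P (seq (\<lambda>k. (!) (c (f k)))))))" by (elim exE)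
  have da: "asg ?Z ?s (d k)" for k using d0 by simp
  have dU: "P (seq d) \<longleftrightarrow> UU U n (\<lambda>f. P (seq (\<lambda>k. (!) (c (f k)))))"
    if "definable B ({..<n} \<times> ?Z) (\<lambda>v. ?s (snd v)) P" for n P
    using conjunct2[OF d0] that by blast
  define e where "e k = map (d k) [0..<length ss]" for k
  have ed: "e k ! p = d k p" if "p \<in> ?Z" for k p using that by (simp add: e_def)
  have et: "e j \<in> tuples M ss" for j unfolding tuples_def
  proof (intro CollectI conjI)
    show "set (e j) \<subseteq> univ M" using da[of j] by (auto simp: e_def asg_def)
    show "sorts M (e j) = ss" using da[of j] by (intro nth_equalityI) (auto simp: e_def asg_def)
  qed
  moreover have "indisc B e" unfolding indisc_def
  proof (intro conjI allI impI)
    show "set (e j) \<subseteq> univ M" for j using et[of j] by (simp add: tuples_def)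
    fix n :: nat and h :: "nat \<Rightarrow> nat" assume h: "\<forall>i j. i < j \<longrightarrow> j < n \<longrightarrow> h i < (h j :: nat)"
    have "\<exists>\<sigma>\<in>Aut B. \<forall>k<n. \<forall>p\<in>?Z. \<sigma> (d k p) = d (h k) p"
      by (rule average_indiscernible[OF U finite_lessThan B m da dU]) (use h in blast)+
    then obtain \<sigma> where \<sigma>: "\<sigma> \<in> Aut B" "\<forall>k<n. \<forall>p\<in>?Z. \<sigma> (d k p) = d (h k) p" by (elim bexE)
    then have "\<forall>k<n. map \<sigma> (e k) = e (h k)" by (simp add: e_def)
    then show "\<exists>\<sigma>\<in>Aut B. \<forall>k<n. map \<sigma> (e k) = e (h k)" using \<sigma>(1) by (intro bexI[of _ \<sigma>])
  qed
  moreover have "P (seq (\<lambda>k. (!) (e k)))"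
    if P: "definable B ({..<n} \<times> ?Z) (\<lambda>v. ss ! snd v) P"
      and f: "\<forall>f. (\<forall>i j. i < j \<longrightarrow> j < n \<longrightarrow> f j < f i) \<longrightarrow> P (seq (\<lambda>k. (!) (c (f k))))" for n P
  proof -
    have "UU U n (\<lambda>f. P (seq (\<lambda>k. (!) (c (f k)))))"
      by (rule UU_decreasing[OF U tails, where l = 0]) (use f in blast)
    then have "P (seq d)" using dU[OF P] by simp
    moreover have "P (seq d) = P (seq (\<lambda>k. (!) (e k)))"
      by (rule definable_agree[OF P]) (use da ed in \<open>auto simp: asg_def\<close>)
    ultimately show ?thesis by simp
  qed
  ultimately show ?thesis by (intro exI[of _ e] conjI allI impI)
qed

text \<open>Extracting twice restores the order.\<close>

theorem extract_indiscernible: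
  fixes c :: "nat \<Rightarrow> 'a list"
  assumes c: "\<And>j. c j \<in> tuples M ss" and B: "smallset B"
  shows "\<exists>d. (\<forall>j. d j \<in> tuples M ss) \<and> indisc B d \<and>
    (\<forall>n P. definable B ({..<n} \<times> {..<length ss}) (\<lambda>v. ss ! snd v) P \<longrightarrow>
      (\<forall>f. (\<forall>i j. i < j \<longrightarrow> j < n \<longrightarrow> f i < f j) \<longrightarrow> P (seq (\<lambda>k. (!) (c (f k))))) \<longrightarrow>
      P (seq (\<lambda>k. (!) (d k))))"
proof -
  let ?Z = "{..<length ss}"
  let ?s = "\<lambda>v :: nat \<times> nat. ss ! snd v"
  have Bu: "B \<subseteq> univ M" using B by (simp add: smallset_def)
  from extract_reversed[where c = c, OF c B] obtain d where d: "\<forall>j. d j \<in> tuples M ss" "indisc B d"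
    "\<forall>n P. definable B ({..<n} \<times> ?Z) ?s P \<longrightarrow>
      (\<forall>f. (\<forall>i j. i < j \<longrightarrow> j < n \<longrightarrow> f j < f i) \<longrightarrow> P (seq (\<lambda>k. (!) (c (f k))))) \<longrightarrow>
      P (seq (\<lambda>k. (!) (d k)))" by (elim exE conjE)
  have dt: "d j \<in> tuples M ss" for j using d(1) by simp
  from extract_reversed[where c = d, OF dt B] obtain e where e: "\<forall>j. e j \<in> tuples M ss" "indisc B e"
    "\<forall>n P. definable B ({..<n} \<times> ?Z) ?s P \<longrightarrow>
      (\<forall>f. (\<forall>i j. i < j \<longrightarrow> j < n \<longrightarrow> f j < f i) \<longrightarrow> P (seq (\<lambda>k. (!) (d (f k))))) \<longrightarrow>
      P (seq (\<lambda>k. (!) (e k)))" by (elim exE conjE)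
  have asg_t: "asg ({..<n} \<times> ?Z) ?s (seq (\<lambda>k. (!) (b k)))" if b: "\<And>j. b j \<in> tuples M ss" for n b
    unfolding asg_def
  proof
    fix v :: "nat \<times> nat" assume "v \<in> {..<n} \<times> ?Z"
    moreover have "sorts M (b (fst v)) = ss" "set (b (fst v)) \<subseteq> univ M" using b[of "fst v"] by (simp_all add: tuples_def)
    ultimately show "b (fst v) ! snd v \<in> univ M \<and> sort_of M (b (fst v) ! snd v) = ss ! snd v" by auto
  qed
  have "P (seq (\<lambda>k. (!) (e k)))"
    if P: "definable B ({..<n} \<times> ?Z) ?s P"
      and f: "\<forall>f. (\<forall>i j. i < j \<longrightarrow> j < n \<longrightarrow> f i < f j) \<longrightarrow> P (seq (\<lambda>k. (!) (c (f k))))" for n P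
  proof -
    let ?P = "\<lambda>g. P (\<lambda>v. g (n - 1 - fst v, snd v))"
    have P': "definable B ({..<n} \<times> ?Z) ?s ?P" by (rule definable_rename[OF P Bu]) auto
    have c1: "?P (seq (\<lambda>k. (!) (c (f k))))" if "\<forall>i j. i < j \<longrightarrow> j < n \<longrightarrow> f j < f i" for f :: "nat \<Rightarrow> nat"
    proof -
      let ?f = "\<lambda>k. if k < n then f (n - 1 - k) else 0"
      have "\<forall>i j. i < j \<longrightarrow> j < n \<longrightarrow> ?f i < ?f j" using that by auto
      from mp[OF spec[OF f, of ?f] this] have "P (seq (\<lambda>k. (!) (c (?f k))))" .
      moreover have "P (seq (\<lambda>k. (!) (c (?f k)))) = ?P (seq (\<lambda>k. (!) (c (f k))))"
        by (rule definable_agree[OF P asg_t[OF c]]) auto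
      ultimately show ?thesis by simp
    qed
    have Pd: "?P (seq (\<lambda>k. (!) (d k)))"
      by (rule mp[OF mp[OF spec[OF spec[OF d(3), of n], of ?P] P']], intro allI impI, rule c1)
    have d1: "P (seq (\<lambda>k. (!) (d (f k))))" if fd: "\<forall>i j. i < j \<longrightarrow> j < n \<longrightarrow> f j < f i" for f :: "nat \<Rightarrow> nat"
    proof -
      let ?f = "\<lambda>k. f (n - 1 - k)"
      obtain \<sigma> where \<sigma>: "\<sigma> \<in> Aut B" "\<forall>k<n. map \<sigma> (d k) = d (?f k)"
        using indiscD[OF d(2), of n ?f] fd by auto
      have as: "asg ({..<n} \<times> ?Z) ?s (seq (\<lambda>k. (!) (d k)))" by (rule asg_t) (simp add: d(1))
      have "?P (\<lambda>v. \<sigma> (seq (\<lambda>k. (!) (d k)) v))" using definable_Aut[OF P' \<sigma>(1) as Bu] Pd by (simp only:)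
      moreover have "?P (\<lambda>v. \<sigma> (seq (\<lambda>k. (!) (d k)) v)) = P (seq (\<lambda>k. (!) (d (f k))))"
      proof (rule definable_agree[OF P])
        show "asg ({..<n} \<times> ?Z) ?s (\<lambda>v. \<sigma> (seq (\<lambda>k. (!) (d k)) (n - 1 - fst v, snd v)))"
          using asg_Aut[OF \<sigma>(1) as] by (auto simp: asg_def)
        show "\<forall>v\<in>{..<n} \<times> ?Z. \<sigma> (seq (\<lambda>k. (!) (d k)) (n - 1 - fst v, snd v)) = seq (\<lambda>k. (!) (d (f k))) v"
        proof
          fix v assume v: "v \<in> {..<n} \<times> ?Z"
          let ?k = "n - 1 - fst v"
          have k: "?k < n" "n - 1 - ?k = fst v" using v by auto
          have len: "length (d j) = length ss" for j
            using d(1) by (auto simp: tuples_def dest: map_eq_imp_length_eq)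
          have "map \<sigma> (d ?k) ! snd v = d (f (fst v)) ! snd v" using \<sigma>(2) k by simp
          moreover have "snd v < length (d ?k)" using v len by auto
          ultimately show "\<sigma> (seq (\<lambda>k. (!) (d k)) (?k, snd v)) = seq (\<lambda>k. (!) (d (f k))) v" by simp
        qed
      qed
      ultimately show ?thesis by simp
    qed
    show ?thesis
      by (rule mp[OF mp[OF spec[OF spec[OF e(3), of n], of P] P]], intro allI impI, rule d1)
  qed
  then show ?thesis using spec[OF e(1)] e(2) by (intro exI[of _ e] conjI allI impI)
qed

end

section \<open>Ehrenfeucht-Mostowski types\<close>

context monster
begin

lemma definable_bound_support:
  assumes P: "definable B (UNIV \<times> Z) s P"
  shows "\<exists>n P'. definable B ({..<n::nat} \<times> Z) s P' \<and> (\<forall>g. asg (UNIV \<times> Z) s g \<longrightarrow> P g = P' g)"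
proof -
  from definable_finite_support[OF P] obtain W P' C where W: "finite W" "W \<subseteq> UNIV \<times> Z" "C \<subseteq> B"
    "definable C W s P'" "\<forall>g. asg (UNIV \<times> Z) s g \<longrightarrow> P g = P' g" by (elim exE conjE)
  obtain n where n: "\<forall>k\<in>fst ` W. k < n" using W(1) finite_nat_set_iff_bounded[of "fst ` W"] by auto
  have "W \<subseteq> {..<n} \<times> Z"
  proof
    fix v assume v: "v \<in> W"
    then have "fst v < n" using n by blast
    then show "v \<in> {..<n} \<times> Z" using subsetD[OF W(2) v] by (auto simp: mem_Times_iff)
  qed
  from definable_mono[OF W(4,3) this] W(5) show ?thesis by blast
qed

lemma asg_tuples:
  fixes c :: "nat \<Rightarrow> 'a list"
  assumes "\<And>j. c j \<in> tuples M ss"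
  shows "asg (X \<times> {..<length ss}) (\<lambda>v. ss ! snd v) (seq (\<lambda>k. (!) (c k)))"
  unfolding asg_def
proof
  fix v assume "v \<in> X \<times> {..<length ss}"
  then have "snd v < length ss" by auto
  moreover have "sorts M (c (fst v)) = ss" "set (c (fst v)) \<subseteq> univ M"
    using assms[of "fst v"] by (simp_all add: tuples_def)
  ultimately show "c (fst v) ! snd v \<in> univ M \<and> sort_of M (c (fst v) ! snd v) = ss ! snd v" by auto
qed

lemma length_tuples: "a \<in> tuples M ss \<Longrightarrow> length a = length ss"
  by (auto simp: tuples_def)

lemma entries_univ: "(\<And>j. c j \<in> tuples M ss) \<Longrightarrow> entries c \<subseteq> univ M"
  by (auto simp: entries_def tuples_def)

lemma smallset_entries: "(\<And>j. c j \<in> tuples M ss) \<Longrightarrow> smallset (entries c)"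
  using entries_univ[of c ss] sm_entries by (simp add: smallset_def)

lemma indisc_shift:
  fixes f :: "nat \<Rightarrow> nat"
  assumes c: "\<And>j. c j \<in> tuples M ss" "indisc A c" and A: "A \<subseteq> univ M"
    and f: "\<forall>i j. i < j \<longrightarrow> j < n \<longrightarrow> f i < f j"
    and P: "definable A ({..<n} \<times> {..<length ss}) (\<lambda>v. ss ! snd v) P"
  shows "P (seq (\<lambda>k. (!) (c (f k)))) = P (seq (\<lambda>k. (!) (c k)))"
proof -
  obtain \<sigma> where \<sigma>: "\<sigma> \<in> Aut A" "\<forall>k<n. map \<sigma> (c k) = c (f k)"
    using indiscD[OF c(2), of n f] f by blast
  let ?g = "seq (\<lambda>k. (!) (c k))"
  have as: "asg ({..<n} \<times> {..<length ss}) (\<lambda>v. ss ! snd v) ?g" by (rule asg_tuples[OF c(1)])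
  have "P (\<lambda>v. \<sigma> (?g v)) = P ?g" by (rule definable_Aut[OF P \<sigma>(1) as A])
  moreover have "P (\<lambda>v. \<sigma> (?g v)) = P (seq (\<lambda>k. (!) (c (f k))))"
  proof (rule definable_agree[OF P asg_Aut[OF \<sigma>(1) as]])
    show "\<forall>v\<in>{..<n} \<times> {..<length ss}. \<sigma> (?g v) = seq (\<lambda>k. (!) (c (f k))) v"
    proof
      fix v assume v: "v \<in> {..<n} \<times> {..<length ss}"
      then have "map \<sigma> (c (fst v)) ! snd v = c (f (fst v)) ! snd v" using \<sigma>(2) by auto
      moreover have "snd v < length (c (fst v))" using v length_tuples[OF c(1)] by auto
      ultimately show "\<sigma> (?g v) = seq (\<lambda>k. (!) (c (f k))) v" by simp
    qed
  qed
  ultimately show ?thesis by simp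
qed

text \<open>Only conditions that hold of all increasing subtuples of \<open>c\<close> are transferred to \<open>d\<close>; so the
  relation is meaningful although \<open>c\<close> is not indiscernible over \<open>B\<close> in general.\<close>

definition em :: "'s list \<Rightarrow> 'a set \<Rightarrow> (nat \<Rightarrow> 'a list) \<Rightarrow> (nat \<Rightarrow> 'a list) \<Rightarrow> bool" where
  "em ss B c d \<longleftrightarrow> (\<forall>j. c j \<in> tuples M ss) \<and> (\<forall>j. d j \<in> tuples M ss) \<and>
    (\<forall>n P. definable B ({..<n} \<times> {..<length ss}) (\<lambda>v. ss ! snd v) P \<longrightarrow>
      (\<forall>f. (\<forall>i j. i < j \<longrightarrow> j < n \<longrightarrow> f i < f j) \<longrightarrow> P (seq (\<lambda>k. (!) (c (f k))))) \<longrightarrow>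
      P (seq (\<lambda>k. (!) (d k))))"

lemma emD:
  assumes "em ss B c d" "definable B ({..<n} \<times> {..<length ss}) (\<lambda>v. ss ! snd v) P"
    "\<And>f. (\<forall>i j. i < j \<longrightarrow> j < n \<longrightarrow> f i < f j) \<Longrightarrow> P (seq (\<lambda>k. (!) (c (f k))))"
  shows "P (seq (\<lambda>k. (!) (d k)))"
  using assms unfolding em_def by blast

text \<open>Over the set \<open>A\<close> over which \<open>c\<close> is already indiscernible, what is true of \<open>c\<close> is true of all its
  increasing subtuples, hence of \<open>d\<close>.\<close>

lemma em_conjugate:
  assumes e: "em ss B c d" and c: "indisc A c" and A: "smallset A" "A \<subseteq> B"
  shows "\<exists>\<sigma>\<in>Aut A. \<forall>k. map \<sigma> (c k) = d k"
proof -
  let ?Z = "{..<length ss}"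
  let ?s = "\<lambda>v :: nat \<times> nat. ss ! snd v"
  have ct: "c j \<in> tuples M ss" and dt: "d j \<in> tuples M ss" for j using e by (simp_all add: em_def)
  have Au: "A \<subseteq> univ M" "sm A" using A(1) by (simp_all add: smallset_def)
  have "\<exists>\<sigma>\<in>Aut A. \<forall>v\<in>UNIV \<times> ?Z. \<sigma> (seq (\<lambda>k. (!) (c k)) v) = seq (\<lambda>k. (!) (d k)) v"
  proof (rule homogeneity[OF Au _ asg_tuples[OF ct] asg_tuples[OF dt]])
    have "(UNIV :: nat set) \<times> ?Z = (\<Union>p\<in>?Z. (\<lambda>k. (k, p)) ` UNIV)" by auto
    moreover have "sm (\<Union>p\<in>?Z. (\<lambda>k. (k, p)) ` (UNIV :: nat set))"
      by (rule sm_UN_finite[OF finite_lessThan]) (rule sm_image[OF sm_countable])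
    ultimately show "sm ((UNIV :: nat set) \<times> ?Z)" by (simp only:)
    fix P assume P: "definable A (UNIV \<times> ?Z) ?s P" "P (seq (\<lambda>k. (!) (c k)))"
    from definable_bound_support[OF P(1)] obtain n P' where P': "definable A ({..<n} \<times> ?Z) ?s P'"
      "\<forall>g. asg (UNIV \<times> ?Z) ?s g \<longrightarrow> P g = P' g" by (elim exE conjE)
    have Pc: "P' (seq (\<lambda>k. (!) (c k)))" using mp[OF spec[OF P'(2)] asg_tuples[OF ct]] P(2) by (rule iffD1)
    have "P' (seq (\<lambda>k. (!) (d k)))"
    proof (rule emD[OF e definable_mono[OF P'(1) A(2) order_refl]])
      show "P' (seq (\<lambda>k. (!) (c (f k))))" if "\<forall>i j. i < j \<longrightarrow> j < n \<longrightarrow> f i < f j" for f :: "nat \<Rightarrow> nat"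
        by (rule iffD2[OF indisc_shift[OF ct c Au(1) that P'(1)] Pc])
    qed
    then show "P (seq (\<lambda>k. (!) (d k)))" by (rule iffD2[OF mp[OF spec[OF P'(2)] asg_tuples[OF dt]]])
  qed
  then obtain \<sigma> where \<sigma>: "\<sigma> \<in> Aut A"
    "\<forall>v\<in>UNIV \<times> ?Z. \<sigma> (seq (\<lambda>k. (!) (c k)) v) = seq (\<lambda>k. (!) (d k)) v" by (elim bexE)
  have "map \<sigma> (c k) = d k" for k
  proof (rule nth_equalityI)
    show "length (map \<sigma> (c k)) = length (d k)" using length_tuples[OF ct] length_tuples[OF dt] by simp
    fix p assume "p < length (map \<sigma> (c k))"
    then have p: "p < length (c k)" "(k, p) \<in> UNIV \<times> ?Z" using length_tuples[OF ct, of k] by auto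
    from bspec[OF \<sigma>(2) p(2)] show "map \<sigma> (c k) ! p = d k ! p" using p(1) by simp
  qed
  then show ?thesis using \<sigma>(1) by blast
qed

text \<open>A condition on \<open>d\<close> with parameters is expressed in finitely many entries of \<open>d\<close>, named by
  their positions.\<close>

lemma name_entries:
  assumes d: "\<And>j. d j \<in> tuples M ss" and A: "A \<subseteq> univ M"
    and P: "definable (A \<union> entries d) V s P"
  shows "\<exists>n P'. definable A (Inl ` V \<union> Inr ` ({..<n} \<times> {..<length ss})) (case_sum s (\<lambda>v. ss ! snd v)) P' \<and>
    (\<forall>g. asg V s g \<longrightarrow> P g = P' (case_sum g (seq (\<lambda>k. (!) (d k)))))"
proof -
  from definable_finite_support[OF P] obtain W Q C where W: "finite W" "W \<subseteq> V" "finite C" "C \<subseteq> A \<union> entries d"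
    "definable C W s Q" "\<forall>g. asg V s g \<longrightarrow> P g = Q g" by (elim exE conjE)
  let ?E = "C \<inter> entries d"
  have "definable (A \<union> ?E) V s Q" by (rule definable_mono[OF W(5) _ W(2)]) (use W(4) in blast)
  from definable_abstract_params[OF this] obtain P1 where
    P1: "definable A (Inl ` V \<union> Inr ` ?E) (case_sum s (sort_of M)) P1"
      "\<forall>g. asg V s g \<longrightarrow> Q g = P1 (case_sum g id)" by (elim exE conjE)
  have "\<forall>u\<in>?E. \<exists>v. snd v < length ss \<and> seq (\<lambda>k. (!) (d k)) v = u"
  proof
    fix u assume "u \<in> ?E"
    then obtain j p where "p < length (d j)" "u = d j ! p" by (auto simp: entries_def in_set_conv_nth)
    then show "\<exists>v. snd v < length ss \<and> seq (\<lambda>k. (!) (d k)) v = u"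
      using length_tuples[OF d, of j] by (intro exI[of _ "(j, p)"]) simp
  qed
  from bchoice[OF this] obtain nm where
    nm: "\<forall>u\<in>?E. snd (nm u) < length ss \<and> seq (\<lambda>k. (!) (d k)) (nm u) = u" ..
  obtain n where n: "\<forall>k\<in>(\<lambda>u. fst (nm u)) ` ?E. k < n"
    using W(3) finite_nat_set_iff_bounded[of "(\<lambda>u. fst (nm u)) ` ?E"] by auto
  let ?V = "Inl ` V \<union> Inr ` ({..<n} \<times> {..<length ss})"
  let ?h = "case_sum Inl (\<lambda>u. Inr (nm u))"
  let ?P = "\<lambda>g. P1 (\<lambda>t. g (?h t))"
  have Eu: "?E \<subseteq> univ M" using entries_univ[of d, OF d] by blast
  have dP: "definable A ?V (case_sum s (\<lambda>v. ss ! snd v)) ?P"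
  proof (rule definable_rename[OF P1(1) A])
    fix t assume t: "t \<in> Inl ` V \<union> Inr ` ?E"
    show "?h t \<in> ?V \<and> case_sum s (\<lambda>v. ss ! snd v) (?h t) = case_sum s (sort_of M) t"
    proof (cases t)
      case (Inl v)
      then show ?thesis using t by auto
    next
      case (Inr u)
      then have u: "u \<in> ?E" using t by blast
      have "fst (nm u) < n" using n u by blast
      then have nV: "nm u \<in> {..<n} \<times> {..<length ss}" using bspec[OF nm u] by (simp add: mem_Times_iff)
      have as: "asg ({..<n} \<times> {..<length ss}) (\<lambda>v. ss ! snd v) (seq (\<lambda>k. (!) (d k)))" by (rule asg_tuples[OF d])
      have "sort_of M (seq (\<lambda>k. (!) (d k)) (nm u)) = ss ! snd (nm u)"
        by (rule conjunct2[OF bspec[OF as[unfolded asg_def] nV]])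
      then have "sort_of M u = ss ! snd (nm u)" using conjunct2[OF bspec[OF nm u]] by simp
      then show ?thesis using Inr nV by simp
    qed
  qed
  have "P g = ?P (case_sum g (seq (\<lambda>k. (!) (d k))))" if g: "asg V s g" for g
  proof -
    have "P g = P1 (case_sum g id)" using W(6) P1(2) g by blast
    also have "\<dots> = ?P (case_sum g (seq (\<lambda>k. (!) (d k))))"
    proof (rule definable_agree[OF P1(1)])
      show "asg (Inl ` V \<union> Inr ` ?E) (case_sum s (sort_of M)) (case_sum g id)"
        unfolding asg_def
      proof
        fix t assume t: "t \<in> Inl ` V \<union> Inr ` ?E"
        show "case_sum g id t \<in> univ M \<and> sort_of M (case_sum g id t) = case_sum s (sort_of M) t"
        proof (cases t)
          case (Inl v)
          then show ?thesis using t g by (auto simp: asg_def)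
        next
          case (Inr u)
          then have "u \<in> ?E" using t by blast
          from subsetD[OF Eu this] show ?thesis using Inr by simp
        qed
      qed
      show "\<forall>t\<in>Inl ` V \<union> Inr ` ?E. case_sum g id t = case_sum g (seq (\<lambda>k. (!) (d k))) (?h t)"
      proof
        fix t assume t: "t \<in> Inl ` V \<union> Inr ` ?E"
        show "case_sum g id t = case_sum g (seq (\<lambda>k. (!) (d k))) (?h t)"
        proof (cases t)
          case (Inr u)
          then have u: "u \<in> ?E" using t by blast
          from bspec[OF nm u] show ?thesis using Inr by simp
        qed simp
      qed
    qed
    finally show ?thesis .
  qed
  then show ?thesis using dP by (intro exI[of _ n] exI[of _ ?P] conjI allI impI)
qed

lemma definable_fix_vars:
  assumes P: "definable A (Inl ` V \<union> Inr ` W) (case_sum s t) P" and g: "asg V s g" "g ` V \<subseteq> B"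
    and B: "A \<subseteq> B" "B \<subseteq> univ M"
  shows "definable B W t (\<lambda>h. P (case_sum g h))"
proof -
  let ?k = "case_sum (\<lambda>v. Inr (g v)) Inl"
  have D: "definable B W t (\<lambda>h. P (\<lambda>x. case_sum h id (?k x)))"
  proof (rule definable_subst[OF P B])
    fix x assume x: "x \<in> Inl ` V \<union> Inr ` W"
    show "?k x \<in> Inl ` W \<union> Inr ` B \<and> case_sum t (sort_of M) (?k x) = case_sum s t x"
    proof (cases x)
      case (Inl v)
      then have v: "v \<in> V" using x by blast
      then have "g v \<in> B" using g(2) by blast
      moreover have "sort_of M (g v) = s v" using g(1) v by (simp add: asg_def)
      ultimately show ?thesis using Inl by simp
    qed (use x in auto)
  qed
  have eq: "(\<lambda>h. P (\<lambda>x. case_sum h id (?k x))) = (\<lambda>h. P (case_sum g h))"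
    by (intro ext arg_cong[where f = P]) (simp split: sum.split)
  show ?thesis using D unfolding eq .
qed

text \<open>Whether another sequence is indiscernible over \<open>c\<close> is a matter of the Ehrenfeucht-Mostowski
  type of \<open>c\<close> over that sequence.\<close>

lemma em_indisc:
  assumes e: "em ss B c d" and b: "\<And>j. b j \<in> tuples M tt" and E: "E \<subseteq> B" and bB: "entries b \<subseteq> B"
    and B: "smallset B" and i: "indisc (E \<union> entries c) b"
  shows "indisc (E \<union> entries d) b"
  unfolding indisc_def
proof (intro conjI allI impI)
  show "set (b j) \<subseteq> univ M" for j using b[of j] by (simp add: tuples_def)
  fix n :: nat and h :: "nat \<Rightarrow> nat" assume h: "\<forall>i j. i < j \<longrightarrow> j < n \<longrightarrow> h i < (h j :: nat)"
  let ?Z = "{..<length tt}"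
  let ?s = "\<lambda>v :: nat \<times> nat. tt ! snd v"
  have ct: "c j \<in> tuples M ss" and dt: "d j \<in> tuples M ss" for j using e by (simp_all add: em_def)
  have Bu: "B \<subseteq> univ M" using B by (simp add: smallset_def)
  have Eu: "E \<subseteq> univ M" using E Bu by blast
  have Es: "smallset E" by (rule smallset_subset[OF B E])
  have Ed: "E \<union> entries d \<subseteq> univ M" "sm (E \<union> entries d)"
    using Es smallset_entries[of d, OF dt] by (simp_all add: smallset_def)
  have bn: "b j ! p \<in> entries b" if "p < length tt" for j p
    unfolding entries_def by (rule UN_I[of j]) (use that length_tuples[OF b, of j] in auto)
  have "\<exists>\<sigma>\<in>Aut (E \<union> entries d). \<forall>v\<in>{..<n} \<times> ?Z.
    \<sigma> (seq (\<lambda>k. (!) (b k)) v) = seq (\<lambda>k. (!) (b (h k))) v"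
  proof (rule homogeneity[OF Ed])
    show "sm ({..<n} \<times> ?Z)" by simp
    show a1: "asg ({..<n} \<times> ?Z) ?s (seq (\<lambda>k. (!) (b k)))"
      and a2: "asg ({..<n} \<times> ?Z) ?s (seq (\<lambda>k. (!) (b (h k))))"
      by (rule asg_tuples[OF b])+
    fix P assume P: "definable (E \<union> entries d) ({..<n} \<times> ?Z) ?s P" "P (seq (\<lambda>k. (!) (b k)))"
    from name_entries[OF dt Eu P(1)] obtain m P' where
      P': "definable E (Inl ` ({..<n} \<times> ?Z) \<union> Inr ` ({..<m} \<times> {..<length ss})) (case_sum ?s (\<lambda>v. ss ! snd v)) P'"
        "\<forall>g. asg ({..<n} \<times> ?Z) ?s g \<longrightarrow> P g = P' (case_sum g (seq (\<lambda>k. (!) (d k))))" by (elim exE conjE)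
    let ?b = "seq (\<lambda>k. (!) (b k))" and ?bh = "seq (\<lambda>k. (!) (b (h k)))"
    have D: "definable B ({..<m} \<times> {..<length ss}) (\<lambda>v. ss ! snd v)
        (\<lambda>g. P' (case_sum ?b g) \<longrightarrow> P' (case_sum ?bh g))"
      by (intro definable_Imp definable_fix_vars[OF P'(1) a1 _ E Bu] definable_fix_vars[OF P'(1) a2 _ E Bu])
        (use bn bB in auto)
    have "P' (case_sum ?b (seq (\<lambda>k. (!) (d k)))) \<longrightarrow> P' (case_sum ?bh (seq (\<lambda>k. (!) (d k))))"
    proof (rule emD[OF e D])
      fix f :: "nat \<Rightarrow> nat" assume "\<forall>i j. i < j \<longrightarrow> j < m \<longrightarrow> f i < (f j :: nat)"
      let ?c = "seq (\<lambda>k. (!) (c (f k)))"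
      have ac: "asg ({..<m} \<times> {..<length ss}) (\<lambda>v. ss ! snd v) ?c" by (rule asg_tuples[OF ct])
      have "?c v \<in> entries c" if "v \<in> {..<m} \<times> {..<length ss}" for v
        unfolding entries_def
        by (rule UN_I[of "f (fst v)"]) (use that length_tuples[OF ct, of "f (fst v)"] in auto)
      then have cc: "?c ` ({..<m} \<times> {..<length ss}) \<subseteq> E \<union> entries c" by blast
      have Ec: "E \<union> entries c \<subseteq> univ M" using Eu entries_univ[of c, OF ct] by simp
      let ?sw = "case_sum Inr Inl :: (nat \<times> nat) + (nat \<times> nat) \<Rightarrow> (nat \<times> nat) + (nat \<times> nat)"
      have sw: "definable E (Inl ` ({..<m} \<times> {..<length ss}) \<union> Inr ` ({..<n} \<times> ?Z)) (case_sum (\<lambda>v. ss ! snd v) ?s)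
          (\<lambda>g. P' (\<lambda>x. g (?sw x)))"
        by (rule definable_rename[OF P'(1) Eu]) auto
      from definable_fix_vars[OF sw ac cc _ Ec]
      have "definable (E \<union> entries c) ({..<n} \<times> ?Z) ?s (\<lambda>g. P' (\<lambda>x. case_sum ?c g (?sw x)))" by simp
      moreover have "(\<lambda>x. case_sum ?c g (?sw x)) = case_sum g ?c" for g
        by (rule ext) (simp split: sum.split)
      ultimately have "definable (E \<union> entries c) ({..<n} \<times> ?Z) ?s (\<lambda>g. P' (case_sum g ?c))" by (simp only:)
      from indisc_shift[OF b i Ec h this]
      show "P' (case_sum ?b ?c) \<longrightarrow> P' (case_sum ?bh ?c)" by simp
    qed
    moreover have "P' (case_sum ?b (seq (\<lambda>k. (!) (d k))))"
      by (rule iffD1[OF mp[OF spec[OF P'(2)] a1] P(2)])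
    ultimately have "P' (case_sum ?bh (seq (\<lambda>k. (!) (d k))))" by (rule mp)
    then show "P ?bh" by (rule iffD2[OF mp[OF spec[OF P'(2)] a2]])
  qed
  then obtain \<sigma> where \<sigma>: "\<sigma> \<in> Aut (E \<union> entries d)" "\<forall>v\<in>{..<n} \<times> ?Z.
    \<sigma> (seq (\<lambda>k. (!) (b k)) v) = seq (\<lambda>k. (!) (b (h k))) v" by (elim bexE)
  have "map \<sigma> (b k) = b (h k)" if k: "k < n" for k
  proof (rule nth_equalityI)
    show "length (map \<sigma> (b k)) = length (b (h k))" using length_tuples[OF b] by simp
    fix p assume "p < length (map \<sigma> (b k))"
    then have p: "p < length (b k)" "(k, p) \<in> {..<n} \<times> ?Z" using length_tuples[OF b, of k] k by auto
    from bspec[OF \<sigma>(2) p(2)] show "map \<sigma> (b k) ! p = b (h k) ! p" using p(1) by simp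
  qed
  then show "\<exists>\<sigma>\<in>Aut (E \<union> entries d). \<forall>k<n. map \<sigma> (b k) = b (h k)" using \<sigma>(1) by blast
qed

text \<open>Whether \<open>\<phi>(x, c)\<close> thorn-forks over \<open>A\<close> depends on the type of \<open>c\<close> over \<open>A\<close> only, and that is the
  same for all increasing subtuples of \<open>c\<close> and for \<open>d\<close>. So independence of a fixed set from \<open>c\<close> also
  is a matter of the Ehrenfeucht-Mostowski type, although independence is not a closed condition.\<close>

lemma thorn_divides_Aut:
  assumes "thorn_divides L \<kappa> M ss \<psi> d A" "\<sigma> \<in> Aut A" "(\<psi>, d) \<in> formulas_over L M ss (univ M)" "A \<subseteq> univ M"
  shows "thorn_divides L \<kappa> M ss \<psi> (map \<sigma> d) A"
proof -
  obtain D where D: "A \<subseteq> D" "D \<subseteq> univ M" "sm D" "strongly_divides L M ss \<psi> d D"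
    using assms(1) unfolding thorn_divides_def by blast
  have d: "set d \<subseteq> univ M" "\<psi> \<in> formulas L (ss @ sorts M d)" using assms(3) by (auto simp: formulas_over_def)
  have \<sigma>e: "\<sigma> \<in> Aut {}" using Aut_mono[OF assms(2)] by simp
  obtain \<tau> where \<tau>: "\<tau> \<in> Aut {}" "\<And>x. x \<in> univ M \<Longrightarrow> \<tau> (\<sigma> x) = x" "\<And>x. x \<in> univ M \<Longrightarrow> \<sigma> (\<tau> x) = x"
    by (rule Aut_inv[OF \<sigma>e]) auto
  have \<sigma>D: "\<sigma> ` D \<subseteq> univ M" "sm (\<sigma> ` D)" using Aut_univ_image[OF \<sigma>e D(2)] sm_image[OF D(3)] by blast+
  have \<tau>\<sigma>: "\<tau> ` \<sigma> ` D = D"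
  proof -
    have "\<tau> ` \<sigma> ` D = (\<lambda>x. x) ` D" unfolding image_image by (intro image_cong refl \<tau>(2)) (use D(2) in blast)
    then show ?thesis by simp
  qed
  have \<sigma>d: "set (map \<sigma> d) \<subseteq> univ M" using Aut_univ_image[OF \<sigma>e d(1)] by simp
  have so: "sorts M (map \<sigma> d) = sorts M d" by (rule Aut_sorts[OF \<sigma>e d(1)])
  have k0: "\<exists>k::nat. \<forall>S \<subseteq> realizations M (sorts M d) (tp L M d D). finite S \<and> card S = k \<longrightarrow>
      \<not> (\<exists>a\<in>tuples M ss. \<forall>b'\<in>S. holds M \<psi> (a @ b'))"
    using D(4) unfolding strongly_divides_def by (rule conjunct2)
  then obtain k where k: "\<forall>S \<subseteq> realizations M (sorts M d) (tp L M d D). finite S \<and> card S = k \<longrightarrow>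
      \<not> (\<exists>a\<in>tuples M ss. \<forall>b'\<in>S. holds M \<psi> (a @ b'))" ..
  have "strongly_divides L M ss \<psi> (map \<sigma> d) (\<sigma> ` D)" unfolding strongly_divides_def
  proof (intro conjI exI[of _ k] allI impI)
    show "\<not> algebraic_over L M (map \<sigma> d) (\<sigma> ` D)"
    proof
      assume "algebraic_over L M (map \<sigma> d) (\<sigma> ` D)"
      from algebraic_over_subset_acl[OF this \<sigma>d \<sigma>D] have *: "\<sigma> x \<in> acl (\<sigma> ` D)" if "x \<in> set d" for x
        using that by auto
      have "x \<in> acl D" if x: "x \<in> set d" for x
        using acl_Aut[OF \<tau>(1) *[OF x] \<sigma>D(1)] \<tau>(2)[OF subsetD[OF d(1) x]] unfolding \<tau>\<sigma> by simp
      then have "algebraic_over L M d D" by (intro subset_acl_algebraic_over D(2,3)) blast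
      then show False using D(4) unfolding strongly_divides_def by blast
    qed
  next
    fix S assume S: "S \<subseteq> realizations M (sorts M (map \<sigma> d)) (tp L M (map \<sigma> d) (\<sigma> ` D))" and fS: "finite S \<and> card S = k"
    have S': "\<exists>\<rho>\<in>Aut D. b' = map \<sigma> (map \<rho> d)" if b': "b' \<in> S" for b'
    proof -
      obtain \<rho>0 where \<rho>0: "\<rho>0 \<in> Aut (\<sigma> ` D)" "b' = map \<rho>0 (map \<sigma> d)"
        using subsetD[OF S b'] unfolding realizations_tp[OF \<sigma>d \<sigma>D] by blast
      obtain \<rho> where \<rho>: "\<rho> \<in> Aut (\<tau> ` \<sigma> ` D)" "\<And>x. x \<in> univ M \<Longrightarrow> \<rho> (\<tau> x) = \<tau> (\<rho>0 x)"
        using Aut_conj[OF \<tau>(1) \<rho>0(1) \<sigma>D(1)] by blast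
      have "\<sigma> (\<rho> x) = \<rho>0 (\<sigma> x)" if "x \<in> set d" for x
      proof -
        have x: "x \<in> univ M" using d(1) that by blast
        have "\<rho> x = \<tau> (\<rho>0 (\<sigma> x))" using \<rho>(2)[OF Aut_univ[OF \<sigma>e x]] \<tau>(2)[OF x] by simp
        then show ?thesis using \<tau>(3)[OF Aut_univ[OF \<rho>0(1) Aut_univ[OF \<sigma>e x]]] by simp
      qed
      then have "b' = map \<sigma> (map \<rho> d)" using \<rho>0(2) by simp
      then show ?thesis using \<rho>(1) unfolding \<tau>\<sigma> by blast
    qed
    have bu: "set b' \<subseteq> univ M \<and> map \<tau> b' \<in> {map \<rho> d |\<rho>. \<rho> \<in> Aut D} \<and> map \<sigma> (map \<tau> b') = b' \<and> sorts M b' = sorts M d"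
      if b': "b' \<in> S" for b'
    proof -
      obtain \<rho> where \<rho>: "\<rho> \<in> Aut D" "b' = map \<sigma> (map \<rho> d)" using S'[OF b'] by blast
      have \<rho>d: "set (map \<rho> d) \<subseteq> univ M" using Aut_univ_image[OF \<rho>(1) d(1)] by simp
      have b'u: "set b' \<subseteq> univ M" unfolding \<rho>(2) using Aut_univ_image[OF \<sigma>e \<rho>d] by (simp only: set_map)
      have "map \<tau> b' = map \<rho> d" unfolding \<rho>(2) using \<tau>(2) \<rho>d by (simp add: subset_iff)
      moreover have "map \<sigma> (map \<tau> b') = b'" using \<tau>(3) b'u by (simp add: map_idI subset_iff)
      moreover have "sorts M b' = sorts M d"
        unfolding \<rho>(2) Aut_sorts[OF \<sigma>e \<rho>d] Aut_sorts[OF \<rho>(1) d(1)] ..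
      ultimately show ?thesis using b'u \<rho>(1) by blast
    qed
    show "\<not> (\<exists>a\<in>tuples M ss. \<forall>b'\<in>S. holds M \<psi> (a @ b'))"
    proof
      assume "\<exists>a\<in>tuples M ss. \<forall>b'\<in>S. holds M \<psi> (a @ b')"
      then obtain a where a: "a \<in> tuples M ss" "\<forall>b'\<in>S. holds M \<psi> (a @ b')" ..
      let ?S = "map \<tau> ` S"
      have "inj_on (map \<tau>) S" by (rule inj_on_inverseI[of _ "map \<sigma>"]) (use bu in blast)
      then have "finite ?S \<and> card ?S = k" using fS by (simp add: card_image)
      moreover have "?S \<subseteq> realizations M (sorts M d) (tp L M d D)"
        unfolding realizations_tp[OF d(1) D(2,3)] using bu by blast
      ultimately have "\<not> (\<exists>a\<in>tuples M ss. \<forall>b'\<in>?S. holds M \<psi> (a @ b'))" using k by (simp only: simp_thms)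
      moreover have "map \<tau> a \<in> tuples M ss" by (rule Aut_tuples[OF \<tau>(1) a(1)])
      moreover have "holds M \<psi> (map \<tau> a @ map \<tau> b')" if b': "b' \<in> S" for b'
      proof -
        have au: "set a \<subseteq> univ M" "sorts M a = ss" using a(1) by (simp_all add: tuples_def)
        have "holds M \<psi> (map \<tau> (a @ b')) = holds M \<psi> (a @ b')"
          by (rule holds_Aut[OF \<tau>(1)]) (use au bu[OF b'] d(2) in simp_all)
        then show ?thesis using bspec[OF a(2) b'] by simp
      qed
      ultimately show False by blast
    qed
  qed
  moreover have "A \<subseteq> \<sigma> ` D" using Aut_fix_image[OF assms(2), of A] D(1) by blast
  ultimately show ?thesis using \<sigma>D unfolding thorn_divides_def by (intro exI[of _ "\<sigma> ` D"]) simp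
qed

lemma thorn_forks_Aut:
  assumes f: "thorn_forks L \<kappa> M ss \<phi> b A" and \<sigma>: "\<sigma> \<in> Aut A" and \<phi>: "(\<phi>, b) \<in> formulas_over L M ss (univ M)"
    and A: "A \<subseteq> univ M"
  shows "thorn_forks L \<kappa> M ss \<phi> (map \<sigma> b) A"
proof -
  from f obtain \<Psi> where \<Psi>: "\<Psi> \<subseteq> formulas_over L M ss (univ M)" "finite \<Psi>"
    "\<forall>(\<psi>, d)\<in>\<Psi>. thorn_divides L \<kappa> M ss \<psi> d A"
    "\<forall>a\<in>tuples M ss. holds M \<phi> (a @ b) \<longrightarrow> (\<exists>(\<psi>, d)\<in>\<Psi>. holds M \<psi> (a @ d))"
    unfolding thorn_forks_def by (elim exE conjE)
  have \<sigma>e: "\<sigma> \<in> Aut {}" using Aut_mono[OF \<sigma>] by simp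
  obtain \<tau> where \<tau>: "\<tau> \<in> Aut {}" "\<And>x. x \<in> univ M \<Longrightarrow> \<tau> (\<sigma> x) = x" "\<And>x. x \<in> univ M \<Longrightarrow> \<sigma> (\<tau> x) = x"
    by (rule Aut_inv[OF \<sigma>e]) auto
  have b: "set b \<subseteq> univ M" "\<phi> \<in> formulas L (ss @ sorts M b)" using \<phi> by (auto simp: formulas_over_def)
  have move: "holds M \<psi> (a @ map \<sigma> d) = holds M \<psi> (map \<tau> a @ d)"
    if a: "a \<in> tuples M ss" and d: "set d \<subseteq> univ M" "\<psi> \<in> formulas L (ss @ sorts M d)" for a \<psi> d
  proof -
    have au: "set a \<subseteq> univ M" "sorts M a = ss" using a by (simp_all add: tuples_def)
    have \<sigma>d: "set (map \<sigma> d) \<subseteq> univ M" using Aut_univ_image[OF \<sigma>e d(1)] by simp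
    have "holds M \<psi> (map \<tau> (a @ map \<sigma> d)) = holds M \<psi> (a @ map \<sigma> d)"
      by (rule holds_Aut[OF \<tau>(1)]) (use au \<sigma>d d(2) Aut_sorts[OF \<sigma>e d(1)] in \<open>simp_all del: map_map\<close>)
    moreover have "map \<tau> (map \<sigma> d) = d" using \<tau>(2) d(1) by (simp add: map_idI subset_iff)
    ultimately show ?thesis by (simp del: map_map)
  qed
  let ?\<Psi> = "(\<lambda>(\<psi>, d). (\<psi>, map \<sigma> d)) ` \<Psi>"
  have p: "(\<psi>, d) \<in> \<Psi> \<Longrightarrow> set d \<subseteq> univ M \<and> \<psi> \<in> formulas L (ss @ sorts M d)" for \<psi> d
    using subsetD[OF \<Psi>(1)] by (auto simp: formulas_over_def)
  have q: "(\<psi>, map \<sigma> d) \<in> formulas_over L M ss (univ M) \<and> thorn_divides L \<kappa> M ss \<psi> (map \<sigma> d) A"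
    if "(\<psi>, d) \<in> \<Psi>" for \<psi> d
  proof
    have "set (map \<sigma> d) \<subseteq> univ M" using Aut_univ_image[OF \<sigma>e] p[OF that] by simp
    moreover have "sorts M (map \<sigma> d) = sorts M d"
      by (rule Aut_sorts[OF \<sigma>e conjunct1[OF p[OF that]]])
    ultimately show "(\<psi>, map \<sigma> d) \<in> formulas_over L M ss (univ M)"
      using p[OF that] by (simp add: formulas_over_def del: map_map)
    show "thorn_divides L \<kappa> M ss \<psi> (map \<sigma> d) A"
      by (rule thorn_divides_Aut[OF _ \<sigma> subsetD[OF \<Psi>(1) that] A]) (use \<Psi>(3) that in blast)
  qed
  show ?thesis unfolding thorn_forks_def
  proof (intro exI[of _ ?\<Psi>] conjI)
    show "?\<Psi> \<subseteq> formulas_over L M ss (univ M)" using q by auto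
    show "finite ?\<Psi>" using \<Psi>(2) by simp
    show "\<forall>(\<psi>, d)\<in>?\<Psi>. thorn_divides L \<kappa> M ss \<psi> d A" using q by auto
    show "\<forall>a\<in>tuples M ss. holds M \<phi> (a @ map \<sigma> b) \<longrightarrow> (\<exists>(\<psi>, d)\<in>?\<Psi>. holds M \<psi> (a @ d))"
    proof (intro ballI impI)
      fix a assume a: "a \<in> tuples M ss" "holds M \<phi> (a @ map \<sigma> b)"
      have "holds M \<phi> (map \<tau> a @ b)" using move[OF a(1) b] a(2) by simp
      moreover have "map \<tau> a \<in> tuples M ss" by (rule Aut_tuples[OF \<tau>(1) a(1)])
      ultimately obtain \<psi> d where pd: "(\<psi>, d) \<in> \<Psi>" "holds M \<psi> (map \<tau> a @ d)" using \<Psi>(4) by blast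
      have "holds M \<psi> (a @ map \<sigma> d)" using move[OF a(1), of d \<psi>] p[OF pd(1)] pd(2) by simp
      then show "\<exists>(\<psi>, d)\<in>?\<Psi>. holds M \<psi> (a @ d)" using pd(1) by (intro bexI[of _ "(\<psi>, map \<sigma> d)"]) auto
    qed
  qed
qed

lemma em_ind:
  assumes e: "em ss B c d" and c: "indisc A c" and A: "smallset A" "A \<subseteq> B"
    and X: "X \<subseteq> B" "ind X A (entries c)" and B: "smallset B"
  shows "ind X A (entries d)"
  unfolding thorn_indep_set_def
proof (intro allI impI thorn_indepI)
  fix x \<phi> b
  assume x: "set x \<subseteq> X" and \<phi>: "(\<phi>, b) \<in> formulas_over L M (sorts M x) (A \<union> entries d)"
    and f: "thorn_forks L \<kappa> M (sorts M x) \<phi> b A" and h: "holds M \<phi> (x @ b)"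
  have ct: "c j \<in> tuples M ss" and dt: "d j \<in> tuples M ss" for j using e by (simp_all add: em_def)
  have Bu: "B \<subseteq> univ M" and Au: "A \<subseteq> univ M" using B A by (simp_all add: smallset_def)
  have xu: "set x \<subseteq> univ M" "set x \<subseteq> B" using x X(1) Bu by blast+
  from em_conjugate[OF e c A] obtain \<sigma> where \<sigma>: "\<sigma> \<in> Aut A" "\<forall>k. map \<sigma> (c k) = d k" by (elim bexE)
  have Ad: "A \<union> entries d \<subseteq> univ M" using Au entries_univ[of d, OF dt] by simp
  have bd: "set b \<subseteq> A \<union> entries d" "\<phi> \<in> formulas L (sorts M x @ sorts M b)" using \<phi> by (auto simp: formulas_over_def)
  have "\<exists>v. (snd v < length ss \<and> seq (\<lambda>k. (!) (d k)) v = u) \<or> u \<in> A" if u: "u \<in> set b" for u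
  proof (cases "u \<in> A")
    case False
    then have "u \<in> entries d" using u bd(1) by blast
    then obtain j p where "p < length (d j)" "u = d j ! p" by (auto simp: entries_def in_set_conv_nth)
    then show ?thesis using length_tuples[OF dt, of j] by (intro exI[of _ "(j, p)"]) simp
  qed blast
  then have "\<forall>u\<in>set b. \<exists>v. (snd v < length ss \<and> seq (\<lambda>k. (!) (d k)) v = u) \<or> u \<in> A" by blast
  from bchoice[OF this] obtain nm where
    nm: "\<forall>u\<in>set b. (snd (nm u) < length ss \<and> seq (\<lambda>k. (!) (d k)) (nm u) = u) \<or> u \<in> A" ..
  obtain n where n: "\<forall>k\<in>(\<lambda>u. fst (nm u)) ` set b. k < n"
    using finite_nat_set_iff_bounded[of "(\<lambda>u. fst (nm u)) ` set b"] by auto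
  let ?W = "{..<n} \<times> {..<length ss}"
  let ?s = "\<lambda>v :: nat \<times> nat. ss ! snd v"
  let ?r = "\<lambda>g u. if u \<in> A then u else g (nm u)"
  let ?t = "map Inr x @ map (\<lambda>u. if u \<in> A then Inr u else Inl (nm u)) b :: ((nat \<times> nat) + 'a) list"
  have nW: "nm u \<in> ?W" "seq (\<lambda>k. (!) (d k)) (nm u) = u" if "u \<in> set b" "u \<notin> A" for u
  proof -
    show "seq (\<lambda>k. (!) (d k)) (nm u) = u" using bspec[OF nm that(1)] that(2) by simp
    have "fst (nm u) < n" using n that(1) by blast
    then show "nm u \<in> ?W" using bspec[OF nm that(1)] that(2) by (simp add: mem_Times_iff)
  qed
  have ad: "asg ?W ?s (seq (\<lambda>k. (!) (d k)))" by (rule asg_tuples[OF dt])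
  have sW: "?s (nm u) = sort_of M u" if "u \<in> set b" "u \<notin> A" for u
    using bspec[OF ad[unfolded asg_def] nW(1)[OF that]] nW(2)[OF that] by simp
  have tm: "map (case_sum g id) ?t = x @ map (?r g) b" for g :: "nat \<times> nat \<Rightarrow> 'a"
    by (simp add: comp_def)
  have sm: "map (case_sum ?s (sort_of M)) ?t = sorts M x @ sorts M b"
    using sW by (simp add: comp_def)
  have D: "definable B ?W ?s (\<lambda>g. \<not> holds M \<phi> (x @ map (?r g) b))"
  proof (rule definable_Not)
    have "set ?t \<subseteq> Inl ` ?W \<union> Inr ` B"
    proof
      fix t assume "t \<in> set ?t"
      then consider y where "y \<in> set x" "t = Inr y" | u where "u \<in> set b" "t = (if u \<in> A then Inr u else Inl (nm u))"
        by auto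
      then show "t \<in> Inl ` ?W \<union> Inr ` B"
      proof cases
        case 1
        then show ?thesis using xu(2) by blast
      next
        case 2
        then show ?thesis using A(2) nW(1)[of u] by (cases "u \<in> A") auto
      qed
    qed
    then show "definable B ?W ?s (\<lambda>g. holds M \<phi> (x @ map (?r g) b))"
      unfolding definable_def using bd(2)
      by (intro exI[of _ \<phi>] exI[of _ ?t] conjI allI impI) (simp_all only: tm sm)
  qed
  have "\<not> holds M \<phi> (x @ map (?r (seq (\<lambda>k. (!) (d k)))) b)"
  proof (rule emD[OF e D])
    fix f' :: "nat \<Rightarrow> nat" assume f': "\<forall>i j. i < j \<longrightarrow> j < n \<longrightarrow> f' i < (f' j :: nat)"
    obtain \<rho> where \<rho>: "\<rho> \<in> Aut A" "\<forall>k<n. map \<rho> (c k) = c (f' k)" using indiscD[OF c, of n f'] f' by blast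
    obtain \<tau> where \<tau>: "\<tau> \<in> Aut A" "\<And>y. y \<in> univ M \<Longrightarrow> \<tau> (\<sigma> y) = y"
      using Aut_inv[OF \<sigma>(1) Au] by blast
    have \<rho>\<tau>: "\<rho> \<circ> \<tau> \<in> Aut A" by (rule Aut_comp[OF \<tau>(1) \<rho>(1)])
    have "(\<rho> \<circ> \<tau>) u = ?r (seq (\<lambda>k. (!) (c (f' k)))) u" if u: "u \<in> set b" for u
    proof (cases "u \<in> A")
      case True
      then show ?thesis using Aut_fix[OF \<rho>\<tau> True] by simp
    next
      case False
      let ?k = "fst (nm u)" and ?p = "snd (nm u)"
      have kp: "?k < n" "?p < length ss" using nW(1)[OF u False] by auto
      have lc: "length (c k) = length ss" for k by (rule length_tuples[OF ct])
      have "u = d ?k ! ?p" using nW(2)[OF u False] by simp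
      also have "\<dots> = map \<sigma> (c ?k) ! ?p" using \<sigma>(2) by simp
      also have "\<dots> = \<sigma> (c ?k ! ?p)" using kp lc by simp
      finally have us: "u = \<sigma> (c ?k ! ?p)" .
      have "c ?k ! ?p \<in> set (c ?k)" by (rule nth_mem) (simp only: lc kp(2))
      moreover have "set (c ?k) \<subseteq> univ M" using ct[of ?k] by (simp add: tuples_def)
      ultimately have cu: "c ?k ! ?p \<in> univ M" by (rule rev_subsetD)
      have "(\<rho> \<circ> \<tau>) u = \<rho> (c ?k ! ?p)" unfolding comp_def by (subst us) (simp add: \<tau>(2)[OF cu])
      also have "\<dots> = map \<rho> (c ?k) ! ?p" using kp lc by simp
      also have "\<dots> = c (f' ?k) ! ?p" using \<rho>(2) kp by simp
      finally show ?thesis using False by simp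
    qed
    then have mb: "map (\<rho> \<circ> \<tau>) b = map (?r (seq (\<lambda>k. (!) (c (f' k))))) b" by simp
    have bu: "set b \<subseteq> univ M" using bd(1) Ad by blast
    have "(\<phi>, b) \<in> formulas_over L M (sorts M x) (univ M)" using bd(2) bu by (simp add: formulas_over_def)
    from thorn_forks_Aut[OF f \<rho>\<tau> this Au]
    have f2: "thorn_forks L \<kappa> M (sorts M x) \<phi> (map (\<rho> \<circ> \<tau>) b) A" .
    have rA: "?r (seq (\<lambda>k. (!) (c (f' k)))) u \<in> A \<union> entries c" if u: "u \<in> set b" for u
    proof (cases "u \<in> A")
      case False
      have "snd (nm u) < length (c (f' (fst (nm u))))" using nW(1)[OF u False] length_tuples[OF ct] by auto
      then have "c (f' (fst (nm u))) ! snd (nm u) \<in> set (c (f' (fst (nm u))))" by (rule nth_mem)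
      then show ?thesis using False by (auto simp: entries_def)
    qed simp
    have "set (map (\<rho> \<circ> \<tau>) b) \<subseteq> A \<union> entries c"
      unfolding mb set_map by (rule image_subsetI) (rule rA)
    moreover have "sorts M (map (\<rho> \<circ> \<tau>) b) = sorts M b" by (rule Aut_sorts[OF \<rho>\<tau> bu])
    ultimately have "(\<phi>, map (\<rho> \<circ> \<tau>) b) \<in> formulas_over L M (sorts M x) (A \<union> entries c)"
      using bd(2) by (simp add: formulas_over_def del: map_map)
    moreover have "thorn_indep L \<kappa> M x A (entries c)" using X(2) x by (simp add: thorn_indep_set_def)
    ultimately have "\<not> holds M \<phi> (x @ map (\<rho> \<circ> \<tau>) b)" using thorn_indepD f2 by blast
    then show "\<not> holds M \<phi> (x @ map (?r (seq (\<lambda>k. (!) (c (f' k))))) b)" unfolding mb .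
  qed
  moreover have "map (?r (seq (\<lambda>k. (!) (d k)))) b = b"
    using nW(2) by (intro map_idI) simp
  ultimately show False using h by simp
qed

end

section \<open>Mutually indiscernible Morley sequences\<close>

context rosy_monster
begin

lemma add_independent:
  assumes PQ: "ind P A Q" and R: "ind R A (P \<union> Q)"
    and s: "smallset P" "smallset A" "smallset Q" "smallset R"
  shows "ind P A (Q \<union> R)"
proof -
  have "ind R (A \<union> Q) (P \<union> Q)" by (rule ind_base[OF R]) auto
  then have "ind R (A \<union> Q) P" by (rule ind_mono) auto
  then have "ind P (A \<union> Q) R" by (rule symmetry) (use s in simp_all)
  then show ?thesis by (rule right_transitivity[OF PQ _ s])
qed

text \<open>A sequence over a small model extending \<open>A \<union> B\<close> does the job once its first term is independent
  from that model over \<open>A\<close>; extension provides this up to an automorphism over \<open>A \<union> B\<close>, which is undone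
  at the end.\<close>

theorem Morley_sequence:
  assumes a: "set a \<subseteq> univ M" and i: "ind (set a) A B" and s: "smallset A" "smallset B"
  shows "\<exists>c. c 0 = a \<and> (\<forall>j. c j \<in> tuples M (sorts M a)) \<and> indisc (A \<union> B) c \<and>
    (\<forall>j. ind (set (c j)) A (\<Union>l<j. set (c l))) \<and> ind (entries c) A B"
proof -
  have as: "smallset (set a)" by (rule smallset_finite) (use a in simp_all)
  have AB: "smallset (A \<union> B)" "A \<union> B \<subseteq> univ M" using s by (simp_all add: smallset_def)
  from Loewenheim_Skolem[OF AB(1)] obtain N where N: "model N" "A \<union> B \<subseteq> N" "smallset N" by (elim exE conjE)
  have BN: "B \<subseteq> N" "A \<subseteq> N" "A \<union> N = N" "N \<subseteq> univ M" using N(2,3) by (auto simp: smallset_def)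
  from ext[OF i BN(1) as s(1) N(3)] obtain \<sigma> where \<sigma>: "\<sigma> \<in> Aut (A \<union> B)" "ind (\<sigma> ` set a) A N"
    by (elim bexE)
  let ?a = "map \<sigma> a"
  have au: "set ?a \<subseteq> univ M" using Aut_univ_image[OF \<sigma>(1) a] by simp
  from Morley_sequence_over_model[OF au N(1,3)] obtain e where e0: "e 0 = ?a"
    and e1: "\<forall>j. \<exists>\<rho>\<in>Aut N. e j = map \<rho> ?a" and e2: "indisc N e"
    and e3: "\<forall>j. ind (set (e j)) N (\<Union>l<j. set (e l))" by (elim exE conjE)
  have es: "smallset (set (e j))" for j by (rule smallset_finite) (use indisc_univ[OF e2] in simp_all)
  have ees: "smallset (\<Union>l<j. set (e l))" for j :: nat by (rule smallset_UN_finite) (use es in simp_all)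
  have e4: "ind (set (e j)) A N" for j
  proof -
    from spec[OF e1, of j] obtain \<rho> where \<rho>: "\<rho> \<in> Aut N" "e j = map \<rho> ?a" by (elim bexE)
    have "ind (\<rho> ` \<sigma> ` set a) (\<rho> ` A) (\<rho> ` N)"
      by (rule ind_Aut[OF \<sigma>(2) Aut_mono[OF \<rho>(1) empty_subsetI] smallset_Aut[OF as \<sigma>(1)] s(1) N(3)])
    then show ?thesis
      unfolding \<rho>(2) set_map Aut_fix_image[OF \<rho>(1) BN(2)] Aut_fix_image[OF \<rho>(1) order_refl] .
  qed
  have e5: "ind (set (e j)) A (N \<union> (\<Union>l<j. set (e l)))" for j
    by (rule right_transitivity[OF e4 _ es s(1) N(3) ees]) (simp only: BN(3) spec[OF e3])
  have e6: "ind (\<Union>l<j. set (e l)) A N" for j :: nat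
  proof (induction j)
    case 0
    show ?case using ind_empty[OF s(1) N(3)] by simp
  next
    case (Suc j)
    have "ind (set (e j)) (A \<union> (\<Union>l<j. set (e l))) (N \<union> (\<Union>l<j. set (e l)))"
      by (rule ind_base[OF e5]) auto
    then have "ind (set (e j)) (A \<union> (\<Union>l<j. set (e l))) N" by (rule ind_mono) auto
    from left_transitivity[OF this Suc es ees s(1) N(3)] show ?case by (simp add: lessThan_Suc)
  qed
  have ent: "\<exists>j. C0 \<subseteq> (\<Union>l<j. set (e l))" if "finite C0" "C0 \<subseteq> entries e" for C0
    using that
  proof (induction C0 rule: finite_induct)
    case (insert x F)
    then obtain j where j: "F \<subseteq> (\<Union>l<j. set (e l))" by auto
    obtain k where k: "x \<in> set (e k)" using insert.prems by (auto simp: entries_def)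
    have "x \<in> (\<Union>l<j + Suc k. set (e l))" by (rule UN_I[of k]) (use k in simp_all)
    moreover have "(\<Union>l<j. set (e l)) \<subseteq> (\<Union>l<j + Suc k. set (e l))" by (rule UN_mono) auto
    ultimately have "insert x F \<subseteq> (\<Union>l<j + Suc k. set (e l))"
      using order_trans[OF j] by (intro insert_subsetI)
    then show ?case ..
  qed simp
  have e7: "ind (entries e) A N"
  proof (rule ind_finite_character)
    fix C0 B0 assume C0: "finite C0" "C0 \<subseteq> entries e" and B0: "finite B0" "B0 \<subseteq> N"
    from ent[OF C0] obtain j where j: "C0 \<subseteq> (\<Union>l<j. set (e l))" ..
    show "ind C0 A B0" by (rule ind_mono[OF e6 j]) (use B0(2) in blast)
  qed
  obtain \<tau> where \<tau>: "\<tau> \<in> Aut (A \<union> B)" "\<And>x. x \<in> univ M \<Longrightarrow> \<tau> (\<sigma> x) = x"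
    using Aut_inv[OF \<sigma>(1) AB(2)] by blast
  have \<tau>e: "\<tau> \<in> Aut {}" by (rule Aut_mono[OF \<tau>(1) empty_subsetI])
  have \<tau>A: "\<tau> ` A = A" "\<tau> ` B = B" "\<tau> ` (A \<union> B) = A \<union> B" by (rule Aut_fix_image[OF \<tau>(1)]; simp)+
  let ?c = "\<lambda>j. map \<tau> (e j)"
  have et: "e j \<in> tuples M (sorts M a)" for j
  proof -
    from spec[OF e1, of j] obtain \<rho> where \<rho>: "\<rho> \<in> Aut N" "e j = map \<rho> ?a" by (elim bexE)
    have "a \<in> tuples M (sorts M a)" using a by (simp add: tuples_def)
    from Aut_tuples[OF \<rho>(1) Aut_tuples[OF \<sigma>(1) this]] show ?thesis using \<rho>(2) by (simp only:)
  qed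
  show ?thesis
  proof (intro exI[of _ ?c] conjI allI)
    show "map \<tau> (e 0) = a" unfolding e0 using \<tau>(2) a by (simp add: map_idI subset_iff)
    show "map \<tau> (e j) \<in> tuples M (sorts M a)" for j by (rule Aut_tuples[OF \<tau>(1) et])
    have "A \<union> B \<subseteq> \<tau> ` N" using image_mono[OF N(2), of \<tau>] unfolding \<tau>A(3) .
    then show "indisc (A \<union> B) ?c" by (rule indisc_mono[OF indisc_Aut[OF e2 \<tau>e BN(4)]])
    show "ind (set (map \<tau> (e j))) A (\<Union>l<j. set (map \<tau> (e l)))" for j
    proof -
      have "ind (set (e j)) A (\<Union>l<j. set (e l))" by (rule ind_mono[OF e5]) auto
      from ind_Aut[OF this \<tau>e es s(1) ees] show ?thesis unfolding set_map \<tau>A(1) image_UN .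
    qed
    have "ind (entries e) A B" by (rule ind_mono[OF e7]) (use BN(1) in auto)
    from ind_Aut[OF this \<tau>e smallset_entries[OF et] s] show "ind (entries ?c) A B"
      unfolding \<tau>A(1,2) entries_def set_map image_UN .
  qed
qed

text \<open>When one member of an independent family is replaced, only the independence of the new member
  from the remaining ones has to be checked: \<open>J k\<close> is independent from the others except \<open>J m\<close>, and
  the new sequence, being independent from all of these together, can be added.\<close>

lemma replace_independent:
  assumes J: "\<And>k. k < n \<Longrightarrow> ind (entries (J k)) A (other_entries n J k)"
    "\<And>k. k < n \<Longrightarrow> smallset (entries (J k))"
    and d: "ind (entries d) A (other_entries n J m)" "smallset (entries d)"
    and A: "smallset A" and mk: "m < n" "k < n"
  shows "ind (entries ((J(m := d)) k)) A (other_entries n (J(m := d)) k)"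
proof (cases "k = m")
  case True
  have "other_entries n (J(m := d)) m = other_entries n J m" by (auto simp: other_entries_def)
  then show ?thesis using d(1) True by simp
next
  case False
  let ?R = "\<Union>j\<in>{..<n} - {k, m}. entries (J j)"
  have 1: "other_entries n J m = entries (J k) \<union> ?R" using False mk by (auto simp: other_entries_def)
  have 2: "other_entries n (J(m := d)) k = ?R \<union> entries d" using False mk
    by (auto simp: other_entries_def split: if_splits)
  have R: "smallset ?R" by (rule smallset_UN_finite) (use J(2) in auto)
  have "ind (entries (J k)) A ?R"
    by (rule ind_mono[OF J(1)[OF mk(2)] order_refl]) (auto simp: other_entries_def)
  from add_independent[OF this d(1)[unfolded 1] J(2)[OF mk(2)] A R d(2)]
  show ?thesis unfolding 2 using False by simp
qed

text \<open>The parameters over which \<open>J k\<close> is known to be indiscernible when the sequences \<open>J j\<close>, \<open>j < m\<close>,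
  have been treated in the second pass.\<close>

definition partial_base :: "nat \<Rightarrow> 'a set \<Rightarrow> (nat \<Rightarrow> nat \<Rightarrow> 'a list) \<Rightarrow> nat \<Rightarrow> nat \<Rightarrow> 'a set" where
  "partial_base n A J m k =
    A \<union> (\<Union>j\<in>{..<n} - {k}. if k < m \<or> j < k then entries (J j) else set (J j 0))"

lemma partial_base_subset: "partial_base n A J m k \<subseteq> A \<union> other_entries n J k"
  by (auto simp: partial_base_def other_entries_def entries_def split: if_splits)

text \<open>The sequences are chosen one after the other, those not yet chosen being constant. So \<open>J k\<close> is
  chosen to be indiscernible over the full earlier sequences, but only over the first terms of the
  later ones.\<close>

lemma first_pass:
  assumes A: "smallset A" and a: "\<forall>i<n. set (a i) \<subseteq> univ M"
    and fam: "thorn_independent_family L \<kappa> M A n a"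
  shows "m \<le> n \<Longrightarrow> \<exists>J. (\<forall>k<n. (\<forall>j. J k j \<in> tuples M (sorts M (a k))) \<and> J k 0 = a k \<and>
      (m \<le> k \<longrightarrow> (\<forall>j. J k j = a k)) \<and> ind (entries (J k)) A (other_entries n J k)) \<and>
    (\<forall>k<m. (\<forall>j. ind (set (J k j)) A (\<Union>l<j. set (J k l))) \<and> indisc (partial_base n A J 0 k) (J k))"
proof (induction m)
  case 0
  show ?case
  proof (intro exI[of _ "\<lambda>k _. a k"] conjI allI impI)
    fix k assume k: "k < n"
    show "a k \<in> tuples M (sorts M (a k))" using a[rule_format, OF k] by (simp add: tuples_def)
    have "ind (set (a k)) A (\<Union>j\<in>{..<n} - {k}. set (a j))"
      by (rule thorn_indep_imp_ind) (use fam k in \<open>simp add: thorn_independent_family_def\<close>)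
    then show "ind (entries (\<lambda>_. a k)) A (other_entries n (\<lambda>k _. a k) k)"
      by (simp add: entries_def other_entries_def)
  qed simp_all
next
  case (Suc m)
  then have mn: "m < n" "m \<le> n" by simp_all
  from Suc.IH[OF mn(2)] obtain J where
    J: "\<forall>k<n. (\<forall>j. J k j \<in> tuples M (sorts M (a k))) \<and> J k 0 = a k \<and>
      (m \<le> k \<longrightarrow> (\<forall>j. J k j = a k)) \<and> ind (entries (J k)) A (other_entries n J k)"
    "\<forall>k<m. (\<forall>j. ind (set (J k j)) A (\<Union>l<j. set (J k l))) \<and> indisc (partial_base n A J 0 k) (J k)"
    by (elim exE conjE)
  have Jt: "J k j \<in> tuples M (sorts M (a k))" if "k < n" for k j using J(1) that by simp
  have Ji: "ind (entries (J k)) A (other_entries n J k)" if "k < n" for k using J(1) that by simp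
  have Js: "smallset (entries (J k))" if "k < n" for k by (rule smallset_entries[OF Jt[OF that]])
  have O: "smallset (other_entries n J m)" unfolding other_entries_def
    by (rule smallset_UN_finite) (use Js in auto)
  have "entries (J m) = set (a m)" using J(1) mn(1) by (simp add: entries_def)
  with Ji[OF mn(1)] have "ind (set (a m)) A (other_entries n J m)" by simp
  from Morley_sequence[OF a[rule_format, OF mn(1)] this A O] obtain c where c: "c 0 = a m"
    "\<forall>j. c j \<in> tuples M (sorts M (a m))" "indisc (A \<union> other_entries n J m) c"
    "\<forall>j. ind (set (c j)) A (\<Union>l<j. set (c l))" "ind (entries c) A (other_entries n J m)" by (elim exE conjE)
  have ct: "c j \<in> tuples M (sorts M (a m))" for j using c(2) by simp
  let ?J = "J(m := c)"
  have oe: "other_entries n ?J m = other_entries n J m" by (auto simp: other_entries_def)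
  have "indisc (partial_base n A ?J 0 m) c"
    by (rule indisc_mono[OF c(3)]) (use partial_base_subset[of n A ?J 0 m] oe in simp)
  moreover have "partial_base n A ?J 0 k = partial_base n A J 0 k" if "k < m" for k
  proof -
    have "J m 0 = a m" using J(1) mn(1) by simp
    then have "(if k < 0 \<or> j < k then entries (?J j) else set (?J j 0)) =
      (if k < 0 \<or> j < k then entries (J j) else set (J j 0))" for j using that c(1) by simp
    then show ?thesis unfolding partial_base_def by (simp only:)
  qed
  ultimately have 2: "\<forall>k<Suc m. (\<forall>j. ind (set (?J k j)) A (\<Union>l<j. set (?J k l))) \<and>
      indisc (partial_base n A ?J 0 k) (?J k)"
    using J(2) c(4) by (simp add: less_Suc_eq)
  have 1: "\<forall>k<n. (\<forall>j. ?J k j \<in> tuples M (sorts M (a k))) \<and> ?J k 0 = a k \<and>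
      (Suc m \<le> k \<longrightarrow> (\<forall>j. ?J k j = a k)) \<and> ind (entries (?J k)) A (other_entries n ?J k)"
  proof (intro allI impI conjI)
    fix k assume k: "k < n"
    show "?J k j \<in> tuples M (sorts M (a k))" for j using Jt[OF k] ct by simp
    show "?J k 0 = a k" using J(1) k c(1) by simp
    show "?J k j = a k" if "Suc m \<le> k" for j using J(1) k that by simp
    show "ind (entries (?J k)) A (other_entries n ?J k)"
      by (rule replace_independent[OF Ji Js c(5) smallset_entries[OF ct] A mn(1) k])
  qed
  show ?case by (intro exI[of _ ?J] conjI 1 2)
qed

text \<open>In step \<open>m\<close> the sequence \<open>J m\<close> is replaced by one that is extracted from it and indiscernible
  over all the other sequences. Indiscernibility of the others over \<open>J m\<close> and their independence from
  it survive, as they depend on its Ehrenfeucht-Mostowski type only. Old and new sequence are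
  conjugate over the parameters over which \<open>J m\<close> was indiscernible before. These contain \<open>A\<close> and the
  first terms of all other sequences, so the type over \<open>A\<close> of the family of first terms does not
  change.\<close>

lemma second_pass:
  assumes A: "smallset A" and a: "\<forall>i<n. set (a i) \<subseteq> univ M"
    and fam: "thorn_independent_family L \<kappa> M A n a"
  shows "m \<le> n \<Longrightarrow> \<exists>J. (\<forall>k<n. (\<forall>j. J k j \<in> tuples M (sorts M (a k))) \<and>
      indisc (partial_base n A J m k) (J k) \<and> ind (entries (J k)) A (other_entries n J k) \<and>
      (\<forall>j. ind (set (J k j)) A (\<Union>l<j. set (J k l)))) \<and>
    (\<exists>\<tau>\<in>Aut A. \<forall>k<n. map \<tau> (a k) = J k 0)"
proof (induction m)
  case 0
  from first_pass[OF A a fam order_refl] obtain J where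
    J: "\<forall>k<n. (\<forall>j. J k j \<in> tuples M (sorts M (a k))) \<and> J k 0 = a k \<and>
      (n \<le> k \<longrightarrow> (\<forall>j. J k j = a k)) \<and> ind (entries (J k)) A (other_entries n J k)"
    "\<forall>k<n. (\<forall>j. ind (set (J k j)) A (\<Union>l<j. set (J k l))) \<and> indisc (partial_base n A J 0 k) (J k)"
    by (elim exE conjE)
  show ?case by (intro exI[of _ J] conjI bexI[OF _ Aut_id]) (use J in simp_all)
next
  case (Suc m)
  then have mn: "m < n" "m \<le> n" by simp_all
  from Suc.IH[OF mn(2)] obtain J \<tau> where
    J: "\<forall>k<n. (\<forall>j. J k j \<in> tuples M (sorts M (a k))) \<and>
      indisc (partial_base n A J m k) (J k) \<and> ind (entries (J k)) A (other_entries n J k) \<and>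
      (\<forall>j. ind (set (J k j)) A (\<Union>l<j. set (J k l)))"
    and \<tau>: "\<tau> \<in> Aut A" "\<forall>k<n. map \<tau> (a k) = J k 0" by (elim exE conjE bexE)
  have Jt: "J k j \<in> tuples M (sorts M (a k))" if "k < n" for k j using J that by simp
  have Ji: "ind (entries (J k)) A (other_entries n J k)" if "k < n" for k using J that by simp
  have Js: "smallset (entries (J k))" if "k < n" for k by (rule smallset_entries[OF Jt[OF that]])
  have O: "smallset (other_entries n J m)" unfolding other_entries_def
    by (rule smallset_UN_finite) (use Js in auto)
  let ?B = "A \<union> other_entries n J m" and ?D = "partial_base n A J m m"
  have B: "smallset ?B" using A O by simp
  have DB: "?D \<subseteq> ?B" by (rule partial_base_subset)
  have AD: "A \<subseteq> partial_base n A J m' k" for m' k by (simp add: partial_base_def)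
  have Jm: "indisc ?D (J m)" using J mn(1) by simp
  from extract_indiscernible[where c = "J m", OF Jt[OF mn(1)] B] obtain d where
    d: "\<forall>j. d j \<in> tuples M (sorts M (a m))" "indisc ?B d"
      "\<forall>n' P. definable ?B ({..<n'} \<times> {..<length (sorts M (a m))}) (\<lambda>v. sorts M (a m) ! snd v) P \<longrightarrow>
        (\<forall>f. (\<forall>i j. i < j \<longrightarrow> j < n' \<longrightarrow> f i < f j) \<longrightarrow> P (seq (\<lambda>k. (!) (J m (f k))))) \<longrightarrow>
        P (seq (\<lambda>k. (!) (d k)))" by (elim exE conjE)
  have dt: "d j \<in> tuples M (sorts M (a m))" for j using d(1) by simp
  have e: "em (sorts M (a m)) ?B (J m) d" unfolding em_def
    by (rule conjI[OF allI[OF Jt[OF mn(1)]] conjI[OF allI[OF dt] d(3)]])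
  from em_conjugate[OF e Jm smallset_subset[OF B DB] DB] obtain \<sigma> where
    \<sigma>: "\<sigma> \<in> Aut ?D" "\<forall>k. map \<sigma> (J m k) = d k" by (elim bexE)
  have \<sigma>A: "\<sigma> \<in> Aut A" by (rule Aut_mono[OF \<sigma>(1) AD])
  let ?J = "J(m := d)"
  have oe: "other_entries n ?J m = other_entries n J m" by (auto simp: other_entries_def)
  have ind_d: "ind (entries d) A (other_entries n J m)"
  proof (rule symmetry)
    have "ind (other_entries n J m) A (entries (J m))" by (rule symmetry[OF Ji Js A O]) (rule mn(1))+
    then show "ind (other_entries n J m) A (entries d)"
      by (rule em_ind[OF e indisc_mono[OF Jm AD] A Un_upper1 Un_upper2 _ B])
  qed (rule O A smallset_entries[OF dt])+
  show ?case
  proof (intro exI[of _ ?J] conjI allI impI)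
    fix k assume k: "k < n"
    show "?J k j \<in> tuples M (sorts M (a k))" for j using Jt[OF k] dt by simp
    show "ind (entries (?J k)) A (other_entries n ?J k)"
      by (rule replace_independent[OF Ji Js ind_d smallset_entries[OF dt] A mn(1) k])
    show "ind (set (?J k j)) A (\<Union>l<j. set (?J k l))" for j
    proof (cases "k = m")
      case True
      have s: "smallset (set (J m l))" for l
        by (rule smallset_finite) (use Jt[OF mn(1), of l] in \<open>simp_all add: tuples_def\<close>)
      have s': "smallset (\<Union>l<j. set (J m l))" by (rule smallset_UN_finite) (use s in simp_all)
      have "ind (set (J m j)) A (\<Union>l<j. set (J m l))" using J mn(1) by simp
      from ind_Aut[OF this Aut_mono[OF \<sigma>A empty_subsetI] s A s']
      have "ind (set (map \<sigma> (J m j))) A (\<Union>l<j. set (map \<sigma> (J m l)))"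
        unfolding Aut_fix_image[OF \<sigma>A order_refl] image_UN set_map .
      then show ?thesis using \<sigma>(2) True by simp
    qed (use J k in simp)
    show "indisc (partial_base n A ?J (Suc m) k) (?J k)"
    proof (cases "k = m")
      case True
      have "indisc (partial_base n A ?J (Suc m) m) d"
        by (rule indisc_mono[OF d(2)]) (use partial_base_subset[of n A ?J "Suc m" m] oe in simp)
      then show ?thesis using True by simp
    next
      case False
      \<comment> \<open>both before and after this step all of the \<open>m\<close>-th sequence belongs to the parameters of the
        \<open>k\<close>-th one\<close>
      let ?E = "A \<union> (\<Union>j\<in>{..<n} - {k, m}. if k < m \<or> j < k then entries (J j) else set (J j 0))"
      have full: "k < m \<or> m < k" "k < Suc m \<longleftrightarrow> k < m" using False by auto
      have ix: "{..<n} - {k} = insert m ({..<n} - {k, m})" using False mn(1) by auto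
      have old: "partial_base n A J m k = ?E \<union> entries (J m)"
        unfolding partial_base_def ix UN_insert using full(1) by auto
      have cong: "(\<Union>j\<in>{..<n} - {k, m}. if k < m \<or> j < k then entries (?J j) else set (?J j 0)) =
        (\<Union>j\<in>{..<n} - {k, m}. if k < m \<or> j < k then entries (J j) else set (J j 0))"
        by (rule SUP_cong) auto
      have new: "partial_base n A ?J (Suc m) k = ?E \<union> entries d"
        unfolding partial_base_def ix UN_insert full(2) cong using full(1) by auto
      have E: "?E \<subseteq> ?B" by (auto simp: other_entries_def entries_def split: if_splits)
      have kB: "entries (J k) \<subseteq> ?B" using k False by (auto simp: other_entries_def)
      have "indisc (?E \<union> entries (J m)) (J k)" using J k unfolding old[symmetric] by simp
      from em_indisc[OF e Jt[OF k] E kB B this] show ?thesis unfolding new using False by simp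
    qed
  next
    show "\<exists>\<tau>\<in>Aut A. \<forall>k<n. map \<tau> (a k) = ?J k 0"
    proof (intro bexI[of _ "\<sigma> \<circ> \<tau>"] allI impI)
      show "\<sigma> \<circ> \<tau> \<in> Aut A" by (rule Aut_comp[OF \<tau>(1) \<sigma>A])
      fix k assume k: "k < n"
      have m1: "map (\<sigma> \<circ> \<tau>) (a k) = map \<sigma> (J k 0)" using \<tau>(2) k by (simp flip: map_map)
      show "map (\<sigma> \<circ> \<tau>) (a k) = ?J k 0"
      proof (cases "k = m")
        case True
        then show ?thesis unfolding m1 using \<sigma>(2) by simp
      next
        case False
        have "set (J k 0) \<subseteq> ?D" using k False
          by (auto simp: partial_base_def entries_def intro!: bexI[of _ k])
        then show ?thesis unfolding m1 using map_Aut_fix[OF \<sigma>(1)] False by simp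
      qed
    qed
  qed
qed

lemma indisc_indiscernible:
  assumes c: "indisc B c" "\<And>j. c j \<in> tuples M ss" and B: "B \<subseteq> univ M"
  shows "indiscernible L M B c"
  unfolding indiscernible_def
proof (intro conjI allI impI)
  have "sorts M (c 0) = ss" using c(2)[of 0] by (simp add: tuples_def)
  then show "c j \<in> tuples M (sorts M (c 0))" for j using c(2)[of j] by simp
  have std: "tp L M (concat (map c is)) B = tp L M (concat (map c [0..<length is])) B"
    if "sorted_wrt (<) is" for "is" :: "nat list"
  proof -
    from indiscD[OF c(1), of "length is" "\<lambda>k. is ! k"] sorted_wrt_nth_less[OF that] obtain \<sigma> where
      \<sigma>: "\<sigma> \<in> Aut B" "\<forall>k<length is. map \<sigma> (c k) = c (is ! k)" by blast
    have "map \<sigma> (concat (map c [0..<length is])) = concat (map (\<lambda>k. map \<sigma> (c k)) [0..<length is])"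
      by (simp add: map_concat comp_def)
    also have "map (\<lambda>k. map \<sigma> (c k)) [0..<length is] = map c is"
      by (rule nth_equalityI) (use \<sigma>(2) in simp_all)
    finally have "concat (map c is) = map \<sigma> (concat (map c [0..<length is]))" ..
    moreover have "set (concat (map c [0..<length is])) \<subseteq> univ M" using indisc_univ[OF c(1)] by auto
    ultimately show ?thesis using tp_map_Aut[OF \<sigma>(1) _ B] by simp
  qed
  fix "is" js :: "nat list"
  assume "sorted_wrt (<) is \<and> sorted_wrt (<) js \<and> length is = length js"
  then show "tp L M (concat (map c is)) B = tp L M (concat (map c js)) B"
    using std[of "is"] std[of js] by simp
qed

lemma indisc_thorn_Morley:
  assumes c: "indisc (A \<union> B) c" "\<And>j. c j \<in> tuples M ss"
    and i: "\<And>j. ind (set (c j)) A (\<Union>l<j. set (c l))" "ind (entries c) A B"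
    and s: "smallset A" "smallset B"
  shows "thorn_Morley L \<kappa> M A (A \<union> B) c"
  unfolding thorn_Morley_def
proof (intro conjI allI)
  have "A \<union> B \<subseteq> univ M" using s by (simp add: smallset_def)
  then show "indiscernible L M (A \<union> B) c" by (rule indisc_indiscernible[OF c])
  fix j
  let ?E = "\<Union>l<j. set (c l)"
  have cs: "smallset (set (c l))" for l
    by (rule smallset_finite) (use c(2)[of l] in \<open>simp_all add: tuples_def\<close>)
  have E: "smallset ?E" by (rule smallset_UN_finite) (use cs in simp_all)
  have "ind B A (entries c)" by (rule symmetry[OF i(2) smallset_entries[OF c(2)] s])
  then have "ind B A (set (c j) \<union> ?E)" by (rule ind_mono) (auto simp: entries_def)
  from add_independent[OF i(1) this cs s(1) E s(2)] have "ind (set (c j)) A (?E \<union> B)" .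
  then have "ind (set (c j)) A (A \<union> B \<union> ?E)" by (rule ind_mono) auto
  then show "thorn_indep L \<kappa> M (c j) A (A \<union> B \<union> ?E)" by (simp add: thorn_indep_set_def)
qed simp

theorem mutually_indiscernible_Morley_sequences:
  assumes A: "smallset A" and a: "\<forall>i<n. set (a i) \<subseteq> univ M"
    and fam: "thorn_independent_family L \<kappa> M A n a"
  shows "\<exists>I. \<forall>i<n. thorn_Morley L \<kappa> M A (A \<union> other_entries n I i) (I i) \<and>
    ind (entries (I i)) A (other_entries n I i) \<and> I i 0 = a i"
proof -
  from second_pass[OF A a fam order_refl] obtain J \<tau> where
    J: "\<forall>k<n. (\<forall>j. J k j \<in> tuples M (sorts M (a k))) \<and>
      indisc (partial_base n A J n k) (J k) \<and> ind (entries (J k)) A (other_entries n J k) \<and>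
      (\<forall>j. ind (set (J k j)) A (\<Union>l<j. set (J k l)))"
    and \<tau>: "\<tau> \<in> Aut A" "\<forall>k<n. map \<tau> (a k) = J k 0" by (elim exE conjE bexE)
  have Au: "A \<subseteq> univ M" using A by (simp add: smallset_def)
  obtain \<rho> where \<rho>: "\<rho> \<in> Aut A" "\<And>x. x \<in> univ M \<Longrightarrow> \<rho> (\<tau> x) = x" using Aut_inv[OF \<tau>(1) Au] by blast
  have \<rho>e: "\<rho> \<in> Aut {}" by (rule Aut_mono[OF \<rho>(1) empty_subsetI])
  have \<rho>A: "\<rho> ` A = A" by (rule Aut_fix_image[OF \<rho>(1) order_refl])
  let ?I = "\<lambda>i j. map \<rho> (J i j)"
  have en: "entries (?I k) = \<rho> ` entries (J k)" for k by (simp only: entries_def set_map image_UN)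
  have oe: "other_entries n ?I k = \<rho> ` other_entries n J k" for k
    by (simp only: other_entries_def en image_UN)
  show ?thesis
  proof (intro exI[of _ ?I] allI impI)
    fix i assume i: "i < n"
    have Jt: "J k j \<in> tuples M (sorts M (a k))" if "k < n" for k j using J that by simp
    have Js: "smallset (entries (J k))" if "k < n" for k by (rule smallset_entries[OF Jt[OF that]])
    have O: "smallset (other_entries n J i)" unfolding other_entries_def
      by (rule smallset_UN_finite) (use Js in auto)
    have OI: "smallset (other_entries n ?I i)" unfolding oe by (rule smallset_Aut[OF O \<rho>(1)])
    have cs: "smallset (set (J i l))" for l
      by (rule smallset_finite) (use Jt[OF i, of l] in \<open>simp_all add: tuples_def\<close>)
    have E: "smallset (\<Union>l<j. set (J i l))" for j :: nat by (rule smallset_UN_finite) (use cs in simp_all)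
    have It: "?I i j \<in> tuples M (sorts M (a i))" for j by (rule Aut_tuples[OF \<rho>(1) Jt[OF i]])
    have pb: "partial_base n A J n i = A \<union> other_entries n J i"
      using i by (simp add: partial_base_def other_entries_def)
    have "indisc (partial_base n A J n i) (J i)" using J i by simp
    then have "indisc (A \<union> other_entries n J i) (J i)" unfolding pb .
    from indisc_Aut[OF this \<rho>e] have ii: "indisc (A \<union> other_entries n ?I i) (?I i)"
      unfolding oe image_Un \<rho>A using A O by (simp add: smallset_def)
    have "ind (entries (J i)) A (other_entries n J i)" using J i by simp
    from ind_Aut[OF this \<rho>e Js[OF i] A O] have ie: "ind (entries (?I i)) A (other_entries n ?I i)"
      unfolding oe en \<rho>A .
    have im: "ind (set (?I i j)) A (\<Union>l<j. set (?I i l))" for j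
    proof -
      have "ind (set (J i j)) A (\<Union>l<j. set (J i l))" using J i by simp
      from ind_Aut[OF this \<rho>e cs A E] show ?thesis unfolding \<rho>A image_UN set_map .
    qed
    have "map \<rho> (map \<tau> (a i)) = a i" using \<rho>(2) a[rule_format, OF i] by (simp add: map_idI subset_iff)
    then have "?I i 0 = a i" using \<tau>(2) i by simp
    then show "thorn_Morley L \<kappa> M A (A \<union> other_entries n ?I i) (?I i) \<and>
        ind (entries (?I i)) A (other_entries n ?I i) \<and> ?I i 0 = a i"
      by (intro conjI indisc_thorn_Morley[OF ii It im ie A OI] ie)
  qed
qed

end

theorem lemma2p6:
  fixes L :: "('s, 'f, 'r) language"
    and T :: "('s, 'f, 'r) fm set"
    and \<kappa> :: "'k rel"
    and M :: "('s, 'f, 'r, 'a) struct"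
    and A :: "'a set"
    and n :: nat
    and a :: "nat \<Rightarrow> 'a list"
  assumes "complete_theory L T"
    and "monster_model L T \<kappa> M"
    and "is_eq L M"
    and "rosy L T \<kappa> M"
    and "A \<subseteq> univ M" and "small \<kappa> A"
    and "\<And>i. i < n \<Longrightarrow> set (a i) \<subseteq> univ M"
    and "thorn_independent_family L \<kappa> M A n a"
  shows "\<exists>I :: nat \<Rightarrow> nat \<Rightarrow> 'a list. \<forall>i<n.
    thorn_Morley L \<kappa> M A (A \<union> other_entries n I i) (I i) \<and>
    indiscernible L M (A \<union> other_entries n I i) (I i) \<and>
    thorn_indep_set L \<kappa> M (entries (I i)) A (other_entries n I i) \<and>
    I i 0 = a i"
proof -
  interpret rosy_monster L T \<kappa> M by unfold_locales (rule assms)+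
  have "smallset A" using assms(5,6) by (simp add: smallset_def)
  moreover have "\<forall>i<n. set (a i) \<subseteq> univ M" using assms(7) by simp
  ultimately have "\<exists>I. \<forall>i<n. thorn_Morley L \<kappa> M A (A \<union> other_entries n I i) (I i) \<and>
    thorn_indep_set L \<kappa> M (entries (I i)) A (other_entries n I i) \<and> I i 0 = a i"
    using assms(8) by (rule mutually_indiscernible_Morley_sequences)
  then obtain I where "\<forall>i<n. thorn_Morley L \<kappa> M A (A \<union> other_entries n I i) (I i) \<and>
    thorn_indep_set L \<kappa> M (entries (I i)) A (other_entries n I i) \<and> I i 0 = a i" ..
  then show ?thesis by (intro exI[of _ I]) (simp add: thorn_Morley_def)
qed

end
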